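(* Over $\mathsf{ACA}_0^\omega$, each of the following items implies the one below it: (1) the Jordan decomposition theorem for the unit interval: every $f:[0,1]\to\mathbb{R}$ of bounded variation is the difference of two non-decreasing functions $g,h:[0,1]\to\mathbb{R}$; (2) $\mathsf{HBU}_{\mathsf{bv}}$: for every $\Psi:[0,1]\to\mathbb{R}^+$ of bounded variation there are $y_0,\dots,y_k\in[0,1]$ with $[0,1]\subset\bigcup_{i\le k}B(y_i,\Psi(y_i))$; (3) $\mathsf{NIN}$: there is no injection from $[0,1]$ to $\mathbb{N}$.
   Context: Work in higher-order arithmetic: $\mathsf{ACA}_0^\omega$ is Kohlenbach's base theory $\mathsf{RCA}_0^\omega$ plus $(\exists^2)$: there is $\varphi^2\le_2 1$ with $(\exists n)(f(n)=0)\leftrightarrow\varphi(f)=0$ for all $f\in\mathbb{N}^{\mathbb{N}}$. Reals are fast-converging Cauchy sequences; functions on reals are arbitrary type-two objects respecting real equality (not second-order codes). $f:[0,1]\to\mathbb{R}$ has bounded variation if there is $k_0\in\mathbb{N}$ with $k_0\ge\sum_i|f(x_i)-f(x_{i+1})|$ for every partition $0=x_0<x_1<\dots<x_n=1$. $B(y,r)$ denotes the open ball of radius $r$ around $y$. *)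

theory Defs
  imports Main
begin

section \<open>The language of finite types\<close>

datatype ty = N | Fn ty ty (infixr "\<^bold>\<rightarrow>" 65)

abbreviation one :: ty where "one \<equiv> N \<^bold>\<rightarrow> N"
abbreviation two :: ty where "two \<equiv> one \<^bold>\<rightarrow> N"

datatype const =
    Zero | Succ | Plus | Times
  | PiC ty ty | SigmaC ty ty ty
  | Rec0

primrec const_ty :: "const \<Rightarrow> ty" where
  "const_ty Zero = N"
| "const_ty Succ = N \<^bold>\<rightarrow> N"
| "const_ty Plus = N \<^bold>\<rightarrow> N \<^bold>\<rightarrow> N"
| "const_ty Times = N \<^bold>\<rightarrow> N \<^bold>\<rightarrow> N"
| "const_ty (PiC \<sigma> \<tau>) = \<sigma> \<^bold>\<rightarrow> \<tau> \<^bold>\<rightarrow> \<sigma>"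
| "const_ty (SigmaC \<rho> \<sigma> \<tau>) = (\<rho> \<^bold>\<rightarrow> \<sigma> \<^bold>\<rightarrow> \<tau>) \<^bold>\<rightarrow> (\<rho> \<^bold>\<rightarrow> \<sigma>) \<^bold>\<rightarrow> \<rho> \<^bold>\<rightarrow> \<tau>"
| "const_ty Rec0 = (N \<^bold>\<rightarrow> N \<^bold>\<rightarrow> N) \<^bold>\<rightarrow> N \<^bold>\<rightarrow> N \<^bold>\<rightarrow> N"

text \<open>Free variables are typed names; bound variables are de Bruijn indices. Apart from \<open><\<close>, the only
  primitive relation is equality at type \<open>N\<close>.\<close>

datatype tm = Bound nat | Free nat ty | Const const | App tm tm

datatype fm = Falsum | Eq tm tm | Less tm tm | Imp fm fm | All ty fm

abbreviation Neg :: "fm \<Rightarrow> fm" where "Neg A \<equiv> Imp A Falsum"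
abbreviation Ex :: "ty \<Rightarrow> fm \<Rightarrow> fm" where "Ex \<sigma> A \<equiv> Neg (All \<sigma> (Neg A))"

text \<open>The list \<open>\<Delta>\<close> gives the types of the dangling bound variables, index 0 first.\<close>

primrec typed :: "ty list \<Rightarrow> tm \<Rightarrow> ty \<Rightarrow> bool" where
  "typed \<Delta> (Bound i) \<tau> \<longleftrightarrow> i < length \<Delta> \<and> \<Delta> ! i = \<tau>"
| "typed \<Delta> (Free x \<sigma>) \<tau> \<longleftrightarrow> \<sigma> = \<tau>"
| "typed \<Delta> (Const c) \<tau> \<longleftrightarrow> const_ty c = \<tau>"
| "typed \<Delta> (App s t) \<tau> \<longleftrightarrow> (\<exists>\<sigma>. typed \<Delta> s (\<sigma> \<^bold>\<rightarrow> \<tau>) \<and> typed \<Delta> t \<sigma>)"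

primrec wf_fm :: "ty list \<Rightarrow> fm \<Rightarrow> bool" where
  "wf_fm \<Delta> Falsum \<longleftrightarrow> True"
| "wf_fm \<Delta> (Eq s t) \<longleftrightarrow> typed \<Delta> s N \<and> typed \<Delta> t N"
| "wf_fm \<Delta> (Less s t) \<longleftrightarrow> typed \<Delta> s N \<and> typed \<Delta> t N"
| "wf_fm \<Delta> (Imp A B) \<longleftrightarrow> wf_fm \<Delta> A \<and> wf_fm \<Delta> B"
| "wf_fm \<Delta> (All \<sigma> A) \<longleftrightarrow> wf_fm (\<sigma> # \<Delta>) A"

primrec qfree :: "fm \<Rightarrow> bool" where
  "qfree Falsum \<longleftrightarrow> True"
| "qfree (Eq s t) \<longleftrightarrow> True"
| "qfree (Less s t) \<longleftrightarrow> True"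
| "qfree (Imp A B) \<longleftrightarrow> qfree A \<and> qfree B"
| "qfree (All \<sigma> A) \<longleftrightarrow> False"

primrec frees_tm :: "tm \<Rightarrow> (nat \<times> ty) set" where
  "frees_tm (Bound i) = {}"
| "frees_tm (Free x \<sigma>) = {(x, \<sigma>)}"
| "frees_tm (Const c) = {}"
| "frees_tm (App s t) = frees_tm s \<union> frees_tm t"

primrec frees :: "fm \<Rightarrow> (nat \<times> ty) set" where
  "frees Falsum = {}"
| "frees (Eq s t) = frees_tm s \<union> frees_tm t"
| "frees (Less s t) = frees_tm s \<union> frees_tm t"
| "frees (Imp A B) = frees A \<union> frees B"
| "frees (All \<sigma> A) = frees A"

primrec inst_tm :: "(nat \<Rightarrow> tm) \<Rightarrow> tm \<Rightarrow> tm" where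
  "inst_tm s (Bound i) = s i"
| "inst_tm s (Free x \<sigma>) = Free x \<sigma>"
| "inst_tm s (Const c) = Const c"
| "inst_tm s (App t u) = App (inst_tm s t) (inst_tm s u)"

definition lift_subst :: "(nat \<Rightarrow> tm) \<Rightarrow> nat \<Rightarrow> tm" where
  "lift_subst s = case_nat (Bound 0) (\<lambda>i. inst_tm (\<lambda>j. Bound (Suc j)) (s i))"

primrec inst :: "(nat \<Rightarrow> tm) \<Rightarrow> fm \<Rightarrow> fm" where
  "inst s Falsum = Falsum"
| "inst s (Eq t u) = Eq (inst_tm s t) (inst_tm s u)"
| "inst s (Less t u) = Less (inst_tm s t) (inst_tm s u)"
| "inst s (Imp A B) = Imp (inst s A) (inst s B)"
| "inst s (All \<sigma> A) = All \<sigma> (inst (lift_subst s) A)"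

abbreviation inst0 :: "tm \<Rightarrow> fm \<Rightarrow> fm" where
  "inst0 t A \<equiv> inst (case_nat t Bound) A"

section \<open>Classical natural deduction\<close>

text \<open>The eigenvariable condition of \<open>AllI\<close> does not concern the theory \<open>T\<close>: free variables in
  members of \<open>T\<close> are implicitly universally quantified.\<close>

inductive proves :: "fm set \<Rightarrow> fm list \<Rightarrow> fm \<Rightarrow> bool" for T where
  Axiom: "A \<in> T \<Longrightarrow> proves T \<Gamma> A"
| Assm: "A \<in> set \<Gamma> \<Longrightarrow> wf_fm [] A \<Longrightarrow> proves T \<Gamma> A"
| ImpI: "wf_fm [] A \<Longrightarrow> proves T (A # \<Gamma>) B \<Longrightarrow> proves T \<Gamma> (Imp A B)"
| ImpE: "proves T \<Gamma> (Imp A B) \<Longrightarrow> proves T \<Gamma> A \<Longrightarrow> proves T \<Gamma> B"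
| Classical: "wf_fm [] A \<Longrightarrow> proves T (Neg A # \<Gamma>) Falsum \<Longrightarrow> proves T \<Gamma> A"
| AllI: "wf_fm [\<sigma>] A \<Longrightarrow> (x, \<sigma>) \<notin> frees A \<Longrightarrow> \<forall>B \<in> set \<Gamma>. (x, \<sigma>) \<notin> frees B \<Longrightarrow>
    proves T \<Gamma> (inst0 (Free x \<sigma>) A) \<Longrightarrow> proves T \<Gamma> (All \<sigma> A)"
| AllE: "proves T \<Gamma> (All \<sigma> A) \<Longrightarrow> typed [] t \<sigma> \<Longrightarrow> proves T \<Gamma> (inst0 t A)"
| EqRefl: "typed [] t N \<Longrightarrow> proves T \<Gamma> (Eq t t)"
| EqSubst: "wf_fm [N] A \<Longrightarrow> typed [] s N \<Longrightarrow> typed [] t N \<Longrightarrow>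
    proves T \<Gamma> (Eq s t) \<Longrightarrow> proves T \<Gamma> (inst0 s A) \<Longrightarrow> proves T \<Gamma> (inst0 t A)"

abbreviation provable :: "fm set \<Rightarrow> fm \<Rightarrow> bool" (infix "\<turnstile>" 50) where
  "T \<turnstile> A \<equiv> proves T [] A"

section \<open>Notation for writing formulas\<close>

text \<open>A term or formula is written as a function of the number of quantifiers above it. The quantifier
  at depth \<open>d\<close> hands to its body the bound variable that, at any depth \<open>e > d\<close>, has index \<open>e - Suc d\<close>.
  Capture is thereby impossible.\<close>

type_synonym ptm = "nat \<Rightarrow> tm"
type_synonym pfm = "nat \<Rightarrow> fm"

definition allq :: "ty \<Rightarrow> (ptm \<Rightarrow> pfm) \<Rightarrow> pfm" where
  "allq \<sigma> F = (\<lambda>d. All \<sigma> (F (\<lambda>e. Bound (e - Suc d)) (Suc d)))"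
definition pimp :: "pfm \<Rightarrow> pfm \<Rightarrow> pfm" (infixr "\<^bold>\<longrightarrow>" 25) where
  "(A \<^bold>\<longrightarrow> B) = (\<lambda>d. Imp (A d) (B d))"
definition pnot :: "pfm \<Rightarrow> pfm" ("\<^bold>\<not> _" [40] 40) where
  "(\<^bold>\<not> A) = (\<lambda>d. Neg (A d))"
definition peq :: "ptm \<Rightarrow> ptm \<Rightarrow> pfm" (infix "\<^bold>=" 50) where
  "(s \<^bold>= t) = (\<lambda>d. Eq (s d) (t d))"
definition pless :: "ptm \<Rightarrow> ptm \<Rightarrow> pfm" (infix "\<^bold><" 50) where
  "(s \<^bold>< t) = (\<lambda>d. Less (s d) (t d))"

syntax
  "_allq" :: "pttrn \<Rightarrow> ty \<Rightarrow> pfm \<Rightarrow> pfm" ("(3\<^bold>\<forall>_ \<^bold>: _./ _)" [0, 0, 10] 10)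
  "_exq" :: "pttrn \<Rightarrow> ty \<Rightarrow> pfm \<Rightarrow> pfm" ("(3\<^bold>\<exists>_ \<^bold>: _./ _)" [0, 0, 10] 10)

definition exq :: "ty \<Rightarrow> (ptm \<Rightarrow> pfm) \<Rightarrow> pfm" where
  "exq \<sigma> F = (\<^bold>\<not> allq \<sigma> (\<lambda>x. \<^bold>\<not> F x))"

translations
  "\<^bold>\<forall>x \<^bold>: \<sigma>. A" \<rightleftharpoons> "CONST allq \<sigma> (\<lambda>x. A)"
  "\<^bold>\<exists>x \<^bold>: \<sigma>. A" \<rightleftharpoons> "CONST exq \<sigma> (\<lambda>x. A)"

definition pand :: "pfm \<Rightarrow> pfm \<Rightarrow> pfm" (infixr "\<^bold>\<and>" 35) where
  "(A \<^bold>\<and> B) = (\<^bold>\<not> (A \<^bold>\<longrightarrow> \<^bold>\<not> B))"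
definition por :: "pfm \<Rightarrow> pfm \<Rightarrow> pfm" (infixr "\<^bold>\<or>" 30) where
  "(A \<^bold>\<or> B) = (\<^bold>\<not> A \<^bold>\<longrightarrow> B)"
definition piff :: "pfm \<Rightarrow> pfm \<Rightarrow> pfm" (infixr "\<^bold>\<longleftrightarrow>" 25) where
  "(A \<^bold>\<longleftrightarrow> B) = ((A \<^bold>\<longrightarrow> B) \<^bold>\<and> (B \<^bold>\<longrightarrow> A))"
definition ple :: "ptm \<Rightarrow> ptm \<Rightarrow> pfm" (infix "\<^bold>\<le>" 50) where
  "(s \<^bold>\<le> t) = (s \<^bold>< t \<^bold>\<or> s \<^bold>= t)"

definition papp :: "ptm \<Rightarrow> ptm \<Rightarrow> ptm" (infixl "\<^bold>\<cdot>" 90) where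
  "s \<^bold>\<cdot> t = (\<lambda>d. App (s d) (t d))"
definition pconst :: "const \<Rightarrow> ptm" where
  "pconst c = (\<lambda>d. Const c)"
definition pzero :: ptm ("\<^bold>0") where
  "\<^bold>0 = pconst Zero"
definition psuc :: "ptm \<Rightarrow> ptm" where
  "psuc t = pconst Succ \<^bold>\<cdot> t"
definition padd :: "ptm \<Rightarrow> ptm \<Rightarrow> ptm" (infixl "\<^bold>+" 65) where
  "s \<^bold>+ t = pconst Plus \<^bold>\<cdot> s \<^bold>\<cdot> t"
definition pmul :: "ptm \<Rightarrow> ptm \<Rightarrow> ptm" (infixl "\<^bold>*" 70) where
  "s \<^bold>* t = pconst Times \<^bold>\<cdot> s \<^bold>\<cdot> t"
definition pone :: ptm ("\<^bold>1") where
  "\<^bold>1 = psuc \<^bold>0"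

text \<open>Equality at higher types is extensional.\<close>

primrec eq_ty :: "ty \<Rightarrow> ptm \<Rightarrow> ptm \<Rightarrow> pfm" where
  "eq_ty N = (\<lambda>s t. s \<^bold>= t)"
| "eq_ty (\<sigma> \<^bold>\<rightarrow> \<tau>) = (\<lambda>s t. \<^bold>\<forall>z \<^bold>: \<sigma>. eq_ty \<tau> (s \<^bold>\<cdot> z) (t \<^bold>\<cdot> z))"

definition sentence :: "pfm \<Rightarrow> fm" where
  "sentence A = A 0"

section \<open>The theories\<close>

text \<open>In \<open>QF_induction\<close>, index 0 of \<open>A\<close> is the induction variable; in \<open>QF_AC\<close>, index 0 of \<open>A\<close> is
  the number \<open>y\<close> and index 1 the function \<open>x\<close>. Further parameters of any type
  may occur as free variables.\<close>

inductive_set RCA0w :: "fm set" where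
  Succ_nonzero: "sentence (\<^bold>\<forall>m \<^bold>: N. \<^bold>\<not> psuc m \<^bold>= \<^bold>0) \<in> RCA0w"
| Succ_inj: "sentence (\<^bold>\<forall>m \<^bold>: N. \<^bold>\<forall>n \<^bold>: N. psuc m \<^bold>= psuc n \<^bold>\<longrightarrow> m \<^bold>= n) \<in> RCA0w"
| Plus_Zero: "sentence (\<^bold>\<forall>m \<^bold>: N. m \<^bold>+ \<^bold>0 \<^bold>= m) \<in> RCA0w"
| Plus_Succ: "sentence (\<^bold>\<forall>m \<^bold>: N. \<^bold>\<forall>n \<^bold>: N. m \<^bold>+ psuc n \<^bold>= psuc (m \<^bold>+ n)) \<in> RCA0w"
| Times_Zero: "sentence (\<^bold>\<forall>m \<^bold>: N. m \<^bold>* \<^bold>0 \<^bold>= \<^bold>0) \<in> RCA0w"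
| Times_Succ: "sentence (\<^bold>\<forall>m \<^bold>: N. \<^bold>\<forall>n \<^bold>: N. m \<^bold>* psuc n \<^bold>= m \<^bold>* n \<^bold>+ m) \<in> RCA0w"
| Less_Zero: "sentence (\<^bold>\<forall>m \<^bold>: N. \<^bold>\<not> m \<^bold>< \<^bold>0) \<in> RCA0w"
| Less_Succ: "sentence (\<^bold>\<forall>m \<^bold>: N. \<^bold>\<forall>n \<^bold>: N. m \<^bold>< psuc n \<^bold>\<longleftrightarrow> m \<^bold>< n \<^bold>\<or> m \<^bold>= n) \<in> RCA0w"
| Pi_eq: "sentence (\<^bold>\<forall>x \<^bold>: \<sigma>. \<^bold>\<forall>y \<^bold>: \<tau>. eq_ty \<sigma> (pconst (PiC \<sigma> \<tau>) \<^bold>\<cdot> x \<^bold>\<cdot> y) x) \<in> RCA0w"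
| Sigma_eq: "sentence (\<^bold>\<forall>x \<^bold>: \<rho> \<^bold>\<rightarrow> \<sigma> \<^bold>\<rightarrow> \<tau>. \<^bold>\<forall>y \<^bold>: \<rho> \<^bold>\<rightarrow> \<sigma>. \<^bold>\<forall>z \<^bold>: \<rho>.
    eq_ty \<tau> (pconst (SigmaC \<rho> \<sigma> \<tau>) \<^bold>\<cdot> x \<^bold>\<cdot> y \<^bold>\<cdot> z) (x \<^bold>\<cdot> z \<^bold>\<cdot> (y \<^bold>\<cdot> z))) \<in> RCA0w"
| Rec0_Zero: "sentence (\<^bold>\<forall>f \<^bold>: N \<^bold>\<rightarrow> N \<^bold>\<rightarrow> N. \<^bold>\<forall>m \<^bold>: N. pconst Rec0 \<^bold>\<cdot> f \<^bold>\<cdot> m \<^bold>\<cdot> \<^bold>0 \<^bold>= m) \<in> RCA0w"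
| Rec0_Succ: "sentence (\<^bold>\<forall>f \<^bold>: N \<^bold>\<rightarrow> N \<^bold>\<rightarrow> N. \<^bold>\<forall>m \<^bold>: N. \<^bold>\<forall>n \<^bold>: N.
    pconst Rec0 \<^bold>\<cdot> f \<^bold>\<cdot> m \<^bold>\<cdot> psuc n \<^bold>= f \<^bold>\<cdot> n \<^bold>\<cdot> (pconst Rec0 \<^bold>\<cdot> f \<^bold>\<cdot> m \<^bold>\<cdot> n)) \<in> RCA0w"
| Extensionality: "sentence (\<^bold>\<forall>x \<^bold>: \<sigma>. \<^bold>\<forall>y \<^bold>: \<sigma>. \<^bold>\<forall>f \<^bold>: \<sigma> \<^bold>\<rightarrow> \<tau>.
    eq_ty \<sigma> x y \<^bold>\<longrightarrow> eq_ty \<tau> (f \<^bold>\<cdot> x) (f \<^bold>\<cdot> y)) \<in> RCA0w"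
| QF_induction: "qfree A \<Longrightarrow> wf_fm [N] A \<Longrightarrow>
    Imp (inst0 (Const Zero) A)
      (Imp (All N (Imp A (inst (case_nat (App (Const Succ) (Bound 0)) (\<lambda>i. Bound (Suc i))) A)))
        (All N A)) \<in> RCA0w"
| QF_AC: "qfree A \<Longrightarrow> wf_fm [N, one] A \<Longrightarrow>
    Imp (All one (Ex N A))
      (Ex two (All one (inst (case_nat (App (Bound 1) (Bound 0)) Bound) A))) \<in> RCA0w"

definition exists2 :: fm where
  "exists2 = sentence (\<^bold>\<exists>\<phi> \<^bold>: two. (\<^bold>\<forall>f \<^bold>: one. \<phi> \<^bold>\<cdot> f \<^bold>\<le> \<^bold>1) \<^bold>\<and>
     (\<^bold>\<forall>f \<^bold>: one. (\<^bold>\<exists>n \<^bold>: N. f \<^bold>\<cdot> n \<^bold>= \<^bold>0) \<^bold>\<longleftrightarrow> \<phi> \<^bold>\<cdot> f \<^bold>= \<^bold>0))"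

definition ACA0w :: "fm set" where
  "ACA0w = insert exists2 RCA0w"

section \<open>Rational and real numbers\<close>

text \<open>A triple \<open>(a, b, c)\<close> of number terms with \<open>c\<close> positive stands for the rational \<open>(a - b) / c\<close>.\<close>

type_synonym rat_tm = "ptm \<times> ptm \<times> ptm"

definition rat_add :: "rat_tm \<Rightarrow> rat_tm \<Rightarrow> rat_tm" where
  "rat_add = (\<lambda>(a, b, c) (a', b', c'). (a \<^bold>* c' \<^bold>+ a' \<^bold>* c, b \<^bold>* c' \<^bold>+ b' \<^bold>* c, c \<^bold>* c'))"
definition rat_sub :: "rat_tm \<Rightarrow> rat_tm \<Rightarrow> rat_tm" where
  "rat_sub = (\<lambda>q (a', b', c'). rat_add q (b', a', c'))"
definition rat_less :: "rat_tm \<Rightarrow> rat_tm \<Rightarrow> pfm" where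
  "rat_less = (\<lambda>(a, b, c) (a', b', c'). a \<^bold>* c' \<^bold>+ b' \<^bold>* c \<^bold>< a' \<^bold>* c \<^bold>+ b \<^bold>* c')"
definition rat_le :: "rat_tm \<Rightarrow> rat_tm \<Rightarrow> pfm" where
  "rat_le = (\<lambda>(a, b, c) (a', b', c'). a \<^bold>* c' \<^bold>+ b' \<^bold>* c \<^bold>\<le> a' \<^bold>* c \<^bold>+ b \<^bold>* c')"

text \<open>\<open>with_abs q A\<close> says that \<open>A\<close> holds of the absolute value of \<open>q\<close>.\<close>

definition with_abs :: "rat_tm \<Rightarrow> (rat_tm \<Rightarrow> pfm) \<Rightarrow> pfm" where
  "with_abs = (\<lambda>(a, b, c) A. (b \<^bold>\<le> a \<^bold>\<and> A (a, b, c)) \<^bold>\<or> (a \<^bold>< b \<^bold>\<and> A (b, a, c)))"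

text \<open>\<open>2\<^sup>n\<close>, as the recursor applied to \<open>\<lambda>i r. r + r\<close> (\<open>\<Sigma>\<Pi>\<Pi>\<close> is the identity).\<close>

definition ppow2 :: "ptm \<Rightarrow> ptm" where
  "ppow2 n = pconst Rec0 \<^bold>\<cdot>
     (pconst (PiC one N) \<^bold>\<cdot>
       (pconst (SigmaC N N N) \<^bold>\<cdot> pconst Plus \<^bold>\<cdot>
         (pconst (SigmaC N one N) \<^bold>\<cdot> pconst (PiC N one) \<^bold>\<cdot> pconst (PiC N N)))) \<^bold>\<cdot> \<^bold>1 \<^bold>\<cdot> n"

definition inv_pow2 :: "ptm \<Rightarrow> rat_tm" where
  "inv_pow2 n = (\<^bold>1, \<^bold>0, ppow2 n)"
definition two_inv_pow2 :: "ptm \<Rightarrow> rat_tm" where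
  "two_inv_pow2 n = (\<^bold>1 \<^bold>+ \<^bold>1, \<^bold>0, ppow2 n)"

definition ppair :: "ptm \<Rightarrow> ptm \<Rightarrow> ptm" where
  "ppair i j = (i \<^bold>+ j) \<^bold>* (i \<^bold>+ j) \<^bold>+ i"

text \<open>The number \<open>((a, b), k)\<close> codes the rational \<open>(a - b) / (k + 1)\<close>. \<open>with_rat t A\<close> says that
  \<open>t\<close> is such a code and that \<open>A\<close> holds of the rational.\<close>

definition with_rat :: "ptm \<Rightarrow> (rat_tm \<Rightarrow> pfm) \<Rightarrow> pfm" where
  "with_rat t A = (\<^bold>\<exists>a \<^bold>: N. \<^bold>\<exists>b \<^bold>: N. \<^bold>\<exists>k \<^bold>: N. t \<^bold>= ppair (ppair a b) k \<^bold>\<and> A (a, b, psuc k))"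

text \<open>A real expression \<open>X\<close> is given by its rational approximations: \<open>X n A\<close> says that \<open>A\<close> holds of
  the \<open>n\<close>-th one. Addition and subtraction shift the index by one to keep the rate of convergence.\<close>

type_synonym real_ex = "ptm \<Rightarrow> (rat_tm \<Rightarrow> pfm) \<Rightarrow> pfm"

definition seq :: "ptm \<Rightarrow> real_ex" where
  "seq x n A = with_rat (x \<^bold>\<cdot> n) A"
definition real_num :: "ptm \<Rightarrow> real_ex" where
  "real_num t n A = A (t, \<^bold>0, \<^bold>1)"
definition real_add :: "real_ex \<Rightarrow> real_ex \<Rightarrow> real_ex" where
  "real_add X Y n A = X (psuc n) (\<lambda>q. Y (psuc n) (\<lambda>r. A (rat_add q r)))"
definition real_sub :: "real_ex \<Rightarrow> real_ex \<Rightarrow> real_ex" where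
  "real_sub X Y n A = X (psuc n) (\<lambda>q. Y (psuc n) (\<lambda>r. A (rat_sub q r)))"
definition real_abs :: "real_ex \<Rightarrow> real_ex" where
  "real_abs X n A = X n (\<lambda>q. with_abs q A)"

definition real_eq :: "real_ex \<Rightarrow> real_ex \<Rightarrow> pfm" (infix "=\<^sub>R" 50) where
  "(X =\<^sub>R Y) = (\<^bold>\<forall>n \<^bold>: N. X n (\<lambda>q. Y n (\<lambda>r. with_abs (rat_sub q r) (\<lambda>a. rat_le a (two_inv_pow2 n)))))"
definition real_less :: "real_ex \<Rightarrow> real_ex \<Rightarrow> pfm" (infix "<\<^sub>R" 50) where
  "(X <\<^sub>R Y) = (\<^bold>\<exists>n \<^bold>: N. X n (\<lambda>q. Y n (\<lambda>r. rat_less (rat_add q (two_inv_pow2 n)) r)))"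
definition real_le :: "real_ex \<Rightarrow> real_ex \<Rightarrow> pfm" (infix "\<le>\<^sub>R" 50) where
  "(X \<le>\<^sub>R Y) = (\<^bold>\<not> Y <\<^sub>R X)"

definition is_real :: "ptm \<Rightarrow> pfm" where
  "is_real x = (\<^bold>\<forall>n \<^bold>: N. \<^bold>\<forall>i \<^bold>: N. seq x n (\<lambda>q. seq x (n \<^bold>+ i) (\<lambda>r.
     with_abs (rat_sub q r) (\<lambda>a. rat_less a (inv_pow2 n)))))"

definition in_unit :: "ptm \<Rightarrow> pfm" where
  "in_unit x = (is_real x \<^bold>\<and> real_num \<^bold>0 \<le>\<^sub>R seq x \<^bold>\<and> seq x \<le>\<^sub>R real_num \<^bold>1)"

section \<open>Functions on the unit interval\<close>

text \<open>Type \<open>one \<^bold>\<rightarrow> one\<close>; values outside the unit interval are irrelevant.\<close>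

definition unit_fun :: "ptm \<Rightarrow> pfm" where
  "unit_fun f =
     ((\<^bold>\<forall>x \<^bold>: one. in_unit x \<^bold>\<longrightarrow> is_real (f \<^bold>\<cdot> x)) \<^bold>\<and>
      (\<^bold>\<forall>x \<^bold>: one. \<^bold>\<forall>y \<^bold>: one. in_unit x \<^bold>\<and> in_unit y \<^bold>\<and> seq x =\<^sub>R seq y \<^bold>\<longrightarrow>
         seq (f \<^bold>\<cdot> x) =\<^sub>R seq (f \<^bold>\<cdot> y)))"

definition nondecreasing :: "ptm \<Rightarrow> pfm" where
  "nondecreasing f = (\<^bold>\<forall>x \<^bold>: one. \<^bold>\<forall>y \<^bold>: one. in_unit x \<^bold>\<and> in_unit y \<^bold>\<and> seq x \<le>\<^sub>R seq y \<^bold>\<longrightarrow>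
     seq (f \<^bold>\<cdot> x) \<le>\<^sub>R seq (f \<^bold>\<cdot> y))"

definition unit_partition :: "ptm \<Rightarrow> ptm \<Rightarrow> pfm" where
  "unit_partition n x =
     ((\<^bold>\<forall>i \<^bold>: N. i \<^bold>\<le> n \<^bold>\<longrightarrow> in_unit (x \<^bold>\<cdot> i)) \<^bold>\<and>
      seq (x \<^bold>\<cdot> \<^bold>0) =\<^sub>R real_num \<^bold>0 \<^bold>\<and> seq (x \<^bold>\<cdot> n) =\<^sub>R real_num \<^bold>1 \<^bold>\<and>
      (\<^bold>\<forall>i \<^bold>: N. i \<^bold>< n \<^bold>\<longrightarrow> seq (x \<^bold>\<cdot> i) <\<^sub>R seq (x \<^bold>\<cdot> psuc i)))"

text \<open>\<open>s i\<close> is the sum of \<open>\<bar>f (x j) - f (x (j + 1))\<bar>\<close> over \<open>j < i\<close>, for all \<open>i \<le> n\<close>. Such an \<open>s\<close>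
  exists and is unique up to equality of reals, provably in \<open>RCA0w\<close>.\<close>

definition variation_sums :: "ptm \<Rightarrow> ptm \<Rightarrow> ptm \<Rightarrow> ptm \<Rightarrow> pfm" where
  "variation_sums f n x s =
     ((\<^bold>\<forall>i \<^bold>: N. i \<^bold>\<le> n \<^bold>\<longrightarrow> is_real (s \<^bold>\<cdot> i)) \<^bold>\<and>
      seq (s \<^bold>\<cdot> \<^bold>0) =\<^sub>R real_num \<^bold>0 \<^bold>\<and>
      (\<^bold>\<forall>i \<^bold>: N. i \<^bold>< n \<^bold>\<longrightarrow> seq (s \<^bold>\<cdot> psuc i) =\<^sub>R
         real_add (seq (s \<^bold>\<cdot> i))
           (real_abs (real_sub (seq (f \<^bold>\<cdot> (x \<^bold>\<cdot> i))) (seq (f \<^bold>\<cdot> (x \<^bold>\<cdot> psuc i)))))))"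

definition bounded_variation :: "ptm \<Rightarrow> pfm" where
  "bounded_variation f = (\<^bold>\<exists>k \<^bold>: N. \<^bold>\<forall>n \<^bold>: N. \<^bold>\<forall>x \<^bold>: N \<^bold>\<rightarrow> one. \<^bold>\<forall>s \<^bold>: N \<^bold>\<rightarrow> one.
     unit_partition n x \<^bold>\<and> variation_sums f n x s \<^bold>\<longrightarrow> seq (s \<^bold>\<cdot> n) \<le>\<^sub>R real_num k)"

section \<open>The three principles\<close>

definition Jordan :: fm where
  "Jordan = sentence (\<^bold>\<forall>f \<^bold>: one \<^bold>\<rightarrow> one. unit_fun f \<^bold>\<and> bounded_variation f \<^bold>\<longrightarrow>
     (\<^bold>\<exists>g \<^bold>: one \<^bold>\<rightarrow> one. \<^bold>\<exists>h \<^bold>: one \<^bold>\<rightarrow> one.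
        unit_fun g \<^bold>\<and> unit_fun h \<^bold>\<and> nondecreasing g \<^bold>\<and> nondecreasing h \<^bold>\<and>
        (\<^bold>\<forall>x \<^bold>: one. in_unit x \<^bold>\<longrightarrow>
           seq (f \<^bold>\<cdot> x) =\<^sub>R real_sub (seq (g \<^bold>\<cdot> x)) (seq (h \<^bold>\<cdot> x)))))"

definition HBU_bv :: fm where
  "HBU_bv = sentence (\<^bold>\<forall>\<Psi> \<^bold>: one \<^bold>\<rightarrow> one. unit_fun \<Psi> \<^bold>\<and>
     (\<^bold>\<forall>x \<^bold>: one. in_unit x \<^bold>\<longrightarrow> real_num \<^bold>0 <\<^sub>R seq (\<Psi> \<^bold>\<cdot> x)) \<^bold>\<and> bounded_variation \<Psi> \<^bold>\<longrightarrow>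
     (\<^bold>\<exists>k \<^bold>: N. \<^bold>\<exists>y \<^bold>: N \<^bold>\<rightarrow> one. (\<^bold>\<forall>i \<^bold>: N. i \<^bold>\<le> k \<^bold>\<longrightarrow> in_unit (y \<^bold>\<cdot> i)) \<^bold>\<and>
        (\<^bold>\<forall>x \<^bold>: one. in_unit x \<^bold>\<longrightarrow> (\<^bold>\<exists>i \<^bold>: N. i \<^bold>\<le> k \<^bold>\<and>
           real_abs (real_sub (seq x) (seq (y \<^bold>\<cdot> i))) <\<^sub>R seq (\<Psi> \<^bold>\<cdot> (y \<^bold>\<cdot> i))))))"

definition NIN :: fm where
  "NIN = sentence (\<^bold>\<not> (\<^bold>\<exists>Y \<^bold>: two.
     (\<^bold>\<forall>x \<^bold>: one. \<^bold>\<forall>y \<^bold>: one. in_unit x \<^bold>\<and> in_unit y \<^bold>\<and> seq x =\<^sub>R seq y \<^bold>\<longrightarrow> Y \<^bold>\<cdot> x \<^bold>= Y \<^bold>\<cdot> y) \<^bold>\<and>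
     (\<^bold>\<forall>x \<^bold>: one. \<^bold>\<forall>y \<^bold>: one. in_unit x \<^bold>\<and> in_unit y \<^bold>\<and> Y \<^bold>\<cdot> x \<^bold>= Y \<^bold>\<cdot> y \<^bold>\<longrightarrow> seq x =\<^sub>R seq y)))"

end

theory Submission
  imports Defs "HOL-Library.Countable" "HOL-Computational_Algebra.Fraction_Field"
begin

text \<open>By Henkin's completeness theorem it suffices to show the implications in extensional models of \<open>ACA0w\<close>
  whose numbers may be nonstandard. Over such a model one builds its rationals and reals as ordered rings, so
  that ordinary arguments apply as long as every induction is over a predicate that the model decides; as
  \<open>exists2\<close> makes number quantifiers decidable, these are the arithmetical ones.

  From \<open>Jordan\<close> to \<open>HBU_bv\<close>: let \<open>\<Psi> = g - h\<close> with \<open>g\<close> and \<open>h\<close> nondecreasing. Then \<open>F = g + h + id\<close> is strictly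
  increasing, and the balls around the countably many points \<open>sup {q. F q < s}\<close>, \<open>q\<close> and \<open>s\<close> rational, already
  cover; the countable Heine-Borel theorem is available in \<open>ACA0w\<close>.

  From \<open>HBU_bv\<close> to \<open>NIN\<close>: if \<open>Y\<close> is injective, then \<open>\<Psi> x = 1 / 4 ^ (Y x + 1)\<close> is positive and has bounded variation,
  but no finite number of its balls covers the unit interval.\<close>

section \<open>Integers, rationals and reals over an ordered semiring\<close>

\<comment> \<open>A real of the model is represented in an ordered ring outside the model, about
  which no induction of the model speaks. So an inequality between reals enters an induction through
  rationals that separate its sides, and the sums that bound a variation are internal sequences.

  Discontinuities of \<open>\<Psi>\<close> may sit at irrational points, so rational centers need
  not cover. They cannot hide from rational levels, however: if \<open>F\<close> jumps from the left
  at \<open>x\<close>, a level inside the jump has \<open>x\<close> itself as its supremum;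
  otherwise levels just below \<open>F x\<close> give centers at \<open>x\<close> or so close to it
  on the left that \<open>g\<close> and \<open>h\<close>, hence \<open>\<Psi>\<close>, have hardly
  changed.

  In the second implication, \<open>\<Psi>\<close> has bounded variation because its values along a
  partition are distinct powers of \<open>1 / 4\<close>. The base 4 also leaves room to escape: an
  open ball of radius \<open>1 / 4 ^ (n + 1)\<close> cannot meet both outer quarters of an interval
  of length \<open>1 / 4 ^ n\<close>.\<close>
quotient_type (overloaded) 'a diff = "'a::linordered_semidom \<times> 'a" / "\<lambda>(a, b) (c, d). a + d = c + b"
  morphisms rep_diff Diff
proof (rule equivpI)
  show "reflp (\<lambda>(a::'a, b) (c, d). a + d = c + b)" by (auto simp: reflp_def)
  show "symp (\<lambda>(a::'a, b) (c, d). a + d = c + b)" by (auto simp: symp_def)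
  show "transp (\<lambda>(a::'a, b) (c, d). a + d = c + b)"
  proof (rule transpI, clarsimp)
    fix a b c d e f :: 'a assume "a + d = c + b" "c + f = e + d"
    then have "a + f + (c + d) = e + b + (c + d)" by (simp add: algebra_simps) (metis add.assoc add.commute)
    then show "a + f = e + b" by simp
  qed
qed

instantiation diff :: (linordered_semidom) comm_ring_1
begin
lift_definition zero_diff :: "'a diff" is "(0, 0)" .
lift_definition one_diff :: "'a diff" is "(1, 0)" .
lift_definition plus_diff :: "'a diff \<Rightarrow> 'a diff \<Rightarrow> 'a diff" is "\<lambda>(a, b) (c, d). (a + c, b + d)"
proof clarsimp
  fix a b c d a' b' c' d' :: 'a assume "a + b' = a' + b" "c + d' = c' + d"
  then have "a + b' + (c + d') = a' + b + (c' + d)" by simp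
  then show "a + c + (b' + d') = a' + c' + (b + d)" by (simp add: algebra_simps)
qed
lift_definition uminus_diff :: "'a diff \<Rightarrow> 'a diff" is "\<lambda>(a, b). (b, a)" by (auto simp: add.commute)
lift_definition minus_diff :: "'a diff \<Rightarrow> 'a diff \<Rightarrow> 'a diff" is "\<lambda>(a, b) (c, d). (a + d, b + c)"
proof clarsimp
  fix a b c d a' b' c' d' :: 'a assume "a + b' = a' + b" "c + d' = c' + d"
  then have "a + b' + (c' + d) = a' + b + (c + d')" by simp
  then show "a + d + (b' + c') = a' + d' + (b + c)" by (simp add: algebra_simps)
qed
lift_definition times_diff :: "'a diff \<Rightarrow> 'a diff \<Rightarrow> 'a diff" is "\<lambda>(a, b) (c, d). (a * c + b * d, a * d + b * c)"
proof clarsimp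
  fix a b c d a' b' c' d' :: 'a assume 1: "a + b' = a' + b" and 2: "c + d' = c' + d"
  have "(a + b') * c + (a' + b) * d + (a' * (c + d') + b' * (c' + d))
      = (a' + b) * c + (a + b') * d + (a' * (c' + d) + b' * (c + d'))"
    using 1 2 by simp
  then have "(a * c + b * d + (a' * d' + b' * c')) + (b' * c + a' * d + a' * c + b' * d)
      = (a' * c' + b' * d' + (a * d + b * c)) + (b' * c + a' * d + a' * c + b' * d)"
    by (simp add: algebra_simps)
  then show "a * c + b * d + (a' * d' + b' * c') = a' * c' + b' * d' + (a * d + b * c)" by simp
qed
instance
  by standard (transfer; auto simp: algebra_simps)+
end

instantiation diff :: (linordered_semidom) linordered_idom
begin
lift_definition less_eq_diff :: "'a diff \<Rightarrow> 'a diff \<Rightarrow> bool" is "\<lambda>(a, b) (c, d). a + d \<le> c + b"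
proof clarsimp
  fix a b c d a' b' c' d' :: 'a assume 1: "a + b' = a' + b" and 2: "c + d' = c' + d"
  have "a + d \<le> c + b \<longleftrightarrow> (a + d) + (b' + d') \<le> (c + b) + (b' + d')" by simp
  also have "\<dots> \<longleftrightarrow> (a + b') + d + d' \<le> (c + d') + b + b'" by (simp add: algebra_simps)
  also have "\<dots> \<longleftrightarrow> (a' + b) + d + d' \<le> (c' + d) + b + b'" using 1 2 by simp
  also have "\<dots> \<longleftrightarrow> (a' + d') + (b + d) \<le> (c' + b') + (b + d)" by (simp add: algebra_simps)
  finally show "a + d \<le> c + b \<longleftrightarrow> a' + d' \<le> c' + b'" by simp
qed
definition less_diff :: "'a diff \<Rightarrow> 'a diff \<Rightarrow> bool" where "less_diff x y \<longleftrightarrow> x \<le> y \<and> \<not> y \<le> x"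
definition abs_diff :: "'a diff \<Rightarrow> 'a diff" where "abs_diff x = (if x < 0 then - x else x)"
definition sgn_diff :: "'a diff \<Rightarrow> 'a diff" where "sgn_diff x = (if x = 0 then 0 else if 0 < x then 1 else - 1)"
instance
proof
  fix x y z :: "'a diff"
  show "(x < y) = (x \<le> y \<and> \<not> y \<le> x)" by (simp add: less_diff_def)
  show "x \<le> x" by transfer auto
  show "x \<le> y \<or> y \<le> x" by transfer auto
  show "x \<le> y \<Longrightarrow> y \<le> x \<Longrightarrow> x = y" by transfer auto
  show "x \<le> z" if "x \<le> y" "y \<le> z"
  using that proof (transfer, clarsimp)
    fix a b c d e f :: 'a assume "a + d \<le> c + b" "c + f \<le> e + d"
    then have "(a + d) + (c + f) \<le> (c + b) + (e + d)" by (rule add_mono)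
    then have "(a + f) + (c + d) \<le> (e + b) + (c + d)" by (simp add: algebra_simps)
    then show "a + f \<le> e + b" by simp
  qed
  show "x \<le> y \<Longrightarrow> z + x \<le> z + y" by transfer (auto simp: algebra_simps add_mono)
  show "\<bar>x\<bar> = (if x < 0 then - x else x)" by (simp add: abs_diff_def)
  show "sgn x = (if x = 0 then 0 else if 0 < x then 1 else - 1)" by (simp add: sgn_diff_def)
  show "z * x < z * y" if "x < y" "0 < z"
  proof -
    have "\<not> z * y \<le> z * x" if "\<not> y \<le> x" "\<not> z \<le> 0" for x y z :: "'a diff"
    using that proof (transfer, clarsimp simp: not_le)
    fix a b c d e f :: 'a assume 1: "a + d < c + b" and "f < e"
      and *: "e * c + f * d + (e * b + f * a) \<le> e * a + f * b + (e * d + f * c)"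
    then obtain k where e: "e = k + f" and k: "0 < k"
      by (metis add_strict_increasing2 le_add_diff_inverse2 less_imp_le not_le add_0 add_le_cancel_right not_less_iff_gr_or_eq)
    have "k * (a + d) + f * (a + b + c + d) < k * (c + b) + f * (a + b + c + d)"
      using mult_strict_left_mono[OF 1 k] by (rule add_strict_right_mono)
    moreover have "k * (a + d) + f * (a + b + c + d) = (k + f) * a + f * b + ((k + f) * d + f * c)"
      "k * (c + b) + f * (a + b + c + d) = (k + f) * c + f * d + ((k + f) * b + f * a)"
      by (simp_all add: distrib_left distrib_right add_ac mult_ac)
    ultimately show False using * unfolding e by simp
  qed
  moreover have "u \<le> v" if "\<not> v \<le> u" for u v :: "'a diff" using that by transfer auto
  ultimately show ?thesis using that by (auto simp: less_diff_def)
  qed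
qed
end

section \<open>Rationals: the fraction field of the differences\<close>

type_synonym 'a qt = "'a diff fract"

lift_definition nd :: "'a::linordered_semidom \<Rightarrow> 'a diff" is "\<lambda>a. (a, 0)" .

definition nq :: "'a::linordered_semidom \<Rightarrow> 'a qt" where "nq a = Fract (nd a) 1"

lemma nd_simps [simp]: "nd 0 = 0" "nd 1 = 1" "nd (a + b) = nd a + nd b" "nd (a * b) = nd a * nd b"
  "nd a = nd b \<longleftrightarrow> a = b" "nd a \<le> nd b \<longleftrightarrow> a \<le> b"
  by (transfer; auto)+
lemma nd_less [simp]: "nd a < nd b \<longleftrightarrow> a < b" by (simp add: less_le)

lemma nq_simps [simp]: "nq 0 = 0" "nq 1 = 1" "nq (a + b) = nq a + nq b" "nq (a * b) = nq a * nq b"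
  "nq a = nq b \<longleftrightarrow> a = b" "nq a \<le> nq b \<longleftrightarrow> a \<le> b" "nq a < nq b \<longleftrightarrow> a < b"
  by (simp_all add: nq_def fract_collapse eq_fract)
lemma nq_numeral [simp]: "nq (numeral k) = numeral k"
proof -
  have "nq (of_nat n) = of_nat n" for n by (induction n) auto
  from this[of "numeral k"] show ?thesis by simp
qed
lemma nq_pos_iff [simp]: "0 < nq a \<longleftrightarrow> 0 < a" "0 = nq a \<longleftrightarrow> 0 = a" "nq a = 0 \<longleftrightarrow> a = 0" "0 \<le> nq a \<longleftrightarrow> 0 \<le> a"
  using nq_simps(5-7)[of 0 a] nq_simps(5)[of a 0] nq_simps(6)[of 0 a] by (auto simp del: nq_simps(5-7))

lemma nd_cases: obtains a b where "z = nd a - nd b"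
proof -
  have "\<exists>a b. z = nd a - nd b" by transfer (auto simp: ac_simps)
  then show ?thesis using that by blast
qed

text \<open>The same normal form as the triples of \<open>rat_tm\<close>, so that rationals of this
  type can be matched with those of the formulas.\<close>

lemma qt_cases: obtains a b c where "0 < c" "q = (nq a - nq b) / nq c"
proof -
  obtain x' y' where 1: "q = Fract x' y'" "y' \<noteq> 0" by (rule Fract_cases)
  obtain x y where y: "y > 0" and q: "q = Fract x y"
  proof (cases "y' > 0")
    case False
    then show ?thesis using 1 that[of "- y'" "- x'"] by simp
  qed (use 1 that in auto)
  obtain a b where x: "x = nd a - nd b" by (rule nd_cases)
  obtain c d where c: "y = nd c - nd d" by (rule nd_cases)
  then have "d < c" using y by simp
  then have *: "nd (c - d) = y" unfolding c using nd_simps(3)[of "c - d" d] by (simp add: algebra_simps less_imp_le del: nd_simps)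
  then have "0 < c - d" using y by (metis nd_less nd_simps(1))
  moreover have "q = (nq a - nq b) / nq (c - d)" unfolding q x nq_def using * y by simp
  ultimately show ?thesis using that by blast
qed

lemma add_diff_add_eq: "(a + b) - (c + d) = (a - c) + (b - d)" for a b c d :: "'a::ab_group_add"
  by simp

section \<open>Cauchy sequences of rationals, indexed by the semiring itself, and the ordered ring
  of their limits\<close>

definition vanishing :: "('a::linordered_semidom \<Rightarrow> 'a qt) \<Rightarrow> bool" where
  "vanishing X \<longleftrightarrow> (\<forall>r>0. \<forall>\<^sub>F n in at_top. \<bar>X n\<bar> < r)"

definition cauchy :: "('a::linordered_semidom \<Rightarrow> 'a qt) \<Rightarrow> bool" where
  "cauchy X \<longleftrightarrow> (\<forall>r>0. \<exists>k. \<forall>m\<ge>k. \<forall>n\<ge>k. \<bar>X m - X n\<bar> < r)"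

lemma vanishing_minus: "vanishing X \<Longrightarrow> vanishing (\<lambda>n. - X n)"
  by (simp add: vanishing_def)

lemma vanishing_add: assumes "vanishing X" "vanishing Y" shows "vanishing (\<lambda>n. X n + Y n)"
  unfolding vanishing_def
proof safe
  fix r :: "'a qt" assume "0 < r"
  then have "\<forall>\<^sub>F n in at_top. \<bar>X n\<bar> < r / 2" "\<forall>\<^sub>F n in at_top. \<bar>Y n\<bar> < r / 2"
    using assms half_gt_zero[of r] unfolding vanishing_def by blast+
  then show "\<forall>\<^sub>F n in at_top. \<bar>X n + Y n\<bar> < r"
  proof eventually_elim
    case (elim n)
    show ?case using abs_triangle_ineq[of "X n" "Y n"] add_strict_mono[OF elim] by simp
  qed
qed

lemma vanishing_mult:
  assumes X: "vanishing X" and b: "b > 0" "\<forall>\<^sub>F n in at_top. \<bar>Y n\<bar> < b" shows "vanishing (\<lambda>n. X n * Y n)"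
  unfolding vanishing_def
proof safe
  fix r :: "'a qt" assume "0 < r"
  with X b have "\<forall>\<^sub>F n in at_top. \<bar>X n\<bar> < r / b" by (auto simp: vanishing_def)
  with b(2) show "\<forall>\<^sub>F n in at_top. \<bar>X n * Y n\<bar> < r"
  proof eventually_elim
    case (elim n)
    have "\<bar>X n\<bar> * \<bar>Y n\<bar> < r / b * b" using elim b(1) by (intro mult_strict_mono') auto
    then show ?case using b(1) by (simp add: abs_mult)
  qed
qed

lemma cauchy_const [simp]: "cauchy (\<lambda>n. c)" by (auto simp: cauchy_def)

lemma cauchy_minus: "cauchy X \<Longrightarrow> cauchy (\<lambda>n. - X n)"
proof -
  have "\<bar>- a - - b\<bar> = \<bar>a - b\<bar>" for a b :: "'a qt" by (simp add: abs_if)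
  then show "cauchy X \<Longrightarrow> cauchy (\<lambda>n. - X n)" by (simp only: cauchy_def)
qed

lemma cauchy_add: assumes "cauchy X" "cauchy Y" shows "cauchy (\<lambda>n. X n + Y n)"
  unfolding cauchy_def
proof safe
  fix r :: "'a qt" assume "0 < r"
  then have "0 < r / 2" by simp
  then obtain k l where kl: "\<forall>m\<ge>k. \<forall>n\<ge>k. \<bar>X m - X n\<bar> < r / 2" "\<forall>m\<ge>l. \<forall>n\<ge>l. \<bar>Y m - Y n\<bar> < r / 2"
    using assms unfolding cauchy_def by metis
  show "\<exists>k. \<forall>m\<ge>k. \<forall>n\<ge>k. \<bar>X m + Y m - (X n + Y n)\<bar> < r"
  proof (intro exI[of _ "max k l"] allI impI)
    fix m n assume "max k l \<le> m" "max k l \<le> n"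
    then have "\<bar>X m - X n\<bar> < r / 2" "\<bar>Y m - Y n\<bar> < r / 2" using kl by auto
    from add_strict_mono[OF this] abs_triangle_ineq[of "X m - X n" "Y m - Y n"]
    show "\<bar>X m + Y m - (X n + Y n)\<bar> < r" by (simp add: algebra_simps)
  qed
qed

lemma cauchy_bounded: assumes "cauchy X" obtains b where "b > 0" "\<forall>\<^sub>F n in at_top. \<bar>X n\<bar> < b"
proof -
  obtain k where k: "\<forall>m\<ge>k. \<forall>n\<ge>k. \<bar>X m - X n\<bar> < 1" using assms unfolding cauchy_def by (meson zero_less_one)
  have "\<bar>X n\<bar> < \<bar>X k\<bar> + 1" if "n \<ge> k" for n
  proof -
    have "\<bar>X n - X k\<bar> < 1" using k that by simp
    then show ?thesis by linarith
  qed
  then have "\<forall>\<^sub>F n in at_top. \<bar>X n\<bar> < \<bar>X k\<bar> + 1" unfolding eventually_at_top_linorder by blast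
  then show ?thesis using that[of "\<bar>X k\<bar> + 1"] abs_ge_zero[of "X k"] by (simp add: add_nonneg_pos)
qed

lemma cauchy_mult: assumes "cauchy X" "cauchy Y" shows "cauchy (\<lambda>n. X n * Y n)"
  unfolding cauchy_def
proof safe
  fix r :: "'a qt" assume r: "0 < r"
  obtain b where b: "b > 0" "\<forall>\<^sub>F n in at_top. \<bar>X n\<bar> < b" by (rule cauchy_bounded[OF assms(1)])
  obtain c where c: "c > 0" "\<forall>\<^sub>F n in at_top. \<bar>Y n\<bar> < c" by (rule cauchy_bounded[OF assms(2)])
  from b c obtain i j where i: "\<And>n. n \<ge> i \<Longrightarrow> \<bar>X n\<bar> < b" and j: "\<And>n. n \<ge> j \<Longrightarrow> \<bar>Y n\<bar> < c"
    unfolding eventually_at_top_linorder by metis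
  have "0 < r / 2 / c" "0 < r / 2 / b" using r b c by auto
  then obtain k l where kl: "\<forall>m\<ge>k. \<forall>n\<ge>k. \<bar>X m - X n\<bar> < r / 2 / c" "\<forall>m\<ge>l. \<forall>n\<ge>l. \<bar>Y m - Y n\<bar> < r / 2 / b"
    using assms unfolding cauchy_def by metis
  show "\<exists>k. \<forall>m\<ge>k. \<forall>n\<ge>k. \<bar>X m * Y m - X n * Y n\<bar> < r"
  proof (intro exI[of _ "max (max i j) (max k l)"] allI impI)
    fix m n assume "max (max i j) (max k l) \<le> m" "max (max i j) (max k l) \<le> n"
    then have *: "\<bar>X m - X n\<bar> < r / 2 / c" "\<bar>Y m - Y n\<bar> < r / 2 / b" "\<bar>X m\<bar> < b" "\<bar>Y n\<bar> < c" using kl i j by auto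
    have "\<bar>X m * Y m - X n * Y n\<bar> = \<bar>X m * (Y m - Y n) + (X m - X n) * Y n\<bar>" by (simp add: algebra_simps)
    also have "\<dots> \<le> \<bar>X m\<bar> * \<bar>Y m - Y n\<bar> + \<bar>X m - X n\<bar> * \<bar>Y n\<bar>"
      by (metis abs_mult abs_triangle_ineq)
    also have "\<dots> < b * (r / 2 / b) + r / 2 / c * c"
      using * b(1) c(1) by (intro add_strict_mono mult_strict_mono') auto
    also have "\<dots> = r" using b(1) c(1) by simp
    finally show "\<bar>X m * Y m - X n * Y n\<bar> < r" .
  qed
qed

\<comment> \<open>All Cauchy sequences count here, including those that are no objects of a model.
  The type only provides the arithmetic and the order; whenever a supremum is needed, it is
  constructed as an element of the model. The relation is partial because it is reflexive on Cauchy
  sequences only.\<close>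
quotient_type (overloaded) 'a creal = "'a::linordered_semidom \<Rightarrow> 'a qt" / partial:
  "\<lambda>X Y. cauchy X \<and> cauchy Y \<and> vanishing (\<lambda>n. X n - Y n)"
  morphisms rep_creal Creal
proof (rule part_equivpI)
  show "\<exists>X::'a \<Rightarrow> 'a qt. cauchy X \<and> cauchy X \<and> vanishing (\<lambda>n. X n - X n)"
    by (rule exI[of _ "\<lambda>_. 0"]) (simp add: vanishing_def)
  show "symp (\<lambda>(X::'a \<Rightarrow> 'a qt) Y. cauchy X \<and> cauchy Y \<and> vanishing (\<lambda>n. X n - Y n))"
    by (auto simp: symp_def vanishing_def abs_minus_commute)
  show "transp (\<lambda>(X::'a \<Rightarrow> 'a qt) Y. cauchy X \<and> cauchy Y \<and> vanishing (\<lambda>n. X n - Y n))"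
    by (rule transpI) (force dest: vanishing_add)
qed

instantiation creal :: (linordered_semidom) comm_ring_1
begin
lift_definition zero_creal :: "'a creal" is "\<lambda>_. 0" by (simp add: vanishing_def)
lift_definition one_creal :: "'a creal" is "\<lambda>_. 1" by (simp add: vanishing_def)
lift_definition plus_creal :: "'a creal \<Rightarrow> 'a creal \<Rightarrow> 'a creal" is "\<lambda>X Y n. X n + Y n"
  by (auto intro: cauchy_add dest: vanishing_add simp: add_diff_add_eq)
lift_definition uminus_creal :: "'a creal \<Rightarrow> 'a creal" is "\<lambda>X n. - X n"
  by (auto intro: cauchy_minus simp: vanishing_def abs_minus_commute)
lift_definition times_creal :: "'a creal \<Rightarrow> 'a creal \<Rightarrow> 'a creal" is "\<lambda>X Y n. X n * Y n"
proof (intro conjI; (elim conjE)?)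
  fix X X' Y Y' :: "'a \<Rightarrow> 'a qt"
  assume *: "cauchy X" "cauchy X'" "cauchy Y" "cauchy Y'" "vanishing (\<lambda>n. X n - X' n)" "vanishing (\<lambda>n. Y n - Y' n)"
  obtain b where b: "b > 0" "\<forall>\<^sub>F n in at_top. \<bar>X n\<bar> < b" by (rule cauchy_bounded[OF *(1)])
  obtain c where c: "c > 0" "\<forall>\<^sub>F n in at_top. \<bar>Y' n\<bar> < c" by (rule cauchy_bounded[OF *(4)])
  from vanishing_add[OF vanishing_mult[OF *(6) b] vanishing_mult[OF *(5) c]]
  show "vanishing (\<lambda>n. X n * Y n - X' n * Y' n)" by (simp add: algebra_simps)
qed (auto intro: cauchy_mult)
definition minus_creal :: "'a creal \<Rightarrow> 'a creal \<Rightarrow> 'a creal" where "minus_creal x y = x + - y"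
instance
proof
  fix x y z :: "'a creal"
  show "x - y = x + - y" by (simp add: minus_creal_def)
  show "(0::'a creal) \<noteq> 1"
  proof transfer
    have "\<not> (\<forall>\<^sub>F n::'a in at_top. \<bar>0 - 1 :: 'a qt\<bar> < 1)" by (simp add: trivial_limit_at_top_linorder)
    then show "\<not> (cauchy (\<lambda>_::'a. 0::'a qt) \<and> cauchy (\<lambda>_::'a. 1::'a qt) \<and> vanishing (\<lambda>n::'a. 0 - 1 :: 'a qt))"
      unfolding vanishing_def using zero_less_one by blast
  qed
qed (transfer, simp add: cauchy_add cauchy_mult cauchy_minus algebra_simps vanishing_def)+
end

definition pos_seq :: "('a::linordered_semidom \<Rightarrow> 'a qt) \<Rightarrow> bool" where
  "pos_seq X \<longleftrightarrow> (\<exists>r>0. \<forall>\<^sub>F n in at_top. r < X n)"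

lemma pos_seq_cong: assumes "vanishing (\<lambda>n. X n - Y n)" "pos_seq X" shows "pos_seq Y"
proof -
  obtain r where "r > 0" "\<forall>\<^sub>F n in at_top. r < X n" using assms(2) unfolding pos_seq_def by blast
  moreover from this(1) have "\<forall>\<^sub>F n in at_top. \<bar>X n - Y n\<bar> < r / 2" using assms(1) half_gt_zero unfolding vanishing_def by blast
  ultimately have *: "r > 0" "\<forall>\<^sub>F n in at_top. r < X n" "\<forall>\<^sub>F n in at_top. \<bar>X n - Y n\<bar> < r / 2" by auto
  from *(2,3) have "\<forall>\<^sub>F n in at_top. r / 2 < Y n"
  proof eventually_elim
    case (elim n)
    moreover have "r / 2 + r / 2 = r" by simp
    ultimately show ?case unfolding abs_less_iff by linarith
  qed
  then show ?thesis using *(1) half_gt_zero unfolding pos_seq_def by blast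
qed

lift_definition pos_creal :: "'a::linordered_semidom creal \<Rightarrow> bool" is pos_seq
proof -
  fix X Y :: "'a \<Rightarrow> 'a qt" assume "cauchy X \<and> cauchy Y \<and> vanishing (\<lambda>n. X n - Y n)"
  moreover from this have "vanishing (\<lambda>n. Y n - X n)" using vanishing_minus by fastforce
  ultimately show "pos_seq X = pos_seq Y" using pos_seq_cong by blast
qed

lemma pos_creal_add: "pos_creal x \<Longrightarrow> pos_creal y \<Longrightarrow> pos_creal (x + y)"
proof transfer
  fix X Y :: "'a \<Rightarrow> 'a qt" assume "pos_seq X" "pos_seq Y"
  then obtain r s where "r > 0" "s > 0" "\<forall>\<^sub>F n in at_top. r < X n" "\<forall>\<^sub>F n in at_top. s < Y n" unfolding pos_seq_def by auto
  moreover from this(3,4) have "\<forall>\<^sub>F n in at_top. r + s < X n + Y n" by eventually_elim (rule add_strict_mono)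
  ultimately show "pos_seq (\<lambda>n. X n + Y n)" unfolding pos_seq_def by (intro exI[of _ "r + s"]) auto
qed

lemma pos_creal_mult: "pos_creal x \<Longrightarrow> pos_creal y \<Longrightarrow> pos_creal (x * y)"
proof transfer
  fix X Y :: "'a \<Rightarrow> 'a qt" assume "pos_seq X" "pos_seq Y"
  then obtain r s where *: "r > 0" "s > 0" "\<forall>\<^sub>F n in at_top. r < X n" "\<forall>\<^sub>F n in at_top. s < Y n" unfolding pos_seq_def by auto
  from *(3,4) have "\<forall>\<^sub>F n in at_top. r * s < X n * Y n"
    by eventually_elim (use *(1,2) in \<open>auto intro: mult_strict_mono'\<close>)
  then show "pos_seq (\<lambda>n. X n * Y n)" unfolding pos_seq_def using *(1,2) by (intro exI[of _ "r * s"]) auto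
qed

lemma pos_creal_not_zero: "\<not> pos_creal 0"
  by transfer (auto simp: pos_seq_def trivial_limit_at_top_linorder)

text \<open>A Cauchy sequence that does not vanish has a term of absolute value at least
  \<open>r\<close> at an index from which it varies by less than \<open>r / 2\<close>. From there on
  it keeps the sign of that term and stays more than \<open>r / 2\<close> away from zero.\<close>

lemma pos_creal_cases: "x = 0 \<or> pos_creal x \<or> pos_creal (- x)"
proof transfer
  fix X :: "'a \<Rightarrow> 'a qt" assume "cauchy X \<and> cauchy X \<and> vanishing (\<lambda>n. X n - X n)"
  then have X: "cauchy X" by simp
  show "(cauchy X \<and> cauchy (\<lambda>_::'a. 0::'a qt) \<and> vanishing (\<lambda>n. X n - 0)) \<or> pos_seq X \<or> pos_seq (\<lambda>n. - X n)"
  proof (cases "vanishing X")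
    case False
    then obtain r where r: "r > 0" and nr: "\<not> (\<forall>\<^sub>F n in at_top. \<bar>X n\<bar> < r)" by (auto simp: vanishing_def)
    have "0 < r / 2" using r by simp
    then obtain k where k: "\<And>m n. m \<ge> k \<Longrightarrow> n \<ge> k \<Longrightarrow> \<bar>X m - X n\<bar> < r / 2" using X unfolding cauchy_def by metis
    obtain m where m: "m \<ge> k" "\<bar>X m\<bar> \<ge> r" using nr unfolding eventually_at_top_linorder by (auto simp: not_less)
    have "(\<forall>n\<ge>k. r / 2 < X n) \<or> (\<forall>n\<ge>k. r / 2 < - X n)"
    proof (cases "X m \<ge> 0")
      case True
      have "r / 2 < X n" if "n \<ge> k" for n using k[OF m(1) that] m(2) True by (auto simp: abs_if field_simps split: if_splits)
      then show ?thesis by blast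
    next
      case False
      have "r / 2 < - X n" if "n \<ge> k" for n using k[OF m(1) that] m(2) False by (auto simp: abs_if field_simps split: if_splits)
      then show ?thesis by blast
    qed
    then show ?thesis using r unfolding pos_seq_def eventually_at_top_linorder by (metis half_gt_zero)
  qed (use X in simp)
qed

instantiation creal :: (linordered_semidom) linordered_idom
begin
definition less_creal :: "'a creal \<Rightarrow> 'a creal \<Rightarrow> bool" where "x < y \<longleftrightarrow> pos_creal (y - x)"
definition less_eq_creal :: "'a creal \<Rightarrow> 'a creal \<Rightarrow> bool" where "x \<le> y \<longleftrightarrow> x < y \<or> x = (y::'a creal)"
definition abs_creal :: "'a creal \<Rightarrow> 'a creal" where "abs_creal x = (if x < 0 then - x else x)"
definition sgn_creal :: "'a creal \<Rightarrow> 'a creal" where "sgn_creal x = (if x = 0 then 0 else if 0 < x then 1 else - 1)"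
instance
proof
  fix x y z :: "'a creal"
  have irr: "\<not> (x < y \<and> y < x)" for x y :: "'a creal"
    unfolding less_creal_def using pos_creal_add[of "x - y" "y - x"] pos_creal_not_zero by auto
  have tr: "x < z" if "x < y" "y < z" for x y z :: "'a creal"
    using that pos_creal_add[of "y - x" "z - y"] by (auto simp: less_creal_def)
  have ir: "\<not> x < x" for x :: "'a creal" using irr[of x x] by simp
  show "(x < y) = (x \<le> y \<and> \<not> y \<le> x)" using irr ir by (auto simp: less_eq_creal_def)
  show "x \<le> x" by (simp add: less_eq_creal_def)
  show "x \<le> y \<Longrightarrow> y \<le> z \<Longrightarrow> x \<le> z" using tr by (auto simp: less_eq_creal_def)
  show "x \<le> y \<Longrightarrow> y \<le> x \<Longrightarrow> x = y" using irr by (auto simp: less_eq_creal_def)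
  show "x \<le> y \<or> y \<le> x" using pos_creal_cases[of "y - x"] by (auto simp: less_eq_creal_def less_creal_def)
  show "x \<le> y \<Longrightarrow> z + x \<le> z + y" by (auto simp: less_eq_creal_def less_creal_def)
  show "x < y \<Longrightarrow> 0 < z \<Longrightarrow> z * x < z * y"
    using pos_creal_mult[of z "y - x"] by (auto simp: less_creal_def algebra_simps)
  show "\<bar>x\<bar> = (if x < 0 then - x else x)" by (simp add: abs_creal_def)
  show "sgn x = (if x = 0 then 0 else if 0 < x then 1 else - 1)" by (simp add: sgn_creal_def)
qed
end

lemma Creal_simps:
  assumes "cauchy X" "cauchy Y"
  shows "Creal X + Creal Y = Creal (\<lambda>n. X n + Y n)" "- Creal X = Creal (\<lambda>n. - X n)"
    "Creal X - Creal Y = Creal (\<lambda>n. X n - Y n)" "pos_creal (Creal X) \<longleftrightarrow> pos_seq X"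
proof -
  have v: "vanishing (\<lambda>n::'a. 0)" by (simp add: vanishing_def)
  show a: "Creal X + Creal Y = Creal (\<lambda>n. X n + Y n)" using assms v by (intro plus_creal.abs_eq) (auto simp: eq_onp_def)
  show b: "- Creal X = Creal (\<lambda>n. - X n)" using assms v by (intro uminus_creal.abs_eq) (auto simp: eq_onp_def)
  have "- Creal Y = Creal (\<lambda>n. - Y n)" using assms v by (intro uminus_creal.abs_eq) (auto simp: eq_onp_def)
  moreover have "Creal X + Creal (\<lambda>n. - Y n) = Creal (\<lambda>n. X n + - Y n)" using assms v
    by (intro plus_creal.abs_eq) (auto simp: eq_onp_def intro: cauchy_minus)
  ultimately show "Creal X - Creal Y = Creal (\<lambda>n. X n - Y n)" by (simp add: minus_creal_def)
  show "pos_creal (Creal X) \<longleftrightarrow> pos_seq X" using assms v by (intro pos_creal.abs_eq) (auto simp: eq_onp_def)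
qed

lemma cauchy_diff: "cauchy X \<Longrightarrow> cauchy Y \<Longrightarrow> cauchy (\<lambda>n. X n - Y n)"
  using cauchy_add[of X "\<lambda>n. - Y n"] cauchy_minus[of Y] by simp

lemma Creal_less: "cauchy X \<Longrightarrow> cauchy Y \<Longrightarrow> Creal X < Creal Y \<longleftrightarrow> (\<exists>r>0. \<forall>\<^sub>F n in at_top. X n + r < Y n)"
  unfolding less_creal_def
  by (subst Creal_simps) (auto simp: Creal_simps(4)[OF cauchy_diff cauchy_diff] pos_seq_def algebra_simps)

definition rq :: "'a::linordered_semidom qt \<Rightarrow> 'a creal" where "rq q = Creal (\<lambda>_. q)"

lemma rq_simps [simp]: "rq 0 = 0" "rq 1 = 1" "rq (a + b) = rq a + rq b" "rq (a - b) = rq a - rq b" "rq (- a) = - rq a"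
  by (simp_all add: rq_def Creal_simps[OF cauchy_const cauchy_const] Creal_simps(2)[OF cauchy_const cauchy_const] zero_creal_def one_creal_def)
lemma rq_less [simp]: "rq a < rq b \<longleftrightarrow> a < b"
proof -
  have "\<exists>r>0. a + r < b" if "a < b" using that by (intro exI[of _ "(b - a) / 2"]) (auto simp: field_simps)
  then show ?thesis unfolding rq_def by (subst Creal_less) (auto simp: trivial_limit_at_top_linorder intro: add_pos_pos dest: less_add_same_cancel1[THEN iffD2] intro: less_trans)
qed
lemma rq_le [simp]: "rq a \<le> rq b \<longleftrightarrow> a \<le> b" by (simp add: not_less[symmetric])

section \<open>Substitution and renaming\<close>

lemma inst_tm_comp: "inst_tm s (inst_tm r t) = inst_tm (\<lambda>i. inst_tm s (r i)) t"
  by (induction t) auto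

lemma inst_tm_Bound [simp]: "inst_tm Bound t = t"
  by (induction t) auto

lemma lift_subst_Bound [simp]: "lift_subst Bound = Bound"
  by (auto simp: lift_subst_def fun_eq_iff split: nat.split)

lemma inst_Bound [simp]: "inst Bound A = A"
  by (induction A) auto

lemma inst_comp: "inst s (inst r A) = inst (\<lambda>i. inst_tm s (r i)) A"
proof (induction A arbitrary: s r)
  case (All \<sigma> A)
  have "(\<lambda>i. inst_tm (lift_subst s) (lift_subst r i)) = lift_subst (\<lambda>i. inst_tm s (r i))"
    by (auto simp: fun_eq_iff lift_subst_def inst_tm_comp split: nat.split)
  then show ?case using All by simp
qed (auto simp: inst_tm_comp)

lemma typed_inst: "typed \<Delta> t \<tau> \<Longrightarrow> (\<And>i. i < length \<Delta> \<Longrightarrow> typed \<Delta>' (s i) (\<Delta> ! i)) \<Longrightarrow> typed \<Delta>' (inst_tm s t) \<tau>"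
  by (induction t arbitrary: \<tau>) auto

lemma wf_inst: "wf_fm \<Delta> A \<Longrightarrow> (\<And>i. i < length \<Delta> \<Longrightarrow> typed \<Delta>' (s i) (\<Delta> ! i)) \<Longrightarrow> wf_fm \<Delta>' (inst s A)"
proof (induction A arbitrary: \<Delta> \<Delta>' s)
  case (All \<sigma> A)
  have "typed (\<sigma> # \<Delta>') (lift_subst s i) ((\<sigma> # \<Delta>) ! i)" if "i < length (\<sigma> # \<Delta>)" for i
    using All.prems(2) that by (auto simp: lift_subst_def split: nat.split intro!: typed_inst)
  moreover have "wf_fm (\<sigma> # \<Delta>) A" using All.prems(1) by simp
  ultimately show ?case using All.IH[of "\<sigma> # \<Delta>" "\<sigma> # \<Delta>'" "lift_subst s"] by simp
qed (auto intro: typed_inst)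

lemma inst_tm_cong: "typed \<Delta> t \<tau> \<Longrightarrow> (\<And>i. i < length \<Delta> \<Longrightarrow> s i = r i) \<Longrightarrow> inst_tm s t = inst_tm r t"
  by (induction t arbitrary: \<tau>) auto

lemma inst_tm_closed: "typed [] t \<tau> \<Longrightarrow> inst_tm s t = t"
  using inst_tm_cong[of "[]" t \<tau> s Bound] by simp

lemma typed_unique: "typed \<Delta> t \<sigma> \<Longrightarrow> typed \<Delta> t \<tau> \<Longrightarrow> \<sigma> = \<tau>"
  by (induction t arbitrary: \<sigma> \<tau>) auto

lemma typed_append: "typed \<Delta> t \<tau> \<Longrightarrow> typed (\<Delta> @ \<Delta>') t \<tau>"
  by (induction t arbitrary: \<tau>) (auto simp: nth_append)

primrec ren_tm :: "(nat \<times> ty \<Rightarrow> nat) \<Rightarrow> tm \<Rightarrow> tm" where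
  "ren_tm \<pi> (Bound i) = Bound i"
| "ren_tm \<pi> (Free x \<sigma>) = Free (\<pi> (x, \<sigma>)) \<sigma>"
| "ren_tm \<pi> (Const c) = Const c"
| "ren_tm \<pi> (App s t) = App (ren_tm \<pi> s) (ren_tm \<pi> t)"

primrec ren :: "(nat \<times> ty \<Rightarrow> nat) \<Rightarrow> fm \<Rightarrow> fm" where
  "ren \<pi> Falsum = Falsum"
| "ren \<pi> (Eq s t) = Eq (ren_tm \<pi> s) (ren_tm \<pi> t)"
| "ren \<pi> (Less s t) = Less (ren_tm \<pi> s) (ren_tm \<pi> t)"
| "ren \<pi> (Imp A B) = Imp (ren \<pi> A) (ren \<pi> B)"
| "ren \<pi> (All \<sigma> A) = All \<sigma> (ren \<pi> A)"

lemma typed_ren [simp]: "typed \<Delta> (ren_tm \<pi> t) \<tau> = typed \<Delta> t \<tau>"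
  by (induction t arbitrary: \<tau>) auto
lemma wf_ren [simp]: "wf_fm \<Delta> (ren \<pi> A) = wf_fm \<Delta> A"
  by (induction A arbitrary: \<Delta>) auto
lemma qfree_ren [simp]: "qfree (ren \<pi> A) = qfree A"
  by (induction A) auto

lemma ren_inst_tm: "ren_tm \<pi> (inst_tm s t) = inst_tm (\<lambda>i. ren_tm \<pi> (s i)) (ren_tm \<pi> t)"
  by (induction t) auto
lemma ren_inst: "ren \<pi> (inst s A) = inst (\<lambda>i. ren_tm \<pi> (s i)) (ren \<pi> A)"
proof (induction A arbitrary: s)
  case (All \<sigma> A)
  have "(\<lambda>i. ren_tm \<pi> (lift_subst s i)) = lift_subst (\<lambda>i. ren_tm \<pi> (s i))"
    by (auto simp: fun_eq_iff lift_subst_def ren_inst_tm split: nat.split)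
  then show ?case using All by simp
qed (auto simp: ren_inst_tm)

lemma ren_tm_cong: "(\<And>p. p \<in> frees_tm t \<Longrightarrow> \<pi> p = \<pi>' p) \<Longrightarrow> ren_tm \<pi> t = ren_tm \<pi>' t"
  by (induction t) auto
lemma ren_cong: "(\<And>p. p \<in> frees A \<Longrightarrow> \<pi> p = \<pi>' p) \<Longrightarrow> ren \<pi> A = ren \<pi>' A"
  by (induction A) (auto intro: ren_tm_cong)

lemma ren_tm_ident: "(\<And>x \<sigma>. \<pi> (x, \<sigma>) = x) \<Longrightarrow> ren_tm \<pi> t = t"
  by (induction t) auto
lemma ren_ident: "(\<And>x \<sigma>. \<pi> (x, \<sigma>) = x) \<Longrightarrow> ren \<pi> A = A"
  by (induction A) (auto simp: ren_tm_ident)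

lemma finite_frees: "finite (frees A)"
proof (induction A)
  have *: "finite (frees_tm t)" for t by (induction t) auto
  case (Eq s t) then show ?case using * by simp
next
  have *: "finite (frees_tm t)" for t by (induction t) auto
  case (Less s t) then show ?case using * by simp
qed auto

lemma fresh: "\<exists>x. (x, \<sigma>) \<notin> frees A \<and> (\<forall>B \<in> set \<Gamma>. (x, \<sigma>) \<notin> frees B)"
proof -
  let ?S = "fst ` (frees A \<union> (\<Union>B \<in> set \<Gamma>. frees B))"
  have "finite ?S" by (simp add: finite_frees)
  then obtain x where "x \<notin> ?S" using ex_new_if_finite[of ?S] infinite_UNIV_nat by blast
  then show ?thesis by (intro exI[of _ x]) force
qed

lemma ren_inst0: "ren \<pi> (inst0 t A) = inst0 (ren_tm \<pi> t) (ren \<pi> A)"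
proof -
  have "(\<lambda>i. ren_tm \<pi> (case_nat t Bound i)) = case_nat (ren_tm \<pi> t) Bound"
    by (auto simp: fun_eq_iff split: nat.split)
  then show ?thesis by (simp add: ren_inst)
qed

text \<open>Weakening is not immediate, because a weaker context may contain an eigenvariable; renaming and
  weakening are therefore proved together.\<close>

lemma proves_ren:
  assumes T: "\<And>A \<pi>. A \<in> T \<Longrightarrow> ren \<pi> A \<in> T"
  shows "proves T \<Gamma> A \<Longrightarrow> ren \<pi> ` set \<Gamma> \<subseteq> set \<Delta> \<Longrightarrow> proves T \<Delta> (ren \<pi> A)"
proof (induction arbitrary: \<pi> \<Delta> rule: proves.induct)
  case (Axiom A \<Gamma>) then show ?case using T proves.Axiom by blast
next
  case (Assm A \<Gamma>) then show ?case by (intro proves.Assm) auto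
next
  case (ImpI A \<Gamma> B)
  then have "proves T (ren \<pi> A # \<Delta>) (ren \<pi> B)" by (intro ImpI.IH) auto
  then show ?case using ImpI by (auto intro: proves.ImpI)
next
  case (ImpE \<Gamma> A B) then show ?case using proves.ImpE by fastforce
next
  case (Classical A \<Gamma>)
  then have "proves T (ren \<pi> (Neg A) # \<Delta>) (ren \<pi> Falsum)" by (intro Classical.IH) auto
  then show ?case using Classical by (auto intro: proves.Classical)
next
  case (AllI \<sigma> A x \<Gamma>)
  obtain y where y: "(y, \<sigma>) \<notin> frees (ren \<pi> A)" "\<forall>B \<in> set \<Delta>. (y, \<sigma>) \<notin> frees B" using fresh by blast
  \<comment> \<open>The induction hypothesis is used for a renaming that sends the eigenvariable to
    a name fresh for \<open>\<Delta>\<close>. On \<open>A\<close> and on \<open>\<Gamma>\<close> it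
    agrees with \<open>\<pi>\<close>, because the eigenvariable does not occur there.\<close>
  let ?\<pi> = "\<pi>((x, \<sigma>) := y)"
  have *: "ren ?\<pi> A = ren \<pi> A" "\<And>B. B \<in> set \<Gamma> \<Longrightarrow> ren ?\<pi> B = ren \<pi> B"
    using AllI.hyps(2,3) by (auto intro!: ren_cong simp del: fun_upd_apply) (metis fun_upd_other)+
  have "proves T \<Delta> (ren ?\<pi> (inst0 (Free x \<sigma>) A))" using *(2) AllI.prems by (intro AllI.IH) (auto simp del: fun_upd_apply)
  then have "proves T \<Delta> (inst0 (Free y \<sigma>) (ren \<pi> A))" by (simp add: ren_inst0 *)
  then show ?case using y AllI.hyps by (auto intro: proves.AllI)
next
  case (AllE \<Gamma> \<sigma> A t)
  then have "proves T \<Delta> (All \<sigma> (ren \<pi> A))" by (simp add: AllE.IH[where \<pi> = \<pi>, simplified])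
  then show ?case using AllE proves.AllE[of T \<Delta> \<sigma> "ren \<pi> A" "ren_tm \<pi> t"] by (simp add: ren_inst0)
next
  case (EqRefl t \<Gamma>) then show ?case by (auto intro: proves.EqRefl)
next
  case (EqSubst A s t \<Gamma>)
  have "proves T \<Delta> (Eq (ren_tm \<pi> s) (ren_tm \<pi> t))" "proves T \<Delta> (inst0 (ren_tm \<pi> s) (ren \<pi> A))"
    using EqSubst.IH[of \<pi> \<Delta>] EqSubst.prems by (simp_all add: ren_inst0)
  then show ?case using EqSubst.hyps proves.EqSubst[of "ren \<pi> A" "ren_tm \<pi> s" "ren_tm \<pi> t" T \<Delta>] by (simp add: ren_inst0)
qed

lemma proves_weaken:
  assumes "\<And>A \<pi>. A \<in> T \<Longrightarrow> ren \<pi> A \<in> T" "proves T \<Gamma> A" "set \<Gamma> \<subseteq> set \<Delta>"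
  shows "proves T \<Delta> A"
proof -
  \<comment> \<open>\<open>fst\<close> is the identity renaming.\<close>
  have "ren fst A = A" "ren fst ` set \<Gamma> \<subseteq> set \<Delta>" using assms(3) by (auto simp: ren_ident)
  then show ?thesis using proves_ren[OF assms(1,2), of fst \<Delta>] by simp
qed

section \<open>Henkin sets\<close>

instance ty :: countable by countable_datatype
instance const :: countable by countable_datatype
instance tm :: countable by countable_datatype
instance fm :: countable by countable_datatype

text \<open>Membership in \<open>H\<close> behaves like truth in a structure whose elements are the
  terms without dangling indices: \<open>Imp_H\<close> and \<open>All_H\<close> are the clauses of
  the truth definition.\<close>

locale henkin =
  fixes T :: "fm set" and H :: "fm set"
  assumes T_sub: "T \<subseteq> H"
    and Falsum_H: "Falsum \<notin> H"
    and Imp_H: "wf_fm [] A \<Longrightarrow> wf_fm [] B \<Longrightarrow> Imp A B \<in> H \<longleftrightarrow> (A \<in> H \<longrightarrow> B \<in> H)"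
    and All_H: "wf_fm [\<sigma>] A \<Longrightarrow> All \<sigma> A \<in> H \<longleftrightarrow> (\<forall>t. typed [] t \<sigma> \<longrightarrow> inst0 t A \<in> H)"
    and EqRefl_H: "typed [] t N \<Longrightarrow> Eq t t \<in> H"
    and EqSubst_H: "wf_fm [N] A \<Longrightarrow> typed [] s N \<Longrightarrow> typed [] t N \<Longrightarrow> Eq s t \<in> H \<Longrightarrow> inst0 s A \<in> H \<Longrightarrow> inst0 t A \<in> H"

locale theory_ext =
  fixes T :: "fm set" and A0 :: fm
  assumes T_ren: "\<And>A \<pi>. A \<in> T \<Longrightarrow> ren \<pi> A \<in> T"
    and unprovable: "\<not> T \<turnstile> A0" and wf_A0: "wf_fm [] A0"
begin

text \<open>A context is a finite list, so a free variable outside it can always be found. Free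
  variables therefore serve as the Henkin constants, and the language need not be extended.\<close>

definition eigen :: "fm list \<Rightarrow> ty \<Rightarrow> fm \<Rightarrow> nat" where
  "eigen \<Gamma> \<sigma> C = (SOME x. (x, \<sigma>) \<notin> frees C \<and> (\<forall>B \<in> set \<Gamma>. (x, \<sigma>) \<notin> frees B))"

definition witness :: "fm list \<Rightarrow> fm \<Rightarrow> fm list" where
  "witness \<Gamma> B = (if \<exists>\<sigma> C. B = Neg (All \<sigma> C)
     then [case B of Imp (All \<sigma> C) _ \<Rightarrow> Neg (inst0 (Free (eigen (B # \<Gamma>) \<sigma> C) \<sigma>) C)] else [])"

lemma witness_Neg_All: "witness \<Gamma> (Neg (All \<sigma> C)) = [Neg (inst0 (Free (eigen (Neg (All \<sigma> C) # \<Gamma>) \<sigma> C) \<sigma>) C)]"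
  by (simp add: witness_def)

text \<open>The Lindenbaum step. An ill-formed candidate leaves the context as it is, since the
  enumeration runs through all of the type \<open>fm\<close>.\<close>

definition step :: "fm list \<Rightarrow> fm \<Rightarrow> fm list" where
  "step \<Gamma> B = (if \<not> wf_fm [] B then \<Gamma> else if proves T (B # \<Gamma>) Falsum then Neg B # \<Gamma> else witness \<Gamma> B @ B # \<Gamma>)"

primrec ctx :: "nat \<Rightarrow> fm list" where
  "ctx 0 = [Neg A0]"
| "ctx (Suc n) = step (ctx n) (from_nat n)"

lemma wk: "proves T \<Gamma> A \<Longrightarrow> set \<Gamma> \<subseteq> set \<Delta> \<Longrightarrow> proves T \<Delta> A"
  using proves_weaken[OF T_ren] by blast

lemma inconsistent_cases:
  assumes "wf_fm [] B" "proves T (B # \<Gamma>) Falsum" "proves T (Neg B # \<Gamma>) Falsum"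
  shows "proves T \<Gamma> Falsum"
proof -
  have "proves T \<Gamma> B" using assms(1,3) by (rule proves.Classical)
  moreover have "proves T \<Gamma> (Neg B)" using assms(1,2) by (rule proves.ImpI)
  ultimately show ?thesis by (rule proves.ImpE[rotated])
qed

lemma set_step: "set \<Gamma> \<subseteq> set (step \<Gamma> B)"
  by (auto simp: step_def)

text \<open>A witness does no harm: were its negated instance inconsistent with the context,
  \<open>Classical\<close> would prove the instance at a fresh variable and \<open>AllI\<close> the
  universal formula whose negation has just been added.\<close>

lemma consistent_step: assumes "\<not> proves T \<Gamma> Falsum" shows "\<not> proves T (step \<Gamma> B) Falsum"
proof (cases "wf_fm [] B \<and> \<not> proves T (B # \<Gamma>) Falsum \<and> (\<exists>\<sigma> C. B = Neg (All \<sigma> C))")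
  case False
  then show ?thesis using assms inconsistent_cases[of B \<Gamma>] by (auto simp: step_def witness_def)
next
  case True
  then obtain \<sigma> C where B: "B = Neg (All \<sigma> C)" and wf: "wf_fm [\<sigma>] C" and con: "\<not> proves T (B # \<Gamma>) Falsum" by auto
  define x where "x = eigen (B # \<Gamma>) \<sigma> C"
  have x: "(x, \<sigma>) \<notin> frees C" "\<forall>B' \<in> set (B # \<Gamma>). (x, \<sigma>) \<notin> frees B'"
    using someI_ex[OF fresh[of \<sigma> C "B # \<Gamma>"]] unfolding x_def eigen_def by auto
  have s: "step \<Gamma> B = Neg (inst0 (Free x \<sigma>) C) # B # \<Gamma>" using True by (simp add: step_def B x_def witness_Neg_All)
  have wfi: "wf_fm [] (inst0 (Free x \<sigma>) C)" by (rule wf_inst[OF wf]) auto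
  show ?thesis
  proof
    assume "proves T (step \<Gamma> B) Falsum"
    then have "proves T (B # \<Gamma>) (inst0 (Free x \<sigma>) C)" unfolding s using wfi by (rule proves.Classical[rotated])
    then have "proves T (B # \<Gamma>) (All \<sigma> C)" using x(2) by (intro proves.AllI[OF wf x(1)]) auto
    moreover have "proves T (B # \<Gamma>) (Neg (All \<sigma> C))" using wf by (auto intro!: proves.Assm simp: B)
    ultimately show False using con proves.ImpE by blast
  qed
qed

lemma consistent_ctx: "\<not> proves T (ctx n) Falsum"
proof (induction n)
  case 0 then show ?case using unprovable wf_A0 proves.Classical by auto
qed (simp add: consistent_step)

lemma ctx_mono: "m \<le> n \<Longrightarrow> set (ctx m) \<subseteq> set (ctx n)"
  by (induction rule: dec_induct) (use set_step in auto)

definition hset :: "fm set" where "hset = {A. \<exists>n. proves T (ctx n) A}"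

lemma hset_mono: "proves T (ctx m) A \<Longrightarrow> m \<le> n \<Longrightarrow> proves T (ctx n) A"
  using wk ctx_mono by blast

lemma hset_mp: "Imp A B \<in> hset \<Longrightarrow> A \<in> hset \<Longrightarrow> B \<in> hset"
proof -
  assume "Imp A B \<in> hset" "A \<in> hset"
  then obtain m n where "proves T (ctx m) (Imp A B)" "proves T (ctx n) A" by (auto simp: hset_def)
  then have "proves T (ctx (max m n)) (Imp A B)" "proves T (ctx (max m n)) A" using hset_mono by auto
  then show "B \<in> hset" unfolding hset_def using proves.ImpE by blast
qed

lemma Falsum_hset: "Falsum \<notin> hset"
  using consistent_ctx by (simp add: hset_def)

lemma hset_complete: "wf_fm [] B \<Longrightarrow> B \<notin> hset \<Longrightarrow> Neg B \<in> hset"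
proof -
  assume wf: "wf_fm [] B" and B: "B \<notin> hset"
  let ?n = "to_nat B"
  have "B \<in> set (ctx (Suc ?n)) \<or> Neg B \<in> set (ctx (Suc ?n))"
    using wf by (auto simp: step_def)
  then have "proves T (ctx (Suc ?n)) B \<or> proves T (ctx (Suc ?n)) (Neg B)"
    using wf by (auto intro!: proves.Assm simp del: ctx.simps)
  then show ?thesis using B unfolding hset_def by blast
qed

lemma hset_henkin: "henkin T hset"
proof
  show "T \<subseteq> hset" by (auto simp: hset_def intro: proves.Axiom)
  show "Falsum \<notin> hset" by (rule Falsum_hset)
  show "Imp A B \<in> hset \<longleftrightarrow> (A \<in> hset \<longrightarrow> B \<in> hset)" if wf: "wf_fm [] A" "wf_fm [] B" for A B
  proof
    assume *: "A \<in> hset \<longrightarrow> B \<in> hset"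
    show "Imp A B \<in> hset"
    proof (cases "A \<in> hset")
      case True
      then obtain n where "proves T (ctx n) B" using * by (auto simp: hset_def)
      then have "proves T (A # ctx n) B" by (rule wk) auto
      then show ?thesis using wf by (auto simp: hset_def intro: proves.ImpI)
    next
      case False
      then obtain n where "proves T (ctx n) (Neg A)" using hset_complete[OF wf(1)] by (auto simp: hset_def)
      then have "proves T (Neg B # A # ctx n) (Neg A)" by (rule wk) auto
      moreover have "proves T (Neg B # A # ctx n) A" using wf by (auto intro: proves.Assm)
      ultimately have "proves T (Neg B # A # ctx n) Falsum" by (rule proves.ImpE)
      with wf(2) have "proves T (A # ctx n) B" by (rule proves.Classical)
      then show ?thesis using wf by (auto simp: hset_def intro: proves.ImpI)
    qed
  qed (use hset_mp in blast)
  show "All \<sigma> A \<in> hset \<longleftrightarrow> (\<forall>t. typed [] t \<sigma> \<longrightarrow> inst0 t A \<in> hset)" if wf: "wf_fm [\<sigma>] A" for \<sigma> A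
  proof
    assume "All \<sigma> A \<in> hset"
    then show "\<forall>t. typed [] t \<sigma> \<longrightarrow> inst0 t A \<in> hset" by (auto simp: hset_def intro: proves.AllE)
  next
    assume *: "\<forall>t. typed [] t \<sigma> \<longrightarrow> inst0 t A \<in> hset"
    show "All \<sigma> A \<in> hset"
    proof (rule ccontr)
      let ?B = "Neg (All \<sigma> A)" and ?n = "to_nat (Neg (All \<sigma> A))"
      assume "All \<sigma> A \<notin> hset"
      then have B: "?B \<in> hset" using hset_complete[of "All \<sigma> A"] wf by simp
      define x where "x = eigen (?B # ctx ?n) \<sigma> A"
      show False
      proof (cases "proves T (?B # ctx ?n) Falsum")
        case True
        then have "Neg ?B \<in> hset" using wf by (auto simp: hset_def intro!: exI[of _ ?n] proves.ImpI)
        then show False using B hset_mp Falsum_hset by blast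
      next
        case False
        then have "Neg (inst0 (Free x \<sigma>) A) \<in> set (ctx (Suc ?n))" using wf by (simp add: step_def x_def witness_Neg_All)
        moreover have "wf_fm [] (inst0 (Free x \<sigma>) A)" by (rule wf_inst[OF wf]) auto
        ultimately have "Neg (inst0 (Free x \<sigma>) A) \<in> hset" unfolding hset_def using proves.Assm by fastforce
        moreover have "inst0 (Free x \<sigma>) A \<in> hset" using * by simp
        ultimately show False using hset_mp Falsum_hset by blast
      qed
    qed
  qed
  show "Eq t t \<in> hset" if "typed [] t N" for t using that by (auto simp: hset_def intro: proves.EqRefl)
  show "inst0 t A \<in> hset" if "wf_fm [N] A" "typed [] s N" "typed [] t N" "Eq s t \<in> hset" "inst0 s A \<in> hset" for A s t
  proof -
    from that obtain m n where "proves T (ctx m) (Eq s t)" "proves T (ctx n) (inst0 s A)" by (auto simp: hset_def)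
    then have "proves T (ctx (max m n)) (Eq s t)" "proves T (ctx (max m n)) (inst0 s A)" using hset_mono by auto
    from proves.EqSubst[OF that(1-3) this] show ?thesis by (auto simp: hset_def)
  qed
qed

lemma A0_hset: "A0 \<notin> hset"
proof -
  have "Neg A0 \<in> hset" using wf_A0 by (auto simp: hset_def intro!: exI[of _ 0] proves.Assm)
  then show ?thesis using hset_mp Falsum_hset by blast
qed

end

section \<open>Well-formedness\<close>

definition bv :: "nat \<Rightarrow> ptm" where "bv d = (\<lambda>e. Bound (e - Suc d))"

text \<open>In the depth notation a term is reused below further quantifiers. Its type is therefore
  demanded at every greater depth, with the types \<open>\<Delta>'\<close> of the additional binders
  in front.\<close>

definition TY :: "ty list \<Rightarrow> ptm \<Rightarrow> ty \<Rightarrow> bool" where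
  "TY \<Delta> t \<sigma> \<longleftrightarrow> (\<forall>\<Delta>'. typed (\<Delta>' @ \<Delta>) (t (length \<Delta>' + length \<Delta>)) \<sigma>)"

lemma TY_weaken: "TY \<Delta> t \<sigma> \<Longrightarrow> TY (\<tau> # \<Delta>) t \<sigma>"
  unfolding TY_def
proof
  fix \<Delta>' assume "\<forall>\<Delta>'. typed (\<Delta>' @ \<Delta>) (t (length \<Delta>' + length \<Delta>)) \<sigma>"
  from this[rule_format, of "\<Delta>' @ [\<tau>]"]
  show "typed (\<Delta>' @ \<tau> # \<Delta>) (t (length \<Delta>' + length (\<tau> # \<Delta>))) \<sigma>" by simp
qed

lemma TY_bv: "TY (\<sigma> # \<Delta>) (bv (length \<Delta>)) \<sigma>"
  by (auto simp: TY_def bv_def nth_append)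

lemma TY_app: "TY \<Delta> s (\<sigma> \<^bold>\<rightarrow> \<tau>) \<Longrightarrow> TY \<Delta> t \<sigma> \<Longrightarrow> TY \<Delta> (s \<^bold>\<cdot> t) \<tau>"
  by (auto simp: TY_def papp_def)

lemma TY_const: "TY \<Delta> (pconst c) (const_ty c)"
  by (auto simp: TY_def pconst_def)

lemma TY_typed: "TY \<Delta> t \<sigma> \<Longrightarrow> typed \<Delta> (t (length \<Delta>)) \<sigma>"
  by (auto simp: TY_def dest: spec[of _ "[]"])

lemma wf_allq: "wf_fm \<Delta> (allq \<sigma> F (length \<Delta>)) \<longleftrightarrow> wf_fm (\<sigma> # \<Delta>) (F (bv (length \<Delta>)) (length (\<sigma> # \<Delta>)))"
  by (simp add: allq_def bv_def)

lemma wf_eq_ty: "TY \<Delta> s \<sigma> \<Longrightarrow> TY \<Delta> t \<sigma> \<Longrightarrow> wf_fm \<Delta> (eq_ty \<sigma> s t (length \<Delta>))"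
proof (induction \<sigma> arbitrary: \<Delta> s t)
  case N then show ?case by (simp add: peq_def TY_typed)
next
  case (Fn \<sigma> \<tau>)
  have "wf_fm (\<sigma> # \<Delta>) (eq_ty \<tau> (s \<^bold>\<cdot> bv (length \<Delta>)) (t \<^bold>\<cdot> bv (length \<Delta>)) (length (\<sigma> # \<Delta>)))"
    by (rule Fn.IH(2)) (auto intro: TY_app TY_weaken[OF Fn.prems(1)] TY_weaken[OF Fn.prems(2)] TY_bv)
  then show ?case unfolding eq_ty.simps wf_allq .
qed

lemma ren_eq_ty: "(\<And>d. ren_tm \<pi> (s d) = s d) \<Longrightarrow> (\<And>d. ren_tm \<pi> (t d) = t d) \<Longrightarrow> ren \<pi> (eq_ty \<sigma> s t d) = eq_ty \<sigma> s t d"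
  by (induction \<sigma> arbitrary: s t d) (auto simp: allq_def peq_def papp_def)

lemmas fm_defs = sentence_def allq_def pimp_def pnot_def peq_def pless_def exq_def pand_def por_def piff_def ple_def
  papp_def pconst_def pzero_def psuc_def padd_def pmul_def pone_def

text \<open>The axioms outside the two quantifier-free schemes have no free variables, and renaming
  an instance of one of these schemes gives another instance of it.\<close>

lemma ACA0w_ren: "A \<in> ACA0w \<Longrightarrow> ren \<pi> A \<in> ACA0w"
proof -
  have *: "ren \<pi> A \<in> RCA0w" if "A \<in> RCA0w"
    using that
  proof cases
    case (Pi_eq \<sigma> \<tau>)
    then have "ren \<pi> A = A" by (simp add: fm_defs ren_eq_ty)
    then show ?thesis using that by simp
  next
    case (Sigma_eq \<rho> \<sigma> \<tau>)
    then have "ren \<pi> A = A" by (simp add: fm_defs ren_eq_ty)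
    then show ?thesis using that by simp
  next
    case (Extensionality \<sigma> \<tau>)
    then have "ren \<pi> A = A" by (simp add: fm_defs ren_eq_ty)
    then show ?thesis using that by simp
  next
    case (QF_induction B)
    have 1: "(\<lambda>i. ren_tm \<pi> (case_nat (App (Const Succ) (Bound 0)) (\<lambda>i. Bound (Suc i)) i)) = case_nat (App (Const Succ) (Bound 0)) (\<lambda>i. Bound (Suc i))"
      by (auto simp: fun_eq_iff split: nat.split)
    have 0: "(\<lambda>i. ren_tm \<pi> (case_nat (Const Zero) Bound i)) = case_nat (Const Zero) Bound"
      by (auto simp: fun_eq_iff split: nat.split)
    show ?thesis using RCA0w.QF_induction[of "ren \<pi> B"] QF_induction by (simp add: ren_inst 0 1)
  next
    case (QF_AC B)
    have 1: "(\<lambda>i. ren_tm \<pi> (case_nat (App (Bound 1) (Bound 0)) Bound i)) = case_nat (App (Bound 1) (Bound 0)) Bound"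
      by (auto simp: fun_eq_iff split: nat.split)
    show ?thesis using RCA0w.QF_AC[of "ren \<pi> B"] QF_AC by (simp add: ren_inst0 ren_inst 1[unfolded One_nat_def])
  qed (use that in \<open>simp add: fm_defs\<close>)+
  have "ren \<pi> exists2 = exists2" by (simp add: exists2_def fm_defs)
  then show "A \<in> ACA0w \<Longrightarrow> ren \<pi> A \<in> ACA0w" using * by (auto simp: ACA0w_def)
qed

lemma wf_sentence_allq: "wf_fm [] (sentence (allq \<sigma> F)) \<longleftrightarrow> wf_fm [\<sigma>] (F (bv 0) (Suc 0))"
  using wf_allq[of "[]"] by (simp add: sentence_def)
lemma wf_allq1: "wf_fm [\<rho>] (allq \<sigma> F (Suc 0)) \<longleftrightarrow> wf_fm [\<sigma>, \<rho>] (F (bv (Suc 0)) (Suc (Suc 0)))"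
  using wf_allq[of "[\<rho>]"] by simp
lemma wf_allq2: "wf_fm [\<rho>, \<tau>] (allq \<sigma> F (Suc (Suc 0))) \<longleftrightarrow> wf_fm [\<sigma>, \<rho>, \<tau>] (F (bv (Suc (Suc 0))) (Suc (Suc (Suc 0))))"
  using wf_allq[of "[\<rho>, \<tau>]"] by simp

lemma TY_bv_simps: "TY [\<sigma>] (bv 0) \<sigma>" "TY [\<rho>, \<sigma>] (bv 0) \<sigma>" "TY [\<sigma>, \<rho>] (bv (Suc 0)) \<sigma>"
  "TY [\<tau>, \<rho>, \<sigma>] (bv 0) \<sigma>" "TY [\<tau>, \<sigma>, \<rho>] (bv (Suc 0)) \<sigma>" "TY [\<sigma>, \<tau>, \<rho>] (bv (Suc (Suc 0))) \<sigma>"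
  using TY_bv[of \<sigma> "[]"] TY_bv[of \<sigma> "[\<rho>]"] TY_bv[of \<sigma> "[\<tau>, \<rho>]"] by (auto intro: TY_weaken)

lemma wf_ACA0w: "A \<in> ACA0w \<Longrightarrow> wf_fm [] A"
proof -
  have *: "wf_fm [] A" if "A \<in> RCA0w"
    using that
  proof cases
    case (Pi_eq \<sigma> \<tau>)
    have "TY [\<tau>, \<sigma>] (pconst (PiC \<sigma> \<tau>) \<^bold>\<cdot> bv 0 \<^bold>\<cdot> bv (Suc 0)) \<sigma>"
      using TY_const[of _ "PiC \<sigma> \<tau>"] by (intro TY_app[where \<sigma> = \<tau>] TY_app[where \<sigma> = \<sigma>]) (auto intro: TY_bv_simps)
    then show ?thesis using wf_eq_ty[of "[\<tau>, \<sigma>]", OF _ TY_bv_simps(2)] by (simp add: Pi_eq wf_sentence_allq wf_allq1)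
  next
    case (Sigma_eq \<rho> \<sigma> \<tau>)
    let ?D = "[\<rho>, \<rho> \<^bold>\<rightarrow> \<sigma>, \<rho> \<^bold>\<rightarrow> \<sigma> \<^bold>\<rightarrow> \<tau>]"
    have "TY ?D (pconst (SigmaC \<rho> \<sigma> \<tau>)) ((\<rho> \<^bold>\<rightarrow> \<sigma> \<^bold>\<rightarrow> \<tau>) \<^bold>\<rightarrow> (\<rho> \<^bold>\<rightarrow> \<sigma>) \<^bold>\<rightarrow> \<rho> \<^bold>\<rightarrow> \<tau>)" using TY_const[of _ "SigmaC \<rho> \<sigma> \<tau>"] by simp
    then have "TY ?D (pconst (SigmaC \<rho> \<sigma> \<tau>) \<^bold>\<cdot> bv 0 \<^bold>\<cdot> bv (Suc 0) \<^bold>\<cdot> bv (Suc (Suc 0))) \<tau>"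
      "TY ?D (bv 0 \<^bold>\<cdot> bv (Suc (Suc 0)) \<^bold>\<cdot> (bv (Suc 0) \<^bold>\<cdot> bv (Suc (Suc 0)))) \<tau>"
      by (meson TY_app TY_bv_simps)+
    then show ?thesis using wf_eq_ty[of ?D] by (simp add: Sigma_eq wf_sentence_allq wf_allq1 wf_allq2)
  next
    case (Extensionality \<sigma> \<tau>)
    let ?D = "[\<sigma> \<^bold>\<rightarrow> \<tau>, \<sigma>, \<sigma>]"
    have "TY ?D (bv (Suc (Suc 0)) \<^bold>\<cdot> bv 0) \<tau>" "TY ?D (bv (Suc (Suc 0)) \<^bold>\<cdot> bv (Suc 0)) \<tau>"
      by (meson TY_app TY_bv_simps)+
    then show ?thesis using wf_eq_ty[of ?D] wf_eq_ty[of ?D, OF TY_bv_simps(4,5)]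
      by (simp add: Extensionality wf_sentence_allq wf_allq1 wf_allq2 pimp_def)
  next
    case (QF_induction B)
    have "wf_fm [] (inst0 (Const Zero) B)" using QF_induction by (auto intro!: wf_inst[of "[N]"])
    moreover have "wf_fm [N] (inst (case_nat (App (Const Succ) (Bound 0)) (\<lambda>i. Bound (Suc i))) B)"
      using QF_induction by (auto intro!: wf_inst[of "[N]"])
    ultimately show ?thesis using QF_induction by simp
  next
    case (QF_AC B)
    have "wf_fm [one, two] (inst (case_nat (App (Bound 1) (Bound 0)) Bound) B)"
      using QF_AC by (auto intro!: wf_inst[of "[N, one]"] simp: less_Suc_eq)
    then show ?thesis using QF_AC by simp
  qed (simp add: fm_defs)+
  have "wf_fm [] exists2" by (simp add: exists2_def fm_defs nth_Cons' )
  then show "A \<in> ACA0w \<Longrightarrow> wf_fm [] A" using * by (auto simp: ACA0w_def)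
qed

section \<open>Models\<close>

locale frame =
  fixes D :: "ty \<Rightarrow> 'u set" and ap :: "'u \<Rightarrow> 'u \<Rightarrow> 'u" and fv :: "nat \<Rightarrow> ty \<Rightarrow> 'u" and cs :: "const \<Rightarrow> 'u"
    and lt :: "'u \<Rightarrow> 'u \<Rightarrow> bool"
begin

primrec ev :: "'u list \<Rightarrow> tm \<Rightarrow> 'u" where
  "ev \<rho> (Bound i) = \<rho> ! i"
| "ev \<rho> (Free x \<sigma>) = fv x \<sigma>"
| "ev \<rho> (Const c) = cs c"
| "ev \<rho> (App s t) = ap (ev \<rho> s) (ev \<rho> t)"

primrec sat :: "'u list \<Rightarrow> fm \<Rightarrow> bool" where
  "sat \<rho> Falsum \<longleftrightarrow> False"
| "sat \<rho> (Eq s t) \<longleftrightarrow> ev \<rho> s = ev \<rho> t"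
| "sat \<rho> (Less s t) \<longleftrightarrow> lt (ev \<rho> s) (ev \<rho> t)"
| "sat \<rho> (Imp A B) \<longleftrightarrow> (sat \<rho> A \<longrightarrow> sat \<rho> B)"
| "sat \<rho> (All \<sigma> A) \<longleftrightarrow> (\<forall>d \<in> D \<sigma>. sat (d # \<rho>) A)"

end

text \<open>By \<open>named\<close>, every element may be used as a parameter: the schemes speak
  about formulas, and an element enters a formula only through a term that denotes it.
  \<open>fun_ext\<close> makes extensional equality the identity.\<close>

locale model = frame D ap fv cs lt for D :: "ty \<Rightarrow> 'u set" and ap fv cs lt +
  assumes ap_closed: "f \<in> D (\<sigma> \<^bold>\<rightarrow> \<tau>) \<Longrightarrow> x \<in> D \<sigma> \<Longrightarrow> ap f x \<in> D \<tau>"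
    and fv_closed: "fv n \<sigma> \<in> D \<sigma>"
    and cs_closed: "cs c \<in> D (const_ty c)"
    and named: "d \<in> D \<sigma> \<Longrightarrow> \<exists>t. typed [] t \<sigma> \<and> ev [] t = d"
    and fun_ext: "f \<in> D (\<sigma> \<^bold>\<rightarrow> \<tau>) \<Longrightarrow> g \<in> D (\<sigma> \<^bold>\<rightarrow> \<tau>) \<Longrightarrow> (\<And>x. x \<in> D \<sigma> \<Longrightarrow> ap f x = ap g x) \<Longrightarrow> f = g"
    and ax: "A \<in> ACA0w \<Longrightarrow> sat [] A"

section \<open>The term model of a Henkin set\<close>

context henkin
begin

text \<open>Indices beyond the list are lowered, as if its binders had been removed. This makes
  \<open>inst0_env\<close> true without side conditions.\<close>

definition env :: "tm list \<Rightarrow> nat \<Rightarrow> tm" where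
  "env \<rho> i = (if i < length \<rho> then \<rho> ! i else Bound (i - length \<rho>))"

definition closed_env :: "tm list \<Rightarrow> ty list \<Rightarrow> bool" where
  "closed_env \<rho> \<Delta> \<longleftrightarrow> list_all2 (typed []) \<rho> \<Delta>"

lemma typed_env: "closed_env \<rho> \<Delta> \<Longrightarrow> typed \<Delta> t \<tau> \<Longrightarrow> typed [] (inst_tm (env \<rho>) t) \<tau>"
  by (rule typed_inst) (auto simp: closed_env_def env_def list_all2_conv_all_nth)

lemma wf_env: "closed_env \<rho> \<Delta> \<Longrightarrow> wf_fm \<Delta> A \<Longrightarrow> wf_fm [] (inst (env \<rho>) A)"
  by (rule wf_inst) (auto simp: closed_env_def env_def list_all2_conv_all_nth)

lemma inst0_env: "inst0 t (inst (lift_subst (env \<rho>)) A) = inst (env (t # \<rho>)) A"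
proof -
  have "(\<lambda>i. inst_tm (case_nat t Bound) (lift_subst (env \<rho>) i)) = env (t # \<rho>)"
  proof
    fix i show "inst_tm (case_nat t Bound) (lift_subst (env \<rho>) i) = env (t # \<rho>) i"
      by (cases i) (auto simp: lift_subst_def inst_tm_comp env_def)
  qed
  then show ?thesis by (simp add: inst_comp)
qed

lemma wf_lift_env: "closed_env \<rho> \<Delta> \<Longrightarrow> wf_fm (\<sigma> # \<Delta>) A \<Longrightarrow> wf_fm [\<sigma>] (inst (lift_subst (env \<rho>)) A)"
  using wf_env[of \<rho> \<Delta> "All \<sigma> A"] by simp

lemma env_Nil [simp]: "env [] = Bound" by (auto simp: env_def)

lemma All_env: "closed_env \<rho> \<Delta> \<Longrightarrow> wf_fm (\<sigma> # \<Delta>) A \<Longrightarrow>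
  inst (env \<rho>) (All \<sigma> A) \<in> H \<longleftrightarrow> (\<forall>t. typed [] t \<sigma> \<longrightarrow> inst (env (t # \<rho>)) A \<in> H)"
  by (simp add: All_H wf_lift_env inst0_env)

primrec eqv :: "ty \<Rightarrow> tm \<Rightarrow> tm \<Rightarrow> bool" where
  "eqv N s t \<longleftrightarrow> Eq s t \<in> H"
| "eqv (\<sigma> \<^bold>\<rightarrow> \<tau>) s t \<longleftrightarrow> (\<forall>z. typed [] z \<sigma> \<longrightarrow> eqv \<tau> (App s z) (App t z))"

definition val :: "tm list \<Rightarrow> ptm \<Rightarrow> tm" where
  "val \<rho> t = inst_tm (env \<rho>) (t (length \<rho>))"

lemma val_app: "val \<rho> (s \<^bold>\<cdot> t) = App (val \<rho> s) (val \<rho> t)"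
  by (simp add: val_def papp_def)
lemma val_bv: "val (z # \<rho>) (bv (length \<rho>)) = z"
  by (simp add: val_def bv_def env_def)

text \<open>The value of a term in the depth notation is not affected by quantifiers further in.
  This invariant is what lets the induction of \<open>eqv_iff\<close> pass below a
  quantifier.\<close>

definition rigid :: "tm list \<Rightarrow> ptm \<Rightarrow> bool" where
  "rigid \<rho> t \<longleftrightarrow> (\<forall>\<rho>'. val (\<rho>' @ \<rho>) t = val \<rho> t)"
lemma rigid_Cons: "rigid \<rho> t \<Longrightarrow> rigid (z # \<rho>) t" "rigid \<rho> t \<Longrightarrow> val (z # \<rho>) t = val \<rho> t"
  unfolding rigid_def by (metis append.assoc append_Cons append_Nil)+
lemma rigid_app: "rigid \<rho> s \<Longrightarrow> rigid \<rho> t \<Longrightarrow> rigid \<rho> (s \<^bold>\<cdot> t)"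
  by (auto simp: rigid_def val_app)
lemma rigid_bv: "rigid (z # \<rho>) (bv (length \<rho>))"
  by (auto simp: rigid_def val_def bv_def env_def nth_append)

lemma eqv_iff: "closed_env \<rho> \<Delta> \<Longrightarrow> TY \<Delta> s \<sigma> \<Longrightarrow> TY \<Delta> t \<sigma> \<Longrightarrow> rigid \<rho> s \<Longrightarrow> rigid \<rho> t \<Longrightarrow>
   inst (env \<rho>) (eq_ty \<sigma> s t (length \<rho>)) \<in> H \<longleftrightarrow> eqv \<sigma> (val \<rho> s) (val \<rho> t)"
proof (induction \<sigma> arbitrary: \<rho> \<Delta> s t)
  case N
  then show ?case by (simp add: peq_def val_def)
next
  case (Fn \<sigma> \<tau>)
  have len: "length \<rho> = length \<Delta>" using Fn.prems(1) by (simp add: closed_env_def list_all2_lengthD)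
  let ?s = "s \<^bold>\<cdot> bv (length \<rho>)" and ?t = "t \<^bold>\<cdot> bv (length \<rho>)"
  have *: "TY (\<sigma> # \<Delta>) ?s \<tau>" "TY (\<sigma> # \<Delta>) ?t \<tau>"
    unfolding len by (auto intro: TY_app TY_weaken[OF Fn.prems(2)] TY_weaken[OF Fn.prems(3)] TY_bv)
  have "inst (env \<rho>) (eq_ty (\<sigma> \<^bold>\<rightarrow> \<tau>) s t (length \<rho>)) = inst (env \<rho>) (All \<sigma> (eq_ty \<tau> ?s ?t (length (\<sigma> # \<Delta>))))"
    by (simp add: allq_def bv_def len)
  also have "\<dots> \<in> H \<longleftrightarrow> (\<forall>z. typed [] z \<sigma> \<longrightarrow> inst (env (z # \<rho>)) (eq_ty \<tau> ?s ?t (length (\<sigma> # \<Delta>))) \<in> H)"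
    by (rule All_env[OF Fn.prems(1)]) (rule wf_eq_ty[OF *])
  also have "\<dots> \<longleftrightarrow> (\<forall>z. typed [] z \<sigma> \<longrightarrow> eqv \<tau> (val (z # \<rho>) ?s) (val (z # \<rho>) ?t))"
  proof (intro all_cong)
    fix z assume z: "typed [] z \<sigma>"
    have "closed_env (z # \<rho>) (\<sigma> # \<Delta>)" using Fn.prems(1) z by (simp add: closed_env_def)
    from Fn.IH(2)[OF this * ] show "inst (env (z # \<rho>)) (eq_ty \<tau> ?s ?t (length (\<sigma> # \<Delta>))) \<in> H \<longleftrightarrow> eqv \<tau> (val (z # \<rho>) ?s) (val (z # \<rho>) ?t)"
      using Fn.prems(4,5) rigid_bv[of z \<rho>] by (simp add: rigid_app rigid_Cons len)
  qed
  finally show ?case using Fn.prems(4,5) by (simp add: val_app rigid_Cons val_bv)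
qed

lemma Eq_sym: assumes "typed [] s N" "typed [] t N" "Eq s t \<in> H" shows "Eq t s \<in> H"
  using EqSubst_H[of "Eq (Bound 0) s" s t] assms by (simp add: inst_tm_closed EqRefl_H typed_append[of "[]" s N "[N]", simplified])
lemma Eq_trans: assumes "typed [] s N" "typed [] t N" "typed [] u N" "Eq s t \<in> H" "Eq t u \<in> H" shows "Eq s u \<in> H"
  using EqSubst_H[of "Eq s (Bound 0)" t u] assms by (simp add: inst_tm_closed typed_append[of "[]" s N "[N]", simplified])

lemma eqv_refl: "typed [] t \<sigma> \<Longrightarrow> eqv \<sigma> t t"
proof (induction \<sigma> arbitrary: t)
  case (Fn \<sigma> \<tau>)
  have "eqv \<tau> (App t z) (App t z)" if "typed [] z \<sigma>" for z
    by (rule Fn.IH(2)) (use Fn.prems that in auto)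
  then show ?case by simp
qed (auto simp: EqRefl_H)
lemma eqv_sym: "typed [] s \<sigma> \<Longrightarrow> typed [] t \<sigma> \<Longrightarrow> eqv \<sigma> s t \<Longrightarrow> eqv \<sigma> t s"
proof (induction \<sigma> arbitrary: s t)
  case (Fn \<sigma> \<tau>)
  have "eqv \<tau> (App t z) (App s z)" if "typed [] z \<sigma>" for z
    by (rule Fn.IH(2)) (use Fn.prems that in auto)
  then show ?case by simp
qed (auto intro: Eq_sym)
lemma eqv_trans: "typed [] s \<sigma> \<Longrightarrow> typed [] t \<sigma> \<Longrightarrow> typed [] u \<sigma> \<Longrightarrow> eqv \<sigma> s t \<Longrightarrow> eqv \<sigma> t u \<Longrightarrow> eqv \<sigma> s u"
proof (induction \<sigma> arbitrary: s t u)
  case (Fn \<sigma> \<tau>)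
  have "eqv \<tau> (App s z) (App u z)" if "typed [] z \<sigma>" for z
    by (rule Fn.IH(2)[of _ "App t z"]) (use Fn.prems that in auto)
  then show ?case by simp
qed (auto intro: Eq_trans)

text \<open>A representative modulo \<open>eqv\<close>. The choice depends on the class of
  \<open>t\<close> alone, so equivalent terms receive the same one, and taking representatives in
  place of classes keeps the universe inside the type \<open>tm\<close>.\<close>

definition nm :: "tm \<Rightarrow> tm" where
  "nm t = (SOME s. \<exists>\<sigma>. typed [] t \<sigma> \<and> typed [] s \<sigma> \<and> eqv \<sigma> t s)"

lemma nm: assumes "typed [] t \<sigma>" shows "typed [] (nm t) \<sigma>" "eqv \<sigma> t (nm t)"
proof -
  have "\<exists>\<sigma>. typed [] t \<sigma> \<and> typed [] t \<sigma> \<and> eqv \<sigma> t t" using assms eqv_refl by blast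
  from someI[of "\<lambda>s. \<exists>\<sigma>. typed [] t \<sigma> \<and> typed [] s \<sigma> \<and> eqv \<sigma> t s", OF this]
  obtain \<tau> where "typed [] t \<tau>" "typed [] (nm t) \<tau>" "eqv \<tau> t (nm t)" unfolding nm_def by blast
  then show "typed [] (nm t) \<sigma>" "eqv \<sigma> t (nm t)" using typed_unique assms by blast+
qed

lemma nm_eq_iff: assumes "typed [] s \<sigma>" "typed [] t \<sigma>" shows "nm s = nm t \<longleftrightarrow> eqv \<sigma> s t"
proof
  assume "nm s = nm t"
  then show "eqv \<sigma> s t" using nm assms eqv_trans eqv_sym by metis
next
  assume *: "eqv \<sigma> s t"
  have "(\<exists>\<tau>. typed [] s \<tau> \<and> typed [] u \<tau> \<and> eqv \<tau> s u) \<longleftrightarrow> (\<exists>\<tau>. typed [] t \<tau> \<and> typed [] u \<tau> \<and> eqv \<tau> t u)" for u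
    using * assms typed_unique eqv_trans eqv_sym by metis
  then show "nm s = nm t" by (simp add: nm_def)
qed

end

locale henkin_ACA = henkin T H for T H +
  assumes T_ACA: "T = ACA0w"
begin

text \<open>The calculus has substitution for equality at type \<open>N\<close> only. At higher
  types the extensionality axiom gives congruence in the argument, and the definition of
  \<open>eqv\<close> gives it in the function.\<close>

lemma eqv_cong:
  assumes "typed [] f (\<sigma> \<^bold>\<rightarrow> \<tau>)" "typed [] g (\<sigma> \<^bold>\<rightarrow> \<tau>)" "typed [] s \<sigma>" "typed [] t \<sigma>"
    "eqv (\<sigma> \<^bold>\<rightarrow> \<tau>) f g" "eqv \<sigma> s t"
  shows "eqv \<tau> (App f s) (App g t)"
proof -
  let ?F = "\<lambda>x y f. eq_ty \<sigma> x y \<^bold>\<longrightarrow> eq_ty \<tau> (f \<^bold>\<cdot> x) (f \<^bold>\<cdot> y)"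
  let ?E = "sentence (\<^bold>\<forall>x \<^bold>: \<sigma>. \<^bold>\<forall>y \<^bold>: \<sigma>. \<^bold>\<forall>f \<^bold>: \<sigma> \<^bold>\<rightarrow> \<tau>. ?F x y f)"
  let ?D = "[\<sigma> \<^bold>\<rightarrow> \<tau>, \<sigma>, \<sigma>]" and ?b = "bv 0" and ?c = "bv (Suc 0)" and ?d = "bv (Suc (Suc 0))"
  let ?\<rho> = "[g, t, s]"
  have E: "?E \<in> ACA0w" by (simp add: ACA0w_def RCA0w.Extensionality)
  have Ei: "?E = All \<sigma> (All \<sigma> (All (\<sigma> \<^bold>\<rightarrow> \<tau>) (?F ?b ?c ?d (Suc (Suc (Suc 0))))))"
    by (simp add: sentence_def allq_def bv_def)
  have ty: "TY ?D (?d \<^bold>\<cdot> ?b) \<tau>" "TY ?D (?d \<^bold>\<cdot> ?c) \<tau>" by (meson TY_app TY_bv_simps)+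
  have wf: "wf_fm ?D (?F ?b ?c ?d (length ?D))"
    using wf_eq_ty[of ?D] wf_eq_ty[of ?D, OF TY_bv_simps(4,5)] ty by (simp add: pimp_def)
  have "inst (env []) (All \<sigma> (All \<sigma> (All (\<sigma> \<^bold>\<rightarrow> \<tau>) (?F ?b ?c ?d (length ?D))))) \<in> H" using E T_sub T_ACA Ei by auto
  then have "inst (env [s]) (All \<sigma> (All (\<sigma> \<^bold>\<rightarrow> \<tau>) (?F ?b ?c ?d (length ?D)))) \<in> H"
    by (rule All_env[THEN iffD1, rule_format, rotated 2, where \<Delta> = "[]"]) (use wf assms in \<open>auto simp: closed_env_def\<close>)
  then have "inst (env [t, s]) (All (\<sigma> \<^bold>\<rightarrow> \<tau>) (?F ?b ?c ?d (length ?D))) \<in> H"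
    by (rule All_env[THEN iffD1, rule_format, rotated 2, where \<Delta> = "[\<sigma>]"]) (use wf assms in \<open>auto simp: closed_env_def\<close>)
  then have "inst (env ?\<rho>) (?F ?b ?c ?d (length ?D)) \<in> H"
    by (rule All_env[THEN iffD1, rule_format, rotated 2, where \<Delta> = "[\<sigma>, \<sigma>]"]) (use wf assms in \<open>auto simp: closed_env_def\<close>)
  moreover have ce: "closed_env ?\<rho> ?D" using assms by (simp add: closed_env_def)
  moreover have w: "wf_fm [] (inst (env ?\<rho>) (eq_ty \<sigma> ?b ?c (length ?D)))" "wf_fm [] (inst (env ?\<rho>) (eq_ty \<tau> (?d \<^bold>\<cdot> ?b) (?d \<^bold>\<cdot> ?c) (length ?D)))"
    using wf wf_env[OF ce] by (auto simp: pimp_def)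
  ultimately have i: "inst (env ?\<rho>) (eq_ty \<sigma> ?b ?c (length ?\<rho>)) \<in> H \<longrightarrow> inst (env ?\<rho>) (eq_ty \<tau> (?d \<^bold>\<cdot> ?b) (?d \<^bold>\<cdot> ?c) (length ?\<rho>)) \<in> H"
    by (simp add: pimp_def Imp_H)
  have v: "val ?\<rho> ?b = s" "val ?\<rho> ?c = t" "val ?\<rho> ?d = g" by (simp_all add: val_def bv_def env_def)
  have r: "rigid ?\<rho> ?b" "rigid ?\<rho> ?c" "rigid ?\<rho> ?d" by (auto simp: rigid_def val_def bv_def env_def nth_append)
  have "eqv \<sigma> s t \<longrightarrow> eqv \<tau> (App g s) (App g t)"
    using i eqv_iff[OF ce, of ?b \<sigma> ?c] eqv_iff[OF ce ty] r by (simp add: TY_bv_simps rigid_app val_app v)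
  moreover have "eqv \<tau> (App f s) (App g s)" using assms by simp
  ultimately show ?thesis using assms eqv_trans[of "App f s" \<tau> "App g s" "App g t"] by auto
qed

definition DH :: "ty \<Rightarrow> tm set" where "DH \<sigma> = {nm t | t. typed [] t \<sigma>}"
definition apH :: "tm \<Rightarrow> tm \<Rightarrow> tm" where "apH s t = nm (App s t)"

sublocale M: frame DH apH "\<lambda>x \<sigma>. nm (Free x \<sigma>)" "\<lambda>c. nm (Const c)" "\<lambda>s t. Less s t \<in> H" .

lemma nm_App: "typed [] f (\<sigma> \<^bold>\<rightarrow> \<tau>) \<Longrightarrow> typed [] s \<sigma> \<Longrightarrow> nm (App (nm f) (nm s)) = nm (App f s)"
proof -
  assume f: "typed [] f (\<sigma> \<^bold>\<rightarrow> \<tau>)" and s: "typed [] s \<sigma>"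
  have "eqv \<tau> (App f s) (App (nm f) (nm s))" by (rule eqv_cong[OF f nm(1)[OF f] s nm(1)[OF s] nm(2)[OF f] nm(2)[OF s]])
  moreover have "typed [] (App f s) \<tau>" "typed [] (App (nm f) (nm s)) \<tau>" using f s nm(1)[OF f] nm(1)[OF s] by auto
  ultimately show ?thesis using nm_eq_iff by metis
qed

lemma ev_nm: "closed_env \<rho> \<Delta> \<Longrightarrow> typed \<Delta> t \<tau> \<Longrightarrow> M.ev (map nm \<rho>) t = nm (inst_tm (env \<rho>) t)"
proof (induction t arbitrary: \<tau>)
  case (Bound i)
  then have "i < length \<rho>" by (simp add: closed_env_def list_all2_lengthD)
  then show ?case by (simp add: env_def)
next
  case (App s t)
  then obtain \<sigma> where "typed \<Delta> s (\<sigma> \<^bold>\<rightarrow> \<tau>)" "typed \<Delta> t \<sigma>" by auto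
  with App show ?case using nm_App[of "inst_tm (env \<rho>) s" \<sigma> \<tau> "inst_tm (env \<rho>) t"]
      typed_env[OF App.prems(1)] by (simp add: App.IH[OF App.prems(1)] apH_def[of "nm _" "nm _"])
qed auto

lemma Less_nm: assumes "typed [] s N" "typed [] t N" shows "Less (nm s) (nm t) \<in> H \<longleftrightarrow> Less s t \<in> H"
proof -
  have st: "Less s' t' \<in> H" if "typed [] s N" "typed [] t N" "typed [] s' N" "typed [] t' N" "Eq s s' \<in> H" "Eq t t' \<in> H" "Less s t \<in> H" for s t s' t'
  proof -
    have "Less s' t \<in> H" using EqSubst_H[of "Less (Bound 0) t" s s'] that
      by (simp add: inst_tm_closed typed_append[of "[]" _ N "[N]", simplified])
    then show ?thesis using EqSubst_H[of "Less s' (Bound 0)" t t'] that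
      by (simp add: inst_tm_closed typed_append[of "[]" _ N "[N]", simplified])
  qed
  note n = nm[OF assms(1)] nm[OF assms(2)]
  have e: "Eq s (nm s) \<in> H" "Eq t (nm t) \<in> H" using n by auto
  then have e': "Eq (nm s) s \<in> H" "Eq (nm t) t \<in> H" using Eq_sym assms n by blast+
  show ?thesis using st[OF assms n(1,3) e] st[OF n(1,3) assms e'] by blast
qed

lemma truth: "closed_env \<rho> \<Delta> \<Longrightarrow> wf_fm \<Delta> A \<Longrightarrow> M.sat (map nm \<rho>) A \<longleftrightarrow> inst (env \<rho>) A \<in> H"
proof (induction A arbitrary: \<rho> \<Delta>)
  case (Eq s t)
  then show ?case using nm_eq_iff[of "inst_tm (env \<rho>) s" N "inst_tm (env \<rho>) t"]
    by (simp add: ev_nm[OF Eq.prems(1), where \<tau> = N] typed_env[OF Eq.prems(1), where \<tau> = N])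
next
  case (Less s t)
  then show ?case using Less_nm by (simp add: ev_nm[OF Less.prems(1), where \<tau> = N] typed_env[OF Less.prems(1)])
next
  case (Imp A B)
  then show ?case by (simp add: Imp_H wf_env[OF Imp.prems(1)])
next
  case (All \<sigma> A)
  have "M.sat (map nm \<rho>) (All \<sigma> A) \<longleftrightarrow> (\<forall>t. typed [] t \<sigma> \<longrightarrow> M.sat (map nm (t # \<rho>)) A)"
    by (auto simp: DH_def)
  also have "\<dots> \<longleftrightarrow> (\<forall>t. typed [] t \<sigma> \<longrightarrow> inst (env (t # \<rho>)) A \<in> H)"
    using All by (intro all_cong All.IH[where \<Delta> = "\<sigma> # \<Delta>"]) (auto simp: closed_env_def)
  also have "\<dots> \<longleftrightarrow> inst (env \<rho>) (All \<sigma> A) \<in> H" using All by (subst All_env) auto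
  finally show ?case .
qed (simp add: Falsum_H)

lemma truth_sentence: "wf_fm [] A \<Longrightarrow> M.sat [] A \<longleftrightarrow> A \<in> H"
  using truth[of "[]" "[]" A] by (simp add: closed_env_def)

lemma term_model: "model DH apH (\<lambda>x \<sigma>. nm (Free x \<sigma>)) (\<lambda>c. nm (Const c)) (\<lambda>s t. Less s t \<in> H)"
proof
  show "apH f x \<in> DH \<tau>" if "f \<in> DH (\<sigma> \<^bold>\<rightarrow> \<tau>)" "x \<in> DH \<sigma>" for f x \<sigma> \<tau>
    using that by (auto simp: DH_def apH_def intro!: exI[of _ "App f x"] nm)
  show "nm (Free x \<sigma>) \<in> DH \<sigma>" for x \<sigma> by (auto simp: DH_def intro!: exI[of _ "Free x \<sigma>"])
  show "nm (Const c) \<in> DH (const_ty c)" for c by (auto simp: DH_def intro!: exI[of _ "Const c"])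
  show "\<exists>t. typed [] t \<sigma> \<and> M.ev [] t = d" if "d \<in> DH \<sigma>" for d \<sigma>
    using that ev_nm[of "[]" "[]"] by (auto simp: DH_def closed_env_def)
  show "M.sat [] A" if "A \<in> ACA0w" for A
    using that truth_sentence wf_ACA0w T_sub T_ACA by blast
  show "f = g" if f: "f \<in> DH (\<sigma> \<^bold>\<rightarrow> \<tau>)" and g: "g \<in> DH (\<sigma> \<^bold>\<rightarrow> \<tau>)" and eq: "\<And>x. x \<in> DH \<sigma> \<Longrightarrow> apH f x = apH g x" for f g \<sigma> \<tau>
  proof -
    obtain s t where st: "f = nm s" "typed [] s (\<sigma> \<^bold>\<rightarrow> \<tau>)" "g = nm t" "typed [] t (\<sigma> \<^bold>\<rightarrow> \<tau>)" using f g by (auto simp: DH_def)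
    have "eqv \<tau> (App s z) (App t z)" if z: "typed [] z \<sigma>" for z
    proof -
      have "nm (App s z) = nm (App t z)" using eq[of "nm z"] z st nm_App[OF st(2) z] nm_App[OF st(4) z] by (auto simp: DH_def apH_def)
      then show ?thesis using st(2,4) z nm_eq_iff[of "App s z" \<tau> "App t z"] by auto
    qed
    then show ?thesis using st nm_eq_iff[OF st(2,4)] by simp
  qed
qed

end

theorem model_existence:
  assumes "\<not> ACA0w \<turnstile> A" "wf_fm [] A"
  shows "\<exists>(D :: ty \<Rightarrow> tm set) ap fv cs lt. model D ap fv cs lt \<and> \<not> frame.sat D ap fv cs lt [] A"
proof -
  interpret theory_ext ACA0w A by standard (use assms ACA0w_ren in auto)
  interpret henkin ACA0w hset by (rule hset_henkin)
  interpret henkin_ACA ACA0w hset by standard simp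
  show ?thesis using term_model truth_sentence[OF assms(2)] A0_hset by blast
qed

section \<open>Semantics of the formula notation\<close>

context frame
begin

text \<open>Values of outer quantifiers come first in \<open>vs\<close>, so that \<open>bv d\<close> always denotes \<open>vs ! d\<close>.\<close>

definition V :: "'u list \<Rightarrow> pfm \<Rightarrow> bool" where "V vs A = sat (rev vs) (A (length vs))"
definition E :: "'u list \<Rightarrow> ptm \<Rightarrow> 'u" where "E vs t = ev (rev vs) (t (length vs))"
text \<open>The counterpart of \<open>rigid\<close>: quantifiers further in append their values to
  \<open>vs\<close>.\<close>

definition stable :: "'u list \<Rightarrow> ptm \<Rightarrow> bool" where "stable vs t \<longleftrightarrow> (\<forall>ws. E (vs @ ws) t = E vs t)"

lemma V_allq: "V vs (allq \<sigma> F) \<longleftrightarrow> (\<forall>v \<in> D \<sigma>. V (vs @ [v]) (F (bv (length vs))))"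
  by (simp add: V_def allq_def bv_def)
lemma V_exq: "V vs (exq \<sigma> F) \<longleftrightarrow> (\<exists>v \<in> D \<sigma>. V (vs @ [v]) (F (bv (length vs))))"
  by (simp add: exq_def pnot_def V_allq[unfolded V_def] V_def)
lemma V_simps:
  "V vs (A \<^bold>\<longrightarrow> B) \<longleftrightarrow> (V vs A \<longrightarrow> V vs B)" "V vs (\<^bold>\<not> A) \<longleftrightarrow> \<not> V vs A"
  "V vs (A \<^bold>\<and> B) \<longleftrightarrow> V vs A \<and> V vs B" "V vs (A \<^bold>\<or> B) \<longleftrightarrow> V vs A \<or> V vs B" "V vs (A \<^bold>\<longleftrightarrow> B) \<longleftrightarrow> (V vs A \<longleftrightarrow> V vs B)"
  "V vs (s \<^bold>= t) \<longleftrightarrow> E vs s = E vs t" "V vs (s \<^bold>< t) \<longleftrightarrow> lt (E vs s) (E vs t)"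
  "V vs (s \<^bold>\<le> t) \<longleftrightarrow> lt (E vs s) (E vs t) \<or> E vs s = E vs t"
  by (auto simp: V_def E_def pimp_def pnot_def pand_def por_def piff_def peq_def pless_def ple_def)
lemma E_app: "E vs (s \<^bold>\<cdot> t) = ap (E vs s) (E vs t)" by (simp add: E_def papp_def)
lemma E_const: "E vs (pconst c) = cs c" by (simp add: E_def pconst_def)
lemma E_bv: "d < length vs \<Longrightarrow> E vs (bv d) = vs ! d" by (simp add: E_def bv_def rev_nth)

abbreviation zr :: 'u where "zr \<equiv> cs Zero"
abbreviation sc :: "'u \<Rightarrow> 'u" where "sc x \<equiv> ap (cs Succ) x"
abbreviation pl :: "'u \<Rightarrow> 'u \<Rightarrow> 'u" where "pl x y \<equiv> ap (ap (cs Plus) x) y"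
abbreviation ti :: "'u \<Rightarrow> 'u \<Rightarrow> 'u" where "ti x y \<equiv> ap (ap (cs Times) x) y"

lemma E_simps: "E vs \<^bold>0 = zr" "E vs (psuc t) = sc (E vs t)" "E vs (s \<^bold>+ t) = pl (E vs s) (E vs t)"
  "E vs (s \<^bold>* t) = ti (E vs s) (E vs t)" "E vs \<^bold>1 = sc zr"
  by (simp_all add: pzero_def psuc_def padd_def pmul_def pone_def E_app E_const)

lemma stable_E: "stable vs t \<Longrightarrow> E (vs @ ws) t = E vs t" by (simp add: stable_def)
lemma stable_append: "stable vs t \<Longrightarrow> stable (vs @ ws) t" by (simp add: stable_def)
lemma stable_bv: "d < length vs \<Longrightarrow> stable vs (bv d)" by (simp add: stable_def E_bv nth_append)
lemma stable_app: "stable vs s \<Longrightarrow> stable vs t \<Longrightarrow> stable vs (s \<^bold>\<cdot> t)" by (simp add: stable_def E_app)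
lemma stable_const: "stable vs (pconst c)" by (simp add: stable_def E_const)
lemma stable_simps: "stable vs \<^bold>0" "stable vs \<^bold>1"
  "stable vs t \<Longrightarrow> stable vs (psuc t)" "stable vs s \<Longrightarrow> stable vs t \<Longrightarrow> stable vs (s \<^bold>+ t)"
  "stable vs s \<Longrightarrow> stable vs t \<Longrightarrow> stable vs (s \<^bold>* t)"
  by (simp_all add: stable_def E_simps)
lemmas stables = stable_append stable_bv stable_app stable_const stable_simps

lemma sat_sentence: "sat [] (sentence A) \<longleftrightarrow> V [] A" by (simp add: V_def sentence_def)

end

section \<open>Internal functions and decidable predicates\<close>

context model
begin

lemma V_eq_ty: "stable vs s \<Longrightarrow> stable vs t \<Longrightarrow> E vs s \<in> D \<sigma> \<Longrightarrow> E vs t \<in> D \<sigma> \<Longrightarrow> V vs (eq_ty \<sigma> s t) \<longleftrightarrow> E vs s = E vs t"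
proof (induction \<sigma> arbitrary: vs s t)
  case (Fn \<sigma> \<tau>)
  have "V vs (eq_ty (\<sigma> \<^bold>\<rightarrow> \<tau>) s t) \<longleftrightarrow> (\<forall>v \<in> D \<sigma>. ap (E vs s) v = ap (E vs t) v)"
    unfolding eq_ty.simps V_allq
  proof (intro ball_cong refl)
    fix v assume "v \<in> D \<sigma>"
    then show "V (vs @ [v]) (eq_ty \<tau> (s \<^bold>\<cdot> bv (length vs)) (t \<^bold>\<cdot> bv (length vs))) \<longleftrightarrow> ap (E vs s) v = ap (E vs t) v"
      using Fn.prems by (subst Fn.IH(2)) (auto simp: stables E_app stable_E E_bv intro: ap_closed)
  qed
  also have "\<dots> \<longleftrightarrow> E vs s = E vs t" using Fn.prems fun_ext by auto
  finally show ?case .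
qed (simp add: V_simps)

lemma cs_types: "zr \<in> D N" "cs Succ \<in> D (N \<^bold>\<rightarrow> N)" "cs Plus \<in> D (N \<^bold>\<rightarrow> N \<^bold>\<rightarrow> N)" "cs Times \<in> D (N \<^bold>\<rightarrow> N \<^bold>\<rightarrow> N)"
  "cs (PiC \<sigma> \<tau>) \<in> D (\<sigma> \<^bold>\<rightarrow> \<tau> \<^bold>\<rightarrow> \<sigma>)" "cs (SigmaC \<rho> \<sigma> \<tau>) \<in> D ((\<rho> \<^bold>\<rightarrow> \<sigma> \<^bold>\<rightarrow> \<tau>) \<^bold>\<rightarrow> (\<rho> \<^bold>\<rightarrow> \<sigma>) \<^bold>\<rightarrow> \<rho> \<^bold>\<rightarrow> \<tau>)"
  "cs Rec0 \<in> D ((N \<^bold>\<rightarrow> N \<^bold>\<rightarrow> N) \<^bold>\<rightarrow> N \<^bold>\<rightarrow> N \<^bold>\<rightarrow> N)"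
  using cs_closed[of Zero] cs_closed[of Succ] cs_closed[of Plus] cs_closed[of Times] cs_closed[of "PiC \<sigma> \<tau>"]
    cs_closed[of "SigmaC \<rho> \<sigma> \<tau>"] cs_closed[of Rec0] by simp_all

lemma N_closed [simp]: "zr \<in> D N" "x \<in> D N \<Longrightarrow> sc x \<in> D N" "x \<in> D N \<Longrightarrow> y \<in> D N \<Longrightarrow> pl x y \<in> D N"
  "x \<in> D N \<Longrightarrow> y \<in> D N \<Longrightarrow> ti x y \<in> D N"
  by (meson cs_types ap_closed)+

lemma axV: "sentence A \<in> RCA0w \<Longrightarrow> V [] A"
  using ax[of "sentence A"] by (simp add: ACA0w_def sat_sentence)

lemmas Vs = V_allq V_exq V_simps E_app E_const E_bv E_simps

lemma PA_axioms:
  "x \<in> D N \<Longrightarrow> sc x \<noteq> zr" "x \<in> D N \<Longrightarrow> y \<in> D N \<Longrightarrow> sc x = sc y \<longleftrightarrow> x = y"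
  "x \<in> D N \<Longrightarrow> pl x zr = x" "x \<in> D N \<Longrightarrow> y \<in> D N \<Longrightarrow> pl x (sc y) = sc (pl x y)"
  "x \<in> D N \<Longrightarrow> ti x zr = zr" "x \<in> D N \<Longrightarrow> y \<in> D N \<Longrightarrow> ti x (sc y) = pl (ti x y) x"
  "x \<in> D N \<Longrightarrow> \<not> lt x zr" "x \<in> D N \<Longrightarrow> y \<in> D N \<Longrightarrow> lt x (sc y) \<longleftrightarrow> lt x y \<or> x = y"
proof -
  show "x \<in> D N \<Longrightarrow> sc x \<noteq> zr" using axV[OF RCA0w.Succ_nonzero] by (simp add: Vs)
  show "x \<in> D N \<Longrightarrow> y \<in> D N \<Longrightarrow> sc x = sc y \<longleftrightarrow> x = y" using axV[OF RCA0w.Succ_inj] by (simp add: Vs) blast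
  show "x \<in> D N \<Longrightarrow> pl x zr = x" using axV[OF RCA0w.Plus_Zero] by (simp add: Vs)
  show "x \<in> D N \<Longrightarrow> y \<in> D N \<Longrightarrow> pl x (sc y) = sc (pl x y)" using axV[OF RCA0w.Plus_Succ] by (simp add: Vs)
  show "x \<in> D N \<Longrightarrow> ti x zr = zr" using axV[OF RCA0w.Times_Zero] by (simp add: Vs)
  show "x \<in> D N \<Longrightarrow> y \<in> D N \<Longrightarrow> ti x (sc y) = pl (ti x y) x" using axV[OF RCA0w.Times_Succ] by (simp add: Vs)
  show "x \<in> D N \<Longrightarrow> \<not> lt x zr" using axV[OF RCA0w.Less_Zero] by (simp add: Vs)
  show "x \<in> D N \<Longrightarrow> y \<in> D N \<Longrightarrow> lt x (sc y) \<longleftrightarrow> lt x y \<or> x = y" using axV[OF RCA0w.Less_Succ] by (simp add: Vs)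
qed

lemma Rec_axioms: "f \<in> D (N \<^bold>\<rightarrow> N \<^bold>\<rightarrow> N) \<Longrightarrow> x \<in> D N \<Longrightarrow> ap (ap (ap (cs Rec0) f) x) zr = x"
  "f \<in> D (N \<^bold>\<rightarrow> N \<^bold>\<rightarrow> N) \<Longrightarrow> x \<in> D N \<Longrightarrow> n \<in> D N \<Longrightarrow> ap (ap (ap (cs Rec0) f) x) (sc n) = ap (ap f n) (ap (ap (ap (cs Rec0) f) x) n)"
  using axV[OF RCA0w.Rec0_Zero] axV[OF RCA0w.Rec0_Succ] by (auto simp: Vs)

lemma Pi_ap: assumes x: "x \<in> D \<sigma>" and y: "y \<in> D \<tau>" shows "ap (ap (cs (PiC \<sigma> \<tau>)) x) y = x"
proof -
  have "V [x, y] (eq_ty \<sigma> (pconst (PiC \<sigma> \<tau>) \<^bold>\<cdot> bv 0 \<^bold>\<cdot> bv (Suc 0)) (bv 0))"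
    using axV[OF RCA0w.Pi_eq[of \<sigma> \<tau>]] x y by (simp add: V_allq)
  moreover have "ap (ap (cs (PiC \<sigma> \<tau>)) x) y \<in> D \<sigma>" using x y by (meson ap_closed cs_types)
  ultimately show ?thesis using x y by (subst (asm) V_eq_ty) (auto simp: Vs stables)
qed

lemma Sigma_ap: assumes x: "x \<in> D (\<rho> \<^bold>\<rightarrow> \<sigma> \<^bold>\<rightarrow> \<tau>)" and y: "y \<in> D (\<rho> \<^bold>\<rightarrow> \<sigma>)" and z: "z \<in> D \<rho>"
  shows "ap (ap (ap (cs (SigmaC \<rho> \<sigma> \<tau>)) x) y) z = ap (ap x z) (ap y z)"
proof -
  have "V [x, y, z] (eq_ty \<tau> (pconst (SigmaC \<rho> \<sigma> \<tau>) \<^bold>\<cdot> bv 0 \<^bold>\<cdot> bv (Suc 0) \<^bold>\<cdot> bv (Suc (Suc 0))) (bv 0 \<^bold>\<cdot> bv (Suc (Suc 0)) \<^bold>\<cdot> (bv (Suc 0) \<^bold>\<cdot> bv (Suc (Suc 0)))))"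
    using axV[OF RCA0w.Sigma_eq[of \<rho> \<sigma> \<tau>]] x y z by (simp add: V_allq)
  moreover have "ap (ap (ap (cs (SigmaC \<rho> \<sigma> \<tau>)) x) y) z \<in> D \<tau>" "ap (ap x z) (ap y z) \<in> D \<tau>"
    using x y z by (meson ap_closed cs_types)+
  ultimately show ?thesis using x y z by (subst (asm) V_eq_ty) (auto simp: Vs stables)
qed

section \<open>Functions definable by terms, and abstraction\<close>

definition envs :: "ty list \<Rightarrow> 'u list set" where "envs \<Delta> = {\<rho>. list_all2 (\<lambda>d \<sigma>. d \<in> D \<sigma>) \<rho> \<Delta>}"

lemma envs_simps [simp]: "\<rho> \<in> envs [] \<longleftrightarrow> \<rho> = []" "x # \<rho> \<in> envs (\<sigma> # \<Delta>) \<longleftrightarrow> x \<in> D \<sigma> \<and> \<rho> \<in> envs \<Delta>"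
  "[] \<in> envs (\<sigma> # \<Delta>) \<longleftrightarrow> False"
  by (auto simp: envs_def)

lemma envs_Cons: "\<rho> \<in> envs (\<sigma> # \<Delta>) \<longleftrightarrow> (\<exists>x \<rho>'. \<rho> = x # \<rho>' \<and> x \<in> D \<sigma> \<and> \<rho>' \<in> envs \<Delta>)"
  by (cases \<rho>) auto

lemma envs_hd_tl: "\<rho> \<in> envs (\<sigma> # \<Delta>) \<Longrightarrow> hd \<rho> \<in> D \<sigma>" "\<rho> \<in> envs (\<sigma> # \<Delta>) \<Longrightarrow> tl \<rho> \<in> envs \<Delta>"
  by (auto simp: envs_Cons)

lemma ev_closed: "\<rho> \<in> envs \<Delta> \<Longrightarrow> typed \<Delta> t \<tau> \<Longrightarrow> ev \<rho> t \<in> D \<tau>"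
proof (induction t arbitrary: \<tau>)
  case (App s t) then show ?case by (auto intro: ap_closed)
qed (auto simp: envs_def list_all2_conv_all_nth fv_closed cs_closed)

lemma ev_shift: "ev (d # \<rho>) (inst_tm (\<lambda>j. Bound (Suc j)) t) = ev \<rho> t"
  by (induction t) auto

lemma ev_inst: "typed \<Delta> t \<tau> \<Longrightarrow> (\<And>i. i < length \<Delta> \<Longrightarrow> ev \<rho> (s i) = \<rho>' ! i) \<Longrightarrow> ev \<rho> (inst_tm s t) = ev \<rho>' t"
  by (induction t arbitrary: \<tau>) auto

lemma sat_inst: "wf_fm \<Delta> A \<Longrightarrow> (\<And>i. i < length \<Delta> \<Longrightarrow> ev \<rho> (s i) = \<rho>' ! i) \<Longrightarrow> sat \<rho> (inst s A) = sat \<rho>' A"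
proof (induction A arbitrary: \<Delta> \<rho> \<rho>' s)
  case (All \<sigma> A)
  have "ev (d # \<rho>) (lift_subst s i) = (d # \<rho>') ! i" if "i < length (\<sigma> # \<Delta>)" for d i
    using All.prems(2) that by (auto simp: lift_subst_def ev_shift split: nat.split)
  then have "sat (d # \<rho>) (inst (lift_subst s) A) = sat (d # \<rho>') A" for d
    using All.prems(1) by (intro All.IH[of "\<sigma> # \<Delta>"]) auto
  then show ?case by simp
qed (auto simp: ev_inst)

lemma ev_named: "typed [] t \<tau> \<Longrightarrow> ev \<rho> t = ev [] t"
  using ev_inst[of "[]" t \<tau> \<rho> Bound "[]"] by simp

definition intl :: "ty list \<Rightarrow> ty \<Rightarrow> ('u list \<Rightarrow> 'u) \<Rightarrow> bool" where
  "intl \<Delta> \<tau> F \<longleftrightarrow> (\<exists>t. typed \<Delta> t \<tau> \<and> (\<forall>\<rho> \<in> envs \<Delta>. ev \<rho> t = F \<rho>))"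

lemma intl_closed: "intl \<Delta> \<tau> F \<Longrightarrow> \<rho> \<in> envs \<Delta> \<Longrightarrow> F \<rho> \<in> D \<tau>"
  unfolding intl_def using ev_closed by fastforce

lemma intl_ap: "intl \<Delta> (\<sigma> \<^bold>\<rightarrow> \<tau>) F \<Longrightarrow> intl \<Delta> \<sigma> G \<Longrightarrow> intl \<Delta> \<tau> (\<lambda>\<rho>. ap (F \<rho>) (G \<rho>))"
  unfolding intl_def by (elim exE conjE, rename_tac s t, rule_tac x = "App s t" in exI) auto

lemma intl_const: assumes "c \<in> D \<tau>" shows "intl \<Delta> \<tau> (\<lambda>_. c)"
proof -
  obtain t where t: "typed [] t \<tau>" "ev [] t = c" using named assms by blast
  then have "typed \<Delta> t \<tau>" using typed_append[of "[]"] by simp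
  moreover have "ev \<rho> t = c" for \<rho> using ev_named[OF t(1), of \<rho>] t(2) by simp
  ultimately show ?thesis unfolding intl_def by blast
qed

lemma intl_cong: "(\<And>\<rho>. \<rho> \<in> envs \<Delta> \<Longrightarrow> F \<rho> = G \<rho>) \<Longrightarrow> intl \<Delta> \<tau> F \<longleftrightarrow> intl \<Delta> \<tau> G"
  by (auto simp: intl_def)

lemma intl_weaken: assumes "intl \<Delta> \<tau> F" shows "intl (\<sigma> # \<Delta>) \<tau> (\<lambda>\<rho>. F (tl \<rho>))"
proof -
  obtain t where t: "typed \<Delta> t \<tau>" "\<forall>\<rho> \<in> envs \<Delta>. ev \<rho> t = F \<rho>" using assms by (auto simp: intl_def)
  have "typed (\<sigma> # \<Delta>) (inst_tm (\<lambda>j. Bound (Suc j)) t) \<tau>" by (rule typed_inst[OF t(1)]) auto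
  then show ?thesis unfolding intl_def using t(2) by (intro exI conjI) (auto simp: envs_Cons ev_shift)
qed

lemma intl_v0: "intl (\<sigma> # \<Delta>) \<sigma> hd"
  unfolding intl_def by (intro exI[of _ "Bound 0"]) (auto simp: envs_Cons)
lemma intl_v1: "intl (\<tau> # \<sigma> # \<Delta>) \<sigma> (\<lambda>\<rho>. hd (tl \<rho>))" by (intro intl_weaken intl_v0)
lemma intl_v2: "intl (\<tau>1 # \<tau> # \<sigma> # \<Delta>) \<sigma> (\<lambda>\<rho>. hd (tl (tl \<rho>)))" by (rule intl_weaken, rule intl_v1)
lemma intl_v3: "intl (\<tau>2 # \<tau>1 # \<tau> # \<sigma> # \<Delta>) \<sigma> (\<lambda>\<rho>. hd (tl (tl (tl \<rho>))))" by (rule intl_weaken, rule intl_v2)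
lemma intl_v4: "intl (\<tau>3 # \<tau>2 # \<tau>1 # \<tau> # \<sigma> # \<Delta>) \<sigma> (\<lambda>\<rho>. hd (tl (tl (tl (tl \<rho>)))))" by (rule intl_weaken, rule intl_v3)
lemma intl_v5: "intl (\<tau>4 # \<tau>3 # \<tau>2 # \<tau>1 # \<tau> # \<sigma> # \<Delta>) \<sigma> (\<lambda>\<rho>. hd (tl (tl (tl (tl (tl \<rho>))))))" by (rule intl_weaken, rule intl_v4)
lemma intl_v6: "intl (\<tau>5 # \<tau>4 # \<tau>3 # \<tau>2 # \<tau>1 # \<tau> # \<sigma> # \<Delta>) \<sigma> (\<lambda>\<rho>. hd (tl (tl (tl (tl (tl (tl \<rho>)))))))" by (rule intl_weaken, rule intl_v5)
lemma intl_v7: "intl (\<tau>6 # \<tau>5 # \<tau>4 # \<tau>3 # \<tau>2 # \<tau>1 # \<tau> # \<sigma> # \<Delta>) \<sigma> (\<lambda>\<rho>. hd (tl (tl (tl (tl (tl (tl (tl \<rho>))))))))" by (rule intl_weaken, rule intl_v6)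
lemma intl_v8: "intl (\<tau>7 # \<tau>6 # \<tau>5 # \<tau>4 # \<tau>3 # \<tau>2 # \<tau>1 # \<tau> # \<sigma> # \<Delta>) \<sigma> (\<lambda>\<rho>. hd (tl (tl (tl (tl (tl (tl (tl (tl \<rho>)))))))))" by (rule intl_weaken, rule intl_v7)
lemmas intl_vs = intl_v0 intl_v1 intl_v2 intl_v3 intl_v4 intl_v5 intl_v6 intl_v7 intl_v8

text \<open>Combinatory completeness by bracket abstraction: \<open>PiC\<close> for a term without
  the variable, \<open>SigmaC\<close> applied to two instances of \<open>PiC\<close> for the
  variable itself, and \<open>SigmaC\<close> for an application.\<close>

lemma intl_abs_ex:
  "typed (\<sigma> # \<Delta>) t \<tau> \<Longrightarrow> \<exists>u. typed \<Delta> u (\<sigma> \<^bold>\<rightarrow> \<tau>) \<and> (\<forall>\<rho> \<in> envs \<Delta>. \<forall>x \<in> D \<sigma>. ap (ev \<rho> u) x = ev (x # \<rho>) t)"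
proof (induction t arbitrary: \<tau>)
  have K: "\<exists>u. typed \<Delta> u (\<sigma> \<^bold>\<rightarrow> \<tau>) \<and> (\<forall>\<rho> \<in> envs \<Delta>. \<forall>x \<in> D \<sigma>. ap (ev \<rho> u) x = ev (x # \<rho>) t)"
    if "typed \<Delta> s \<tau>" "\<And>\<rho> x. ev (x # \<rho>) t = ev \<rho> s" for s t \<tau>
    by (rule exI[of _ "App (Const (PiC \<tau> \<sigma>)) s"]) (use that in \<open>auto simp: Pi_ap ev_closed\<close>)
  {
    case (Bound i)
    show ?case
    proof (cases i)
      case 0
      then have "\<tau> = \<sigma>" using Bound by simp
      have "ap (ap (ap (cs (SigmaC \<sigma> (\<sigma> \<^bold>\<rightarrow> \<sigma>) \<sigma>)) (cs (PiC \<sigma> (\<sigma> \<^bold>\<rightarrow> \<sigma>)))) (cs (PiC \<sigma> \<sigma>))) x = x" if "x \<in> D \<sigma>" for x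
      proof -
        have "ap (cs (PiC \<sigma> \<sigma>)) x \<in> D (\<sigma> \<^bold>\<rightarrow> \<sigma>)" using that cs_types ap_closed by meson
        then show ?thesis using that by (simp add: Sigma_ap cs_types Pi_ap)
      qed
      then show ?thesis using 0 \<open>\<tau> = \<sigma>\<close>
        by (intro exI[of _ "App (App (Const (SigmaC \<sigma> (\<sigma> \<^bold>\<rightarrow> \<sigma>) \<sigma>)) (Const (PiC \<sigma> (\<sigma> \<^bold>\<rightarrow> \<sigma>)))) (Const (PiC \<sigma> \<sigma>))"]) auto
    next
      case (Suc j)
      then show ?thesis using Bound by (intro K[of "Bound j"]) auto
    qed
  next
    case (Free x \<tau>') then show ?case by (intro K[of "Free x \<tau>'"]) auto
  next
    case (Const c) then show ?case by (intro K[of "Const c"]) auto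
  next
    case (App s t)
    then obtain \<tau>' where ty: "typed (\<sigma> # \<Delta>) s (\<tau>' \<^bold>\<rightarrow> \<tau>)" "typed (\<sigma> # \<Delta>) t \<tau>'" by auto
    then obtain u v where u: "typed \<Delta> u (\<sigma> \<^bold>\<rightarrow> \<tau>' \<^bold>\<rightarrow> \<tau>)" "\<forall>\<rho> \<in> envs \<Delta>. \<forall>x \<in> D \<sigma>. ap (ev \<rho> u) x = ev (x # \<rho>) s"
      and v: "typed \<Delta> v (\<sigma> \<^bold>\<rightarrow> \<tau>')" "\<forall>\<rho> \<in> envs \<Delta>. \<forall>x \<in> D \<sigma>. ap (ev \<rho> v) x = ev (x # \<rho>) t"
      using App.IH by meson
    show ?case
      by (rule exI[of _ "App (App (Const (SigmaC \<sigma> \<tau>' \<tau>)) u) v"])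
        (use u v in \<open>auto simp: Sigma_ap[OF ev_closed[OF _ u(1)] ev_closed[OF _ v(1)]]\<close>)
  }
qed

text \<open>By \<open>fun_ext\<close> at most one element qualifies; there is one if
  \<open>F\<close> is given by a term.\<close>

definition lam :: "ty \<Rightarrow> ty \<Rightarrow> ('u \<Rightarrow> 'u) \<Rightarrow> 'u" where
  "lam \<sigma> \<tau> F = (THE f. f \<in> D (\<sigma> \<^bold>\<rightarrow> \<tau>) \<and> (\<forall>x \<in> D \<sigma>. ap f x = F x))"

lemma lam_eqI: "f \<in> D (\<sigma> \<^bold>\<rightarrow> \<tau>) \<Longrightarrow> (\<And>x. x \<in> D \<sigma> \<Longrightarrow> ap f x = F x) \<Longrightarrow> lam \<sigma> \<tau> F = f"
  unfolding lam_def by (rule the_equality) (auto intro: fun_ext)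

lemma lam_ex:
  assumes "intl (\<sigma> # \<Delta>) \<tau> (\<lambda>\<rho>. F (hd \<rho>) (tl \<rho>))"
  obtains u where "typed \<Delta> u (\<sigma> \<^bold>\<rightarrow> \<tau>)" "\<And>\<rho> x. \<rho> \<in> envs \<Delta> \<Longrightarrow> x \<in> D \<sigma> \<Longrightarrow> ap (ev \<rho> u) x = F x \<rho>"
    "\<And>\<rho>. \<rho> \<in> envs \<Delta> \<Longrightarrow> lam \<sigma> \<tau> (\<lambda>x. F x \<rho>) = ev \<rho> u"
proof -
  obtain t where t: "typed (\<sigma> # \<Delta>) t \<tau>" "\<And>\<rho>. \<rho> \<in> envs (\<sigma> # \<Delta>) \<Longrightarrow> ev \<rho> t = F (hd \<rho>) (tl \<rho>)"
    using assms by (auto simp: intl_def)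
  obtain u where u: "typed \<Delta> u (\<sigma> \<^bold>\<rightarrow> \<tau>)" "\<forall>\<rho> \<in> envs \<Delta>. \<forall>x \<in> D \<sigma>. ap (ev \<rho> u) x = ev (x # \<rho>) t"
    using intl_abs_ex[OF t(1)] by blast
  have *: "ap (ev \<rho> u) x = F x \<rho>" if "\<rho> \<in> envs \<Delta>" "x \<in> D \<sigma>" for \<rho> x using u(2) t(2)[of "x # \<rho>"] that by simp
  moreover have "lam \<sigma> \<tau> (\<lambda>x. F x \<rho>) = ev \<rho> u" if "\<rho> \<in> envs \<Delta>" for \<rho>
    by (rule lam_eqI) (use * that ev_closed[OF that u(1)] in auto)
  ultimately show ?thesis using that u(1) by blast
qed

lemma intl_lam: "intl (\<sigma> # \<Delta>) \<tau> (\<lambda>\<rho>. F (hd \<rho>) (tl \<rho>)) \<Longrightarrow> intl \<Delta> (\<sigma> \<^bold>\<rightarrow> \<tau>) (\<lambda>\<rho>. lam \<sigma> \<tau> (\<lambda>x. F x \<rho>))"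
  by (erule lam_ex) (auto simp: intl_def)

lemma ap_lam: "intl (\<sigma> # \<Delta>) \<tau> (\<lambda>\<rho>. F (hd \<rho>) (tl \<rho>)) \<Longrightarrow> \<rho> \<in> envs \<Delta> \<Longrightarrow> x \<in> D \<sigma> \<Longrightarrow> ap (lam \<sigma> \<tau> (\<lambda>x. F x \<rho>)) x = F x \<rho>"
  by (erule lam_ex) auto

lemma lam1: assumes "intl [\<sigma>] \<tau> (\<lambda>\<rho>. F (hd \<rho>))"
  shows "lam \<sigma> \<tau> F \<in> D (\<sigma> \<^bold>\<rightarrow> \<tau>)" "x \<in> D \<sigma> \<Longrightarrow> ap (lam \<sigma> \<tau> F) x = F x"
  using intl_closed[OF intl_lam[of \<sigma> "[]" \<tau> "\<lambda>x _. F x"], of "[]"] ap_lam[of \<sigma> "[]" \<tau> "\<lambda>x _. F x" "[]"] assms by auto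

section \<open>Decidable predicates: closure under number quantifiers, induction and choice\<close>

definition qf :: "ty list \<Rightarrow> ('u list \<Rightarrow> bool) \<Rightarrow> bool" where
  "qf \<Delta> P \<longleftrightarrow> (\<exists>A. qfree A \<and> wf_fm \<Delta> A \<and> (\<forall>\<rho> \<in> envs \<Delta>. sat \<rho> A = P \<rho>))"

lemma qf_eq: "intl \<Delta> N F \<Longrightarrow> intl \<Delta> N G \<Longrightarrow> qf \<Delta> (\<lambda>\<rho>. F \<rho> = G \<rho>)"
  unfolding intl_def qf_def by (elim exE conjE, rename_tac s t, rule_tac x = "Eq s t" in exI) auto
lemma qf_less: "intl \<Delta> N F \<Longrightarrow> intl \<Delta> N G \<Longrightarrow> qf \<Delta> (\<lambda>\<rho>. lt (F \<rho>) (G \<rho>))"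
  unfolding intl_def qf_def by (elim exE conjE, rename_tac s t, rule_tac x = "Less s t" in exI) auto
lemma qf_imp: "qf \<Delta> P \<Longrightarrow> qf \<Delta> Q \<Longrightarrow> qf \<Delta> (\<lambda>\<rho>. P \<rho> \<longrightarrow> Q \<rho>)"
  unfolding qf_def by (elim exE conjE, rename_tac s t, rule_tac x = "Imp s t" in exI) auto
lemma qf_iff: "qf \<Delta> P \<Longrightarrow> qf \<Delta> Q \<Longrightarrow> qf \<Delta> (\<lambda>\<rho>. P \<rho> \<longleftrightarrow> Q \<rho>)"
  unfolding qf_def by (elim exE conjE, rename_tac s t, rule_tac x = "Neg (Imp (Imp s t) (Neg (Imp t s)))" in exI) auto

lemma qf_AC:
  assumes "qf [N, one] P" "\<And>x. x \<in> D one \<Longrightarrow> \<exists>y \<in> D N. P [y, x]"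
  shows "\<exists>f \<in> D two. \<forall>x \<in> D one. P [ap f x, x]"
proof -
  obtain A where A: "qfree A" "wf_fm [N, one] A" "\<And>\<rho>. \<rho> \<in> envs [N, one] \<Longrightarrow> sat \<rho> A = P \<rho>"
    using assms(1) by (auto simp: qf_def)
  have "sat [x, f] (inst (case_nat (App (Bound 1) (Bound 0)) Bound) A) = sat [ap f x, x] A" for x f
    by (rule sat_inst[OF A(2)]) (auto simp: less_Suc_eq)
  moreover have "sat [] (Imp (All one (Ex N A)) (Ex two (All one (inst (case_nat (App (Bound 1) (Bound 0)) Bound) A))))"
    by (rule ax) (unfold ACA0w_def, rule insertI2, rule RCA0w.QF_AC[OF A(1,2)])
  ultimately have "(\<forall>x \<in> D one. \<exists>y \<in> D N. P [y, x]) \<longrightarrow> (\<exists>f \<in> D two. \<forall>x \<in> D one. sat [ap f x, x] A)"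
    using A(3) by simp
  moreover have "sat [ap f x, x] A = P [ap f x, x]" if "f \<in> D two" "x \<in> D one" for f x
    using that by (intro A(3)) (auto intro: ap_closed)
  ultimately show ?thesis using assms(2) by blast
qed

text \<open>Quantifier-free choice selects a number for a function. To apply it to two numbers, they
  are packed into one function as its values at 0 and at 1; the recursor with a constant step
  provides it.\<close>

definition sw :: "'u \<Rightarrow> 'u \<Rightarrow> 'u" where
  "sw a b = ap (ap (cs Rec0) (ap (cs (PiC one N)) (ap (cs (PiC N N)) b))) a"

lemma sw: assumes "a \<in> D N" "b \<in> D N" shows "sw a b \<in> D one" "ap (sw a b) zr = a" "ap (sw a b) (sc zr) = b"
proof -
  have *: "ap (cs (PiC N N)) b \<in> D one" using assms by (meson ap_closed cs_types)
  moreover from * have "ap (cs (PiC one N)) (ap (cs (PiC N N)) b) \<in> D (N \<^bold>\<rightarrow> N \<^bold>\<rightarrow> N)" by (meson ap_closed cs_types)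
  ultimately show "sw a b \<in> D one" "ap (sw a b) zr = a" "ap (sw a b) (sc zr) = b"
    unfolding sw_def using assms by (auto simp: Rec_axioms Pi_ap) (meson ap_closed cs_types)
qed

lemma intl_sw: "intl \<Delta> N F \<Longrightarrow> intl \<Delta> N G \<Longrightarrow> intl \<Delta> one (\<lambda>\<rho>. sw (F \<rho>) (G \<rho>))"
  unfolding sw_def by (rule intl_ap intl_const cs_types | assumption)+

definition dec :: "ty list \<Rightarrow> ('u list \<Rightarrow> bool) \<Rightarrow> bool" where
  "dec \<Delta> P \<longleftrightarrow> (\<exists>F. intl \<Delta> N F \<and> (\<forall>\<rho> \<in> envs \<Delta>. F \<rho> = zr \<longleftrightarrow> P \<rho>))"

lemma dec_cong: "(\<And>\<rho>. \<rho> \<in> envs \<Delta> \<Longrightarrow> P \<rho> = Q \<rho>) \<Longrightarrow> dec \<Delta> P \<longleftrightarrow> dec \<Delta> Q"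
  by (auto simp: dec_def)

text \<open>Quantifier-free choice applied to \<open>R \<longleftrightarrow> y = 0\<close> yields a
  characteristic functional on packed pairs, which is then composed with \<open>F\<close> and
  \<open>G\<close>.\<close>

lemma dec_graph:
  assumes R: "qf [N, one] (\<lambda>\<rho>. R (ap (hd (tl \<rho>)) zr) (ap (hd (tl \<rho>)) (sc zr)) \<longleftrightarrow> hd \<rho> = zr)"
    and FG: "intl \<Delta> N F" "intl \<Delta> N G"
  shows "dec \<Delta> (\<lambda>\<rho>. R (F \<rho>) (G \<rho>))"
proof -
  have "\<exists>y \<in> D N. R (ap x zr) (ap x (sc zr)) \<longleftrightarrow> y = zr" if "x \<in> D one" for x
    using PA_axioms(1)[of zr] N_closed(2)[of zr] by (cases "R (ap x zr) (ap x (sc zr))") auto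
  then obtain f where f: "f \<in> D two" "\<forall>x \<in> D one. R (ap x zr) (ap x (sc zr)) \<longleftrightarrow> ap f x = zr"
    using qf_AC[OF R] by auto
  have "intl \<Delta> N (\<lambda>\<rho>. ap f (sw (F \<rho>) (G \<rho>)))" by (rule intl_ap[OF intl_const[OF f(1)] intl_sw[OF FG]])
  moreover have "ap f (sw (F \<rho>) (G \<rho>)) = zr \<longleftrightarrow> R (F \<rho>) (G \<rho>)" if "\<rho> \<in> envs \<Delta>" for \<rho>
    using bspec[OF f(2) sw(1)[OF intl_closed[OF FG(1) that] intl_closed[OF FG(2) that]]]
    by (simp add: sw(2,3)[OF intl_closed[OF FG(1) that] intl_closed[OF FG(2) that]])
  ultimately show ?thesis unfolding dec_def by blast
qed

lemmas intl_rules = intl_ap intl_vs intl_const cs_types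

lemma dec_eq: "intl \<Delta> N F \<Longrightarrow> intl \<Delta> N G \<Longrightarrow> dec \<Delta> (\<lambda>\<rho>. F \<rho> = G \<rho>)"
  by (rule dec_graph[where R = "(=)"]) (rule qf_iff qf_eq intl_rules)+
lemma dec_less: "intl \<Delta> N F \<Longrightarrow> intl \<Delta> N G \<Longrightarrow> dec \<Delta> (\<lambda>\<rho>. lt (F \<rho>) (G \<rho>))"
  by (rule dec_graph[where R = lt]) (rule qf_iff qf_eq qf_less intl_rules)+
lemma dec_imp: assumes "dec \<Delta> P" "dec \<Delta> Q" shows "dec \<Delta> (\<lambda>\<rho>. P \<rho> \<longrightarrow> Q \<rho>)"
proof -
  obtain F G where F: "intl \<Delta> N F" "\<And>\<rho>. \<rho> \<in> envs \<Delta> \<Longrightarrow> F \<rho> = zr \<longleftrightarrow> P \<rho>"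
    and G: "intl \<Delta> N G" "\<And>\<rho>. \<rho> \<in> envs \<Delta> \<Longrightarrow> G \<rho> = zr \<longleftrightarrow> Q \<rho>"
    using assms by (auto simp: dec_def)
  have "dec \<Delta> (\<lambda>\<rho>. F \<rho> = zr \<longrightarrow> G \<rho> = zr)"
    by (rule dec_graph[where R = "\<lambda>x y. x = zr \<longrightarrow> y = zr", OF _ F(1) G(1)]) (rule qf_iff qf_eq qf_imp intl_rules)+
  then show ?thesis by (subst (asm) dec_cong[where Q = "\<lambda>\<rho>. P \<rho> \<longrightarrow> Q \<rho>"]) (auto simp: F G)
qed
lemma dec_const: "dec \<Delta> (\<lambda>_. b)"
  using dec_eq[OF intl_const[OF cs_types(1)] intl_const[OF cs_types(1)], of \<Delta>]
    dec_eq[OF intl_const[OF cs_types(1)] intl_const[OF N_closed(2)[OF cs_types(1)]], of \<Delta>] PA_axioms(1)[of zr] N_closed(1)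
  by (cases b) (metis (full_types))+
lemma dec_not: "dec \<Delta> P \<Longrightarrow> dec \<Delta> (\<lambda>\<rho>. \<not> P \<rho>)"
  using dec_imp[OF _ dec_const[of _ False]] by simp
lemma dec_conj: "dec \<Delta> P \<Longrightarrow> dec \<Delta> Q \<Longrightarrow> dec \<Delta> (\<lambda>\<rho>. P \<rho> \<and> Q \<rho>)"
  using dec_not[OF dec_imp[OF _ dec_not]] by simp
lemma dec_disj: "dec \<Delta> P \<Longrightarrow> dec \<Delta> Q \<Longrightarrow> dec \<Delta> (\<lambda>\<rho>. P \<rho> \<or> Q \<rho>)"
  using dec_imp[OF dec_not] by (simp add: disj_imp)
lemma dec_iff: "dec \<Delta> P \<Longrightarrow> dec \<Delta> Q \<Longrightarrow> dec \<Delta> (\<lambda>\<rho>. P \<rho> \<longleftrightarrow> Q \<rho>)"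
  using dec_conj[OF dec_imp dec_imp] by (simp add: iff_conv_conj_imp)

lemma exists2_ex: "\<exists>\<phi> \<in> D two. \<forall>f \<in> D one. (\<exists>n \<in> D N. ap f n = zr) \<longleftrightarrow> ap \<phi> f = zr"
proof -
  have "sat [] exists2" by (rule ax) (simp add: ACA0w_def)
  then show ?thesis unfolding exists2_def sat_sentence by (simp add: Vs) blast
qed

lemma dec_charE:
  assumes "dec (\<sigma> # \<Delta>) (\<lambda>\<rho>. P (hd \<rho>) (tl \<rho>))"
  obtains F where "intl (\<sigma> # \<Delta>) N (\<lambda>\<rho>. F (hd \<rho>) (tl \<rho>))"
    "\<And>\<rho> x. \<rho> \<in> envs \<Delta> \<Longrightarrow> x \<in> D \<sigma> \<Longrightarrow> F x \<rho> = zr \<longleftrightarrow> P x \<rho>"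
proof -
  obtain F where F: "intl (\<sigma> # \<Delta>) N F" "\<forall>\<rho> \<in> envs (\<sigma> # \<Delta>). F \<rho> = zr \<longleftrightarrow> P (hd \<rho>) (tl \<rho>)"
    using assms unfolding dec_def by blast
  have "intl (\<sigma> # \<Delta>) N (\<lambda>\<rho>. F (hd \<rho> # tl \<rho>))"
    by (rule intl_cong[THEN iffD1, OF _ F(1)]) (auto simp: envs_Cons)
  moreover have "F (x # \<rho>) = zr \<longleftrightarrow> P x \<rho>" if "\<rho> \<in> envs \<Delta>" "x \<in> D \<sigma>" for x \<rho>
    using F(2)[rule_format, of "x # \<rho>"] that by simp
  ultimately show ?thesis using that[of "\<lambda>x \<rho>. F (x # \<rho>)"] by blast
qed

text \<open>The functional of \<open>exists2\<close>, applied to the characteristic function of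
  \<open>P\<close>, decides the quantifier. Thus all arithmetical predicates become decidable, with
  parameters of any type.\<close>

lemma dec_ex: assumes "dec (N # \<Delta>) (\<lambda>\<rho>. P (hd \<rho>) (tl \<rho>))" shows "dec \<Delta> (\<lambda>\<rho>. \<exists>n \<in> D N. P n \<rho>)"
proof -
  obtain F where F: "intl (N # \<Delta>) N (\<lambda>\<rho>. F (hd \<rho>) (tl \<rho>))"
    "\<And>\<rho> x. \<rho> \<in> envs \<Delta> \<Longrightarrow> x \<in> D N \<Longrightarrow> F x \<rho> = zr \<longleftrightarrow> P x \<rho>" by (rule dec_charE[OF assms]) blast
  obtain \<phi> where \<phi>: "\<phi> \<in> D two" "\<forall>f \<in> D one. (\<exists>n \<in> D N. ap f n = zr) \<longleftrightarrow> ap \<phi> f = zr" using exists2_ex by blast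
  have i: "intl \<Delta> N (\<lambda>\<rho>. ap \<phi> (lam N N (\<lambda>x. F x \<rho>)))" by (rule intl_ap[OF intl_const[OF \<phi>(1)] intl_lam[OF F(1)]])
  have "ap \<phi> (lam N N (\<lambda>x. F x \<rho>)) = zr \<longleftrightarrow> (\<exists>n \<in> D N. P n \<rho>)" if "\<rho> \<in> envs \<Delta>" for \<rho>
    using bspec[OF \<phi>(2) intl_closed[OF intl_lam[OF F(1)] that]] ap_lam[OF F(1) that] F(2)[OF that] by (metis (no_types, lifting))
  then show ?thesis using i unfolding dec_def by blast
qed
lemma dec_all: assumes "dec (N # \<Delta>) (\<lambda>\<rho>. P (hd \<rho>) (tl \<rho>))" shows "dec \<Delta> (\<lambda>\<rho>. \<forall>n \<in> D N. P n \<rho>)"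
  using dec_not[OF dec_ex[OF dec_not[OF assms]]] by simp

text \<open>A decided predicate is equivalent to an equation with right side zero, and that is a
  quantifier-free formula.\<close>

lemma dec_induct:
  assumes P: "dec [N] (\<lambda>\<rho>. P (hd \<rho>))" and base: "P zr" and step: "\<And>n. n \<in> D N \<Longrightarrow> P n \<Longrightarrow> P (sc n)" and n: "n \<in> D N"
  shows "P n"
proof -
  obtain F t where t: "typed [N] t N" and F: "\<forall>\<rho> \<in> envs [N]. ev \<rho> t = F \<rho>" "\<forall>\<rho> \<in> envs [N]. F \<rho> = zr \<longleftrightarrow> P (hd \<rho>)"
    using P by (auto simp: dec_def intl_def)
  let ?A = "Eq t (Const Zero)"
  have s: "sat [x] ?A = P x" if "x \<in> D N" for x using F that by (simp del: envs_simps) (metis envs_simps(1,2) list.sel(1))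
  have "wf_fm [N] ?A" using t by simp
  then have a: "sat [] (inst0 (Const Zero) ?A) = sat [zr] ?A"
    "sat [x] (inst (case_nat (App (Const Succ) (Bound 0)) (\<lambda>i. Bound (Suc i))) ?A) = sat [sc x] ?A" for x
    by (auto intro!: sat_inst[of "[N]"] simp del: sat.simps inst.simps)
  have "sat [] (Imp (inst0 (Const Zero) ?A) (Imp (All N (Imp ?A (inst (case_nat (App (Const Succ) (Bound 0)) (\<lambda>i. Bound (Suc i))) ?A))) (All N ?A)))"
    by (rule ax) (unfold ACA0w_def, rule insertI2, rule RCA0w.QF_induction, use t in simp_all)
  then have "sat [zr] ?A \<longrightarrow> (\<forall>x \<in> D N. sat [x] ?A \<longrightarrow> sat [sc x] ?A) \<longrightarrow> (\<forall>x \<in> D N. sat [x] ?A)"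
    using a unfolding sat.simps(4,5) by blast
  then show ?thesis using s base step n by simp
qed

text \<open>Quantifier-free choice for \<open>\<phi> f = 0 \<longrightarrow> f y = 0\<close> gives
  Feferman's \<open>\<mu>\<close>, which finds a zero of \<open>f\<close> if there is one. The
  witness is then a term in the variables of \<open>\<Delta>\<close>, whatever their types.\<close>

lemma dec_choice:
  assumes P: "dec (N # \<Delta>) (\<lambda>\<rho>. P (hd \<rho>) (tl \<rho>))"
  shows "\<exists>F. intl \<Delta> N F \<and> (\<forall>\<rho> \<in> envs \<Delta>. (\<exists>n \<in> D N. P n \<rho>) \<longrightarrow> P (F \<rho>) \<rho>)"
proof -
  obtain F where F: "intl (N # \<Delta>) N (\<lambda>\<rho>. F (hd \<rho>) (tl \<rho>))"
    "\<And>\<rho> x. \<rho> \<in> envs \<Delta> \<Longrightarrow> x \<in> D N \<Longrightarrow> F x \<rho> = zr \<longleftrightarrow> P x \<rho>" by (rule dec_charE[OF P]) blast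
  obtain \<phi> where \<phi>: "\<phi> \<in> D two" "\<forall>f \<in> D one. (\<exists>n \<in> D N. ap f n = zr) \<longleftrightarrow> ap \<phi> f = zr" using exists2_ex by blast
  have "qf [N, one] (\<lambda>\<rho>. ap \<phi> (hd (tl \<rho>)) = zr \<longrightarrow> ap (hd (tl \<rho>)) (hd \<rho>) = zr)"
    by (rule qf_imp qf_eq intl_rules \<phi>(1))+
  moreover have "\<exists>y \<in> D N. ap \<phi> x = zr \<longrightarrow> ap x y = zr" if "x \<in> D one" for x
    using bspec[OF \<phi>(2) that] cs_types(1) by blast
  ultimately obtain \<mu> where \<mu>: "\<mu> \<in> D two" "\<forall>f \<in> D one. ap \<phi> f = zr \<longrightarrow> ap f (ap \<mu> f) = zr"
    using qf_AC[of "\<lambda>\<rho>. ap \<phi> (hd (tl \<rho>)) = zr \<longrightarrow> ap (hd (tl \<rho>)) (hd \<rho>) = zr"] by auto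
  have "intl \<Delta> N (\<lambda>\<rho>. ap \<mu> (lam N N (\<lambda>x. F x \<rho>)))" by (rule intl_ap[OF intl_const[OF \<mu>(1)] intl_lam[OF F(1)]])
  moreover have "P (ap \<mu> (lam N N (\<lambda>x. F x \<rho>))) \<rho>" if \<rho>: "\<rho> \<in> envs \<Delta>" and ex: "\<exists>n \<in> D N. P n \<rho>" for \<rho>
  proof -
    let ?f = "lam N N (\<lambda>x. F x \<rho>)"
    have f: "?f \<in> D one" by (rule intl_closed[OF intl_lam[OF F(1)] \<rho>])
    then have m: "ap \<mu> ?f \<in> D N" using \<mu>(1) ap_closed by blast
    have "\<exists>n \<in> D N. ap ?f n = zr" using ex F(2)[OF \<rho>] ap_lam[OF F(1) \<rho>] by auto
    then have "ap ?f (ap \<mu> ?f) = zr" using \<phi>(2) \<mu>(2) f by blast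
    then show ?thesis using ap_lam[OF F(1) \<rho> m] F(2)[OF \<rho> m] by simp
  qed
  ultimately show ?thesis by blast
qed

lemmas dec_rules = dec_imp dec_not dec_conj dec_disj dec_iff dec_ex dec_all dec_less dec_eq intl_rules

end

section \<open>The numbers of a model\<close>

text \<open>Stated for a bare structure, so that both the numbers of a countermodel and the copy of
  the natural numbers can be shown to have these properties. The order is left to be recovered from
  addition.\<close>

definition num_struct :: "'u set \<Rightarrow> 'u \<Rightarrow> ('u \<Rightarrow> 'u) \<Rightarrow> ('u \<Rightarrow> 'u \<Rightarrow> 'u) \<Rightarrow> ('u \<Rightarrow> 'u \<Rightarrow> 'u) \<Rightarrow> bool" where
  "num_struct C z s p t \<longleftrightarrow> z \<in> C \<and> (\<forall>x \<in> C. s x \<in> C) \<and> (\<forall>x \<in> C. \<forall>y \<in> C. p x y \<in> C) \<and> (\<forall>x \<in> C. \<forall>y \<in> C. t x y \<in> C)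
    \<and> (\<forall>x \<in> C. p z x = x) \<and> (\<forall>x \<in> C. \<forall>y \<in> C. p x y = p y x) \<and> (\<forall>x \<in> C. \<forall>y \<in> C. \<forall>w \<in> C. p (p x y) w = p x (p y w))
    \<and> (\<forall>x \<in> C. \<forall>y \<in> C. \<forall>w \<in> C. p x y = p x w \<longrightarrow> y = w)
    \<and> (\<forall>x \<in> C. t (s z) x = x) \<and> (\<forall>x \<in> C. t z x = z) \<and> (\<forall>x \<in> C. \<forall>y \<in> C. t x y = t y x)
    \<and> (\<forall>x \<in> C. \<forall>y \<in> C. \<forall>w \<in> C. t (t x y) w = t x (t y w)) \<and> (\<forall>x \<in> C. \<forall>y \<in> C. \<forall>w \<in> C. t (p x y) w = p (t x w) (t y w))
    \<and> (\<forall>x \<in> C. s x \<noteq> z) \<and> (\<forall>x \<in> C. s x = p x (s z)) \<and> (\<forall>x \<in> C. x = z \<or> (\<exists>k \<in> C. x = s k))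
    \<and> (\<forall>x \<in> C. \<forall>y \<in> C. (\<exists>k \<in> C. y = p x k) \<or> (\<exists>k \<in> C. x = p y k))"

context model
begin

lemma pl_zl: "y \<in> D N \<Longrightarrow> pl zr y = y"
  by (rule dec_induct[where P = "\<lambda>y. pl zr y = y"]) ((rule dec_rules | assumption)+ | simp add: PA_axioms)+
lemma pl_sl: assumes x: "x \<in> D N" shows "y \<in> D N \<Longrightarrow> pl (sc x) y = sc (pl x y)"
  by (rule dec_induct[where P = "\<lambda>y. pl (sc x) y = sc (pl x y)"]) ((rule dec_rules x)+ | simp add: PA_axioms x)+
lemma pl_comm: assumes x: "x \<in> D N" shows "y \<in> D N \<Longrightarrow> pl x y = pl y x"
  by (rule dec_induct[where P = "\<lambda>y. pl x y = pl y x"]) ((rule dec_rules x)+ | simp add: PA_axioms x pl_zl pl_sl)+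
lemma pl_assoc: assumes x: "x \<in> D N" "y \<in> D N" shows "w \<in> D N \<Longrightarrow> pl (pl x y) w = pl x (pl y w)"
  by (rule dec_induct[where P = "\<lambda>w. pl (pl x y) w = pl x (pl y w)"]) ((rule dec_rules x)+ | simp add: PA_axioms x)+
lemma pl_cancel: assumes x: "y \<in> D N" "w \<in> D N" shows "x \<in> D N \<Longrightarrow> pl x y = pl x w \<longrightarrow> y = w"
  by (rule dec_induct[where P = "\<lambda>x. pl x y = pl x w \<longrightarrow> y = w"]) ((rule dec_rules x)+ | simp add: PA_axioms x pl_zl pl_sl)+
lemma ti_zl: "y \<in> D N \<Longrightarrow> ti zr y = zr"
  by (rule dec_induct[where P = "\<lambda>y. ti zr y = zr"]) ((rule dec_rules)+ | simp add: PA_axioms)+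
lemma ti_sl: assumes x: "x \<in> D N" shows "y \<in> D N \<Longrightarrow> ti (sc x) y = pl (ti x y) y"
proof (rule dec_induct[where P = "\<lambda>y. ti (sc x) y = pl (ti x y) y"])
  fix y assume y: "y \<in> D N" "ti (sc x) y = pl (ti x y) y"
  then show "ti (sc x) (sc y) = pl (ti x (sc y)) (sc y)"
    using x pl_comm[of x y] by (simp add: PA_axioms pl_assoc)
qed ((rule dec_rules x)+ | simp add: PA_axioms x)+
lemma ti_comm: assumes x: "x \<in> D N" shows "y \<in> D N \<Longrightarrow> ti x y = ti y x"
  by (rule dec_induct[where P = "\<lambda>y. ti x y = ti y x"]) ((rule dec_rules x)+ | simp add: PA_axioms x ti_zl ti_sl)+
lemma ti_distl: assumes x: "x \<in> D N" "y \<in> D N" shows "w \<in> D N \<Longrightarrow> ti x (pl y w) = pl (ti x y) (ti x w)"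
  by (rule dec_induct[where P = "\<lambda>w. ti x (pl y w) = pl (ti x y) (ti x w)"]) ((rule dec_rules x)+ | simp add: PA_axioms x pl_assoc)+
lemma ti_assoc: assumes x: "x \<in> D N" "y \<in> D N" shows "w \<in> D N \<Longrightarrow> ti (ti x y) w = ti x (ti y w)"
  by (rule dec_induct[where P = "\<lambda>w. ti (ti x y) w = ti x (ti y w)"]) ((rule dec_rules x)+ | simp add: PA_axioms x ti_distl)+

lemma N_cases: "x \<in> D N \<Longrightarrow> x = zr \<or> (\<exists>k \<in> D N. x = sc k)"
  by (rule dec_induct[where P = "\<lambda>x. x = zr \<or> (\<exists>k \<in> D N. x = sc k)"]) ((rule dec_rules)+ | simp | blast)+

text \<open>The primitive relation \<open>lt\<close> is axiomatized only by recursion on its right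
  argument; this identifies it with the order that addition defines.\<close>

lemma lt_iff: assumes x: "x \<in> D N" shows "y \<in> D N \<Longrightarrow> lt x y \<longleftrightarrow> (\<exists>k \<in> D N. y = pl x (sc k))"
proof (rule dec_induct[where P = "\<lambda>y. lt x y \<longleftrightarrow> (\<exists>k \<in> D N. y = pl x (sc k))"])
  show "lt x zr \<longleftrightarrow> (\<exists>k \<in> D N. zr = pl x (sc k))" using x by (auto simp: PA_axioms dest: sym)
  fix y assume y: "y \<in> D N" and IH: "lt x y \<longleftrightarrow> (\<exists>k \<in> D N. y = pl x (sc k))"
  have "(\<exists>k \<in> D N. sc y = pl x (sc k)) \<longleftrightarrow> (\<exists>k \<in> D N. y = pl x k)" using x y by (auto simp: PA_axioms)
  also have "\<dots> \<longleftrightarrow> y = x \<or> (\<exists>k \<in> D N. y = pl x (sc k))"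
    using N_cases x N_closed(1,2) PA_axioms(3) by metis
  finally show "lt x (sc y) \<longleftrightarrow> (\<exists>k \<in> D N. sc y = pl x (sc k))" using IH x y by (auto simp: PA_axioms)
qed (rule dec_rules x)+

lemma lt_linear: assumes y: "y \<in> D N" shows "x \<in> D N \<Longrightarrow> (\<exists>k \<in> D N. y = pl x k) \<or> (\<exists>k \<in> D N. x = pl y k)"
proof (rule dec_induct[where P = "\<lambda>x. (\<exists>k \<in> D N. y = pl x k) \<or> (\<exists>k \<in> D N. x = pl y k)"])
  show "(\<exists>k \<in> D N. y = pl zr k) \<or> (\<exists>k \<in> D N. zr = pl y k)" using y pl_zl by metis
  fix x assume x: "x \<in> D N" and "(\<exists>k \<in> D N. y = pl x k) \<or> (\<exists>k \<in> D N. x = pl y k)"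
  then consider k where "k \<in> D N" "y = pl x k" | k where "k \<in> D N" "x = pl y k" by blast
  then show "(\<exists>k \<in> D N. y = pl (sc x) k) \<or> (\<exists>k \<in> D N. sc x = pl y k)"
  proof cases
    case (1 k)
    then consider (zero) "k = zr" | (suc) l where "l \<in> D N" "k = sc l" using N_cases by blast
    then show ?thesis
    proof cases
      case zero
      then have "sc x = pl y (sc zr)" using 1 x by (simp add: PA_axioms)
      then show ?thesis using N_closed(1,2) by blast
    next
      case (suc l)
      then have "y = pl (sc x) l" using 1 x by (simp add: PA_axioms pl_sl)
      then show ?thesis using suc by blast
    qed
  next
    case (2 k)
    then have "sc x = pl y (sc k)" using y by (simp add: PA_axioms)
    then show ?thesis using 2 N_closed(2) by blast
  qed
qed (rule dec_rules y)+

lemma num_struct_N: "num_struct (D N) zr sc pl ti"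
proof -
  have d: "ti (pl x y) w = pl (ti x w) (ti y w)" if "x \<in> D N" "y \<in> D N" "w \<in> D N" for x y w
    using ti_comm[of "pl x y" w] ti_comm[of x w] ti_comm[of y w] ti_distl[of w x y] that by simp
  have one: "ti (sc zr) x = x" "sc x = pl x (sc zr)" if "x \<in> D N" for x
    using that by (simp_all add: ti_sl ti_zl pl_zl PA_axioms)
  show ?thesis
    unfolding num_struct_def
    by (intro conjI ballI) (rule pl_zl pl_comm pl_assoc pl_cancel one ti_zl ti_comm ti_assoc d PA_axioms(1) N_cases lt_linear N_closed | assumption)+
qed

end

text \<open>The failure of either implication counts, so that one fixed model, and with it one type
  of numbers, serves for both.\<close>

definition bad_model :: "(ty \<Rightarrow> tm set) \<times> (tm \<Rightarrow> tm \<Rightarrow> tm) \<times> (nat \<Rightarrow> ty \<Rightarrow> tm) \<times> (const \<Rightarrow> tm) \<times> (tm \<Rightarrow> tm \<Rightarrow> bool) \<Rightarrow> bool" where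
  "bad_model = (\<lambda>(D, ap, fv, cs, lt). model D ap fv cs lt \<and>
     \<not> (frame.sat D ap fv cs lt [] (Imp Jordan HBU_bv) \<and> frame.sat D ap fv cs lt [] (Imp HBU_bv NIN)))"

text \<open>A type cannot depend on a model. So the numbers of one fixed countermodel are made into a type; if
  there is no countermodel, a copy of the natural numbers takes their place.\<close>

definition the_struct :: "tm set \<times> tm \<times> (tm \<Rightarrow> tm) \<times> (tm \<Rightarrow> tm \<Rightarrow> tm) \<times> (tm \<Rightarrow> tm \<Rightarrow> tm)" where
  "the_struct = (if Collect bad_model = {}
     then let n = (\<lambda>t. THE i. t = Bound i) in
       (range Bound, Bound 0, \<lambda>t. Bound (Suc (n t)), \<lambda>s t. Bound (n s + n t), \<lambda>s t. Bound (n s * n t))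
     else case SOME M. bad_model M of (D, ap, fv, cs, lt) \<Rightarrow>
       (D N, cs Zero, \<lambda>x. ap (cs Succ) x, \<lambda>x y. ap (ap (cs Plus) x) y, \<lambda>x y. ap (ap (cs Times) x) y))"

definition "sC = fst the_struct"
definition "sZ = fst (snd the_struct)"
definition "sS = fst (snd (snd the_struct))"
definition "sP = fst (snd (snd (snd the_struct)))"
definition "sT = snd (snd (snd (snd the_struct)))"

lemma num_struct_the: "num_struct sC sZ sS sP sT"
proof (cases "Collect bad_model = {}")
  case True
  have "\<exists>k. (b::nat) = a + k \<or> a = b + k" for a b by presburger
  then have l: "(\<exists>k. (b::nat) = a + k) \<or> (\<exists>k. a = b + k)" for a b by blast
  have c: "(a::nat) = 0 \<or> (\<exists>k. a = Suc k)" for a by presburger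
  show ?thesis using True
    by (simp add: sC_def sZ_def sS_def sP_def sT_def the_struct_def num_struct_def algebra_simps l c)
next
  case False
  obtain D ap fv cs lt where M: "(SOME M. bad_model M) = (D, ap, fv, cs, lt)" by (rule prod_cases5)
  have "bad_model (D, ap, fv, cs, lt)" using False someI_ex[of bad_model] by (auto simp: M)
  then interpret model D ap fv cs lt unfolding bad_model_def by simp
  show ?thesis using False num_struct_N
    by (simp add: sC_def sZ_def sS_def sP_def sT_def the_struct_def M del: Collect_empty_eq)
qed

lemma struct_facts:
  "sZ \<in> sC" "x \<in> sC \<Longrightarrow> sS x \<in> sC" "x \<in> sC \<Longrightarrow> y \<in> sC \<Longrightarrow> sP x y \<in> sC" "x \<in> sC \<Longrightarrow> y \<in> sC \<Longrightarrow> sT x y \<in> sC"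
  "x \<in> sC \<Longrightarrow> sP sZ x = x" "x \<in> sC \<Longrightarrow> y \<in> sC \<Longrightarrow> sP x y = sP y x"
  "x \<in> sC \<Longrightarrow> y \<in> sC \<Longrightarrow> w \<in> sC \<Longrightarrow> sP (sP x y) w = sP x (sP y w)"
  "x \<in> sC \<Longrightarrow> y \<in> sC \<Longrightarrow> w \<in> sC \<Longrightarrow> sP x y = sP x w \<longleftrightarrow> y = w"
  "x \<in> sC \<Longrightarrow> sT (sS sZ) x = x" "x \<in> sC \<Longrightarrow> sT sZ x = sZ" "x \<in> sC \<Longrightarrow> y \<in> sC \<Longrightarrow> sT x y = sT y x"
  "x \<in> sC \<Longrightarrow> y \<in> sC \<Longrightarrow> w \<in> sC \<Longrightarrow> sT (sT x y) w = sT x (sT y w)"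
  "x \<in> sC \<Longrightarrow> y \<in> sC \<Longrightarrow> w \<in> sC \<Longrightarrow> sT (sP x y) w = sP (sT x w) (sT y w)"
  "x \<in> sC \<Longrightarrow> sP x (sS sZ) \<noteq> sZ" "x \<in> sC \<Longrightarrow> x = sZ \<or> (\<exists>k \<in> sC. x = sP k (sS sZ))"
  "x \<in> sC \<Longrightarrow> y \<in> sC \<Longrightarrow> (\<exists>k \<in> sC. y = sP x k) \<or> (\<exists>k \<in> sC. x = sP y k)"
  using num_struct_the unfolding num_struct_def by - (elim conjE, (blast | metis))+

typedef mnat = sC using struct_facts(1) by blast

setup_lifting type_definition_mnat

instantiation mnat :: "{comm_semiring_1, cancel_comm_monoid_add, linorder}"
begin
lift_definition zero_mnat :: mnat is sZ by (rule struct_facts | assumption)+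
lift_definition one_mnat :: mnat is "sS sZ" by (rule struct_facts | assumption)+
lift_definition plus_mnat :: "mnat \<Rightarrow> mnat \<Rightarrow> mnat" is sP by (rule struct_facts | assumption)+
lift_definition times_mnat :: "mnat \<Rightarrow> mnat \<Rightarrow> mnat" is sT by (rule struct_facts | assumption)+
definition minus_mnat :: "mnat \<Rightarrow> mnat \<Rightarrow> mnat" where "x - y = (if \<exists>k. x = y + (k::mnat) then THE k. x = y + k else 0)"
definition less_eq_mnat :: "mnat \<Rightarrow> mnat \<Rightarrow> bool" where "x \<le> y \<longleftrightarrow> (\<exists>k. y = x + (k::mnat))"
definition less_mnat :: "mnat \<Rightarrow> mnat \<Rightarrow> bool" where "x < y \<longleftrightarrow> x \<le> y \<and> x \<noteq> (y::mnat)"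

lemma mnat_axioms:
  fixes x y w :: mnat
  shows "0 + x = x" "x + y = y + x" "(x + y) + w = x + (y + w)" "x + y = x + w \<longleftrightarrow> y = w"
    "1 * x = x" "0 * x = 0" "x * y = y * x" "(x * y) * w = x * (y * w)" "(x + y) * w = x * w + y * w"
    "x + 1 \<noteq> 0" "x = 0 \<or> (\<exists>k. x = k + 1)" "(\<exists>k. y = x + k) \<or> (\<exists>k. x = y + k)"
proof -
  show "0 + x = x" by transfer (rule struct_facts)
  show "x + y = y + x" by transfer (rule struct_facts)
  show "(x + y) + w = x + (y + w)" by transfer (rule struct_facts)
  show "x + y = x + w \<longleftrightarrow> y = w" by transfer (rule struct_facts)
  show "1 * x = x" by transfer (rule struct_facts)
  show "0 * x = 0" by transfer (rule struct_facts)
  show "x * y = y * x" by transfer (rule struct_facts)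
  show "(x * y) * w = x * (y * w)" by transfer (rule struct_facts)
  show "(x + y) * w = x * w + y * w" by transfer (rule struct_facts)
  show "x + 1 \<noteq> 0" by transfer (rule struct_facts)
  show "x = 0 \<or> (\<exists>k. x = k + 1)" by transfer (use struct_facts(15) in simp)
  show "(\<exists>k. y = x + k) \<or> (\<exists>k. x = y + k)" by transfer (use struct_facts(16) in simp)
qed

lemma mnat_add_eq_0: "x + y = 0 \<Longrightarrow> y = (0::mnat)"
  using mnat_axioms(3,10,11) by metis

lemma mnat_diff: "(x + y) - x = (y::mnat)"
  unfolding minus_mnat_def using mnat_axioms(4) by auto

lemma mnat_zero_diff: "(0::mnat) - w = 0"
proof (cases "w = 0")
  case True
  then show ?thesis using mnat_diff[of 0 0] mnat_axioms(1)[of 0] by simp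
next
  case False
  then have "\<not> (\<exists>k. 0 = w + k)" using mnat_add_eq_0[of _ w] mnat_axioms(2)[of w] by metis
  then show ?thesis by (simp add: minus_mnat_def)
qed

lemma mnat_antisym: "x \<le> y \<Longrightarrow> y \<le> x \<Longrightarrow> x = (y::mnat)"
proof -
  assume "x \<le> y" "y \<le> x"
  then obtain k l where k: "y = x + k" "x = y + l" by (auto simp: less_eq_mnat_def)
  have "x + (k + l) = (x + k) + l" by (rule mnat_axioms(3)[symmetric])
  also have "\<dots> = y + l" by (simp only: k(1))
  also have "\<dots> = 0 + x" by (simp only: k(2)[symmetric] mnat_axioms(1))
  also have "\<dots> = x + 0" by (rule mnat_axioms(2))
  finally have "k + l = 0" by (simp only: mnat_axioms(4))
  then have "l = 0" by (rule mnat_add_eq_0)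
  then have "x = y + 0" using k(2) by (simp only:)
  also have "\<dots> = 0 + y" by (rule mnat_axioms(2))
  finally show "x = y" by (simp only: mnat_axioms(1))
qed

instance
proof
  fix x y w :: mnat
  show "x + y - x = y" by (rule mnat_diff)
  show "x - y - w = x - (y + w)"
  proof (cases "\<exists>k. x = y + w + k")
    case True
    then obtain k where k: "x = y + w + k" by blast
    then show ?thesis using mnat_diff[of y "w + k"] by (simp add: mnat_diff mnat_axioms(3)[symmetric])
  next
    case False
    then have n: "x - (y + w) = 0" by (simp add: minus_mnat_def)
    show ?thesis
    proof (cases "\<exists>k. x = y + k")
      case True
      then obtain k where k: "x = y + k" by blast
      then have "\<not> (\<exists>l. k = w + l)" using False mnat_axioms(3) by metis
      then show ?thesis using n k mnat_diff by (simp add: minus_mnat_def)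
    next
      case F2: False
      then have "x - y = 0" by (simp add: minus_mnat_def)
      moreover have "(0::mnat) - w = 0" by (rule mnat_zero_diff)
      ultimately show ?thesis using n by simp
    qed
  qed
  show "(x < y) = (x \<le> y \<and> \<not> y \<le> x)"
    unfolding less_mnat_def using mnat_antisym mnat_axioms(12)[of y x] by (auto simp: less_eq_mnat_def)
  show "x \<le> x" unfolding less_eq_mnat_def using mnat_axioms(1,2) by metis
  show "x \<le> y \<Longrightarrow> y \<le> w \<Longrightarrow> x \<le> w" unfolding less_eq_mnat_def using mnat_axioms(3) by metis
  show "x \<le> y \<Longrightarrow> y \<le> x \<Longrightarrow> x = y" by (rule mnat_antisym)
  show "x \<le> y \<or> y \<le> x" unfolding less_eq_mnat_def by (rule mnat_axioms)
  show "0 \<noteq> (1::mnat)" using mnat_axioms(1,10) by metis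
  show "x * 0 = 0" by (simp only: mnat_axioms(7)[of x 0] mnat_axioms(6))
qed (fact mnat_axioms)+

end

instance mnat :: discrete_linordered_semidom
proof
  fix x y w :: mnat
  have nz: "x * y \<noteq> 0" if x: "x \<noteq> 0" and y: "y \<noteq> 0" for x y :: mnat
  proof -
    obtain a b where "x = a + 1" "y = b + 1" using x y mnat_axioms(11)[of x] mnat_axioms(11)[of y] by blast
    then have "x * y = (a * y + b) + 1" by (simp add: distrib_left distrib_right add_ac)
    then show ?thesis using mnat_axioms(10)[of "a * y + b"] by simp
  qed
  show "x \<noteq> 0 \<Longrightarrow> y \<noteq> 0 \<Longrightarrow> x * y \<noteq> 0" by (rule nz)
  show "0 < (1::mnat)" unfolding less_mnat_def less_eq_mnat_def by (metis add_0 zero_neq_one)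
  show "x \<le> y \<Longrightarrow> w + x \<le> w + y" unfolding less_eq_mnat_def by (metis add.assoc)
  show "w * (x - y) = w * x - w * y"
  proof (cases "y \<le> x")
    case True
    then obtain k where k: "x = y + k" by (auto simp: less_eq_mnat_def)
    then show ?thesis by (simp add: distrib_left)
  next
    case False
    then have *: "x - y = 0" by (simp add: minus_mnat_def less_eq_mnat_def)
    from False obtain k where "y = x + k" using linear[of x y] by (auto simp: less_eq_mnat_def)
    then have "w * x - w * y = 0 - w * k" by (simp add: distrib_left diff_diff_add[symmetric])
    then show ?thesis using * mnat_zero_diff by (simp add: mnat_axioms(7)[of w 0] mnat_axioms(6))
  qed
  show "y \<le> x \<Longrightarrow> x - y + y = x" by (auto simp: less_eq_mnat_def add.commute)
  show "x < y \<Longrightarrow> 0 < w \<Longrightarrow> w * x < w * y"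
  proof -
    assume "x < y" "0 < w"
    then obtain k where k: "y = x + k" "k \<noteq> 0" "w \<noteq> 0" by (auto simp: less_mnat_def less_eq_mnat_def)
    then have "w * y = w * x + w * k" "w * k \<noteq> 0" using nz by (auto simp: distrib_left)
    then show ?thesis unfolding less_mnat_def less_eq_mnat_def by (metis add_cancel_left_right)
  qed
  show "x < y \<longleftrightarrow> x + 1 \<le> y"
  proof
    assume "x < y"
    then obtain k where k: "y = x + k" "k \<noteq> 0" by (auto simp: less_mnat_def less_eq_mnat_def)
    then obtain l where "k = l + 1" using mnat_axioms(11) by blast
    then show "x + 1 \<le> y" using k by (auto simp: less_eq_mnat_def intro!: exI[of _ l] simp: ac_simps)
  next
    assume "x + 1 \<le> y"
    then obtain k where "y = x + (k + 1)" by (auto simp: less_eq_mnat_def ac_simps)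
    then show "x < y" unfolding less_mnat_def less_eq_mnat_def by (metis add_cancel_left_right mnat_axioms(10))
  qed
qed

text \<open>An isomorphic copy of the numbers of the model that is a type of class
  \<open>discrete_linordered_semidom\<close>. Over it the rationals \<open>'n qt\<close> and the
  reals \<open>'n creal\<close> are types as well, with the arithmetic of ordered rings.\<close>

locale nmodel = model D ap fv cs lt for D :: "ty \<Rightarrow> 'u set" and ap fv cs lt +
  fixes nu :: "'n::discrete_linordered_semidom \<Rightarrow> 'u"
  assumes bij_nu: "bij_betw nu UNIV (D N)"
    and nu_zero: "nu 0 = zr" and nu_Suc: "nu (a + 1) = sc (nu a)" and nu_add: "nu (a + b) = pl (nu a) (nu b)"
    and nu_mult: "nu (a * b) = ti (nu a) (nu b)" and nu_less: "lt (nu a) (nu b) \<longleftrightarrow> a < b"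

theorem nmodel_existence:
  assumes "\<not> (ACA0w \<turnstile> Imp Jordan HBU_bv \<and> ACA0w \<turnstile> Imp HBU_bv NIN)"
    and wf: "wf_fm [] (Imp Jordan HBU_bv)" "wf_fm [] (Imp HBU_bv NIN)"
  shows "\<exists>(D :: ty \<Rightarrow> tm set) ap fv cs lt (nu :: mnat \<Rightarrow> tm). nmodel D ap fv cs lt nu \<and>
     \<not> (frame.sat D ap fv cs lt [] (Imp Jordan HBU_bv) \<and> frame.sat D ap fv cs lt [] (Imp HBU_bv NIN))"
proof -
  have "\<exists>M. bad_model M"
  proof -
    obtain D :: "ty \<Rightarrow> tm set" and ap fv cs lt where "model D ap fv cs lt"
      "\<not> (frame.sat D ap fv cs lt [] (Imp Jordan HBU_bv) \<and> frame.sat D ap fv cs lt [] (Imp HBU_bv NIN))"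
      using assms(1) model_existence[OF _ wf(1)] model_existence[OF _ wf(2)] by meson
    then show ?thesis unfolding bad_model_def by (intro exI[of _ "(D, ap, fv, cs, lt)"]) simp
  qed
  then have b: "bad_model (SOME M. bad_model M)" "Collect bad_model \<noteq> {}" using someI_ex[of bad_model] by auto
  obtain D ap fv cs lt where M: "(SOME M. bad_model M) = (D, ap, fv, cs, lt)" by (rule prod_cases5)
  from b(1) have b': "bad_model (D, ap, fv, cs, lt)" by (simp add: M)
  then interpret model D ap fv cs lt unfolding bad_model_def by simp
  have s: "sC = D N" "sZ = zr" "sS = (\<lambda>x. sc x)" "sP = (\<lambda>x y. pl x y)" "sT = (\<lambda>x y. ti x y)"
    using b(2) by (simp_all add: sC_def sZ_def sS_def sP_def sT_def the_struct_def M del: Collect_empty_eq)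
  have "nmodel D ap fv cs lt Rep_mnat"
  proof
    show "bij_betw Rep_mnat UNIV (D N)"
      unfolding bij_betw_def using type_definition.Rep_range[OF type_definition_mnat] by (simp add: inj_def Rep_mnat_inject s(1))
    show z: "Rep_mnat 0 = zr" by (simp add: zero_mnat.rep_eq s)
    show a: "Rep_mnat (a + b) = pl (Rep_mnat a) (Rep_mnat b)" for a b by (simp add: plus_mnat.rep_eq s)
    show "Rep_mnat (a * b) = ti (Rep_mnat a) (Rep_mnat b)" for a b by (simp add: times_mnat.rep_eq s)
    have in_N: "Rep_mnat a \<in> D N" for a using Rep_mnat s by auto
    have o: "Rep_mnat 1 = sc zr" by (simp add: one_mnat.rep_eq s)
    show sc: "Rep_mnat (a + 1) = sc (Rep_mnat a)" for a using in_N by (simp add: a o PA_axioms)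
    have ab: "Rep_mnat (Abs_mnat x) = x" if "x \<in> D N" for x using Abs_mnat_inverse that s by simp
    show "lt (Rep_mnat a) (Rep_mnat b) \<longleftrightarrow> a < b" for a b
    proof -
      have "lt (Rep_mnat a) (Rep_mnat b) \<longleftrightarrow> (\<exists>k \<in> D N. Rep_mnat b = pl (Rep_mnat a) (sc k))" by (simp add: lt_iff in_N)
      also have "\<dots> \<longleftrightarrow> (\<exists>k. Rep_mnat b = Rep_mnat (a + (k + 1)))" 
      proof
        assume "\<exists>k \<in> D N. Rep_mnat b = pl (Rep_mnat a) (sc k)"
        then obtain k where "k \<in> D N" "Rep_mnat b = pl (Rep_mnat a) (sc k)" by blast
        then have "Rep_mnat b = Rep_mnat (a + (Abs_mnat k + 1))" by (simp only: a[of a] sc ab)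
        then show "\<exists>k. Rep_mnat b = Rep_mnat (a + (k + 1))" by blast
      qed (use in_N in \<open>auto simp only: a[of a] sc\<close>)
      also have "\<dots> \<longleftrightarrow> a + 1 \<le> b" unfolding Rep_mnat_inject less_eq_mnat_def by (simp add: ac_simps)
      finally show ?thesis by (simp add: less_iff_succ_less_eq)
    qed
  qed
  moreover have "\<not> (sat [] (Imp Jordan HBU_bv) \<and> sat [] (Imp HBU_bv NIN))" using b' unfolding bad_model_def prod.case by (rule conjunct2)
  ultimately show ?thesis by blast
qed

section \<open>Density of the rationals\<close>

lemma Creal_cases: obtains X where "cauchy X" "x = Creal X"
proof -
  have "\<exists>X. cauchy X \<and> x = Creal X" by (induction x rule: creal.abs_induct) auto
  then show ?thesis using that by blast
qed

lemma creal_dense: fixes x y :: "'a::linordered_semidom creal" assumes "x < y" shows "\<exists>q. x < rq q \<and> rq q < y"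
proof -
  obtain X where X: "cauchy X" "x = Creal X" by (rule Creal_cases)
  obtain Y where Y: "cauchy Y" "y = Creal Y" by (rule Creal_cases)
  obtain r where r: "r > 0" "\<forall>\<^sub>F n in at_top. X n + r < Y n" using assms X Y Creal_less by blast
  \<comment> \<open>From \<open>k\<close> on, \<open>X\<close> stays within \<open>s\<close> of
    \<open>X k\<close>. So \<open>X k + (s + s)\<close> lies at least \<open>s\<close> above the
    tail of \<open>X\<close>, and it lies at least \<open>s\<close> below the tail of
    \<open>Y\<close>, which eventually exceeds \<open>X\<close> by \<open>4 * s\<close>.\<close>
  define s where "s = r / 4"
  have s: "s > 0" "r = s + s + s + s" using r(1) by (auto simp: s_def)
  obtain k where k: "\<And>m. m \<ge> k \<Longrightarrow> \<bar>X m - X k\<bar> < s" using X(1) s(1) unfolding cauchy_def by (metis order_refl)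
  have e: "\<forall>\<^sub>F n in at_top. n \<ge> k" by (rule eventually_ge_at_top)
  have "\<forall>\<^sub>F n in at_top. X n + s < X k + (s + s)"
    using e
  proof eventually_elim
    case (elim n)
    then show ?case using k[of n] by (simp add: abs_less_iff algebra_simps)
  qed
  then have "x < rq (X k + (s + s))" unfolding X(2) rq_def using Creal_less[OF X(1) cauchy_const] s(1) by blast
  moreover have "\<forall>\<^sub>F n in at_top. X k + (s + s) + s < Y n"
    using e r(2)
  proof eventually_elim
    case (elim n)
    then have "X k < s + X n" using k[of n] by (simp add: abs_less_iff algebra_simps)
    then have "X k + (s + s) + s < s + X n + (s + s) + s" by simp
    also have "\<dots> = X n + r" by (simp add: s(2))
    finally show ?case using elim by simp
  qed
  then have "rq (X k + (s + s)) < y" unfolding Y(2) rq_def using Creal_less[OF cauchy_const Y(1)] s(1) by blast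
  ultimately show ?thesis by blast
qed

section \<open>Numbers, rationals and reals of a model\<close>

context nmodel
begin

definition num :: "'u \<Rightarrow> 'n" where "num u = inv_into UNIV nu u"

lemma num_nu [simp]: "num (nu n) = n" using bij_nu unfolding num_def bij_betw_def by (simp add: inv_f_f)
lemma nu_num: "u \<in> D N \<Longrightarrow> nu (num u) = u" using bij_nu unfolding num_def bij_betw_def by (simp add: f_inv_into_f)
lemma nu_N [simp]: "nu n \<in> D N" using bij_nu by (auto simp: bij_betw_def)
lemma nu_inj [simp]: "nu m = nu n \<longleftrightarrow> m = n" by (metis num_nu)
lemma ball_N: "(\<forall>v \<in> D N. P v) \<longleftrightarrow> (\<forall>n. P (nu n))" by (metis nu_N nu_num)
lemma bex_N: "(\<exists>v \<in> D N. P v) \<longleftrightarrow> (\<exists>n. P (nu n))" by (metis nu_N nu_num)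
lemma nu_one: "nu 1 = sc zr" using nu_Suc[of 0] nu_zero by simp

lemma less_Suc: "x < y + 1 \<longleftrightarrow> x \<le> (y::'n)"
  using less_iff_succ_less_eq[of x "y + 1"] by simp
lemma nonneg [simp]: "0 \<le> (n::'n)"
proof -
  have "\<not> lt (nu n) zr" by (simp add: PA_axioms)
  then show ?thesis using nu_less[of n 0] nu_zero by simp
qed
lemma pos_Suc [simp]: "0 < (n::'n) + 1" by (simp add: less_Suc)
lemma pos_iff: "0 < (n::'n) \<longleftrightarrow> n \<noteq> 0" by (simp add: less_le)
lemma le_ex: "(m::'n) \<le> n \<longleftrightarrow> (\<exists>k. n = m + k)"
  by (metis le_add_diff_inverse le_add_same_cancel1 nonneg)

definition intln :: "ty list \<Rightarrow> ('u list \<Rightarrow> 'n) \<Rightarrow> bool" where "intln \<Delta> F \<longleftrightarrow> intl \<Delta> N (\<lambda>\<rho>. nu (F \<rho>))"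

definition sq :: "'u \<Rightarrow> 'n \<Rightarrow> 'n" where "sq x n = num (ap x (nu n))"

lemma nu_sq: "x \<in> D one \<Longrightarrow> nu (sq x n) = ap x (nu n)" unfolding sq_def by (rule nu_num) (auto intro: ap_closed)

lemma intln_num: "intl \<Delta> N F \<Longrightarrow> intln \<Delta> (\<lambda>\<rho>. num (F \<rho>))"
  unfolding intln_def by (subst intl_cong[of \<Delta> _ F]) (auto intro: nu_num intl_closed)
lemma intln_const: "intln \<Delta> (\<lambda>_. c)" unfolding intln_def by (rule intl_const) simp
lemma intln_add: "intln \<Delta> F \<Longrightarrow> intln \<Delta> G \<Longrightarrow> intln \<Delta> (\<lambda>\<rho>. F \<rho> + G \<rho>)"
  unfolding intln_def nu_add by (rule intl_rules | assumption)+
lemma intln_mult: "intln \<Delta> F \<Longrightarrow> intln \<Delta> G \<Longrightarrow> intln \<Delta> (\<lambda>\<rho>. F \<rho> * G \<rho>)"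
  unfolding intln_def nu_mult by (rule intl_rules | assumption)+
lemma intln_sq: "intl \<Delta> one X \<Longrightarrow> intln \<Delta> F \<Longrightarrow> intln \<Delta> (\<lambda>\<rho>. sq (X \<rho>) (F \<rho>))"
  unfolding sq_def by (rule intln_num) (unfold intln_def, rule intl_ap)
lemma intl_nu: "intln \<Delta> F \<Longrightarrow> intl \<Delta> N (\<lambda>\<rho>. nu (F \<rho>))" by (simp add: intln_def)

lemma dec_eqn: "intln \<Delta> F \<Longrightarrow> intln \<Delta> G \<Longrightarrow> dec \<Delta> (\<lambda>\<rho>. F \<rho> = G \<rho>)"
  unfolding intln_def using dec_eq by fastforce
lemma dec_lessn: "intln \<Delta> F \<Longrightarrow> intln \<Delta> G \<Longrightarrow> dec \<Delta> (\<lambda>\<rho>. F \<rho> < G \<rho>)"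
  unfolding intln_def using dec_less[of \<Delta> "\<lambda>\<rho>. nu (F \<rho>)" "\<lambda>\<rho>. nu (G \<rho>)"] by (simp add: nu_less)
lemma dec_len: "intln \<Delta> F \<Longrightarrow> intln \<Delta> G \<Longrightarrow> dec \<Delta> (\<lambda>\<rho>. F \<rho> \<le> G \<rho>)"
  unfolding not_less[symmetric] by (intro dec_not dec_lessn)

lemma dec_exn: assumes "dec (N # \<Delta>) (\<lambda>\<rho>. P (num (hd \<rho>)) (tl \<rho>))" shows "dec \<Delta> (\<lambda>\<rho>. \<exists>n. P n \<rho>)"
  using dec_ex[of \<Delta> "\<lambda>x. P (num x)", OF assms] by (simp add: bex_N)
lemma dec_alln: assumes "dec (N # \<Delta>) (\<lambda>\<rho>. P (num (hd \<rho>)) (tl \<rho>))" shows "dec \<Delta> (\<lambda>\<rho>. \<forall>n. P n \<rho>)"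
  using dec_all[of \<Delta> "\<lambda>x. P (num x)", OF assms] by (simp add: ball_N)

lemma ind: assumes "dec [N] (\<lambda>\<rho>. P (num (hd \<rho>)))" "P 0" "\<And>n. P n \<Longrightarrow> P (n + 1)" shows "P (n::'n)"
proof -
  have st: "P (num (sc u))" if "u \<in> D N" "P (num u)" for u
    using assms(3)[OF that(2)] num_nu[of "num u + 1"] by (simp add: nu_Suc nu_num[OF that(1)])
  have b: "P (num zr)" using assms(2) num_nu[of 0] unfolding nu_zero by simp
  have "P (num (nu n))" by (rule dec_induct[of "\<lambda>u. P (num u)", OF assms(1) b st nu_N])
  then show ?thesis by simp
qed

lemma choice: assumes "dec (N # \<Delta>) (\<lambda>\<rho>. P (num (hd \<rho>)) (tl \<rho>))"
  shows "\<exists>F. intln \<Delta> F \<and> (\<forall>\<rho> \<in> envs \<Delta>. (\<exists>n. P n \<rho>) \<longrightarrow> P (F \<rho>) \<rho>)"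
proof -
  obtain F where F: "intl \<Delta> N F" "\<forall>\<rho> \<in> envs \<Delta>. (\<exists>n \<in> D N. P (num n) \<rho>) \<longrightarrow> P (num (F \<rho>)) \<rho>"
    using dec_choice[of \<Delta> "\<lambda>x. P (num x)", OF assms] by blast
  then show ?thesis using intln_num[OF F(1)] by (intro exI[of _ "\<lambda>\<rho>. num (F \<rho>)"]) (simp add: bex_N)
qed

lemma choice1: assumes "dec [N, N] (\<lambda>\<rho>. P (num (hd (tl \<rho>))) (num (hd \<rho>)))" "\<And>i. \<exists>m. P i m"
  shows "\<exists>f \<in> D one. \<forall>i. P i (sq f i)"
proof -
  obtain F where F: "intln [N] F" "\<forall>\<rho> \<in> envs [N]. (\<exists>n. P (num (hd \<rho>)) n) \<longrightarrow> P (num (hd \<rho>)) (F \<rho>)"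
    using choice[of "[N]" "\<lambda>n \<rho>. P (num (hd \<rho>)) n", OF assms(1)] by blast
  let ?G = "\<lambda>u. nu (F [u])"
  have G: "intl [N] N (\<lambda>\<rho>. ?G (hd \<rho>))"
    by (rule intl_cong[THEN iffD1, OF _ F(1)[unfolded intln_def]]) (auto simp: envs_Cons)
  have "P i (sq (lam N N ?G) i)" for i
    using F(2)[rule_format, of "[nu i]"] lam1(2)[OF G, of "nu i"] assms(2)[of i] by (simp add: sq_def)
  then show ?thesis using lam1(1)[OF G] by blast
qed

text \<open>The form of choice that yields a sequence of reals, with \<open>n\<close> as the index
  of the approximation, or a doubly indexed family of summands.\<close>

lemma choice2: assumes "dec [N, N, N] (\<lambda>\<rho>. P (num (hd (tl (tl \<rho>)))) (num (hd (tl \<rho>))) (num (hd \<rho>)))" "\<And>i n. \<exists>m. P i n m"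
  shows "\<exists>f \<in> D (N \<^bold>\<rightarrow> one). \<forall>i n. P i n (sq (ap f (nu i)) n)"
proof -
  obtain F where F: "intln [N, N] F" "\<forall>\<rho> \<in> envs [N, N]. (\<exists>n. P (num (hd (tl \<rho>))) (num (hd \<rho>)) n) \<longrightarrow> P (num (hd (tl \<rho>))) (num (hd \<rho>)) (F \<rho>)"
    using choice[of "[N, N]" "\<lambda>n \<rho>. P (num (hd (tl \<rho>))) (num (hd \<rho>)) n", OF assms(1)] by blast
  let ?G = "\<lambda>u \<rho>. nu (F (u # \<rho>))"
  have G: "intl [N, N] N (\<lambda>\<rho>. ?G (hd \<rho>) (tl \<rho>))"
    by (rule intl_cong[THEN iffD1, OF _ F(1)[unfolded intln_def]]) (auto simp: envs_Cons)
  let ?H = "\<lambda>v. lam N N (\<lambda>u. ?G u [v])"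
  have H: "intl [N] one (\<lambda>\<rho>. ?H (hd \<rho>))"
    by (rule intl_cong[THEN iffD1, OF _ intl_lam[OF G]]) (auto simp: envs_Cons)
  have "P i n (sq (ap (lam N one ?H) (nu i)) n)" for i n
    using F(2)[rule_format, of "[nu n, nu i]"] lam1(2)[OF H, of "nu i"] ap_lam[OF G, of "[nu i]" "nu n"] assms(2)[of i n]
    by (simp add: sq_def)
  then show ?thesis using lam1(1)[OF H] by blast
qed

text \<open>Literally the step function that \<open>ppow2\<close> hands to the recursor. Hence
  \<open>p2\<close> is the power of two as the model computes it, for nonstandard exponents
  too.\<close>

definition dbl :: 'u where
  "dbl = ap (cs (PiC one N)) (ap (ap (cs (SigmaC N N N)) (cs Plus)) (ap (ap (cs (SigmaC N one N)) (cs (PiC N one))) (cs (PiC N N))))"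
definition p2 :: "'n \<Rightarrow> 'n" where "p2 n = num (ap (ap (ap (cs Rec0) dbl) (sc zr)) (nu n))"

lemma dbl: "dbl \<in> D (N \<^bold>\<rightarrow> N \<^bold>\<rightarrow> N)" "i \<in> D N \<Longrightarrow> r \<in> D N \<Longrightarrow> ap (ap dbl i) r = pl r r"
proof -
  let ?I = "ap (ap (cs (SigmaC N one N)) (cs (PiC N one))) (cs (PiC N N))"
  let ?f = "ap (ap (cs (SigmaC N N N)) (cs Plus)) ?I"
  have I: "?I \<in> D one" by (meson ap_closed cs_types)
  then have f: "?f \<in> D one" by (meson ap_closed cs_types)
  then show "dbl \<in> D (N \<^bold>\<rightarrow> N \<^bold>\<rightarrow> N)" unfolding dbl_def by (meson ap_closed cs_types)
  assume *: "i \<in> D N" "r \<in> D N"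
  have "ap ?I r = r"
  proof -
    have "ap (cs (PiC N N)) r \<in> D one" using * by (meson ap_closed cs_types)
    then show ?thesis using * by (simp add: Sigma_ap cs_types Pi_ap)
  qed
  then have "ap ?f r = pl r r" using * I by (simp add: Sigma_ap cs_types)
  then show "ap (ap dbl i) r = pl r r" unfolding dbl_def using * f by (simp add: Pi_ap)
qed

lemma nu_p2: "nu (p2 n) = ap (ap (ap (cs Rec0) dbl) (sc zr)) (nu n)"
  unfolding p2_def by (rule nu_num) (meson ap_closed cs_types dbl(1) N_closed nu_N)

lemma E_ppow2: "E vs t = nu n \<Longrightarrow> E vs (ppow2 t) = nu (p2 n)"
  by (simp add: ppow2_def nu_p2 E_app E_const E_simps dbl_def)

lemma p2_0 [simp]: "p2 0 = 1"
  using Rec_axioms(1)[OF dbl(1), of "sc zr"] nu_p2[of 0] by (simp add: nu_zero nu_one[symmetric])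
lemma p2_Suc [simp]: "p2 (n + 1) = p2 n + p2 n"
proof -
  have "nu (p2 (n + 1)) = ap (ap dbl (nu n)) (nu (p2 n))"
    unfolding nu_p2 nu_Suc by (rule Rec_axioms(2)[OF dbl(1)]) simp_all
  also have "\<dots> = pl (nu (p2 n)) (nu (p2 n))" by (rule dbl(2)) simp_all
  also have "\<dots> = nu (p2 n + p2 n)" by (simp only: nu_add)
  finally show ?thesis by simp
qed

lemma intln_p2: "intln \<Delta> F \<Longrightarrow> intln \<Delta> (\<lambda>\<rho>. p2 (F \<rho>))"
  unfolding intln_def nu_p2 by (rule intl_rules dbl(1) N_closed | assumption)+

lemmas N_rules = intln_add intln_mult intln_p2 intln_sq intln_num intln_const
lemmas dec_intros = dec_imp dec_not dec_conj dec_disj dec_iff dec_exn dec_alln dec_lessn dec_len dec_eqn N_rules intl_rules intl_nu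

lemma less_p2: "n < p2 n"
proof (rule ind[where P = "\<lambda>n. n < p2 n"])
  fix n assume "n < p2 n"
  then have "n + 1 \<le> p2 n" "0 < p2 n" by (simp_all only: less_iff_succ_less_eq[symmetric] le_less_trans[OF nonneg])
  then show "n + 1 < p2 (n + 1)" using add_less_le_mono[of 0 "p2 n" "n + 1" "p2 n"] by simp
qed ((rule dec_intros)+ | simp)+

lemma p2_pos [simp]: "0 < p2 n" using less_p2[of n] nonneg[of n] by (rule le_less_trans[rotated])
lemma p2_nz [simp]: "p2 n \<noteq> 0" using p2_pos[of n] by (simp only: pos_iff not_False_eq_True)

lemma p2_add: "p2 (m + n) = p2 m * p2 n"
  by (rule ind[where P = "\<lambda>n. p2 (m + n) = p2 m * p2 n"]) ((rule dec_intros)+ | simp add: add.assoc[symmetric] distrib_left)+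

lemma p2_mono: "m \<le> n \<Longrightarrow> p2 m \<le> p2 n"
proof -
  assume "m \<le> n"
  then obtain k where k: "n = m + k" by (auto simp: le_ex)
  have "1 \<le> p2 k" using p2_pos[of k] by (simp add: less_iff_succ_less_eq)
  then show ?thesis using mult_left_mono[of 1 "p2 k" "p2 m"] by (simp add: k p2_add)
qed

definition ip :: "'n \<Rightarrow> 'n qt" where "ip n = 1 / nq (p2 n)"

lemma ip_pos [simp]: "0 < ip n" by (simp add: ip_def)
lemma ip_Suc: "ip n = ip (n + 1) + ip (n + 1)" unfolding ip_def p2_Suc by (simp add: field_simps)
lemma ip_mono: "m \<le> n \<Longrightarrow> ip n \<le> ip m" unfolding ip_def by (simp add: frac_le p2_mono)

text \<open>A positive rational with denominator \<open>c\<close> is at least \<open>1 / c\<close>,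
  and \<open>c < p2 c\<close>. The rationals are thus archimedean relative to the numbers of the
  model.\<close>

lemma qt_arch: fixes r :: "'n qt" assumes "r > 0" shows "\<exists>n\<ge>k. ip n < r"
proof -
  obtain a b c where abc: "0 < c" "r = (nq a - nq b) / nq c" by (rule qt_cases)
  then have "b < a" using assms less_asym[of 0 "nq c"] by (auto simp: zero_less_divide_iff)
  then have "b + 1 \<le> a" by (simp only: less_iff_succ_less_eq)
  then have "nq (b + 1) \<le> nq a" by (simp only: nq_simps(6))
  then have "1 / nq c \<le> r" using abc by (simp add: divide_right_mono)
  moreover have "ip c < 1 / nq c" using abc(1) less_p2[of c] unfolding ip_def by (intro divide_strict_left_mono) auto
  moreover have "ip (max k c) \<le> ip c" by (rule ip_mono) simp
  ultimately show ?thesis by (intro exI[of _ "max k c"]) auto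
qed

lemma creal_arch: assumes "0 < (r::'n creal)" shows "\<exists>n. rq (ip n) < r"
proof -
  obtain q where "0 < rq q" "rq q < r" using creal_dense[OF assms] by auto
  moreover then have "0 < q" using rq_less[of 0 q] by simp
  then obtain n where "ip n < q" using qt_arch[of q 0] by auto
  ultimately have "rq (ip n) < r" using rq_less[of "ip n" q] less_trans by blast
  then show ?thesis by blast
qed

section \<open>Fast converging sequences: their order and arithmetic\<close>

definition fast :: "('n \<Rightarrow> 'n qt) \<Rightarrow> bool" where "fast xs \<longleftrightarrow> (\<forall>n i. \<bar>xs n - xs (n + i)\<bar> \<le> ip n)"

lemma fastD: "fast xs \<Longrightarrow> n \<le> m \<Longrightarrow> \<bar>xs n - xs m\<bar> \<le> ip n" by (auto simp: fast_def le_ex)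

lemma fast_cauchy: assumes "fast xs" shows "cauchy xs"
  unfolding cauchy_def
proof safe
  fix r :: "'n qt" assume "0 < r"
  then have "0 < r / 2" by simp
  then obtain n where n: "ip n < r / 2" using qt_arch[of "r / 2" 0] by auto
  show "\<exists>k. \<forall>m\<ge>k. \<forall>n\<ge>k. \<bar>xs m - xs n\<bar> < r"
  proof (intro exI[of _ n] allI impI)
    fix m l assume "n \<le> m" "n \<le> l"
    then have "\<bar>xs n - xs m\<bar> \<le> ip n" "\<bar>xs n - xs l\<bar> \<le> ip n" using assms fastD by auto
    then have "xs m - xs l \<le> ip n + ip n" "xs l - xs m \<le> ip n + ip n" by (auto simp: abs_le_iff algebra_simps)
    moreover have "ip n + ip n < r" using n by (simp add: field_simps)
    ultimately show "\<bar>xs m - xs l\<bar> < r" by (simp add: abs_less_iff)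
  qed
qed

text \<open>After the index \<open>n\<close> each sequence moves by at most \<open>ip n\<close>, so
  a gap beyond \<open>ip n + ip n\<close> at a single index never closes. Conversely, an eventual
  gap \<open>r\<close> exceeds \<open>ip n + ip n\<close> for large \<open>n\<close>.\<close>

lemma fast_less: assumes "fast xs" "fast ys" shows "(\<exists>n. xs n + (ip n + ip n) < ys n) \<longleftrightarrow> Creal xs < Creal ys"
proof
  assume "\<exists>n. xs n + (ip n + ip n) < ys n"
  then obtain n where n: "xs n + (ip n + ip n) < ys n" by blast
  \<comment> \<open>Half of the excess of the gap; it survives at all later indices.\<close>
  define r where "r = (ys n - xs n - (ip n + ip n)) / 2"
  have r: "r > 0" "ys n = xs n + (ip n + ip n) + (r + r)" using n by (auto simp: r_def field_simps)
  have "xs m + r < ys m" if "m \<ge> n" for m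
  proof -
    have "\<bar>xs n - xs m\<bar> \<le> ip n" "\<bar>ys n - ys m\<bar> \<le> ip n" using assms fastD that by auto
    then have "xs m \<le> xs n + ip n" "ys n \<le> ys m + ip n" by (auto simp: abs_le_iff algebra_simps)
    then show ?thesis using r by simp
  qed
  then show "Creal xs < Creal ys" using r(1) Creal_less[OF assms[THEN fast_cauchy]] unfolding eventually_at_top_linorder by blast
next
  assume "Creal xs < Creal ys"
  then obtain r k where r: "r > 0" "\<And>n. n \<ge> k \<Longrightarrow> xs n + r < ys n"
    using Creal_less[OF assms[THEN fast_cauchy]] unfolding eventually_at_top_linorder by blast
  then obtain n where n: "n \<ge> k" "ip n < r / 2" using qt_arch[of "r / 2" k] by auto
  then have "ip n + ip n < r" by (simp add: field_simps)
  then show "\<exists>n. xs n + (ip n + ip n) < ys n" using r(2)[OF n(1)] by (intro exI[of _ n]) simp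
qed

lemma fast_eq: assumes "fast xs" "fast ys" shows "(\<forall>n. \<bar>xs n - ys n\<bar> \<le> ip n + ip n) \<longleftrightarrow> Creal xs = Creal ys"
proof -
  have "(\<forall>n. \<bar>xs n - ys n\<bar> \<le> ip n + ip n) \<longleftrightarrow> \<not> (\<exists>n. xs n + (ip n + ip n) < ys n) \<and> \<not> (\<exists>n. ys n + (ip n + ip n) < xs n)"
    by (auto simp: abs_le_iff not_less algebra_simps)
  also have "\<dots> \<longleftrightarrow> \<not> Creal xs < Creal ys \<and> \<not> Creal ys < Creal xs"
    unfolding fast_less[OF assms] fast_less[OF assms(2,1)] ..
  finally show ?thesis by auto
qed

text \<open>The expressions \<open>real_add\<close> and \<open>real_sub\<close> read their arguments
  one index later, so that two errors \<open>ip (n + 1)\<close> add up to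
  \<open>ip n\<close>.\<close>

lemma fast_shift: assumes "fast xs" shows "fast (\<lambda>n. xs (n + 1))" "Creal (\<lambda>n. xs (n + 1)) = Creal xs"
proof -
  show f: "fast (\<lambda>n. xs (n + 1))"
    unfolding fast_def
  proof (intro allI)
    fix n i
    have "\<bar>xs (n + 1) - xs (n + i + 1)\<bar> \<le> ip (n + 1)" using fastD[OF assms, of "n + 1" "n + i + 1"] by simp
    also have "\<dots> \<le> ip n" by (rule ip_mono) simp
    finally show "\<bar>xs (n + 1) - xs (n + i + 1)\<bar> \<le> ip n" .
  qed
  have "\<bar>xs (n + 1) - xs n\<bar> \<le> ip n + ip n" for n
    using fastD[OF assms, of n "n + 1"] ip_pos[of n] by (simp add: abs_minus_commute)
  then show "Creal (\<lambda>n. xs (n + 1)) = Creal xs" using fast_eq[OF f assms] by blast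
qed

lemma fast_add: assumes "fast xs" "fast ys"
  shows "fast (\<lambda>n. xs (n + 1) + ys (n + 1))" "Creal (\<lambda>n. xs (n + 1) + ys (n + 1)) = Creal xs + Creal ys"
proof -
  show "fast (\<lambda>n. xs (n + 1) + ys (n + 1))" unfolding fast_def
  proof (intro allI)
    fix n i
    have "\<bar>xs (n + 1) - xs (n + i + 1)\<bar> \<le> ip (n + 1)" "\<bar>ys (n + 1) - ys (n + i + 1)\<bar> \<le> ip (n + 1)"
      using fastD[of _ "n + 1" "n + i + 1"] assms by simp_all
    then show "\<bar>xs (n + 1) + ys (n + 1) - (xs (n + i + 1) + ys (n + i + 1))\<bar> \<le> ip n"
      using ip_Suc[of n] by (simp add: abs_le_iff)
  qed
  show "Creal (\<lambda>n. xs (n + 1) + ys (n + 1)) = Creal xs + Creal ys"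
    using Creal_simps(1)[OF fast_cauchy fast_cauchy, OF fast_shift(1) fast_shift(1), OF assms] fast_shift(2) assms by simp
qed

lemma fast_minus: assumes "fast xs" shows "fast (\<lambda>n. - xs n)" "Creal (\<lambda>n. - xs n) = - Creal xs"
  using assms Creal_simps(2)[OF fast_cauchy[OF assms] fast_cauchy[OF assms]] by (auto simp: fast_def abs_minus_commute)

lemma fast_sub: assumes "fast xs" "fast ys"
  shows "fast (\<lambda>n. xs (n + 1) - ys (n + 1))" "Creal (\<lambda>n. xs (n + 1) - ys (n + 1)) = Creal xs - Creal ys"
  using fast_add[OF assms(1) fast_minus(1)[OF assms(2)]] fast_minus(2)[OF assms(2)] by simp_all

lemma fast_abs: assumes "fast xs" shows "fast (\<lambda>n. \<bar>xs n\<bar>)" "Creal (\<lambda>n. \<bar>xs n\<bar>) = \<bar>Creal xs\<bar>"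
proof -
  show f: "fast (\<lambda>n. \<bar>xs n\<bar>)" unfolding fast_def
    using assms[unfolded fast_def] abs_triangle_ineq3 order_trans by blast
  have c: "0 \<le> Creal xs \<Longrightarrow> Creal (\<lambda>n. \<bar>xs n\<bar>) = Creal xs" if xs: "fast xs" and f: "fast (\<lambda>n. \<bar>xs n\<bar>)" for xs
  proof (rule antisym; rule ccontr)
    assume "0 \<le> Creal xs" and "\<not> Creal (\<lambda>n. \<bar>xs n\<bar>) \<le> Creal xs"
    then obtain r where r: "r > 0" "\<forall>\<^sub>F n in at_top. xs n + r < \<bar>xs n\<bar>"
      using Creal_less[OF fast_cauchy[OF xs] fast_cauchy[OF f]] by (auto simp: not_le)
    from r(2) have "\<forall>\<^sub>F n in at_top. xs n + r / 2 < 0"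
    proof eventually_elim
      case (elim n)
      then have "xs n + r < - xs n" using r(1) by (cases "xs n < 0") (auto simp: abs_if)
      then show ?case by (simp add: field_simps)
    qed
    then have "Creal xs < 0" using Creal_less[OF fast_cauchy[OF xs] cauchy_const[of 0]] half_gt_zero[OF r(1)]
      unfolding zero_creal_def by blast
    then show False using \<open>0 \<le> Creal xs\<close> by simp
  next
    assume "\<not> Creal xs \<le> Creal (\<lambda>n. \<bar>xs n\<bar>)"
    then obtain r where r: "r > 0" "\<forall>\<^sub>F n in at_top. \<bar>xs n\<bar> + r < xs n"
      using Creal_less[OF fast_cauchy[OF f] fast_cauchy[OF xs]] by (auto simp: not_le)
    from r(2) have "\<forall>\<^sub>F n::'n in at_top. False"
      by eventually_elim (use r(1) in \<open>auto simp: abs_if split: if_splits\<close>)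
    then show False by (simp add: trivial_limit_at_top_linorder)
  qed
  show "Creal (\<lambda>n. \<bar>xs n\<bar>) = \<bar>Creal xs\<bar>"
  proof (cases "0 \<le> Creal xs")
    case True then show ?thesis using c[OF assms f] by simp
  next
    case False
    then have "Creal (\<lambda>n. \<bar>- xs n\<bar>) = - Creal xs"
      using c[OF fast_minus(1)[OF assms]] f fast_minus(2)[OF assms] by simp
    then show ?thesis using False by simp
  qed
qed

lemma fast_const: "fast (\<lambda>_. q)" "Creal (\<lambda>_. q) = rq q"
  by (auto simp: fast_def rq_def less_imp_le)

end

section \<open>Semantics of the formulas about real numbers\<close>

context nmodel
begin

section \<open>Pairs of numbers and codes of rationals\<close>

definition pr :: "'n \<Rightarrow> 'n \<Rightarrow> 'n" where "pr i j = (i + j) * (i + j) + i"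

text \<open>With \<open>s = i + j\<close>, the value \<open>pr i j\<close> lies in the range from
  \<open>s * s\<close> up to, but excluding, \<open>(s + 1) * (s + 1)\<close>. These ranges are
  disjoint and increase with \<open>s\<close>.\<close>

lemma pr_less: assumes "i + j < i' + j'" shows "pr i j < pr i' j'"
proof -
  let ?s = "i + j" and ?t = "i' + j'"
  have "?s + 1 \<le> ?t" using assms by (simp only: less_iff_succ_less_eq)
  then have "(?s + 1) * (?s + 1) \<le> ?t * ?t" by (intro mult_mono) auto
  moreover have "pr i j + (?s + j + 1) = (?s + 1) * (?s + 1)" by (simp add: pr_def algebra_simps)
  moreover have "pr i j < pr i j + (?s + j + 1)" by (simp add: add_nonneg_pos)
  ultimately have "pr i j < ?t * ?t" by (simp only: less_le_trans)
  then show ?thesis unfolding pr_def[of i' j'] by (simp add: add_strict_increasing2 add.commute less_le_trans)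
qed

lemma pr_inj: "pr i j = pr i' j' \<longleftrightarrow> i = i' \<and> j = j'"
proof
  assume p: "pr i j = pr i' j'"
  then have s: "i + j = i' + j'" using pr_less[of i j i' j'] pr_less[of i' j' i j] by (metis less_irrefl linorder_less_linear)
  then have "i = i'" using p by (simp add: pr_def)
  then show "i = i' \<and> j = j'" using s by simp
qed auto

definition code :: "'n \<Rightarrow> 'n \<Rightarrow> 'n \<Rightarrow> 'n" where "code a b k = pr (pr a b) k"
definition qv :: "'n \<Rightarrow> 'n \<Rightarrow> 'n \<Rightarrow> 'n qt" where "qv a b k = (nq a - nq b) / nq (k + 1)"
definition isc :: "'n \<Rightarrow> bool" where "isc m \<longleftrightarrow> (\<exists>a b k. m = code a b k)"
text \<open>The pairing is not onto, so not every number decodes; the value is meaningful under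
  \<open>isc\<close> only.\<close>

definition dq :: "'n \<Rightarrow> 'n qt" where "dq m = (THE q. \<exists>a b k. m = code a b k \<and> q = qv a b k)"

lemma code_inj: "code a b k = code a' b' k' \<longleftrightarrow> a = a' \<and> b = b' \<and> k = k'"
  by (auto simp: code_def pr_inj)
lemma dq_code [simp]: "dq (code a b k) = qv a b k" by (auto simp: dq_def code_inj)
lemma isc_code [simp]: "isc (code a b k)" by (auto simp: isc_def)

section \<open>What number, rational and real expressions denote\<close>

definition nd :: "'u list \<Rightarrow> ptm \<Rightarrow> 'n \<Rightarrow> bool" where "nd vs t n \<longleftrightarrow> stable vs t \<and> E vs t = nu n"

lemma nd_append: "nd vs t n \<Longrightarrow> nd (vs @ ws) t n" by (simp add: nd_def stable_append stable_E)
lemma nd_simps: "nd vs \<^bold>0 0" "nd vs \<^bold>1 1" "nd vs t n \<Longrightarrow> nd vs (psuc t) (n + 1)"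
  "nd vs s m \<Longrightarrow> nd vs t n \<Longrightarrow> nd vs (s \<^bold>+ t) (m + n)" "nd vs s m \<Longrightarrow> nd vs t n \<Longrightarrow> nd vs (s \<^bold>* t) (m * n)"
  by (simp_all add: nd_def stables E_simps nu_zero nu_one nu_add nu_mult) (simp add: nu_Suc[symmetric] nu_add nu_one)
lemma nd_ppow2: "nd vs t n \<Longrightarrow> nd vs (ppow2 t) (p2 n)"
  unfolding nd_def using E_ppow2[of _ t n] by (auto simp: stable_def)
lemma nd_bv: "nd (vs @ nu n # ws) (bv (length vs)) n" "nd (vs @ [nu m, nu n]) (bv (Suc (length vs))) n"
  "nd (vs @ [nu m, nu m', nu n]) (bv (Suc (Suc (length vs)))) n"
  by (simp_all add: nd_def stable_bv E_bv nth_append)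
lemma nd_less: "nd vs s m \<Longrightarrow> nd vs t n \<Longrightarrow> V vs (s \<^bold>< t) \<longleftrightarrow> m < n"
  and nd_le: "nd vs s m \<Longrightarrow> nd vs t n \<Longrightarrow> V vs (s \<^bold>\<le> t) \<longleftrightarrow> m \<le> n"
  and nd_eq: "nd vs s m \<Longrightarrow> nd vs t n \<Longrightarrow> V vs (s \<^bold>= t) \<longleftrightarrow> m = n"
  by (auto simp: nd_def V_simps nu_less le_less)

definition rd :: "'u list \<Rightarrow> rat_tm \<Rightarrow> 'n qt \<Rightarrow> bool" where
  "rd vs = (\<lambda>(a, b, c) q. \<exists>x y z. nd vs a x \<and> nd vs b y \<and> nd vs c z \<and> 0 < z \<and> q = (nq x - nq y) / nq z)"

lemma rd_append: "rd vs r q \<Longrightarrow> rd (vs @ ws) r q"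
  unfolding rd_def using nd_append by fastforce

lemma rdE: assumes "rd vs r q"
  obtains a b c x y z where "r = (a, b, c)" "nd vs a x" "nd vs b y" "nd vs c z" "0 < z" "q = (nq x - nq y) / nq z"
  using assms unfolding rd_def by (cases r) auto

lemma rdI: "nd vs a x \<Longrightarrow> nd vs b y \<Longrightarrow> nd vs c z \<Longrightarrow> 0 < z \<Longrightarrow> q = (nq x - nq y) / nq z \<Longrightarrow> rd vs (a, b, c) q"
  unfolding rd_def by auto

lemma rd_add: assumes "rd vs r q" "rd vs r' q'" shows "rd vs (rat_add r r') (q + q')"
proof -
  obtain a b c x y z where 1: "r = (a, b, c)" "nd vs a x" "nd vs b y" "nd vs c z" "0 < z" "q = (nq x - nq y) / nq z" by (rule rdE[OF assms(1)])
  obtain a' b' c' x' y' z' where 2: "r' = (a', b', c')" "nd vs a' x'" "nd vs b' y'" "nd vs c' z'" "0 < z'" "q' = (nq x' - nq y') / nq z'" by (rule rdE[OF assms(2)])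
  show ?thesis unfolding 1(1) 2(1) rat_add_def prod.case
    by (rule rdI, (rule nd_simps 1 2)+) (use 1(5) 2(5) in \<open>auto simp: 1(6) 2(6) field_simps\<close>)
qed

lemma rd_sub: assumes "rd vs r q" "rd vs r' q'" shows "rd vs (rat_sub r r') (q - q')"
proof -
  obtain a' b' c' x' y' z' where 2: "r' = (a', b', c')" "nd vs a' x'" "nd vs b' y'" "nd vs c' z'" "0 < z'" "q' = (nq x' - nq y') / nq z'" by (rule rdE[OF assms(2)])
  have "rd vs (b', a', c') (- q')" by (rule rdI[OF 2(3,2,4,5)]) (simp add: 2(6) minus_divide_left)
  then show ?thesis using rd_add[OF assms(1), of "(b', a', c')" "- q'"] by (simp add: rat_sub_def 2(1))
qed

lemma frac_less_iff: assumes "0 < (z::'n)" "0 < z'"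
  shows "(nq x - nq y) / nq z < (nq x' - nq y') / nq z' \<longleftrightarrow> x * z' + y' * z < x' * z + y * z'"
proof -
  have "(nq x - nq y) / nq z < (nq x' - nq y') / nq z' \<longleftrightarrow> nq (x * z' + y' * z) < nq (x' * z + y * z')"
  proof -
    have z: "0 < nq z" "0 < nq z'" using assms by simp_all
    have "(nq x - nq y) / nq z < (nq x' - nq y') / nq z' \<longleftrightarrow> (nq x - nq y) * nq z' < (nq x' - nq y') * nq z"
      by (simp only: pos_divide_less_eq[OF z(1)] times_divide_eq_left pos_less_divide_eq[OF z(2)])
    also have "\<dots> \<longleftrightarrow> nq (x * z' + y' * z) < nq (x' * z + y * z')" by (simp only: nq_simps(3,4)) (simp add: algebra_simps)
    finally show ?thesis .
  qed
  then show ?thesis by (simp only: nq_simps(7))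
qed

lemma V_rat_less: assumes "rd vs r q" "rd vs r' q'" shows "V vs (rat_less r r') \<longleftrightarrow> q < q'"
  and V_rat_le: "V vs (rat_le r r') \<longleftrightarrow> q \<le> q'"
proof -
  obtain a b c x y z where 1: "r = (a, b, c)" "nd vs a x" "nd vs b y" "nd vs c z" "0 < z" "q = (nq x - nq y) / nq z" by (rule rdE[OF assms(1)])
  obtain a' b' c' x' y' z' where 2: "r' = (a', b', c')" "nd vs a' x'" "nd vs b' y'" "nd vs c' z'" "0 < z'" "q' = (nq x' - nq y') / nq z'" by (rule rdE[OF assms(2)])
  show "V vs (rat_less r r') \<longleftrightarrow> q < q'"
    unfolding 1(1) 2(1) rat_less_def prod.case 1(6) 2(6) frac_less_iff[OF 1(5) 2(5)]
    by (rule nd_less; (rule nd_simps 1 2)+)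
  have "V vs (rat_le r r') \<longleftrightarrow> x * z' + y' * z \<le> x' * z + y * z'"
    unfolding 1(1) 2(1) rat_le_def prod.case by (rule nd_le; (rule nd_simps 1 2)+)
  also have "\<dots> \<longleftrightarrow> \<not> q' < q"
    unfolding 1(6) 2(6) frac_less_iff[OF 2(5) 1(5)] by (simp add: not_less add.commute)
  finally show "V vs (rat_le r r') \<longleftrightarrow> q \<le> q'" by (simp add: not_less)
qed

lemma V_with_abs: assumes "rd vs r q" "\<And>s. rd vs s \<bar>q\<bar> \<Longrightarrow> V vs (A s) = P" shows "V vs (with_abs r A) = P"
proof -
  obtain a b c x y z where 1: "r = (a, b, c)" "nd vs a x" "nd vs b y" "nd vs c z" "0 < z" "q = (nq x - nq y) / nq z" by (rule rdE[OF assms(1)])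
  show ?thesis
  proof (cases "y \<le> x")
    case True
    then have "\<bar>q\<bar> = q" using 1(5) by (simp add: 1(6))
    then have "V vs (A (a, b, c)) = P" "\<not> x < y" using assms True by (simp_all add: 1(1) not_less)
    then show ?thesis using True unfolding 1(1) with_abs_def by (auto simp add: V_simps(3,4) nd_le[OF 1(3,2)] nd_less[OF 1(2,3)])
  next
    case False
    then have "q < 0" using 1(5) unfolding 1(6) by (intro divide_neg_pos) simp_all
    then have "\<bar>q\<bar> = (nq y - nq x) / nq z" unfolding 1(6) by (simp only: abs_of_neg minus_divide_left minus_diff_eq)
    then have "rd vs (b, a, c) \<bar>q\<bar>" by (intro rdI[OF 1(3,2,4,5)])
    then have "V vs (A (b, a, c)) = P" using assms(2) by blast
    then show ?thesis using False unfolding 1(1) with_abs_def by (auto simp add: V_simps(3,4) nd_le[OF 1(3,2)] nd_less[OF 1(2,3)])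
  qed
qed

lemma rd_inv_pow2: "nd vs t n \<Longrightarrow> rd vs (inv_pow2 t) (ip n)"
  unfolding inv_pow2_def by (rule rdI[OF nd_simps(2,1) nd_ppow2]) (auto simp: ip_def)
lemma rd_two_inv_pow2: "nd vs t n \<Longrightarrow> rd vs (two_inv_pow2 t) (ip n + ip n)"
  unfolding two_inv_pow2_def by (rule rdI[OF nd_simps(4)[OF nd_simps(2,2)] nd_simps(1) nd_ppow2]) (auto simp: ip_def field_simps)

text \<open>\<open>with_rat\<close> hides three quantifiers, so the continuation \<open>A\<close> is
  evaluated in a longer environment. Its truth value \<open>P\<close> does not depend on that
  extension, and the code determines the rational.\<close>

lemma V_with_rat:
  assumes t: "nd vs t m" and A: "\<And>ws r q. rd (vs @ ws) r q \<Longrightarrow> isc m \<Longrightarrow> q = dq m \<Longrightarrow> V (vs @ ws) (A r) = P"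
  shows "V vs (with_rat t A) \<longleftrightarrow> isc m \<and> P"
proof -
  let ?a = "bv (length vs)" and ?b = "bv (Suc (length vs))" and ?k = "bv (Suc (Suc (length vs)))"
  have e: "V (vs @ [nu a, nu b, nu k]) (t \<^bold>= ppair (ppair ?a ?b) ?k) \<longleftrightarrow> m = code a b k" for a b k
    unfolding ppair_def code_def pr_def
    by (rule nd_eq) (rule nd_append[OF t] nd_simps nd_bv | (use nd_bv(1)[of "vs @ [nu a]" b "[nu k]"] in \<open>simp; fail\<close>) | (use nd_bv(1)[of "vs @ [nu a, nu b]" k "[]"] in \<open>simp; fail\<close>))+
  have A': "V (vs @ [nu a, nu b, nu k]) (A (?a, ?b, psuc ?k)) = P" if "m = code a b k" for a b k
  proof (rule A)
    have "nd (vs @ [nu a, nu b, nu k]) ?b b" "nd (vs @ [nu a, nu b, nu k]) ?k k"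
      using nd_bv(1)[of "vs @ [nu a]" b "[nu k]"] nd_bv(1)[of "vs @ [nu a, nu b]" k "[]"] by simp_all
    then show "rd (vs @ [nu a, nu b, nu k]) (?a, ?b, psuc ?k) (qv a b k)"
      by (intro rdI[OF nd_bv(1) _ nd_simps(3)]) (auto simp: qv_def)
  qed (auto simp: that)
  have "V vs (with_rat t A) \<longleftrightarrow> (\<exists>a b k. m = code a b k \<and> V (vs @ [nu a, nu b, nu k]) (A (?a, ?b, psuc ?k)))"
    unfolding with_rat_def using e by (simp add: V_exq bex_N V_simps(3))
  also have "\<dots> \<longleftrightarrow> isc m \<and> P" using A' unfolding isc_def by blast
  finally show ?thesis .
qed

definition rs :: "'u \<Rightarrow> 'n \<Rightarrow> 'n qt" where "rs x n = dq (sq x n)"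
definition isreal :: "'u \<Rightarrow> bool" where
  "isreal x \<longleftrightarrow> x \<in> D one \<and> (\<forall>n. isc (sq x n)) \<and> (\<forall>n i. \<bar>rs x n - rs x (n + i)\<bar> < ip n)"
definition rv :: "'u \<Rightarrow> 'n creal" where "rv x = Creal (rs x)"

lemma isreal_D: "isreal x \<Longrightarrow> x \<in> D one" by (simp add: isreal_def)
lemma isreal_fast: "isreal x \<Longrightarrow> fast (rs x)" by (auto simp: isreal_def fast_def less_imp_le)

text \<open>A \<open>real_ex\<close> is written in continuation style: it passes an approximation on
  to \<open>A\<close>, possibly below new quantifiers. The extensions \<open>ws\<close> and
  \<open>ws'\<close> of the environment account for the quantifiers outside and inside
  \<open>X\<close>.\<close>

definition rex :: "'u list \<Rightarrow> real_ex \<Rightarrow> ('n \<Rightarrow> 'n qt) \<Rightarrow> bool" where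
  "rex vs X xs \<longleftrightarrow> (\<forall>ws t n A P. nd (vs @ ws) t n \<longrightarrow>
     (\<forall>ws' r. rd (vs @ ws @ ws') r (xs n) \<longrightarrow> V (vs @ ws @ ws') (A r) = P) \<longrightarrow> V (vs @ ws) (X t A) = P)"

lemma rexD: "rex vs X xs \<Longrightarrow> nd (vs @ ws) t n \<Longrightarrow>
   (\<And>ws' r. rd (vs @ ws @ ws') r (xs n) \<Longrightarrow> V (vs @ ws @ ws') (A r) = P) \<Longrightarrow> V (vs @ ws) (X t A) = P"
  unfolding rex_def by blast

lemma nd_sq: "stable vs x \<Longrightarrow> E vs x \<in> D one \<Longrightarrow> nd vs t n \<Longrightarrow> nd vs (x \<^bold>\<cdot> t) (sq (E vs x) n)"
  by (simp add: nd_def stable_app E_app nu_sq)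

lemma V_seq: "stable vs x \<Longrightarrow> E vs x \<in> D one \<Longrightarrow> nd (vs @ ws) t n \<Longrightarrow>
  (\<And>ws' r. rd (vs @ ws @ ws') r (rs (E vs x) n) \<Longrightarrow> isc (sq (E vs x) n) \<Longrightarrow> V (vs @ ws @ ws') (A r) = P) \<Longrightarrow>
  V (vs @ ws) (seq x t A) \<longleftrightarrow> isc (sq (E vs x) n) \<and> P"
  unfolding seq_def
  by (rule V_with_rat) (use nd_sq[of "vs @ ws" x t n] in \<open>auto simp: stable_append stable_E rs_def\<close>)

lemma rex_seq: "stable vs x \<Longrightarrow> isreal (E vs x) \<Longrightarrow> rex vs (seq x) (rs (E vs x))"
  unfolding rex_def
proof (intro allI impI)
  fix ws t n A P assume x: "stable vs x" "isreal (E vs x)" and t: "nd (vs @ ws) t n"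
    and A: "\<forall>ws' r. rd (vs @ ws @ ws') r (rs (E vs x) n) \<longrightarrow> V (vs @ ws @ ws') (A r) = P"
  have "V (vs @ ws) (seq x t A) \<longleftrightarrow> isc (sq (E vs x) n) \<and> P"
    by (rule V_seq[OF x(1) isreal_D[OF x(2)] t]) (use A in blast)
  then show "V (vs @ ws) (seq x t A) = P" using x(2) by (simp add: isreal_def)
qed

lemma rex_num: "nd vs t k \<Longrightarrow> rex vs (real_num t) (\<lambda>_. nq k)"
  unfolding rex_def real_num_def
proof (intro allI impI)
  fix ws s n A P assume t: "nd vs t k" and *: "\<forall>ws' r. rd (vs @ ws @ ws') r (nq k) \<longrightarrow> V (vs @ ws @ ws') (A r) = P"
  have "rd (vs @ ws) (t, \<^bold>0, \<^bold>1) (nq k)" by (rule rdI[OF nd_append[OF t] nd_simps(1,2)]) auto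
  then show "V (vs @ ws) (A (t, \<^bold>0, \<^bold>1)) = P" using *[rule_format, of "[]"] by simp
qed

lemma rex_binop:
  assumes X: "rex vs X xs" and Y: "rex vs Y ys"
    and op: "\<And>vs r s p q. rd vs r p \<Longrightarrow> rd vs s q \<Longrightarrow> rd vs (f r s) (g p q)"
  shows "rex vs (\<lambda>n A. X (psuc n) (\<lambda>q. Y (psuc n) (\<lambda>r. A (f q r)))) (\<lambda>n. g (xs (n + 1)) (ys (n + 1)))"
  unfolding rex_def
proof (intro allI impI)
  fix ws t n A P
  assume t: "nd (vs @ ws) t n" and A: "\<forall>ws' r. rd (vs @ ws @ ws') r (g (xs (n + 1)) (ys (n + 1))) \<longrightarrow> V (vs @ ws @ ws') (A r) = P"
  show "V (vs @ ws) (X (psuc t) (\<lambda>q. Y (psuc t) (\<lambda>r. A (f q r)))) = P"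
  proof (rule rexD[OF X nd_simps(3)[OF t]])
    fix ws' q assume q: "rd (vs @ ws @ ws') q (xs (n + 1))"
    have t': "nd (vs @ (ws @ ws')) (psuc t) (n + 1)" using nd_append[OF nd_simps(3)[OF t], of ws'] by simp
    have "V (vs @ (ws @ ws')) (Y (psuc t) (\<lambda>r. A (f q r))) = P"
    proof (rule rexD[OF Y t'])
      fix ws'' r assume r: "rd (vs @ (ws @ ws') @ ws'') r (ys (n + 1))"
      have "rd (vs @ (ws @ ws') @ ws'') q (xs (n + 1))" using rd_append[OF q, of ws''] by simp
      from op[OF this r] show "V (vs @ (ws @ ws') @ ws'') (A (f q r)) = P" using A[rule_format, of "ws' @ ws''"] by simp
    qed
    then show "V (vs @ ws @ ws') (Y (psuc t) (\<lambda>r. A (f q r))) = P" by simp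
  qed
qed

lemma rex_add: "rex vs X xs \<Longrightarrow> rex vs Y ys \<Longrightarrow> rex vs (real_add X Y) (\<lambda>n. xs (n + 1) + ys (n + 1))"
  using rex_binop[of vs X xs Y ys rat_add "(+)"] rd_add by (simp add: real_add_def[abs_def])
lemma rex_sub: "rex vs X xs \<Longrightarrow> rex vs Y ys \<Longrightarrow> rex vs (real_sub X Y) (\<lambda>n. xs (n + 1) - ys (n + 1))"
  using rex_binop[of vs X xs Y ys rat_sub "(-)"] rd_sub by (simp add: real_sub_def[abs_def])
lemma rex_abs: assumes "rex vs X xs" shows "rex vs (real_abs X) (\<lambda>n. \<bar>xs n\<bar>)"
  unfolding rex_def real_abs_def
proof (intro allI impI)
  fix ws t n A P
  assume t: "nd (vs @ ws) t n" and A: "\<forall>ws' r. rd (vs @ ws @ ws') r \<bar>xs n\<bar> \<longrightarrow> V (vs @ ws @ ws') (A r) = P"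
  show "V (vs @ ws) (X t (\<lambda>q. with_abs q A)) = P"
    by (rule rexD[OF assms t], erule V_with_abs) (use A in blast)
qed

lemma V_comparison:
  assumes X: "rex vs X xs" and Y: "rex vs Y ys"
    and B: "\<And>ws r s t n. rd (vs @ ws) r (xs n) \<Longrightarrow> rd (vs @ ws) s (ys n) \<Longrightarrow> nd (vs @ ws) t n \<Longrightarrow> V (vs @ ws) (B t r s) = Q n"
  shows "V (vs @ [nu n]) (X (bv (length vs)) (\<lambda>q. Y (bv (length vs)) (\<lambda>r. B (bv (length vs)) q r))) = Q n"
proof (rule rexD[OF X nd_bv(1)])
  fix ws' q assume q: "rd (vs @ [nu n] @ ws') q (xs n)"
  have t: "nd (vs @ [nu n] @ ws') (bv (length vs)) n" using nd_append[OF nd_bv(1)[of vs n "[]"], of ws'] by simp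
  show "V (vs @ [nu n] @ ws') (Y (bv (length vs)) (\<lambda>r. B (bv (length vs)) q r)) = Q n"
  proof (rule rexD[OF Y t])
    fix ws'' r assume r: "rd (vs @ ([nu n] @ ws') @ ws'') r (ys n)"
    have "rd (vs @ ([nu n] @ ws') @ ws'') q (xs n)" "nd (vs @ ([nu n] @ ws') @ ws'') (bv (length vs)) n"
      using rd_append[OF q, of ws''] nd_append[OF t, of ws''] by simp_all
    from B[OF this(1) r this(2)] show "V (vs @ ([nu n] @ ws') @ ws'') (B (bv (length vs)) q r) = Q n" .
  qed
qed

definition rden :: "'u list \<Rightarrow> real_ex \<Rightarrow> 'n creal \<Rightarrow> bool" where
  "rden vs X r \<longleftrightarrow> (\<exists>xs. rex vs X xs \<and> fast xs \<and> r = Creal xs)"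

lemma V_real_less: assumes "rden vs X r" "rden vs Y s" shows "V vs (X <\<^sub>R Y) \<longleftrightarrow> r < s"
proof -
  obtain xs ys where x: "rex vs X xs" "fast xs" "r = Creal xs" and y: "rex vs Y ys" "fast ys" "s = Creal ys" using assms by (auto simp: rden_def)
  have "V vs (X <\<^sub>R Y) \<longleftrightarrow> (\<exists>n. xs n + (ip n + ip n) < ys n)"
    unfolding real_less_def V_exq bex_N
  proof (intro ex_cong1)
    fix n show "V (vs @ [nu n]) (X (bv (length vs)) (\<lambda>q. Y (bv (length vs)) (rat_less (rat_add q (two_inv_pow2 (bv (length vs))))))) = (xs n + (ip n + ip n) < ys n)"
      by (rule V_comparison[OF x(1) y(1), where B = "\<lambda>t q. rat_less (rat_add q (two_inv_pow2 t))"]) (intro V_rat_less rd_add rd_two_inv_pow2)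
  qed
  then show ?thesis using fast_less x y by simp
qed

lemma V_real_eq: assumes "rden vs X r" "rden vs Y s" shows "V vs (X =\<^sub>R Y) \<longleftrightarrow> r = s"
proof -
  obtain xs ys where x: "rex vs X xs" "fast xs" "r = Creal xs" and y: "rex vs Y ys" "fast ys" "s = Creal ys" using assms by (auto simp: rden_def)
  have "V vs (X =\<^sub>R Y) \<longleftrightarrow> (\<forall>n. \<bar>xs n - ys n\<bar> \<le> ip n + ip n)"
    unfolding real_eq_def V_allq ball_N
  proof (intro all_cong1)
    fix n show "V (vs @ [nu n]) (X (bv (length vs)) (\<lambda>q. Y (bv (length vs)) (\<lambda>r. with_abs (rat_sub q r) (\<lambda>a. rat_le a (two_inv_pow2 (bv (length vs))))))) = (\<bar>xs n - ys n\<bar> \<le> ip n + ip n)"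
      by (rule V_comparison[OF x(1) y(1), where B = "\<lambda>t q r. with_abs (rat_sub q r) (\<lambda>a. rat_le a (two_inv_pow2 t))"])
        (rule V_with_abs, rule rd_sub, assumption+, rule V_rat_le, assumption, rule rd_two_inv_pow2)
  qed
  then show ?thesis using fast_eq x y by simp
qed

lemma V_real_le: "rden vs X r \<Longrightarrow> rden vs Y s \<Longrightarrow> V vs (X \<le>\<^sub>R Y) \<longleftrightarrow> r \<le> s"
  by (simp add: real_le_def V_simps(2) V_real_less not_less)

lemma rden_seq: "stable vs x \<Longrightarrow> isreal (E vs x) \<Longrightarrow> rden vs (seq x) (rv (E vs x))"
  unfolding rden_def rv_def using rex_seq isreal_fast by blast
lemma rden_num: "nd vs t k \<Longrightarrow> rden vs (real_num t) (rq (nq k))"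
  unfolding rden_def using rex_num[of vs t k] fast_const[of "nq k"] by (intro exI[of _ "\<lambda>_. nq k"]) simp
lemma rden_add: "rden vs X r \<Longrightarrow> rden vs Y s \<Longrightarrow> rden vs (real_add X Y) (r + s)"
  unfolding rden_def by (elim exE conjE, intro exI conjI) (rule rex_add, assumption+, (simp add: fast_add)+)
lemma rden_sub: "rden vs X r \<Longrightarrow> rden vs Y s \<Longrightarrow> rden vs (real_sub X Y) (r - s)"
  unfolding rden_def by (elim exE conjE, intro exI conjI) (rule rex_sub, assumption+, (simp add: fast_sub)+)
lemma rden_abs: "rden vs X r \<Longrightarrow> rden vs (real_abs X) \<bar>r\<bar>"
  unfolding rden_def by (elim exE conjE, intro exI conjI) (rule rex_abs, assumption+, (simp add: fast_abs)+)
lemma rden_zero: "rden vs (real_num \<^bold>0) 0" using rden_num[OF nd_simps(1)] by simp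
lemma rden_one: "rden vs (real_num \<^bold>1) 1" using rden_num[OF nd_simps(2)] by simp
text \<open>Being a real includes that all terms are codes, which \<open>rex_seq\<close>
  presupposes. So the formula is evaluated by \<open>V_seq\<close>, which carries \<open>isc\<close>
  along.\<close>

lemma V_is_real: assumes "stable vs x" "E vs x \<in> D one" shows "V vs (is_real x) \<longleftrightarrow> isreal (E vs x)"
proof -
  let ?x = "E vs x" and ?n = "bv (length vs)" and ?i = "bv (Suc (length vs))"
  have *: "V (vs @ [nu n, nu i]) (seq x ?n (\<lambda>q. seq x (?n \<^bold>+ ?i) (\<lambda>r. with_abs (rat_sub q r) (\<lambda>a. rat_less a (inv_pow2 ?n)))))
    \<longleftrightarrow> isc (sq ?x n) \<and> (isc (sq ?x (n + i)) \<and> \<bar>rs ?x n - rs ?x (n + i)\<bar> < ip n)" for n i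
  proof (rule V_seq[OF assms nd_bv(1)])
    fix ws' q assume q: "rd (vs @ [nu n, nu i] @ ws') q (rs ?x n)"
    have n: "nd (vs @ [nu n, nu i] @ ws') ?n n" using nd_bv(1)[of vs n "nu i # ws'"] by simp
    have i: "nd (vs @ [nu n, nu i] @ ws') ?i i" using nd_bv(1)[of "vs @ [nu n]" i ws'] by simp
    show "V (vs @ [nu n, nu i] @ ws') (seq x (?n \<^bold>+ ?i) (\<lambda>r. with_abs (rat_sub q r) (\<lambda>a. rat_less a (inv_pow2 ?n))))
      \<longleftrightarrow> isc (sq ?x (n + i)) \<and> \<bar>rs ?x n - rs ?x (n + i)\<bar> < ip n"
    proof (rule V_seq[OF assms nd_simps(4)[OF n i]])
      fix ws'' r assume r: "rd (vs @ ([nu n, nu i] @ ws') @ ws'') r (rs ?x (n + i))"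
      have q': "rd (vs @ ([nu n, nu i] @ ws') @ ws'') q (rs ?x n)" "nd (vs @ ([nu n, nu i] @ ws') @ ws'') ?n n"
        using rd_append[OF q, of ws''] nd_append[OF n, of ws''] by simp_all
      show "V (vs @ ([nu n, nu i] @ ws') @ ws'') (with_abs (rat_sub q r) (\<lambda>a. rat_less a (inv_pow2 ?n))) \<longleftrightarrow> \<bar>rs ?x n - rs ?x (n + i)\<bar> < ip n"
        by (rule V_with_abs[OF rd_sub[OF q'(1) r]]) (rule V_rat_less[OF _ rd_inv_pow2[OF q'(2)]])
    qed
  qed
  have "V vs (is_real x) \<longleftrightarrow> (\<forall>n i. isc (sq ?x n) \<and> (isc (sq ?x (n + i)) \<and> \<bar>rs ?x n - rs ?x (n + i)\<bar> < ip n))"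
    unfolding is_real_def using * by (simp add: V_allq ball_N)
  then show ?thesis using assms(2) unfolding isreal_def by blast
qed

definition unit :: "'u \<Rightarrow> bool" where "unit x \<longleftrightarrow> isreal x \<and> 0 \<le> rv x \<and> rv x \<le> 1"

lemma V_in_unit: assumes "stable vs x" "E vs x \<in> D one" shows "V vs (in_unit x) \<longleftrightarrow> unit (E vs x)"
proof (cases "isreal (E vs x)")
  case True
  then show ?thesis unfolding in_unit_def V_simps(3) V_is_real[OF assms] unit_def
    by (simp add: V_real_le[OF rden_zero rden_seq[OF assms(1)]] V_real_le[OF rden_seq[OF assms(1)] rden_one])
next
  case False
  then show ?thesis unfolding in_unit_def V_simps(3) V_is_real[OF assms] unit_def by simp
qed

lemma unit_real: "unit x \<Longrightarrow> isreal x" by (simp add: unit_def)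
lemma unit_D: "unit x \<Longrightarrow> x \<in> D one" by (simp add: unit_def isreal_D)

end

context nmodel
begin

section \<open>Functions on the unit interval, and the three principles read in the model\<close>

lemma E_bvs: "E (vs @ v # ws) (bv (length vs)) = v" "E (vs @ v # w # ws) (bv (Suc (length vs))) = w"
  "E (vs @ v # w # u # ws) (bv (Suc (Suc (length vs)))) = u"
  by (simp_all add: E_bv nth_append)
lemma stable_bvs: "stable (vs @ v # ws) (bv (length vs))" "stable (vs @ v # w # ws) (bv (Suc (length vs)))"
  "stable (vs @ v # w # u # ws) (bv (Suc (Suc (length vs))))"
  by (simp_all add: stable_bv)

lemmas Es = E_bvs E_app E_simps E_bv stable_E stable_bvs stables

lemma V_seq_eq: "stable vs x \<Longrightarrow> stable vs y \<Longrightarrow> isreal (E vs x) \<Longrightarrow> isreal (E vs y) \<Longrightarrow> V vs (seq x =\<^sub>R seq y) \<longleftrightarrow> rv (E vs x) = rv (E vs y)"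
  and V_seq_le: "stable vs x \<Longrightarrow> stable vs y \<Longrightarrow> isreal (E vs x) \<Longrightarrow> isreal (E vs y) \<Longrightarrow> V vs (seq x \<le>\<^sub>R seq y) \<longleftrightarrow> rv (E vs x) \<le> rv (E vs y)"
  and V_seq_less: "stable vs x \<Longrightarrow> stable vs y \<Longrightarrow> isreal (E vs x) \<Longrightarrow> isreal (E vs y) \<Longrightarrow> V vs (seq x <\<^sub>R seq y) \<longleftrightarrow> rv (E vs x) < rv (E vs y)"
  by (simp_all add: V_real_eq V_real_le V_real_less rden_seq)

definition ufun :: "'u \<Rightarrow> bool" where
  "ufun f \<longleftrightarrow> f \<in> D (one \<^bold>\<rightarrow> one) \<and> (\<forall>x. unit x \<longrightarrow> isreal (ap f x)) \<and>
     (\<forall>x y. unit x \<and> unit y \<and> rv x = rv y \<longrightarrow> rv (ap f x) = rv (ap f y))"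

lemma ufun_real: "ufun f \<Longrightarrow> unit x \<Longrightarrow> isreal (ap f x)" by (simp add: ufun_def)
lemma ufun_D: "ufun f \<Longrightarrow> f \<in> D (one \<^bold>\<rightarrow> one)" by (simp add: ufun_def)
lemma ufun_eq: "ufun f \<Longrightarrow> unit x \<Longrightarrow> unit y \<Longrightarrow> rv x = rv y \<Longrightarrow> rv (ap f x) = rv (ap f y)" unfolding ufun_def by blast

lemma V_unit_fun: assumes "stable vs f" "E vs f \<in> D (one \<^bold>\<rightarrow> one)" shows "V vs (unit_fun f) \<longleftrightarrow> ufun (E vs f)"
proof -
  let ?f = "E vs f"
  have 1: "V vs (\<^bold>\<forall>x \<^bold>: one. in_unit x \<^bold>\<longrightarrow> is_real (f \<^bold>\<cdot> x)) \<longleftrightarrow> (\<forall>x. unit x \<longrightarrow> isreal (ap ?f x))"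
    using assms ap_closed unit_D by (auto simp: V_allq V_simps V_in_unit V_is_real Es)
  have 2: "V vs (\<^bold>\<forall>x \<^bold>: one. \<^bold>\<forall>y \<^bold>: one. in_unit x \<^bold>\<and> in_unit y \<^bold>\<and> seq x =\<^sub>R seq y \<^bold>\<longrightarrow> seq (f \<^bold>\<cdot> x) =\<^sub>R seq (f \<^bold>\<cdot> y))
     \<longleftrightarrow> (\<forall>x y. unit x \<and> unit y \<and> rv x = rv y \<longrightarrow> rv (ap ?f x) = rv (ap ?f y))" if "\<forall>x. unit x \<longrightarrow> isreal (ap ?f x)"
  proof -
    let ?x = "bv (length vs)" and ?y = "bv (Suc (length vs))"
    have "V (vs @ [v, w]) (in_unit ?x) \<longleftrightarrow> unit v" "V (vs @ [v, w]) (in_unit ?y) \<longleftrightarrow> unit w" if "v \<in> D one" "w \<in> D one" for v w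
      using that V_in_unit[of "vs @ [v, w]" ?x] V_in_unit[of "vs @ [v, w]" ?y] by (simp_all add: Es)
    moreover have "V (vs @ [v, w]) (seq ?x =\<^sub>R seq ?y) \<longleftrightarrow> rv v = rv w"
      "V (vs @ [v, w]) (seq (f \<^bold>\<cdot> ?x) =\<^sub>R seq (f \<^bold>\<cdot> ?y)) \<longleftrightarrow> rv (ap ?f v) = rv (ap ?f w)" if "unit v" "unit w" for v w
      using that \<open>\<forall>x. unit x \<longrightarrow> isreal (ap ?f x)\<close> V_seq_eq[of "vs @ [v, w]" ?x ?y] V_seq_eq[of "vs @ [v, w]" "f \<^bold>\<cdot> ?x" "f \<^bold>\<cdot> ?y"] assms(1)
      by (simp_all add: Es unit_real)
    moreover have "V vs (\<^bold>\<forall>x \<^bold>: one. \<^bold>\<forall>y \<^bold>: one. in_unit x \<^bold>\<and> in_unit y \<^bold>\<and> seq x =\<^sub>R seq y \<^bold>\<longrightarrow> seq (f \<^bold>\<cdot> x) =\<^sub>R seq (f \<^bold>\<cdot> y))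
       \<longleftrightarrow> (\<forall>v \<in> D one. \<forall>w \<in> D one. V (vs @ [v, w]) (in_unit ?x) \<and> V (vs @ [v, w]) (in_unit ?y) \<and> V (vs @ [v, w]) (seq ?x =\<^sub>R seq ?y) \<longrightarrow>
         V (vs @ [v, w]) (seq (f \<^bold>\<cdot> ?x) =\<^sub>R seq (f \<^bold>\<cdot> ?y)))"
      by (simp add: V_allq V_simps(1,3))
    ultimately show ?thesis using unit_D by (smt (verit))
  qed
  show ?thesis unfolding unit_fun_def ufun_def V_simps(3) using 1 2 assms(2) by blast
qed

definition umono :: "'u \<Rightarrow> bool" where
  "umono f \<longleftrightarrow> (\<forall>x y. unit x \<and> unit y \<and> rv x \<le> rv y \<longrightarrow> rv (ap f x) \<le> rv (ap f y))"

lemma V_nondecreasing: "stable vs f \<Longrightarrow> ufun (E vs f) \<Longrightarrow> V vs (nondecreasing f) \<longleftrightarrow> umono (E vs f)"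
proof -
  assume f: "stable vs f" "ufun (E vs f)"
  let ?x = "bv (length vs)" and ?y = "bv (Suc (length vs))"
  have "V (vs @ [v, w]) (in_unit ?x) \<longleftrightarrow> unit v" "V (vs @ [v, w]) (in_unit ?y) \<longleftrightarrow> unit w" if "v \<in> D one" "w \<in> D one" for v w
    using that V_in_unit[of "vs @ [v, w]" ?x] V_in_unit[of "vs @ [v, w]" ?y] by (simp_all add: Es)
  moreover have "V (vs @ [v, w]) (seq ?x \<le>\<^sub>R seq ?y) \<longleftrightarrow> rv v \<le> rv w"
    "V (vs @ [v, w]) (seq (f \<^bold>\<cdot> ?x) \<le>\<^sub>R seq (f \<^bold>\<cdot> ?y)) \<longleftrightarrow> rv (ap (E vs f) v) \<le> rv (ap (E vs f) w)" if "unit v" "unit w" for v w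
    using that V_seq_le[of "vs @ [v, w]" ?x ?y] V_seq_le[of "vs @ [v, w]" "f \<^bold>\<cdot> ?x" "f \<^bold>\<cdot> ?y"] f
    by (simp_all add: Es unit_real ufun_real)
  moreover have "V vs (nondecreasing f) \<longleftrightarrow> (\<forall>v \<in> D one. \<forall>w \<in> D one. V (vs @ [v, w]) (in_unit ?x) \<and> V (vs @ [v, w]) (in_unit ?y) \<and> V (vs @ [v, w]) (seq ?x \<le>\<^sub>R seq ?y) \<longrightarrow>
       V (vs @ [v, w]) (seq (f \<^bold>\<cdot> ?x) \<le>\<^sub>R seq (f \<^bold>\<cdot> ?y)))"
    by (simp add: nondecreasing_def V_allq V_simps(1,3))
  ultimately show ?thesis using unit_D unfolding umono_def by (smt (verit))
qed

definition part :: "'n \<Rightarrow> 'u \<Rightarrow> bool" where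
  "part n x \<longleftrightarrow> (\<forall>i\<le>n. unit (ap x (nu i))) \<and> rv (ap x (nu 0)) = 0 \<and> rv (ap x (nu n)) = 1 \<and>
     (\<forall>i<n. rv (ap x (nu i)) < rv (ap x (nu (i + 1))))"

lemma V_unit_partition: assumes "nd vs t n" "stable vs x" "E vs x \<in> D (N \<^bold>\<rightarrow> one)"
  shows "V vs (unit_partition t x) \<longleftrightarrow> part n (E vs x)"
proof -
  let ?x = "E vs x"
  have x: "ap ?x (nu i) \<in> D one" for i using assms(3) ap_closed by auto
  have t: "stable vs t" "E vs t = nu n" using assms(1) by (auto simp: nd_def)
  have 1: "V vs (\<^bold>\<forall>i \<^bold>: N. i \<^bold>\<le> t \<^bold>\<longrightarrow> in_unit (x \<^bold>\<cdot> i)) \<longleftrightarrow> (\<forall>i\<le>n. unit (ap ?x (nu i)))"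
    using assms x by (simp add: V_allq ball_N V_simps(1) nd_le[OF nd_bv(1) nd_append] V_in_unit Es)
  have 2: "V vs (seq (x \<^bold>\<cdot> \<^bold>0) =\<^sub>R real_num \<^bold>0) \<longleftrightarrow> rv (ap ?x (nu 0)) = 0"
    "V vs (seq (x \<^bold>\<cdot> t) =\<^sub>R real_num \<^bold>1) \<longleftrightarrow> rv (ap ?x (nu n)) = 1" if "\<forall>i\<le>n. unit (ap ?x (nu i))"
    using V_real_eq[OF rden_seq rden_zero, of vs "x \<^bold>\<cdot> \<^bold>0"] V_real_eq[OF rden_seq rden_one, of vs "x \<^bold>\<cdot> t"] assms(2) t that nonneg[of n]
    by (simp_all add: Es unit_real nu_zero[symmetric])
  have 3: "V vs (\<^bold>\<forall>i \<^bold>: N. i \<^bold>< t \<^bold>\<longrightarrow> seq (x \<^bold>\<cdot> i) <\<^sub>R seq (x \<^bold>\<cdot> psuc i)) \<longleftrightarrow> (\<forall>i<n. rv (ap ?x (nu i)) < rv (ap ?x (nu (i + 1))))"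
    if "\<forall>i\<le>n. unit (ap ?x (nu i))"
  proof -
    have "isreal (ap ?x (nu i))" "isreal (ap ?x (sc (nu i)))" if "i < n" for i
      using that \<open>\<forall>i\<le>n. unit (ap ?x (nu i))\<close>[rule_format, of i] \<open>\<forall>i\<le>n. unit (ap ?x (nu i))\<close>[rule_format, of "i + 1"]
      by (auto simp: unit_real nu_Suc less_iff_succ_less_eq[symmetric])
    then show ?thesis using assms by (simp add: V_allq ball_N V_simps(1) nd_less[OF nd_bv(1) nd_append] V_seq_less Es nu_Suc)
  qed
  show ?thesis unfolding unit_partition_def part_def V_simps(3) using 1 2 3 by blast
qed

definition vsum :: "'u \<Rightarrow> 'n \<Rightarrow> 'u \<Rightarrow> 'u \<Rightarrow> bool" where
  "vsum f n x s \<longleftrightarrow> (\<forall>i\<le>n. isreal (ap s (nu i))) \<and> rv (ap s (nu 0)) = 0 \<and>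
     (\<forall>i<n. rv (ap s (nu (i + 1))) = rv (ap s (nu i)) + \<bar>rv (ap f (ap x (nu i))) - rv (ap f (ap x (nu (i + 1))))\<bar>)"

lemma V_variation_sums:
  assumes "nd vs t n" "stable vs x" "E vs x \<in> D (N \<^bold>\<rightarrow> one)" "stable vs s" "E vs s \<in> D (N \<^bold>\<rightarrow> one)"
    "stable vs f" "ufun (E vs f)" "part n (E vs x)"
  shows "V vs (variation_sums f t x s) \<longleftrightarrow> vsum (E vs f) n (E vs x) (E vs s)"
proof -
  let ?x = "E vs x" and ?s = "E vs s" and ?f = "E vs f"
  have s: "ap ?s (nu i) \<in> D one" for i using assms(5) ap_closed by auto
  have 1: "V vs (\<^bold>\<forall>i \<^bold>: N. i \<^bold>\<le> t \<^bold>\<longrightarrow> is_real (s \<^bold>\<cdot> i)) \<longleftrightarrow> (\<forall>i\<le>n. isreal (ap ?s (nu i)))"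
    using assms s by (simp add: V_allq ball_N V_simps(1) nd_le[OF nd_bv(1) nd_append] V_is_real Es)
  have 2: "V vs (seq (s \<^bold>\<cdot> \<^bold>0) =\<^sub>R real_num \<^bold>0) \<longleftrightarrow> rv (ap ?s (nu 0)) = 0" if "\<forall>i\<le>n. isreal (ap ?s (nu i))"
    using V_real_eq[OF rden_seq rden_zero, of vs "s \<^bold>\<cdot> \<^bold>0"] assms(4) that nonneg[of n]
    by (simp_all add: Es nu_zero[symmetric])
  have 3: "V vs (\<^bold>\<forall>i \<^bold>: N. i \<^bold>< t \<^bold>\<longrightarrow> seq (s \<^bold>\<cdot> psuc i) =\<^sub>R
         real_add (seq (s \<^bold>\<cdot> i)) (real_abs (real_sub (seq (f \<^bold>\<cdot> (x \<^bold>\<cdot> i))) (seq (f \<^bold>\<cdot> (x \<^bold>\<cdot> psuc i))))))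
     \<longleftrightarrow> (\<forall>i<n. rv (ap ?s (nu (i + 1))) = rv (ap ?s (nu i)) + \<bar>rv (ap ?f (ap ?x (nu i))) - rv (ap ?f (ap ?x (nu (i + 1))))\<bar>)"
    if r: "\<forall>i\<le>n. isreal (ap ?s (nu i))"
    unfolding V_allq ball_N V_simps(1)
  proof (intro all_cong1)
    fix i
    let ?i = "bv (length vs)" and ?vs = "vs @ [nu i]"
    have e: "V ?vs (seq (s \<^bold>\<cdot> psuc ?i) =\<^sub>R real_add (seq (s \<^bold>\<cdot> ?i)) (real_abs (real_sub (seq (f \<^bold>\<cdot> (x \<^bold>\<cdot> ?i))) (seq (f \<^bold>\<cdot> (x \<^bold>\<cdot> psuc ?i))))))
      \<longleftrightarrow> rv (ap ?s (nu (i + 1))) = rv (ap ?s (nu i)) + \<bar>rv (ap ?f (ap ?x (nu i))) - rv (ap ?f (ap ?x (nu (i + 1))))\<bar>" if "i < n"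
    proof -
      have st: "stable ?vs ?i" "stable ?vs s" "stable ?vs f" "stable ?vs x" using assms by (auto simp: Es)
      have ev: "E ?vs (s \<^bold>\<cdot> psuc ?i) = ap ?s (nu (i + 1))" "E ?vs (s \<^bold>\<cdot> ?i) = ap ?s (nu i)" "E ?vs (f \<^bold>\<cdot> (x \<^bold>\<cdot> ?i)) = ap ?f (ap ?x (nu i))"
        "E ?vs (f \<^bold>\<cdot> (x \<^bold>\<cdot> psuc ?i)) = ap ?f (ap ?x (nu (i + 1)))"
        using assms by (simp_all add: Es nu_Suc)
      have "i + 1 \<le> n" "i \<le> n" using that by (simp_all add: less_iff_succ_less_eq[symmetric])
      then have re: "isreal (ap ?s (nu (i + 1)))" "isreal (ap ?s (nu i))" "isreal (ap ?f (ap ?x (nu i)))" "isreal (ap ?f (ap ?x (nu (i + 1))))"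
        using r assms(7,8) by (auto simp: part_def ufun_real)
      have "rden ?vs (seq (s \<^bold>\<cdot> psuc ?i)) (rv (ap ?s (nu (i + 1))))" "rden ?vs (seq (s \<^bold>\<cdot> ?i)) (rv (ap ?s (nu i)))"
        "rden ?vs (seq (f \<^bold>\<cdot> (x \<^bold>\<cdot> ?i))) (rv (ap ?f (ap ?x (nu i))))" "rden ?vs (seq (f \<^bold>\<cdot> (x \<^bold>\<cdot> psuc ?i))) (rv (ap ?f (ap ?x (nu (i + 1)))))"
        using rden_seq[of ?vs "s \<^bold>\<cdot> psuc ?i"] rden_seq[of ?vs "s \<^bold>\<cdot> ?i"] rden_seq[of ?vs "f \<^bold>\<cdot> (x \<^bold>\<cdot> ?i)"] rden_seq[of ?vs "f \<^bold>\<cdot> (x \<^bold>\<cdot> psuc ?i)"]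
          ev re st by (simp_all add: stables)
      then show ?thesis by (intro V_real_eq rden_add rden_abs rden_sub)
    qed
    show "(V ?vs (?i \<^bold>< t) \<longrightarrow> V ?vs (seq (s \<^bold>\<cdot> psuc ?i) =\<^sub>R real_add (seq (s \<^bold>\<cdot> ?i)) (real_abs (real_sub (seq (f \<^bold>\<cdot> (x \<^bold>\<cdot> ?i))) (seq (f \<^bold>\<cdot> (x \<^bold>\<cdot> psuc ?i)))))))
      \<longleftrightarrow> (i < n \<longrightarrow> rv (ap ?s (nu (i + 1))) = rv (ap ?s (nu i)) + \<bar>rv (ap ?f (ap ?x (nu i))) - rv (ap ?f (ap ?x (nu (i + 1))))\<bar>)"
      using e nd_less[OF nd_bv(1) nd_append[OF assms(1)]] by blast
  qed
  show ?thesis unfolding variation_sums_def vsum_def V_simps(3) using 1 2 3 by blast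
qed

definition bvar :: "'u \<Rightarrow> bool" where
  "bvar f \<longleftrightarrow> (\<exists>k. \<forall>n. \<forall>x \<in> D (N \<^bold>\<rightarrow> one). \<forall>s \<in> D (N \<^bold>\<rightarrow> one). part n x \<and> vsum f n x s \<longrightarrow> rv (ap s (nu n)) \<le> rq (nq k))"

lemma V_bounded_variation: assumes "stable vs f" "ufun (E vs f)" shows "V vs (bounded_variation f) \<longleftrightarrow> bvar (E vs f)"
  unfolding bounded_variation_def bvar_def V_exq bex_N V_allq ball_N
proof (intro ex_cong1 all_cong1 ball_cong refl)
  fix k n x s assume x: "x \<in> D (N \<^bold>\<rightarrow> one)" and s: "s \<in> D (N \<^bold>\<rightarrow> one)"
  let ?vs = "((vs @ [nu k]) @ [nu n]) @ [x]"
  let ?ws = "?vs @ [s]"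
  let ?k = "bv (length vs)" and ?n = "bv (length (vs @ [nu k]))" and ?x = "bv (length ((vs @ [nu k]) @ [nu n]))" and ?s = "bv (length ?vs)"
  have n: "nd ?ws ?n n" "nd ?ws ?k k" "stable ?ws ?x" "E ?ws ?x = x" "stable ?ws ?s" "E ?ws ?s = s" "stable ?ws f" "E ?ws f = E vs f"
    using assms(1) by (simp_all add: nd_def stable_bv E_bv nth_append stable_append stable_E)
  have "V ?ws (unit_partition ?n ?x) \<longleftrightarrow> part n x" using V_unit_partition[OF n(1,3)] n(4) x by simp
  moreover have "V ?ws (variation_sums f ?n ?x ?s) \<longleftrightarrow> vsum (E vs f) n x s" if "part n x"
    using V_variation_sums[OF n(1,3) _ n(5) _ n(7)] n x s assms(2) that by simp
  moreover have "V ?ws (seq (?s \<^bold>\<cdot> ?n) \<le>\<^sub>R real_num ?k) \<longleftrightarrow> rv (ap s (nu n)) \<le> rq (nq k)" if "vsum (E vs f) n x s"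
  proof (rule V_real_le[OF _ rden_num[OF n(2)]])
    have "E ?ws (?s \<^bold>\<cdot> ?n) = ap s (nu n)" "stable ?ws (?s \<^bold>\<cdot> ?n)" using n by (simp_all add: nd_def E_app stable_app)
    moreover have "isreal (ap s (nu n))" using that by (auto simp: vsum_def)
    ultimately show "rden ?ws (seq (?s \<^bold>\<cdot> ?n)) (rv (ap s (nu n)))" using rden_seq[of ?ws "?s \<^bold>\<cdot> ?n"] by simp
  qed
  ultimately show "V ?ws (unit_partition ?n ?x \<^bold>\<and> variation_sums f ?n ?x ?s \<^bold>\<longrightarrow> seq (?s \<^bold>\<cdot> ?n) \<le>\<^sub>R real_num ?k)
     \<longleftrightarrow> (part n x \<and> vsum (E vs f) n x s \<longrightarrow> rv (ap s (nu n)) \<le> rq (nq k))"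
    unfolding V_simps(1,3) by blast
qed

lemma sat_Jordan: "sat [] Jordan \<longleftrightarrow> (\<forall>f. ufun f \<and> bvar f \<longrightarrow>
   (\<exists>g h. ufun g \<and> ufun h \<and> umono g \<and> umono h \<and> (\<forall>x. unit x \<longrightarrow> rv (ap f x) = rv (ap g x) - rv (ap h x))))" (is "_ \<longleftrightarrow> ?R")
proof -
  have c: "V [f, g, h] (\<^bold>\<forall>x \<^bold>: one. in_unit x \<^bold>\<longrightarrow> seq (bv 0 \<^bold>\<cdot> x) =\<^sub>R real_sub (seq (bv (Suc 0) \<^bold>\<cdot> x)) (seq (bv (Suc (Suc 0)) \<^bold>\<cdot> x)))
     \<longleftrightarrow> (\<forall>x. unit x \<longrightarrow> rv (ap f x) = rv (ap g x) - rv (ap h x))" if u: "ufun f" "ufun g" "ufun h" for f g h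
  proof -
    have "V [f, g, h, x] (seq (bv 0 \<^bold>\<cdot> bv (Suc (Suc (Suc 0)))) =\<^sub>R real_sub (seq (bv (Suc 0) \<^bold>\<cdot> bv (Suc (Suc (Suc 0))))) (seq (bv (Suc (Suc 0)) \<^bold>\<cdot> bv (Suc (Suc (Suc 0))))))
      \<longleftrightarrow> rv (ap f x) = rv (ap g x) - rv (ap h x)" if "unit x" for x
    proof -
      let ?vs = "[f, g, h, x]" and ?x = "bv (Suc (Suc (Suc 0)))"
      have "rden ?vs (seq (bv 0 \<^bold>\<cdot> ?x)) (rv (ap f x))" "rden ?vs (seq (bv (Suc 0) \<^bold>\<cdot> ?x)) (rv (ap g x))" "rden ?vs (seq (bv (Suc (Suc 0)) \<^bold>\<cdot> ?x)) (rv (ap h x))"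
        using rden_seq[of ?vs "bv 0 \<^bold>\<cdot> ?x"] rden_seq[of ?vs "bv (Suc 0) \<^bold>\<cdot> ?x"] rden_seq[of ?vs "bv (Suc (Suc 0)) \<^bold>\<cdot> ?x"] u that
        by (simp_all add: Es ufun_real)
      then show ?thesis by (intro V_real_eq rden_sub)
    qed
    moreover have "V [f, g, h, x] (in_unit (bv (Suc (Suc (Suc 0))))) \<longleftrightarrow> unit x" if "x \<in> D one" for x using that V_in_unit[of "[f, g, h, x]" "bv (Suc (Suc (Suc 0)))"] by (simp add: Es)
    ultimately show ?thesis using unit_D by (auto simp: V_allq V_simps(1))
  qed
  have uf: "V [f] (unit_fun (bv 0)) \<longleftrightarrow> ufun f" if "f \<in> D (one \<^bold>\<rightarrow> one)" for f
    using V_unit_fun[of "[f]" "bv 0"] that by (simp add: Es)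
  have ug: "V [f, g, h] (unit_fun (bv (Suc 0))) \<longleftrightarrow> ufun g" if "g \<in> D (one \<^bold>\<rightarrow> one)" for f g h
    using V_unit_fun[of "[f, g, h]" "bv (Suc 0)"] that by (simp add: Es)
  have uh: "V [f, g, h] (unit_fun (bv (Suc (Suc 0)))) \<longleftrightarrow> ufun h" if "h \<in> D (one \<^bold>\<rightarrow> one)" for f g h
    using V_unit_fun[of "[f, g, h]" "bv (Suc (Suc 0))"] that by (simp add: Es)
  have bf: "V [f] (bounded_variation (bv 0)) \<longleftrightarrow> bvar f" if "ufun f" for f
    using V_bounded_variation[of "[f]" "bv 0"] that by (simp add: Es)
  have mg: "V [f, g, h] (nondecreasing (bv (Suc 0))) \<longleftrightarrow> umono g" if "ufun g" for f g h
    using V_nondecreasing[of "[f, g, h]" "bv (Suc 0)"] that by (simp add: Es)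
  have mh: "V [f, g, h] (nondecreasing (bv (Suc (Suc 0)))) \<longleftrightarrow> umono h" if "ufun h" for f g h
    using V_nondecreasing[of "[f, g, h]" "bv (Suc (Suc 0))"] that by (simp add: Es)
  have "sat [] Jordan \<longleftrightarrow> (\<forall>f \<in> D (one \<^bold>\<rightarrow> one). V [f] (unit_fun (bv 0)) \<and> V [f] (bounded_variation (bv 0)) \<longrightarrow>
    (\<exists>g \<in> D (one \<^bold>\<rightarrow> one). \<exists>h \<in> D (one \<^bold>\<rightarrow> one). V [f, g, h] (unit_fun (bv (Suc 0))) \<and> V [f, g, h] (unit_fun (bv (Suc (Suc 0)))) \<and>
      V [f, g, h] (nondecreasing (bv (Suc 0))) \<and> V [f, g, h] (nondecreasing (bv (Suc (Suc 0)))) \<and>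
      V [f, g, h] (\<^bold>\<forall>x \<^bold>: one. in_unit x \<^bold>\<longrightarrow> seq (bv 0 \<^bold>\<cdot> x) =\<^sub>R real_sub (seq (bv (Suc 0) \<^bold>\<cdot> x)) (seq (bv (Suc (Suc 0)) \<^bold>\<cdot> x)))))"
    by (simp only: Jordan_def sat_sentence V_allq[of "[]"] V_simps V_exq append_Nil append_Cons list.size add_0_right add_Suc_right plus_nat.add_0 One_nat_def)
  also have "\<dots> \<longleftrightarrow> (\<forall>f \<in> D (one \<^bold>\<rightarrow> one). ufun f \<and> bvar f \<longrightarrow> (\<exists>g \<in> D (one \<^bold>\<rightarrow> one). \<exists>h \<in> D (one \<^bold>\<rightarrow> one).
      ufun g \<and> ufun h \<and> umono g \<and> umono h \<and> (\<forall>x. unit x \<longrightarrow> rv (ap f x) = rv (ap g x) - rv (ap h x))))"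
    \<comment> \<open>The translations of the later conjuncts presuppose \<open>ufun\<close>. The
      congruence rules supply it from the earlier ones.\<close>
    by (simp only: uf ug uh bf mg mh c cong: conj_cong imp_cong ball_cong bex_cong)
  also have "\<dots> \<longleftrightarrow> ?R" using ufun_D by blast
  finally show ?thesis .
qed

lemma sat_HBU: "sat [] HBU_bv \<longleftrightarrow> (\<forall>f. ufun f \<and> (\<forall>x. unit x \<longrightarrow> 0 < rv (ap f x)) \<and> bvar f \<longrightarrow>
   (\<exists>k. \<exists>y \<in> D (N \<^bold>\<rightarrow> one). (\<forall>i\<le>k. unit (ap y (nu i))) \<and>
     (\<forall>x. unit x \<longrightarrow> (\<exists>i\<le>k. \<bar>rv x - rv (ap y (nu i))\<bar> < rv (ap f (ap y (nu i)))))))" (is "_ \<longleftrightarrow> ?R")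
proof -
  have uf: "V [f] (unit_fun (bv 0)) \<longleftrightarrow> ufun f" if "f \<in> D (one \<^bold>\<rightarrow> one)" for f
    using V_unit_fun[of "[f]" "bv 0"] that by (simp_all add: Es)
  have bf: "V [f] (bounded_variation (bv 0)) \<longleftrightarrow> bvar f" if "ufun f" for f
    using V_bounded_variation[of "[f]" "bv 0"] that by (simp add: Es)
  have pf: "V [f] (\<^bold>\<forall>x \<^bold>: one. in_unit x \<^bold>\<longrightarrow> real_num \<^bold>0 <\<^sub>R seq (bv 0 \<^bold>\<cdot> x)) \<longleftrightarrow> (\<forall>x. unit x \<longrightarrow> 0 < rv (ap f x))" if "ufun f" for f
  proof -
    have "V [f, x] (real_num \<^bold>0 <\<^sub>R seq (bv 0 \<^bold>\<cdot> bv (Suc 0))) \<longleftrightarrow> 0 < rv (ap f x)" if "unit x" for x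
      using V_real_less[OF rden_zero rden_seq, of "[f, x]" "bv 0 \<^bold>\<cdot> bv (Suc 0)"] that \<open>ufun f\<close> by (simp add: Es ufun_real)
    moreover have "V [f, x] (in_unit (bv (Suc 0))) \<longleftrightarrow> unit x" if "x \<in> D one" for x using that V_in_unit[of "[f, x]" "bv (Suc 0)"] by (simp add: Es)
    ultimately show ?thesis using unit_D by (auto simp: V_allq V_simps(1))
  qed
  have y1: "V [f, nu k, y] (\<^bold>\<forall>i \<^bold>: N. i \<^bold>\<le> bv (Suc 0) \<^bold>\<longrightarrow> in_unit (bv (Suc (Suc 0)) \<^bold>\<cdot> i)) \<longleftrightarrow> (\<forall>i\<le>k. unit (ap y (nu i)))"
    if "y \<in> D (N \<^bold>\<rightarrow> one)" for f k y
  proof -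
    have "V [f, nu k, y, nu i] (bv (Suc (Suc (Suc 0))) \<^bold>\<le> bv (Suc 0)) \<longleftrightarrow> i \<le> k" for i
      by (rule nd_le) (simp_all add: nd_def Es)
    moreover have "V [f, nu k, y, nu i] (in_unit (bv (Suc (Suc 0)) \<^bold>\<cdot> bv (Suc (Suc (Suc 0))))) \<longleftrightarrow> unit (ap y (nu i))" for i
      using V_in_unit[of "[f, nu k, y, nu i]" "bv (Suc (Suc 0)) \<^bold>\<cdot> bv (Suc (Suc (Suc 0)))"] ap_closed[OF that nu_N] by (simp add: Es)
    ultimately show ?thesis by (simp add: V_allq ball_N V_simps(1))
  qed
  have y2: "V [f, nu k, y] (\<^bold>\<forall>x \<^bold>: one. in_unit x \<^bold>\<longrightarrow> (\<^bold>\<exists>i \<^bold>: N. i \<^bold>\<le> bv (Suc 0) \<^bold>\<and>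
        real_abs (real_sub (seq x) (seq (bv (Suc (Suc 0)) \<^bold>\<cdot> i))) <\<^sub>R seq (bv 0 \<^bold>\<cdot> (bv (Suc (Suc 0)) \<^bold>\<cdot> i))))
     \<longleftrightarrow> (\<forall>x. unit x \<longrightarrow> (\<exists>i\<le>k. \<bar>rv x - rv (ap y (nu i))\<bar> < rv (ap f (ap y (nu i)))))"
    if "ufun f" "\<forall>i\<le>k. unit (ap y (nu i))" for f k y
  proof -
    let ?x = "bv (Suc (Suc (Suc 0)))" and ?i = "bv (Suc (Suc (Suc (Suc 0))))"
    have "V [f, nu k, y, x, nu i] (?i \<^bold>\<le> bv (Suc 0)) \<longleftrightarrow> i \<le> k" for x i
      by (rule nd_le) (simp_all add: nd_def Es)
    moreover have "V [f, nu k, y, x] (in_unit ?x) \<longleftrightarrow> unit x" if "x \<in> D one" for x using that V_in_unit[of "[f, nu k, y, x]" ?x] by (simp add: Es)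
    moreover have "V [f, nu k, y, x, nu i] (real_abs (real_sub (seq ?x) (seq (bv (Suc (Suc 0)) \<^bold>\<cdot> ?i))) <\<^sub>R seq (bv 0 \<^bold>\<cdot> (bv (Suc (Suc 0)) \<^bold>\<cdot> ?i)))
      \<longleftrightarrow> \<bar>rv x - rv (ap y (nu i))\<bar> < rv (ap f (ap y (nu i)))" if "i \<le> k" "unit x" for x i
    proof -
      let ?vs = "[f, nu k, y, x, nu i]"
      have "rden ?vs (seq ?x) (rv x)" "rden ?vs (seq (bv (Suc (Suc 0)) \<^bold>\<cdot> ?i)) (rv (ap y (nu i)))" "rden ?vs (seq (bv 0 \<^bold>\<cdot> (bv (Suc (Suc 0)) \<^bold>\<cdot> ?i))) (rv (ap f (ap y (nu i))))"
        using rden_seq[of ?vs ?x] rden_seq[of ?vs "bv (Suc (Suc 0)) \<^bold>\<cdot> ?i"] rden_seq[of ?vs "bv 0 \<^bold>\<cdot> (bv (Suc (Suc 0)) \<^bold>\<cdot> ?i)"]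
          that \<open>ufun f\<close> \<open>\<forall>i\<le>k. unit (ap y (nu i))\<close> by (simp_all add: Es ufun_real unit_real)
      then show ?thesis by (intro V_real_less rden_abs rden_sub)
    qed
    moreover have "V [f, nu k, y] (\<^bold>\<forall>x \<^bold>: one. in_unit x \<^bold>\<longrightarrow> (\<^bold>\<exists>i \<^bold>: N. i \<^bold>\<le> bv (Suc 0) \<^bold>\<and>
        real_abs (real_sub (seq x) (seq (bv (Suc (Suc 0)) \<^bold>\<cdot> i))) <\<^sub>R seq (bv 0 \<^bold>\<cdot> (bv (Suc (Suc 0)) \<^bold>\<cdot> i))))
      \<longleftrightarrow> (\<forall>x \<in> D one. V [f, nu k, y, x] (in_unit ?x) \<longrightarrow> (\<exists>i. V [f, nu k, y, x, nu i] (?i \<^bold>\<le> bv (Suc 0)) \<and>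
        V [f, nu k, y, x, nu i] (real_abs (real_sub (seq ?x) (seq (bv (Suc (Suc 0)) \<^bold>\<cdot> ?i))) <\<^sub>R seq (bv 0 \<^bold>\<cdot> (bv (Suc (Suc 0)) \<^bold>\<cdot> ?i)))))"
      by (simp add: V_allq V_exq bex_N V_simps(1,3))
    ultimately show ?thesis using unit_D by (smt (verit))
  qed
  have "sat [] HBU_bv \<longleftrightarrow> (\<forall>f \<in> D (one \<^bold>\<rightarrow> one). V [f] (unit_fun (bv 0)) \<and> V [f] (\<^bold>\<forall>x \<^bold>: one. in_unit x \<^bold>\<longrightarrow> real_num \<^bold>0 <\<^sub>R seq (bv 0 \<^bold>\<cdot> x)) \<and> V [f] (bounded_variation (bv 0)) \<longrightarrow>
    (\<exists>k. \<exists>y \<in> D (N \<^bold>\<rightarrow> one). V [f, nu k, y] (\<^bold>\<forall>i \<^bold>: N. i \<^bold>\<le> bv (Suc 0) \<^bold>\<longrightarrow> in_unit (bv (Suc (Suc 0)) \<^bold>\<cdot> i)) \<and>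
      V [f, nu k, y] (\<^bold>\<forall>x \<^bold>: one. in_unit x \<^bold>\<longrightarrow> (\<^bold>\<exists>i \<^bold>: N. i \<^bold>\<le> bv (Suc 0) \<^bold>\<and>
        real_abs (real_sub (seq x) (seq (bv (Suc (Suc 0)) \<^bold>\<cdot> i))) <\<^sub>R seq (bv 0 \<^bold>\<cdot> (bv (Suc (Suc 0)) \<^bold>\<cdot> i))))))"
    by (simp only: HBU_bv_def sat_sentence V_allq[of "[]"] V_simps(1,3) V_exq[of "[_]"] V_exq[of "[_, _]"] bex_N append_Nil append_Cons list.size add_0_right add_Suc_right plus_nat.add_0 One_nat_def)
  also have "\<dots> \<longleftrightarrow> (\<forall>f \<in> D (one \<^bold>\<rightarrow> one). ufun f \<and> (\<forall>x. unit x \<longrightarrow> 0 < rv (ap f x)) \<and> bvar f \<longrightarrow>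
     (\<exists>k. \<exists>y \<in> D (N \<^bold>\<rightarrow> one). (\<forall>i\<le>k. unit (ap y (nu i))) \<and>
       (\<forall>x. unit x \<longrightarrow> (\<exists>i\<le>k. \<bar>rv x - rv (ap y (nu i))\<bar> < rv (ap f (ap y (nu i)))))))"
    by (simp only: uf bf pf y1 y2 simp_thms cong: conj_cong imp_cong ball_cong bex_cong)
  also have "\<dots> \<longleftrightarrow> ?R"
  proof -
    have "(\<forall>f \<in> D (one \<^bold>\<rightarrow> one). ufun f \<and> P f \<longrightarrow> Q f) \<longleftrightarrow> (\<forall>f. ufun f \<and> P f \<longrightarrow> Q f)" for P Q using ufun_D by blast
    then show ?thesis by this
  qed
  finally show ?thesis .
qed

lemma sat_NIN: "sat [] NIN \<longleftrightarrow> \<not> (\<exists>Y \<in> D two. \<forall>x y. unit x \<and> unit y \<longrightarrow> (ap Y x = ap Y y \<longleftrightarrow> rv x = rv y))" (is "_ \<longleftrightarrow> ?R")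
proof -
  have u: "V [Y, x, y] (in_unit (bv (Suc 0))) \<longleftrightarrow> unit x" "V [Y, x, y] (in_unit (bv (Suc (Suc 0)))) \<longleftrightarrow> unit y" if "x \<in> D one" "y \<in> D one" for Y x y
    using that V_in_unit[of "[Y, x, y]" "bv (Suc 0)"] V_in_unit[of "[Y, x, y]" "bv (Suc (Suc 0))"] by (simp_all add: Es)
  have e: "V [Y, x, y] (seq (bv (Suc 0)) =\<^sub>R seq (bv (Suc (Suc 0)))) \<longleftrightarrow> rv x = rv y" if "unit x" "unit y" for Y x y
    using that V_seq_eq[of "[Y, x, y]" "bv (Suc 0)" "bv (Suc (Suc 0))"] by (simp add: Es unit_real)
  have a: "V [Y, x, y] (bv 0 \<^bold>\<cdot> bv (Suc 0) \<^bold>= bv 0 \<^bold>\<cdot> bv (Suc (Suc 0))) \<longleftrightarrow> ap Y x = ap Y y" for Y x y by (simp add: V_simps Es)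
  have "sat [] NIN \<longleftrightarrow> \<not> (\<exists>Y \<in> D two.
     (\<forall>x \<in> D one. \<forall>y \<in> D one. V [Y, x, y] (in_unit (bv (Suc 0))) \<and> V [Y, x, y] (in_unit (bv (Suc (Suc 0)))) \<and> V [Y, x, y] (seq (bv (Suc 0)) =\<^sub>R seq (bv (Suc (Suc 0)))) \<longrightarrow>
       V [Y, x, y] (bv 0 \<^bold>\<cdot> bv (Suc 0) \<^bold>= bv 0 \<^bold>\<cdot> bv (Suc (Suc 0)))) \<and>
     (\<forall>x \<in> D one. \<forall>y \<in> D one. V [Y, x, y] (in_unit (bv (Suc 0))) \<and> V [Y, x, y] (in_unit (bv (Suc (Suc 0)))) \<and> V [Y, x, y] (bv 0 \<^bold>\<cdot> bv (Suc 0) \<^bold>= bv 0 \<^bold>\<cdot> bv (Suc (Suc 0))) \<longrightarrow>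
       V [Y, x, y] (seq (bv (Suc 0)) =\<^sub>R seq (bv (Suc (Suc 0))))))"
    by (simp only: NIN_def sat_sentence V_allq V_simps(1-5) V_exq append_Nil append_Cons list.size add_0_right add_Suc_right plus_nat.add_0 One_nat_def)
  also have "\<dots> \<longleftrightarrow> ?R" using u e a unit_D by (smt (verit))
  finally show ?thesis .
qed

end

section \<open>Decidability of comparisons of reals\<close>

context nmodel
begin

text \<open>Rationals are no objects of the language; they are definable through terms for the two
  parts of the numerator and for the denominator.\<close>

definition intlq :: "ty list \<Rightarrow> ('u list \<Rightarrow> 'n qt) \<Rightarrow> bool" where
  "intlq \<Delta> Q \<longleftrightarrow> (\<exists>F G H. intln \<Delta> F \<and> intln \<Delta> G \<and> intln \<Delta> H \<and> (\<forall>\<rho>. 0 < H \<rho> \<and> Q \<rho> = (nq (F \<rho>) - nq (G \<rho>)) / nq (H \<rho>)))"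

definition fr :: "'n \<Rightarrow> 'n \<Rightarrow> 'n qt" where "fr a k = nq a / nq (k + 1)"

lemma intlq_qv: "intln \<Delta> F \<Longrightarrow> intln \<Delta> G \<Longrightarrow> intln \<Delta> H \<Longrightarrow> intlq \<Delta> (\<lambda>\<rho>. qv (F \<rho>) (G \<rho>) (H \<rho>))"
  unfolding intlq_def qv_def
  by (rule exI[of _ F], rule exI[of _ G], rule exI[of _ "\<lambda>\<rho>. H \<rho> + 1"])
    (intro conjI allI intln_add[OF _ intln_const] pos_Suc refl)
lemma intlq_fr: "intln \<Delta> F \<Longrightarrow> intln \<Delta> H \<Longrightarrow> intlq \<Delta> (\<lambda>\<rho>. fr (F \<rho>) (H \<rho>))"
  using intlq_qv[OF _ intln_const[of _ 0], of \<Delta> F H] by (simp add: qv_def fr_def)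
lemma intlq_ip: assumes "intln \<Delta> F" shows "intlq \<Delta> (\<lambda>\<rho>. ip (F \<rho>))"
  unfolding intlq_def ip_def
  by (rule exI[of _ "\<lambda>_. 1"], rule exI[of _ "\<lambda>_. 0"], rule exI[of _ "\<lambda>\<rho>. p2 (F \<rho>)"])
    (auto intro: N_rules assms)
lemma qt_qv: obtains a b k where "q = qv a b (k::'n)"
proof -
  obtain a b c where c: "0 < c" "q = (nq a - nq b) / nq c" by (rule qt_cases)
  then have "c = (c - 1) + 1" by (simp add: less_iff_succ_less_eq)
  then show ?thesis using c(2) that[of a b "c - 1"] by (simp add: qv_def)
qed
lemma intlq_add: assumes "intlq \<Delta> P" "intlq \<Delta> Q" shows "intlq \<Delta> (\<lambda>\<rho>. P \<rho> + Q \<rho>)"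
proof -
  obtain F G H where P: "intln \<Delta> F" "intln \<Delta> G" "intln \<Delta> H" "\<And>\<rho>. 0 < H \<rho> \<and> P \<rho> = (nq (F \<rho>) - nq (G \<rho>)) / nq (H \<rho>)"
    using assms(1) unfolding intlq_def by blast
  obtain F' G' H' where Q: "intln \<Delta> F'" "intln \<Delta> G'" "intln \<Delta> H'" "\<And>\<rho>. 0 < H' \<rho> \<and> Q \<rho> = (nq (F' \<rho>) - nq (G' \<rho>)) / nq (H' \<rho>)"
    using assms(2) unfolding intlq_def by blast
  have *: "0 < H \<rho> * H' \<rho> \<and> P \<rho> + Q \<rho> = (nq (F \<rho> * H' \<rho> + F' \<rho> * H \<rho>) - nq (G \<rho> * H' \<rho> + G' \<rho> * H \<rho>)) / nq (H \<rho> * H' \<rho>)" for \<rho>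
  proof -
    have nz: "nq (H \<rho>) \<noteq> 0" "nq (H' \<rho>) \<noteq> 0" "0 < H \<rho> * H' \<rho>" using P(4)[of \<rho>] Q(4)[of \<rho>] by auto
    have e: "P \<rho> = (nq (F \<rho>) - nq (G \<rho>)) / nq (H \<rho>)" "Q \<rho> = (nq (F' \<rho>) - nq (G' \<rho>)) / nq (H' \<rho>)" using P(4) Q(4) by blast+
    show ?thesis using nz unfolding e by (simp add: add_frac_eq algebra_simps)
  qed
  show ?thesis unfolding intlq_def
    by (rule exI[of _ "\<lambda>\<rho>. F \<rho> * H' \<rho> + F' \<rho> * H \<rho>"], rule exI[of _ "\<lambda>\<rho>. G \<rho> * H' \<rho> + G' \<rho> * H \<rho>"], rule exI[of _ "\<lambda>\<rho>. H \<rho> * H' \<rho>"])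
      (intro conjI allI intln_add intln_mult P(1-3) Q(1-3) *)
qed
lemma intlq_minus: assumes "intlq \<Delta> P" shows "intlq \<Delta> (\<lambda>\<rho>. - P \<rho>)"
proof -
  obtain F G H where P: "intln \<Delta> F" "intln \<Delta> G" "intln \<Delta> H" "\<And>\<rho>. 0 < H \<rho> \<and> P \<rho> = (nq (F \<rho>) - nq (G \<rho>)) / nq (H \<rho>)"
    using assms(1) unfolding intlq_def by blast
  have *: "0 < H \<rho> \<and> - P \<rho> = (nq (G \<rho>) - nq (F \<rho>)) / nq (H \<rho>)" for \<rho>
    using P(4)[of \<rho>] by (simp add: minus_divide_left)
  show ?thesis unfolding intlq_def
    by (rule exI[of _ G], rule exI[of _ F], rule exI[of _ H]) (intro conjI allI P(1-3) *)
qed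
lemma intlq_diff: "intlq \<Delta> P \<Longrightarrow> intlq \<Delta> Q \<Longrightarrow> intlq \<Delta> (\<lambda>\<rho>. P \<rho> - Q \<rho>)"
  using intlq_add[OF _ intlq_minus, of \<Delta> P Q] by simp
lemma dec_qless: assumes "intlq \<Delta> P" "intlq \<Delta> Q" shows "dec \<Delta> (\<lambda>\<rho>. P \<rho> < Q \<rho>)"
proof -
  obtain F G H where P: "intln \<Delta> F" "intln \<Delta> G" "intln \<Delta> H" "\<And>\<rho>. 0 < H \<rho> \<and> P \<rho> = (nq (F \<rho>) - nq (G \<rho>)) / nq (H \<rho>)"
    using assms(1) unfolding intlq_def by blast
  obtain F' G' H' where Q: "intln \<Delta> F'" "intln \<Delta> G'" "intln \<Delta> H'" "\<And>\<rho>. 0 < H' \<rho> \<and> Q \<rho> = (nq (F' \<rho>) - nq (G' \<rho>)) / nq (H' \<rho>)"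
    using assms(2) unfolding intlq_def by blast
  have "P \<rho> < Q \<rho> \<longleftrightarrow> F \<rho> * H' \<rho> + G' \<rho> * H \<rho> < F' \<rho> * H \<rho> + G \<rho> * H' \<rho>" for \<rho>
    using P(4)[of \<rho>] Q(4)[of \<rho>] frac_less_iff by simp
  then show ?thesis by (simp only:) (rule dec_lessn N_rules P(1-3) Q(1-3))+
qed
lemma dec_qle: "intlq \<Delta> P \<Longrightarrow> intlq \<Delta> Q \<Longrightarrow> dec \<Delta> (\<lambda>\<rho>. P \<rho> \<le> Q \<rho>)"
  unfolding not_less[symmetric] by (intro dec_not dec_qless)
lemma ex_qt: "(\<exists>q. P q) \<longleftrightarrow> (\<exists>a b k. P (qv a b k))"
  by (metis qt_qv)
lemma dec_exq: assumes "dec (N # N # N # \<Delta>) (\<lambda>\<rho>. P (qv (num (hd (tl (tl \<rho>)))) (num (hd (tl \<rho>))) (num (hd \<rho>))) (tl (tl (tl \<rho>))))"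
  shows "dec \<Delta> (\<lambda>\<rho>. \<exists>q. P q \<rho>)"
  unfolding ex_qt by (intro dec_exn) (rule assms)
lemma intln_code: "intln \<Delta> F \<Longrightarrow> intln \<Delta> G \<Longrightarrow> intln \<Delta> H \<Longrightarrow> intln \<Delta> (\<lambda>\<rho>. code (F \<rho>) (G \<rho>) (H \<rho>))"
  unfolding code_def pr_def by (rule N_rules | assumption)+

lemma intln_weaken: "intln \<Delta> F \<Longrightarrow> intln (\<sigma> # \<Delta>) (\<lambda>\<rho>. F (tl \<rho>))"
  unfolding intln_def by (rule intl_weaken)
lemma intlq_weaken: "intlq \<Delta> Q \<Longrightarrow> intlq (\<sigma> # \<Delta>) (\<lambda>\<rho>. Q (tl \<rho>))"
  unfolding intlq_def
proof (elim exE conjE)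
  fix F G H assume *: "intln \<Delta> F" "intln \<Delta> G" "intln \<Delta> H" "\<forall>\<rho>. 0 < H \<rho> \<and> Q \<rho> = (nq (F \<rho>) - nq (G \<rho>)) / nq (H \<rho>)"
  show "\<exists>F G H. intln (\<sigma> # \<Delta>) F \<and> intln (\<sigma> # \<Delta>) G \<and> intln (\<sigma> # \<Delta>) H \<and> (\<forall>\<rho>. 0 < H \<rho> \<and> Q (tl \<rho>) = (nq (F \<rho>) - nq (G \<rho>)) / nq (H \<rho>))"
    by (rule exI[of _ "\<lambda>\<rho>. F (tl \<rho>)"], rule exI[of _ "\<lambda>\<rho>. G (tl \<rho>)"], rule exI[of _ "\<lambda>\<rho>. H (tl \<rho>)"])
      (intro conjI allI intln_weaken *(1-3) *(4)[rule_format, THEN conjunct1] *(4)[rule_format, THEN conjunct2])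
qed

text \<open>Since \<open>dq\<close> takes its values outside the model, the approximation is decoded
  by quantifiers over numbers. For a real \<open>x\<close> this arithmetical predicate means
  \<open>rv x < rq q\<close>, and \<open>abv\<close> is its mirror image.\<close>

definition bel :: "'u \<Rightarrow> 'n qt \<Rightarrow> bool" where
  "bel x q \<longleftrightarrow> (\<exists>n u v w. sq x n = code u v w \<and> qv u v w + ip n < q)"
definition abv :: "'u \<Rightarrow> 'n qt \<Rightarrow> bool" where
  "abv x q \<longleftrightarrow> (\<exists>n u v w. sq x n = code u v w \<and> q + ip n < qv u v w)"

lemma dec_bel: assumes "intl \<Delta> one X" "intlq \<Delta> Q" shows "dec \<Delta> (\<lambda>\<rho>. bel (X \<rho>) (Q \<rho>))"
  unfolding bel_def
  by (rule dec_exn)+ (rule dec_conj dec_eqn dec_qless intlq_add intlq_qv intlq_ip intln_code intln_sq intln_num intl_vs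
      intlq_weaken[OF intlq_weaken[OF intlq_weaken[OF intlq_weaken[OF assms(2)]]]]
      intl_weaken[OF intl_weaken[OF intl_weaken[OF intl_weaken[OF assms(1)]]]])+
lemma dec_abv: assumes "intl \<Delta> one X" "intlq \<Delta> Q" shows "dec \<Delta> (\<lambda>\<rho>. abv (X \<rho>) (Q \<rho>))"
  unfolding abv_def
  by (rule dec_exn)+ (rule dec_conj dec_eqn dec_qless intlq_add intlq_qv intlq_ip intln_code intln_sq intln_num intl_vs
      intlq_weaken[OF intlq_weaken[OF intlq_weaken[OF intlq_weaken[OF assms(2)]]]]
      intl_weaken[OF intl_weaken[OF intl_weaken[OF intl_weaken[OF assms(1)]]]])+

lemma rv_bounds: assumes "isreal x" shows "rv x \<le> rq (rs x n + ip n)" "rq (rs x n - ip n) \<le> rv x"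
proof -
  have f: "fast (rs x)" by (rule isreal_fast[OF assms])
  have c: "cauchy (rs x)" by (rule fast_cauchy[OF f])
  have e: "\<forall>\<^sub>F m in at_top. n \<le> m" by (rule eventually_ge_at_top)
  show "rv x \<le> rq (rs x n + ip n)"
  proof (rule ccontr)
    assume "\<not> rv x \<le> rq (rs x n + ip n)"
    then obtain r where r: "r > 0" "\<forall>\<^sub>F m in at_top. rs x n + ip n + r < rs x m"
      using Creal_less[OF cauchy_const c] by (auto simp: not_le rv_def rq_def)
    from e r(2) have "\<forall>\<^sub>F m::'n in at_top. False"
    proof eventually_elim
      case (elim m)
      then have "rs x m \<le> rs x n + ip n" using fastD[OF f, of n m] by (simp add: abs_le_iff)
      then show ?case using elim(2) r(1) by simp
    qed
    then show False by (simp add: trivial_limit_at_top_linorder)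
  qed
  show "rq (rs x n - ip n) \<le> rv x"
  proof (rule ccontr)
    assume "\<not> rq (rs x n - ip n) \<le> rv x"
    then obtain r where r: "r > 0" "\<forall>\<^sub>F m in at_top. rs x m + r < rs x n - ip n"
      using Creal_less[OF c cauchy_const] by (auto simp: not_le rv_def rq_def simp del: rq_simps)
    from e r(2) have "\<forall>\<^sub>F m::'n in at_top. False"
    proof eventually_elim
      case (elim m)
      then have "rs x n - ip n \<le> rs x m" using fastD[OF f, of n m] by (simp add: abs_le_iff)
      then show ?case using elim(2) r(1) by simp
    qed
    then show False by (simp add: trivial_limit_at_top_linorder)
  qed
qed

lemma rs_code: "isreal x \<Longrightarrow> \<exists>u v w. sq x n = code u v w \<and> rs x n = qv u v w"
  unfolding isreal_def rs_def isc_def by (metis dq_code)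

lemma rv_less: assumes "isreal x" shows "rv x < rq q \<longleftrightarrow> (\<exists>n. rs x n + ip n < q)"
proof
  assume "rv x < rq q"
  then obtain p where p: "rv x < rq p" "rq p < rq q" using creal_dense by blast
  then have "0 < (q - p) / 2" by simp
  then obtain n where n: "ip n < (q - p) / 2" using qt_arch[of _ 0] by blast
  have "rq (rs x n - ip n) < rq p" using rv_bounds(2)[OF assms, of n] p(1) by order
  then have "rs x n - ip n < p" by (simp only: rq_less)
  then have "rs x n < p + ip n" by (simp add: algebra_simps)
  then have "rs x n + ip n < p + (ip n + ip n)" by simp
  also have "\<dots> < q" using n by (simp add: field_simps)
  finally show "\<exists>n. rs x n + ip n < q" by blast
next
  assume "\<exists>n. rs x n + ip n < q"
  then obtain n where "rs x n + ip n < q" by blast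
  then have "rq (rs x n + ip n) < rq q" by (simp only: rq_less)
  then show "rv x < rq q" using rv_bounds(1)[OF assms, of n] by order
qed

lemma less_rv: assumes "isreal x" shows "rq q < rv x \<longleftrightarrow> (\<exists>n. q + ip n < rs x n)"
proof
  assume "rq q < rv x"
  then obtain p where p: "rq q < rq p" "rq p < rv x" using creal_dense by blast
  then have "0 < (p - q) / 2" by simp
  then obtain n where n: "ip n < (p - q) / 2" using qt_arch[of _ 0] by blast
  have "rq p < rq (rs x n + ip n)" using rv_bounds(1)[OF assms, of n] p(2) by order
  then have "p < rs x n + ip n" by (simp only: rq_less)
  moreover have "q + (ip n + ip n) < p" using n by (simp add: field_simps)
  ultimately have "q + ip n < rs x n" by simp
  then show "\<exists>n. q + ip n < rs x n" by blast
next
  assume "\<exists>n. q + ip n < rs x n"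
  then obtain n where "q < rs x n - ip n" by (auto simp: algebra_simps)
  then have "rq q < rq (rs x n - ip n)" by (simp only: rq_less)
  then show "rq q < rv x" using rv_bounds(2)[OF assms, of n] by order
qed

lemma bel_iff: "isreal x \<Longrightarrow> bel x q \<longleftrightarrow> rv x < rq q"
  unfolding bel_def rv_less using rs_code code_inj by (metis (no_types, lifting))
lemma abv_iff: "isreal x \<Longrightarrow> abv x q \<longleftrightarrow> rq q < rv x"
  unfolding abv_def less_rv using rs_code code_inj by (metis (no_types, lifting))

text \<open>The rational \<open>p\<close> divides the bound between the two summands, so that each
  of them is compared with a rational only.\<close>

definition sumless :: "'u \<Rightarrow> 'u \<Rightarrow> 'n qt \<Rightarrow> bool" where
  "sumless x y q \<longleftrightarrow> (\<exists>p. bel x p \<and> bel y (q - p))"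

lemma sumless_iff: assumes "isreal x" "isreal y" shows "sumless x y q \<longleftrightarrow> rv x + rv y < rq q"
proof
  assume "sumless x y q"
  then obtain p where "rv x < rq p" "rv y < rq (q - p)" using assms by (auto simp: sumless_def bel_iff)
  then have "rv x + rv y < rq p + rq (q - p)" by (rule add_strict_mono)
  then show "rv x + rv y < rq q" by simp
next
  assume "rv x + rv y < rq q"
  then have "rv x < rq q - rv y" by (simp add: algebra_simps)
  then obtain p where p: "rv x < rq p" "rq p < rq q - rv y" using creal_dense by blast
  then have "rv y < rq (q - p)" by (simp add: algebra_simps)
  then show "sumless x y q" using p assms by (auto simp: sumless_def bel_iff)
qed

text \<open>The rational \<open>r\<close> separates \<open>\<bar>q - y\<bar> + e\<close> from
  \<open>z\<close>. Once it is there, the absolute value unfolds into two comparisons of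
  \<open>y\<close> with rationals.\<close>

definition within :: "'n qt \<Rightarrow> 'u \<Rightarrow> 'u \<Rightarrow> 'n qt \<Rightarrow> bool" where
  "within q y z e \<longleftrightarrow> (\<exists>r. abv z r \<and> abv y (q + e - r) \<and> bel y (q - e + r))"

lemma within_iff: assumes "isreal y" "isreal z" shows "within q y z e \<longleftrightarrow> \<bar>rq q - rv y\<bar> + rq e < rv z"
proof
  assume "within q y z e"
  then obtain r where "rq r < rv z" "rq (q + e - r) < rv y" "rv y < rq (q - e + r)" using assms by (auto simp: within_def bel_iff abv_iff)
  then show "\<bar>rq q - rv y\<bar> + rq e < rv z" by (simp add: abs_if split: if_splits)
next
  assume "\<bar>rq q - rv y\<bar> + rq e < rv z"
  then obtain r where "\<bar>rq q - rv y\<bar> + rq e < rq r" "rq r < rv z" using creal_dense by blast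
  then have "rq r < rv z" "rq (q + e - r) < rv y" "rv y < rq (q - e + r)" by (auto simp: abs_if split: if_splits)
  then show "within q y z e" using assms by (auto simp: within_def bel_iff abv_iff)
qed

lemma intl_weaken3: "intl \<Delta> \<tau> F \<Longrightarrow> intl (\<sigma>1 # \<sigma>2 # \<sigma>3 # \<Delta>) \<tau> (\<lambda>\<rho>. F (tl (tl (tl \<rho>))))"
  by (rule intl_weaken[OF intl_weaken[OF intl_weaken]])
lemma intlq_weaken3: "intlq \<Delta> F \<Longrightarrow> intlq (\<sigma>1 # \<sigma>2 # \<sigma>3 # \<Delta>) (\<lambda>\<rho>. F (tl (tl (tl \<rho>))))"
  by (rule intlq_weaken[OF intlq_weaken[OF intlq_weaken]])

lemma dec_sumless: assumes "intl \<Delta> one X" "intl \<Delta> one Y" "intlq \<Delta> Q" shows "dec \<Delta> (\<lambda>\<rho>. sumless (X \<rho>) (Y \<rho>) (Q \<rho>))"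
  unfolding sumless_def
  by (rule dec_exq) (rule dec_conj dec_bel intlq_diff intlq_qv intln_num intl_vs assms(1,2)[THEN intl_weaken3] assms(3)[THEN intlq_weaken3])+
lemma dec_within: assumes "intl \<Delta> one X" "intl \<Delta> one Y" "intlq \<Delta> Q" "intlq \<Delta> P" shows "dec \<Delta> (\<lambda>\<rho>. within (Q \<rho>) (X \<rho>) (Y \<rho>) (P \<rho>))"
  unfolding within_def
  by (rule dec_exq) (rule dec_conj dec_bel dec_abv intlq_diff intlq_add intlq_qv intln_num intl_vs assms(1,2)[THEN intl_weaken3] assms(3,4)[THEN intlq_weaken3])+

section \<open>Rational points and suprema in the unit interval\<close>

definition cr :: "'n \<Rightarrow> 'n \<Rightarrow> 'u" where "cr a k = ap (cs (PiC N N)) (nu (code a 0 k))"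

lemma intl_cr: "intln \<Delta> F \<Longrightarrow> intln \<Delta> G \<Longrightarrow> intl \<Delta> one (\<lambda>\<rho>. cr (F \<rho>) (G \<rho>))"
  unfolding cr_def by (rule intl_ap[OF intl_const[OF cs_types(5)]]) (rule intl_nu intln_code N_rules | assumption)+

lemma cr: "isreal (cr a k)" "rv (cr a k) = rq (fr a k)"
proof -
  have s: "sq (cr a k) n = code a 0 k" for n by (simp add: sq_def cr_def Pi_ap)
  have "cr a k \<in> D one" unfolding cr_def by (meson ap_closed cs_types nu_N)
  then show "isreal (cr a k)" by (simp add: isreal_def s rs_def)
  show "rv (cr a k) = rq (fr a k)" by (simp add: rv_def rs_def[abs_def] s rq_def qv_def fr_def)
qed

lemma nq_Suc_pos [simp]: "0 < nq (k::'n) + 1" "nq k + 1 \<noteq> 0"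
  using nq_pos_iff(1)[of "k + 1"] by (auto simp del: nq_pos_iff)

lemma fr_simps [simp]: "fr 0 k = 0" "fr 1 0 = 1" "0 \<le> fr a k" "fr a k = 0 \<longleftrightarrow> a = 0"
  by (auto simp: fr_def zero_le_divide_iff)
lemma fr_le_1: "fr a k \<le> 1 \<longleftrightarrow> a \<le> k + 1"
proof -
  have "0 < nq (k + 1)" by (simp only: nq_pos_iff pos_Suc)
  then show ?thesis unfolding fr_def by (simp only: divide_le_eq_1_pos nq_simps(6))
qed
lemma unit_cr: "a \<le> k + 1 \<Longrightarrow> unit (cr a k)"
  using rq_le[of 0 "fr a k"] rq_le[of "fr a k" 1] by (simp add: unit_def cr fr_le_1)

lemma fr_cases: assumes "0 \<le> q" obtains a k where "q = fr a k"
proof -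
  obtain a b k where q: "q = qv a b k" by (rule qt_qv)
  have "0 < nq (k + 1)" by (simp only: nq_pos_iff pos_Suc)
  then have "b \<le> a" using assms unfolding q qv_def by (simp only: zero_le_divide_iff) (auto simp: not_less[symmetric])
  then have "a = (a - b) + b" by simp
  then have "nq a - nq b = nq (a - b)" using nq_simps(3)[of "a - b" b] by (simp add: algebra_simps)
  then show ?thesis using that[of "a - b" k] by (simp add: q qv_def fr_def)
qed

lemma fr_dense: assumes "0 \<le> x" "x < y" "y \<le> 1" obtains a k where "a \<le> k + 1" "x < rq (fr a k)" "rq (fr a k) < y"
proof -
  obtain q where q: "x < rq q" "rq q < y" using creal_dense assms(2) by blast
  have "0 < rq q" "rq q < 1" using assms q by (auto intro: le_less_trans less_le_trans)
  then have "0 \<le> q" "q \<le> 1" using rq_less[of 0 q] rq_less[of q 1] by auto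
  moreover then obtain a k where "q = fr a k" using fr_cases by blast
  ultimately show ?thesis using that q by (simp add: fr_le_1)
qed

lemma sup_exists:
  assumes dec: "\<And>\<Delta> F G H. intln \<Delta> F \<Longrightarrow> intln \<Delta> G \<Longrightarrow> intln \<Delta> H \<Longrightarrow> dec \<Delta> (\<lambda>\<rho>. A (F \<rho>) (G \<rho>) (H \<rho>))"
    and zero: "\<And>i. A i 0 0"
  shows "\<exists>c \<in> D (N \<^bold>\<rightarrow> one). \<forall>i. unit (ap c (nu i)) \<and>
    (\<forall>a k. a \<le> k + 1 \<and> A i a k \<longrightarrow> rq (fr a k) \<le> rv (ap c (nu i))) \<and>
    (\<forall>q. rq q < rv (ap c (nu i)) \<longrightarrow> (\<exists>a k. a \<le> k + 1 \<and> A i a k \<and> q < fr a k))"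
proof -
  define S where "S i q \<longleftrightarrow> (\<exists>a k. a \<le> k + 1 \<and> A i a k \<and> q \<le> fr a k)" for i q
  define P where "P i n m \<longleftrightarrow> (\<exists>j w. w + 1 = p2 n \<and> m = code j 0 w \<and> S i (fr j w) \<and> \<not> S i (fr (j + 1) w))" for i n m
  have dS: "dec \<Delta> (\<lambda>\<rho>. S (F \<rho>) (Q \<rho>))" if "intln \<Delta> F" "intlq \<Delta> Q" for \<Delta> F Q
    unfolding S_def
    by (rule dec_exn)+ (rule dec_conj dec_len dec dec_qle intlq_fr N_rules intl_vs that(1)[THEN intln_weaken, THEN intln_weaken] that(2)[THEN intlq_weaken, THEN intlq_weaken])+
  have dP: "dec [N, N, N] (\<lambda>\<rho>. P (num (hd (tl (tl \<rho>)))) (num (hd (tl \<rho>))) (num (hd \<rho>)))"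
    unfolding P_def
    by (rule dec_exn)+ (rule dec_conj dec_not dec_eqn dS intln_code intlq_fr N_rules intl_vs)+
  have ex: "\<exists>m. P i n m" for i n
  proof -
    define w where "w = p2 n - 1"
    have w: "w + 1 = p2 n" using p2_pos[of n] by (simp add: w_def less_iff_succ_less_eq)
    have "\<exists>j. S i (fr j w) \<and> \<not> S i (fr (j + 1) w)"
    proof (rule ccontr)
      assume *: "\<not> (\<exists>j. S i (fr j w) \<and> \<not> S i (fr (j + 1) w))"
      have "S i (fr j w)" for j
      proof (rule ind[where P = "\<lambda>j. S i (fr j w)"])
        show "dec [N] (\<lambda>\<rho>. S i (fr (num (hd \<rho>)) w))" by (rule dS intlq_fr N_rules intl_vs)+
        show "S i (fr 0 w)" unfolding S_def using zero[of i] by (intro exI[of _ 0]) simp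
      qed (use * in blast)
      from this[of "w + 1 + 1"] obtain a k where a: "a \<le> k + 1" "fr (w + 1 + 1) w \<le> fr a k" unfolding S_def by blast
      then have "fr (w + 1 + 1) w \<le> 1" using fr_le_1[of a k] by auto
      then show False by (simp add: fr_le_1)
    qed
    then show ?thesis unfolding P_def using w by blast
  qed
  obtain c where c: "c \<in> D (N \<^bold>\<rightarrow> one)" "\<And>i n. P i n (sq (ap c (nu i)) n)" using choice2[OF dP ex] by blast
  show ?thesis
  proof (intro bexI[OF _ c(1)] allI)
    fix i
    let ?x = "ap c (nu i)"
    have x: "?x \<in> D one" using c(1) ap_closed by auto
    have n: "isc (sq ?x n) \<and> S i (rs ?x n) \<and> \<not> S i (rs ?x n + ip n)" for n
    proof -
      obtain j w where jw: "w + 1 = p2 n" "sq ?x n = code j 0 w" "S i (fr j w)" "\<not> S i (fr (j + 1) w)"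
        using c(2)[of i n] unfolding P_def by blast
      have "rs ?x n = fr j w" by (simp add: rs_def jw(2) qv_def fr_def)
      moreover have "fr (j + 1) w = fr j w + ip n" unfolding fr_def ip_def jw(1) by (simp add: add_divide_distrib)
      ultimately show ?thesis using jw by simp
    qed
    \<comment> \<open>The point of \<open>A i\<close> that witnesses the \<open>n\<close>-th
      approximation lies below \<open>rs ?x m + ip m\<close>, which is an upper bound. Used in both
      directions, this gives the rate of convergence.\<close>
    have le: "rs ?x n < rs ?x m + ip m" for n m
    proof -
      obtain a k where "a \<le> k + 1" "A i a k" "rs ?x n \<le> fr a k" using n[of n] unfolding S_def by blast
      moreover have "\<not> rs ?x m + ip m \<le> fr a k" using n[of m] calculation unfolding S_def by blast
      ultimately show ?thesis by order
    qed
    have real: "isreal ?x" unfolding isreal_def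
    proof (intro conjI allI x)
      fix m l
      show "isc (sq ?x m)" using n by blast
      have "ip (m + l) \<le> ip m" by (rule ip_mono) simp
      then show "\<bar>rs ?x m - rs ?x (m + l)\<bar> < ip m" using le[of m "m + l"] le[of "m + l" m] by (simp add: abs_less_iff algebra_simps)
    qed
    have up: "rq (fr a k) \<le> rv ?x" if "a \<le> k + 1" "A i a k" for a k
    proof (rule ccontr)
      assume "\<not> rq (fr a k) \<le> rv ?x"
      then obtain m where "rs ?x m + ip m < fr a k" using rv_less[OF real] by (auto simp: not_le)
      then have "S i (rs ?x m + ip m)" unfolding S_def using that less_imp_le by blast
      then show False using n by blast
    qed
    have lo: "\<exists>a k. a \<le> k + 1 \<and> A i a k \<and> q < fr a k" if qx: "rq q < rv ?x" for q
    proof -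
      obtain m where m: "q + ip m < rs ?x m" using less_rv[OF real, THEN iffD1, OF qx] by blast
      obtain a k where ak: "a \<le> k + 1" "A i a k" "rs ?x m \<le> fr a k" using n[of m] unfolding S_def by blast
      have "q < fr a k" by (rule less_trans[OF _ less_le_trans[OF m ak(3)]]) simp
      then show ?thesis using ak by blast
    qed
    have "0 \<le> rv ?x" using up[of 0 0] zero by simp
    moreover have "rv ?x \<le> 1"
    proof (rule ccontr)
      assume "\<not> rv ?x \<le> 1"
      then obtain a k where "a \<le> k + 1" "1 < fr a k" using lo[of 1] by auto
      then show False using fr_le_1[of a k] by auto
    qed
    ultimately show "unit ?x \<and> (\<forall>a k. a \<le> k + 1 \<and> A i a k \<longrightarrow> rq (fr a k) \<le> rv ?x) \<and>
      (\<forall>q. rq q < rv ?x \<longrightarrow> (\<exists>a k. a \<le> k + 1 \<and> A i a k \<and> q < fr a k))"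
      unfolding unit_def using real up lo by blast
  qed
qed

end

section \<open>From the Jordan decomposition to finite subcovers\<close>

text \<open>For moving from the supremum \<open>z\<close> to a rational point \<open>p\<close> near
  it: one \<open>e\<close> pays for the move, the other for the margin \<open>d\<close>.\<close>

lemma abs_slack: "\<bar>p - z\<bar> \<le> e \<Longrightarrow> \<bar>z - c\<bar> + (e + e) < f \<Longrightarrow> d \<le> d' \<Longrightarrow> d' < e \<Longrightarrow> \<bar>p - c\<bar> + d < f"
  for p :: "'a::linordered_idom"
  by (simp add: abs_if split: if_splits)

context nmodel
begin

lemma umonoD: "umono f \<Longrightarrow> unit x \<Longrightarrow> unit y \<Longrightarrow> rv x \<le> rv y \<Longrightarrow> rv (ap f x) \<le> rv (ap f y)"
  unfolding umono_def by blast

text \<open>The function \<open>F = g + h + id\<close> is strictly increasing and dominates the oscillation of \<open>f = g - h\<close>.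
  As centers of the covering balls one takes the points \<open>sup {q. F q < s}\<close> for rational levels \<open>s\<close>; they
  form an internal sequence, although \<open>f\<close> may have discontinuities at irrational points.\<close>

lemma centers:
  assumes f: "ufun f" "\<And>x. unit x \<Longrightarrow> 0 < rv (ap f x)" and g: "ufun g" "umono g" and h: "ufun h" "umono h"
    and fgh: "\<And>x. unit x \<Longrightarrow> rv (ap f x) = rv (ap g x) - rv (ap h x)"
  shows "\<exists>c \<in> D (N \<^bold>\<rightarrow> one). (\<forall>i. unit (ap c (nu i))) \<and>
    (\<forall>x. unit x \<longrightarrow> (\<exists>i. \<bar>rv x - rv (ap c (nu i))\<bar> < rv (ap f (ap c (nu i)))))"
proof -
  \<comment> \<open>The index codes a rational level \<open>s\<close>, and the second disjunct says
    that \<open>F\<close> is below \<open>s\<close> at the rational point. The point 0 is added so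
    that the set is never empty.\<close>
  define A where "A i a k \<longleftrightarrow> a = 0 \<or> (\<exists>u v w. i = code u v w \<and> sumless (ap g (cr a k)) (ap h (cr a k)) (qv u v w - fr a k))" for i a k
  have dA: "dec \<Delta> (\<lambda>\<rho>. A (F \<rho>) (G \<rho>) (H \<rho>))" if "intln \<Delta> F" "intln \<Delta> G" "intln \<Delta> H" for \<Delta> F G H
    unfolding A_def
    by (rule dec_disj, rule dec_eqn[OF that(2) intln_const], (rule dec_exn)+)
      (rule dec_conj dec_eqn dec_sumless intlq_diff intlq_qv intlq_fr intln_code intl_cr
        intl_ap[OF intl_const[OF ufun_D[OF g(1)]]] intl_ap[OF intl_const[OF ufun_D[OF h(1)]]]
        intln_num intl_vs that[THEN intln_weaken, THEN intln_weaken, THEN intln_weaken])+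
  obtain c where c: "c \<in> D (N \<^bold>\<rightarrow> one)" and cu: "\<And>i. unit (ap c (nu i))"
    and up: "\<And>i a k. a \<le> k + 1 \<Longrightarrow> A i a k \<Longrightarrow> rq (fr a k) \<le> rv (ap c (nu i))"
    and lo: "\<And>i q. rq q < rv (ap c (nu i)) \<Longrightarrow> \<exists>a k. a \<le> k + 1 \<and> A i a k \<and> q < fr a k"
  proof -
    have "A i 0 0" for i by (simp add: A_def)
    from sup_exists[where A = A, OF dA this] show ?thesis using that by blast
  qed
  define F where "F x = rv (ap g x) + rv (ap h x) + rv x" for x
  have A_iff: "A (code u v w) a k \<longleftrightarrow> a = 0 \<or> F (cr a k) < rq (qv u v w)" if "a \<le> k + 1" for u v w a k
  proof -
    have "sumless (ap g (cr a k)) (ap h (cr a k)) (qv u v w - fr a k) \<longleftrightarrow> F (cr a k) < rq (qv u v w)"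
      using unit_cr[OF that] g h by (subst sumless_iff) (auto simp: ufun_real F_def cr algebra_simps)
    then show ?thesis unfolding A_def code_inj by blast
  qed
  have F_mono: "F x \<le> F y" if "unit x" "unit y" "rv x \<le> rv y" for x y
    unfolding F_def using umonoD[OF g(2) that] umonoD[OF h(2) that] that(3) by (intro add_mono)
  have F_strict: "F x < F y" if "unit x" "unit y" "rv x < rv y" for x y
    unfolding F_def using umonoD[OF g(2) that(1,2)] umonoD[OF h(2) that(1,2)] that(3) by (intro add_le_less_mono add_mono) auto
  \<comment> \<open>A point of the level set beyond \<open>x\<close> would have a value of
    \<open>F\<close> below \<open>s\<close>, hence below \<open>F x\<close>, against the
    monotonicity of \<open>F\<close>.\<close>
  have c_le: "rv (ap c (nu (code u v w))) \<le> rv x" if x: "unit x" and s: "rq (qv u v w) < F x" for x u v w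
  proof (rule ccontr)
    assume "\<not> ?thesis"
    then obtain q where q: "rv x < rq q" "rq q < rv (ap c (nu (code u v w)))" using creal_dense by (auto simp: not_le)
    then obtain a k where ak: "a \<le> k + 1" "A (code u v w) a k" "q < fr a k" using lo by blast
    have x_less: "rv x < rv (cr a k)" using q(1) ak(3) by (simp add: cr) (metis less_trans rq_less)
    have "a \<noteq> 0"
    proof
      assume "a = 0"
      then have "rv x < 0" using x_less by (simp add: cr)
      then show False using x by (simp add: unit_def)
    qed
    then have "F (cr a k) < rq (qv u v w)" using ak A_iff by blast
    then have "F (cr a k) < F x" using s by order
    then show False using F_mono[OF x unit_cr[OF ak(1)]] x_less by simp
  qed
  have "\<exists>i. \<bar>rv x - rv (ap c (nu i))\<bar> < rv (ap f (ap c (nu i)))" if x: "unit x" for x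
  proof -
    \<comment> \<open>One \<open>d\<close> will bound the distance from \<open>x\<close> to the
      center, the other the loss of \<open>f\<close> on the way.\<close>
    obtain d where d: "0 < d" "d + d < rv (ap f x)"
    proof -
      obtain q where q: "0 < rq q" "rq q < rv (ap f x)" using creal_dense[OF f(2)[OF x]] by blast
      have "0 < rq (q / 2)" using q(1) rq_less[of 0 q] rq_less[of 0 "q / 2"] by simp
      moreover have "rq (q / 2) + rq (q / 2) < rv (ap f x)" using q(2) by (simp add: rq_simps(3)[symmetric])
      ultimately show ?thesis using that by blast
    qed
    obtain s where s: "F x - d < rq s" "rq s < F x" using creal_dense[of "F x - d" "F x"] d(1) by auto
    obtain u v w where uvw: "s = qv u v w" by (rule qt_qv)
    let ?c = "ap c (nu (code u v w))"
    have le: "rv ?c \<le> rv x" using c_le[OF x] s uvw by blast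
    show ?thesis
    \<comment> \<open>Equality occurs, for instance, if \<open>s\<close> lies in a jump of
      \<open>F\<close> from the left at \<open>x\<close>; then the radius at the center is
      \<open>f x\<close>. Otherwise there are rational points between the center and
      \<open>x\<close>.\<close>
    proof (cases "rv ?c = rv x")
      case True
      then have "rv (ap f ?c) = rv (ap f x)" using ufun_eq[OF f(1) cu x] by blast
      then show ?thesis using True f(2)[OF x] by (intro exI[of _ "code u v w"]) simp
    next
      case False
      then have "rv ?c < rv x" using le by simp
      then obtain a k where ak: "a \<le> k + 1" "rv ?c < rq (fr a k)" "rq (fr a k) < rv x"
        using fr_dense[of "rv ?c" "rv x"] cu[of "code u v w"] x unfolding unit_def by blast
      let ?q = "cr a k"
      have q: "unit ?q" "rv ?q < rv x" using unit_cr[OF ak(1)] ak(3) by (simp_all add: cr)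
      have "\<not> A (code u v w) a k" using up[OF ak(1)] ak(2) by (meson not_less)
      then have sq: "rq s \<le> F ?q" using A_iff[OF ak(1)] uvw by auto
      \<comment> \<open>The second level lies above \<open>F ?q\<close>, so its supremum is at least
        \<open>?q\<close>. This puts \<open>F\<close> at the new center at \<open>rq s\<close> or
        higher, that is, above \<open>F x - d\<close>.\<close>
      obtain s' where s': "F ?q < rq s'" "rq s' < F x" using creal_dense[OF F_strict[OF q(1) x q(2)]] by blast
      obtain u' v' w' where uvw': "s' = qv u' v' w'" by (rule qt_qv)
      let ?c' = "ap c (nu (code u' v' w'))"
      have le': "rv ?c' \<le> rv x" using c_le[OF x] s' uvw' by blast
      have "rv ?q \<le> rv ?c'" using up[OF ak(1)] A_iff[OF ak(1)] s' uvw' by (simp add: cr)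
      then have "F x - d < F ?c'" using F_mono[OF q(1) cu] s(1) sq by (meson less_le_trans order_trans)
      moreover have "rv (ap g ?c') \<le> rv (ap g x)" "rv (ap h ?c') \<le> rv (ap h x)"
        using umonoD[OF g(2) cu x le'] umonoD[OF h(2) cu x le'] by auto
      \<comment> \<open>All three summands of \<open>F\<close> are monotone, so from
        \<open>?c'\<close> to \<open>x\<close> each of them grows by less than \<open>d\<close>.
        Hence the distance is below \<open>d\<close>, while \<open>f\<close> at \<open>?c'\<close>
        exceeds \<open>f x - d\<close>, which is above \<open>d\<close>.\<close>
      ultimately have "\<bar>rv x - rv ?c'\<bar> < rv (ap f ?c')"
        using le' d fgh[OF x] fgh[OF cu] unfolding F_def by (simp add: abs_if)
      then show ?thesis by blast
    qed
  qed
  then show ?thesis using c cu by blast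
qed

lemma fr_Suc: "0 < fr 1 m" by (simp add: fr_def)
lemma fr_anti: "m \<le> n \<Longrightarrow> fr 1 n \<le> fr 1 m"
  unfolding fr_def by (rule frac_le) simp_all
lemma fr_arch: assumes "0 < (r::'n creal)" obtains m where "rq (fr 1 m) < r"
proof -
  obtain n where n: "rq (ip n) < r" using creal_arch assms by blast
  have "p2 n = (p2 n - 1) + 1" using p2_pos[of n] by (simp add: less_iff_succ_less_eq)
  then have "ip n = fr 1 (p2 n - 1)" by (simp add: ip_def fr_def)
  then show ?thesis using that n by metis
qed

text \<open>A supremum argument over the rational points up to which finitely many balls suffice. In
  \<open>W\<close> the number \<open>n\<close> both bounds the indices of the balls and fixes a
  margin \<open>fr 1 n\<close> by which a rational point lies inside its ball. The margin lets
  rational points stand for all points, since each point is closer than that to a rational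
  one.\<close>

lemma heine_borel:
  assumes f: "ufun f" and c: "c \<in> D (N \<^bold>\<rightarrow> one)" "\<And>i. unit (ap c (nu i))"
    and cover: "\<And>x. unit x \<Longrightarrow> \<exists>i. \<bar>rv x - rv (ap c (nu i))\<bar> < rv (ap f (ap c (nu i)))"
  shows "\<exists>n. \<forall>x. unit x \<longrightarrow> (\<exists>i\<le>n. \<bar>rv x - rv (ap c (nu i))\<bar> < rv (ap f (ap c (nu i))))"
proof -
  define W where "W p l n \<longleftrightarrow> (\<exists>i<n. within (fr p l) (ap c (nu i)) (ap f (ap c (nu i))) (fr 1 n))" for p l n
  define A where "A (i::'n) a k \<longleftrightarrow> a = 0 \<or> (\<exists>n. \<forall>p l. p \<le> l + 1 \<and> fr p l \<le> fr a k \<longrightarrow> W p l n)" for i a k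
  have W_iff: "W p l n \<longleftrightarrow> (\<exists>i<n. \<bar>rq (fr p l) - rv (ap c (nu i))\<bar> + rq (fr 1 n) < rv (ap f (ap c (nu i))))" for p l n
    unfolding W_def using c(2) f by (simp add: within_iff unit_real ufun_real)
  have dW: "dec \<Delta> (\<lambda>\<rho>. W (F \<rho>) (G \<rho>) (H \<rho>))" if "intln \<Delta> F" "intln \<Delta> G" "intln \<Delta> H" for \<Delta> F G H
    unfolding W_def
    by (rule dec_exn, (rule dec_conj dec_lessn dec_within intlq_fr intln_const
        intl_ap[OF intl_const[OF ufun_D[OF f]]] intl_ap[OF intl_const[OF c(1)]] intl_nu
        intln_num intl_vs that[THEN intln_weaken])+)
  have dA: "dec \<Delta> (\<lambda>\<rho>. A (F \<rho>) (G \<rho>) (H \<rho>))" if "intln \<Delta> F" "intln \<Delta> G" "intln \<Delta> H" for \<Delta> F G H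
    unfolding A_def
    by (rule dec_disj, rule dec_eqn[OF that(2) intln_const], rule dec_exn, (rule dec_alln)+)
      (rule dec_imp dec_conj dec_len dW dec_qle intlq_fr intln_add intln_const
        intln_num intl_vs that[THEN intln_weaken, THEN intln_weaken, THEN intln_weaken])+
  have A0: "A i 0 0" for i by (simp add: A_def)
  obtain z' where z': "z' \<in> D (N \<^bold>\<rightarrow> one)" "\<forall>i. unit (ap z' (nu i)) \<and>
    (\<forall>a k. a \<le> k + 1 \<and> A i a k \<longrightarrow> rq (fr a k) \<le> rv (ap z' (nu i))) \<and>
    (\<forall>q. rq q < rv (ap z' (nu i)) \<longrightarrow> (\<exists>a k. a \<le> k + 1 \<and> A i a k \<and> q < fr a k))"
    using sup_exists[where A = A, OF dA A0] by blast
  define z where "z = ap z' (nu 0)"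
  have zu: "unit z" and up: "\<And>a k. a \<le> k + 1 \<Longrightarrow> A 0 a k \<Longrightarrow> rq (fr a k) \<le> rv z"
    and lo: "\<And>q. rq q < rv z \<Longrightarrow> \<exists>a k. a \<le> k + 1 \<and> A 0 a k \<and> q < fr a k"
    using z'(2)[rule_format, of 0] unfolding z_def by blast+
  have W_mono: "W p l n'" if W: "W p l n" and nn: "n \<le> n'" for p l n n'
  proof -
    obtain i where i: "i < n" "\<bar>rq (fr p l) - rv (ap c (nu i))\<bar> + rq (fr 1 n) < rv (ap f (ap c (nu i)))" using W unfolding W_iff by blast
    have "rq (fr 1 n') \<le> rq (fr 1 n)" using fr_anti[OF nn] by simp
    then have "\<bar>rq (fr p l) - rv (ap c (nu i))\<bar> + rq (fr 1 n') < rv (ap f (ap c (nu i)))" using i(2) by (meson add_left_mono le_less_trans)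
    then show ?thesis unfolding W_iff using i(1) nn by (meson less_le_trans)
  qed
  obtain j where j: "\<bar>rv z - rv (ap c (nu j))\<bar> < rv (ap f (ap c (nu j)))" using cover[OF zu] by blast
  obtain e where e: "0 < rq e" "\<bar>rv z - rv (ap c (nu j))\<bar> + (rq e + rq e) < rv (ap f (ap c (nu j)))"
  proof -
    have "0 < rv (ap f (ap c (nu j))) - \<bar>rv z - rv (ap c (nu j))\<bar>" using j by simp
    then obtain q where q: "0 < rq q" "rq q < rv (ap f (ap c (nu j))) - \<bar>rv z - rv (ap c (nu j))\<bar>" using creal_dense by blast
    have "0 < rq (q / 2)" using q(1) rq_less[of 0 q] rq_less[of 0 "q / 2"] by simp
    moreover have "rq (q / 2) + rq (q / 2) = rq q" by (simp add: rq_simps(3)[symmetric])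
    ultimately show ?thesis using that q(2) by (metis add.commute less_diff_eq)
  qed
  obtain m where m: "rq (fr 1 m) < rq e" using fr_arch[OF e(1)] by blast
  have near: "W p l n" if "\<bar>rq (fr p l) - rv z\<bar> \<le> rq e" "j < n" "m \<le> n" for p l n
  proof -
    have "rq (fr 1 n) \<le> rq (fr 1 m)" using fr_anti[OF that(3)] by simp
    then have "\<bar>rq (fr p l) - rv (ap c (nu j))\<bar> + rq (fr 1 n) < rv (ap f (ap c (nu j)))"
      by (rule abs_slack[OF that(1) e(2) _ m])
    then show ?thesis unfolding W_iff using that(2) by blast
  qed
  \<comment> \<open>Points clearly below the supremum lie below a member of \<open>A\<close>. If
    \<open>rv z - rq e\<close> is negative, there are no such points.\<close>
  have low: "\<exists>n. \<forall>p l. p \<le> l + 1 \<and> rq (fr p l) < rv z - rq e \<longrightarrow> W p l n"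
  proof (cases "0 \<le> rv z - rq e")
    case False
    then have "\<not> rq (fr p l) < rv z - rq e" for p l using rq_le[of 0 "fr p l"] by simp
    then show ?thesis by blast
  next
    case True
    obtain q where q: "rv z - rq e < rq q" "rq q < rv z" using creal_dense[of "rv z - rq e" "rv z"] e(1) by auto
    obtain a k where ak: "a \<le> k + 1" "A 0 a k" "q < fr a k" using lo[OF q(2)] by blast
    have l: "rv z - rq e < rq (fr a k)" using q(1) ak(3) by (meson less_trans rq_less)
    then have "a \<noteq> 0" using True by auto
    then obtain n where n: "\<forall>p l. p \<le> l + 1 \<and> fr p l \<le> fr a k \<longrightarrow> W p l n" using ak(2) unfolding A_def by blast
    have "fr p l \<le> fr a k" if "rq (fr p l) < rv z - rq e" for p l
      using l that less_trans[of "rq (fr p l)" "rv z - rq e" "rq (fr a k)"] by (simp add: less_imp_le)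
    then show ?thesis using n by blast
  qed
  then obtain n0 where n0: "\<And>p l. p \<le> l + 1 \<Longrightarrow> rq (fr p l) < rv z - rq e \<Longrightarrow> W p l n0" by blast
  \<comment> \<open>\<open>n0\<close> serves the points below \<open>z - e\<close>. For the points
    within \<open>e\<close> of \<open>z\<close>, the bound \<open>j + 1\<close> brings the ball
    number \<open>j\<close> in, and \<open>m\<close> makes the margin smaller than
    \<open>e\<close>.\<close>
  define n where "n = max n0 (max (j + 1) m)"
  have n: "n0 \<le> n" "j < n" "m \<le> n" by (auto simp: n_def less_max_iff_disj le_max_iff_disj less_Suc)
  have all: "W p l n" if "p \<le> l + 1" "rq (fr p l) \<le> rv z + rq e" for p l
  proof (cases "rq (fr p l) < rv z - rq e")
    case True then show ?thesis using n0 that W_mono n by blast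
  next
    case False then show ?thesis using that by (intro near n) (simp add: abs_le_iff algebra_simps)
  qed
  \<comment> \<open>If the supremum were below 1, a rational point just beyond it and within
    \<open>e\<close> would also belong to \<open>A\<close>.\<close>
  have z1: "rv z = 1"
  proof (rule ccontr)
    assume "rv z \<noteq> 1"
    then have "rv z < min 1 (rv z + rq e)" using zu e(1) by (simp add: unit_def)
    moreover have "0 \<le> rv z" using zu by (simp add: unit_def)
    ultimately obtain a k where ak: "a \<le> k + 1" "rv z < rq (fr a k)" "rq (fr a k) < min 1 (rv z + rq e)"
      using fr_dense[of "rv z" "min 1 (rv z + rq e)"] by auto
    have "W p l n" if "p \<le> l + 1" "fr p l \<le> fr a k" for p l
    proof (rule all[OF that(1)])
      have "rq (fr p l) \<le> rq (fr a k)" using that(2) by simp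
      also have "\<dots> \<le> rv z + rq e" using ak(3) by simp
      finally show "rq (fr p l) \<le> rv z + rq e" .
    qed
    then have "A 0 a k" unfolding A_def by blast
    then show False using up[OF ak(1)] ak(2) by simp
  qed
  have W1: "W p l n" if "p \<le> l + 1" for p l
  proof (rule all[OF that])
    have "rq (fr p l) \<le> 1" using fr_le_1[of p l] that rq_le[of "fr p l" 1] by simp
    then show "rq (fr p l) \<le> rv z + rq e" using z1 e(1) by simp
  qed
  have "\<exists>i\<le>n. \<bar>rv x - rv (ap c (nu i))\<bar> < rv (ap f (ap c (nu i)))" if x: "unit x" for x
  proof -
    have pos: "0 < rq (fr 1 n)" using fr_Suc[of n] rq_less[of 0 "fr 1 n"] by simp
    obtain p l where pl: "p \<le> l + 1" "\<bar>rv x - rq (fr p l)\<bar> < rq (fr 1 n)"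
    proof (cases "rv x = 1")
      case True
      then show ?thesis using pos by (intro that[of 1 0]) simp_all
    next
      case False
      then have "rv x < min 1 (rv x + rq (fr 1 n))" "0 \<le> rv x" using x pos by (simp_all add: unit_def)
      then obtain p l where "p \<le> l + 1" "rv x < rq (fr p l)" "rq (fr p l) < min 1 (rv x + rq (fr 1 n))"
        using fr_dense[of "rv x" "min 1 (rv x + rq (fr 1 n))"] by auto
      then show ?thesis by (intro that[of p l]) (simp_all add: abs_if)
    qed
    obtain i where i: "i < n" "\<bar>rq (fr p l) - rv (ap c (nu i))\<bar> + rq (fr 1 n) < rv (ap f (ap c (nu i)))"
      using W1[OF pl(1)] unfolding W_iff by blast
    have "\<bar>rv x - rv (ap c (nu i))\<bar> \<le> \<bar>rv x - rq (fr p l)\<bar> + \<bar>rq (fr p l) - rv (ap c (nu i))\<bar>"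
      using abs_triangle_ineq[of "rv x - rq (fr p l)" "rq (fr p l) - rv (ap c (nu i))"] by simp
    then have "\<bar>rv x - rv (ap c (nu i))\<bar> < rv (ap f (ap c (nu i)))" using pl(2) i(2) by simp
    then show ?thesis using i(1) less_imp_le by blast
  qed
  then show ?thesis by blast
qed

theorem Jordan_imp_HBU: assumes "sat [] Jordan" shows "sat [] HBU_bv"
  unfolding sat_HBU
proof (intro allI impI, elim conjE)
  fix f assume f: "ufun f" "\<forall>x. unit x \<longrightarrow> 0 < rv (ap f x)" "bvar f"
  then obtain g h where gh: "ufun g" "umono g" "ufun h" "umono h" "\<And>x. unit x \<Longrightarrow> rv (ap f x) = rv (ap g x) - rv (ap h x)"
    using assms unfolding sat_Jordan by blast
  obtain c where c: "c \<in> D (N \<^bold>\<rightarrow> one)" "\<And>i. unit (ap c (nu i))"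
    "\<And>x. unit x \<Longrightarrow> \<exists>i. \<bar>rv x - rv (ap c (nu i))\<bar> < rv (ap f (ap c (nu i)))"
    using centers[OF f(1) _ gh] f(2) by blast
  from heine_borel[OF f(1) c] c
  show "\<exists>k. \<exists>y\<in>D (N \<^bold>\<rightarrow> one). (\<forall>i\<le>k. unit (ap y (nu i))) \<and>
      (\<forall>x. unit x \<longrightarrow> (\<exists>i\<le>k. \<bar>rv x - rv (ap y (nu i))\<bar> < rv (ap f (ap y (nu i)))))" by blast
qed

end

section \<open>From finite subcovers to the uncountability of the unit interval\<close>

context nmodel
begin

lemma dec_weaken: "dec \<Delta> P \<Longrightarrow> dec (\<sigma> # \<Delta>) (\<lambda>\<rho>. P (tl \<rho>))"
  unfolding dec_def by (elim exE conjE, rule exI, rule conjI[OF intl_weaken]) (auto dest: envs_hd_tl(2))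

text \<open>Definition by cases on a decided predicate: the graph is decided, and
  \<open>choice\<close> replaces it by a term.\<close>

lemma intln_if: assumes "dec \<Delta> P" "intln \<Delta> F" "intln \<Delta> G" shows "intln \<Delta> (\<lambda>\<rho>. if P \<rho> then F \<rho> else G \<rho>)"
proof -
  have "dec (N # \<Delta>) (\<lambda>\<rho>. (P (tl \<rho>) \<longrightarrow> num (hd \<rho>) = F (tl \<rho>)) \<and> (\<not> P (tl \<rho>) \<longrightarrow> num (hd \<rho>) = G (tl \<rho>)))"
    by (rule dec_conj dec_imp dec_not dec_weaken dec_eqn intln_num intl_vs intln_weaken assms)+
  from choice[of \<Delta> "\<lambda>n \<rho>. (P \<rho> \<longrightarrow> n = F \<rho>) \<and> (\<not> P \<rho> \<longrightarrow> n = G \<rho>)", OF this]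
  obtain H where H: "intln \<Delta> H" "\<And>\<rho>. \<rho> \<in> envs \<Delta> \<Longrightarrow> (P \<rho> \<longrightarrow> H \<rho> = F \<rho>) \<and> (\<not> P \<rho> \<longrightarrow> H \<rho> = G \<rho>)" by (metis (no_types, lifting))
  show ?thesis unfolding intln_def by (rule intl_cong[THEN iffD1, OF _ H(1)[unfolded intln_def]]) (use H(2) in auto)
qed

text \<open>The default value settles the case \<open>m < n\<close>, so that the graph of the
  difference is decided and the difference becomes definable by a term.\<close>

definition sb :: "'n \<Rightarrow> 'n \<Rightarrow> 'n" where "sb m n = (if n \<le> m then m - n else 0)"

lemma sb: "n \<le> m \<Longrightarrow> n + sb m n = m" by (simp add: sb_def)

lemma intln_sb: assumes "intln \<Delta> F" "intln \<Delta> G" shows "intln \<Delta> (\<lambda>\<rho>. sb (F \<rho>) (G \<rho>))"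
proof -
  have "dec (N # \<Delta>) (\<lambda>\<rho>. (G (tl \<rho>) \<le> F (tl \<rho>) \<longrightarrow> F (tl \<rho>) = G (tl \<rho>) + num (hd \<rho>)) \<and> (\<not> G (tl \<rho>) \<le> F (tl \<rho>) \<longrightarrow> num (hd \<rho>) = 0))"
    by (rule dec_conj dec_imp dec_not dec_len dec_eqn intln_add intln_weaken assms intln_const intln_num intl_vs)+
  from choice[of \<Delta> "\<lambda>n \<rho>. (G \<rho> \<le> F \<rho> \<longrightarrow> F \<rho> = G \<rho> + n) \<and> (\<not> G \<rho> \<le> F \<rho> \<longrightarrow> n = 0)", OF this]
  obtain H where H: "intln \<Delta> H" "\<And>\<rho>. \<rho> \<in> envs \<Delta> \<Longrightarrow> (\<exists>n. (G \<rho> \<le> F \<rho> \<longrightarrow> F \<rho> = G \<rho> + n) \<and> (\<not> G \<rho> \<le> F \<rho> \<longrightarrow> n = 0)) \<Longrightarrow>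
     (G \<rho> \<le> F \<rho> \<longrightarrow> F \<rho> = G \<rho> + H \<rho>) \<and> (\<not> G \<rho> \<le> F \<rho> \<longrightarrow> H \<rho> = 0)" by blast
  have "H \<rho> = sb (F \<rho>) (G \<rho>)" if "\<rho> \<in> envs \<Delta>" for \<rho>
  proof (cases "G \<rho> \<le> F \<rho>")
    case True
    then have "F \<rho> = G \<rho> + H \<rho>" using H(2)[OF that] sb[OF True] by metis
    then show ?thesis using sb[OF True] by (metis add_left_cancel)
  next
    case False
    then show ?thesis using H(2)[OF that] by (simp add: sb_def)
  qed
  then show ?thesis unfolding intln_def by (intro intl_cong[THEN iffD1, OF _ H(1)[unfolded intln_def]]) auto
qed

text \<open>A sum over an initial segment of nonstandard length exists only inside the model. The
  recursor builds the partial sums, for all rows \<open>m\<close> at once.\<close>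

lemma primrec_sum: assumes v: "v \<in> D (N \<^bold>\<rightarrow> one)"
  shows "\<exists>t \<in> D (N \<^bold>\<rightarrow> one). \<forall>m. sq (ap t (nu m)) 0 = 0 \<and> (\<forall>i. sq (ap t (nu m)) (i + 1) = sq (ap t (nu m)) i + sq (ap v (nu m)) i)"
proof -
  define st where "st u = lam N one (\<lambda>i. lam N N (\<lambda>r. pl r (ap (ap v u) i)))" for u
  have i1: "intl [N] (N \<^bold>\<rightarrow> N \<^bold>\<rightarrow> N) (\<lambda>\<rho>. st (hd \<rho>))"
    unfolding st_def by (rule intl_lam, rule intl_lam) (rule intl_ap intl_vs intl_const cs_types v)+
  have st: "st u \<in> D (N \<^bold>\<rightarrow> N \<^bold>\<rightarrow> N)" "i \<in> D N \<Longrightarrow> r \<in> D N \<Longrightarrow> ap (ap (st u) i) r = pl r (ap (ap v u) i)" if u: "u \<in> D N" for u i r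
  proof -
    have 1: "intl [N] one (\<lambda>\<rho>. lam N N (\<lambda>r. pl r (ap (ap v u) (hd \<rho>))))"
      by (rule intl_lam) (rule intl_ap intl_vs intl_const cs_types v u)+
    show "st u \<in> D (N \<^bold>\<rightarrow> N \<^bold>\<rightarrow> N)" unfolding st_def by (rule lam1(1)[OF 1])
    assume i: "i \<in> D N" and r: "r \<in> D N"
    have 2: "intl [N] N (\<lambda>\<rho>. pl (hd \<rho>) (ap (ap v u) i))" by (rule intl_ap intl_vs intl_const cs_types v u i)+
    show "ap (ap (st u) i) r = pl r (ap (ap v u) i)" unfolding st_def lam1(2)[OF 1 i] by (rule lam1(2)[OF 2 r])
  qed
  let ?G = "\<lambda>u. ap (ap (cs Rec0) (st u)) zr"
  have G: "intl [N] one (\<lambda>\<rho>. ?G (hd \<rho>))" by (rule intl_ap i1 intl_const cs_types)+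
  have e: "ap (lam N one ?G) (nu m) = ?G (nu m)" for m by (rule lam1(2)[OF G nu_N])
  have "sq (?G (nu m)) 0 = 0 \<and> (\<forall>i. sq (?G (nu m)) (i + 1) = sq (?G (nu m)) i + sq (ap v (nu m)) i)" for m
  proof (intro conjI allI)
    show "sq (?G (nu m)) 0 = 0" unfolding sq_def nu_zero Rec_axioms(1)[OF st(1)[OF nu_N] cs_types(1)] by (metis num_nu nu_zero)
    fix i
    let ?x = "ap (?G (nu m)) (nu i)"
    have x: "?x \<in> D N" using st(1)[OF nu_N, of m] by (meson ap_closed cs_types nu_N)
    have y: "ap (ap v (nu m)) (nu i) \<in> D N" using v by (meson ap_closed nu_N)
    have "ap (?G (nu m)) (nu (i + 1)) = pl ?x (ap (ap v (nu m)) (nu i))"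
      unfolding nu_Suc Rec_axioms(2)[OF st(1)[OF nu_N] cs_types(1) nu_N] by (rule st(2)[OF nu_N nu_N x])
    also have "\<dots> = nu (num ?x + num (ap (ap v (nu m)) (nu i)))" by (simp only: nu_add nu_num[OF x] nu_num[OF y])
    finally show "sq (?G (nu m)) (i + 1) = sq (?G (nu m)) i + sq (ap v (nu m)) i" by (simp only: sq_def num_nu)
  qed
  then show ?thesis using lam1(1)[OF G] e by (intro bexI[of _ "lam N one ?G"]) simp_all
qed

text \<open>Seen from outside, the indices up to \<open>n\<close> may be infinitely many. The bound
  is therefore found by an internal induction.\<close>

lemma bounded_values: assumes b: "b \<in> D one" shows "\<exists>l. \<forall>i\<le>n. sq b i \<le> l"
proof (rule ind[where P = "\<lambda>n. \<exists>l. \<forall>i\<le>n. sq b i \<le> l"])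
  show "dec [N] (\<lambda>\<rho>. \<exists>l. \<forall>i\<le>num (hd \<rho>). sq b i \<le> l)"
    by (rule dec_exn, rule dec_alln) (rule dec_imp dec_len intln_sq intln_num intl_vs intl_const b)+
  show "\<exists>l. \<forall>i\<le>0. sq b i \<le> l" by (metis antisym nonneg order_refl)
  fix n assume "\<exists>l. \<forall>i\<le>n. sq b i \<le> l"
  then obtain l where l: "\<And>i. i \<le> n \<Longrightarrow> sq b i \<le> l" by blast
  have "sq b i \<le> max l (sq b (n + 1))" if "i \<le> n + 1" for i
  proof (cases "i = n + 1")
    case False
    then have "i < n + 1" using that by (simp only: le_less) simp
    then have "i \<le> n" by (simp only: less_Suc)
    then show ?thesis using l by (simp add: le_max_iff_disj)
  qed simp
  then show "\<exists>l. \<forall>i\<le>n + 1. sq b i \<le> l" by blast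
qed

text \<open>This is Kraft's inequality. The sum \<open>T m (n + 1)\<close> of
  \<open>2 ^ (l - b i)\<close> over those \<open>i \<le> n\<close> with \<open>b i < m\<close> is bounded by induction on \<open>m\<close>: each step from \<open>m\<close> to
  \<open>m + 1\<close> contributes at most one summand.\<close>

lemma kraft:
  assumes b: "b \<in> D one" and distinct: "\<And>i j. i < j \<Longrightarrow> j \<le> n \<Longrightarrow> sq b i \<noteq> sq b j"
  obtains l t where "t \<in> D one" "\<And>i. i \<le> n \<Longrightarrow> sq b i \<le> l" "sq t 0 = 0"
    "\<And>i. i \<le> n \<Longrightarrow> sq t (i + 1) = sq t i + p2 (sb l (sq b i))" "sq t (n + 1) \<le> p2 (l + 1)"
proof -
  obtain l where l: "\<And>i. i \<le> n \<Longrightarrow> sq b i \<le> l" using bounded_values[OF b] by blast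
  define v where "v m i = (if sq b i < m then p2 (sb l (sq b i)) else 0)" for m i
  have "dec [N, N, N] (\<lambda>\<rho>. num (hd \<rho>) = v (num (hd (tl (tl \<rho>)))) (num (hd (tl \<rho>))))"
    unfolding v_def by (rule dec_eqn intln_if dec_lessn intln_sq intln_p2 intln_sb intln_const intln_num intl_vs intl_const b)+
  from choice2[of "\<lambda>m i x. x = v m i", OF this] obtain v' where v': "v' \<in> D (N \<^bold>\<rightarrow> one)" "\<And>m i. sq (ap v' (nu m)) i = v m i" by blast
  obtain t' where t': "t' \<in> D (N \<^bold>\<rightarrow> one)" "\<And>m. sq (ap t' (nu m)) 0 = 0"
    "\<And>m i. sq (ap t' (nu m)) (i + 1) = sq (ap t' (nu m)) i + v m i" using primrec_sum[OF v'(1)] v'(2) by auto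
  define T where "T m i = sq (ap t' (nu m)) i" for m i
  have iT: "intln \<Delta> (\<lambda>\<rho>. T (F \<rho>) (G \<rho>))" if "intln \<Delta> F" "intln \<Delta> G" for \<Delta> F G
    unfolding T_def by (rule intln_sq intl_ap intl_const t'(1) intl_nu that)+
  have T0: "T m 0 = 0" and TS: "T m (i + 1) = T m i + v m i" for m i using t' by (simp_all add: T_def)
  have Tzero: "T 0 i = 0" for i
    by (rule ind[where P = "\<lambda>i. T 0 i = 0"]) ((rule dec_eqn iT intln_const intln_num intl_vs)+ | simp add: T0 TS v_def not_less)+
  \<comment> \<open>Rows \<open>m\<close> and \<open>m + 1\<close> differ by the summand of an index
    \<open>j\<close> with \<open>b j = m\<close>. The values of \<open>b\<close> are distinct, so
    there is at most one; the induction is along the row.\<close>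
  have step: "i \<le> n + 1 \<longrightarrow> ((\<exists>j<i. sq b j = m) \<longrightarrow> T (m + 1) i = T m i + p2 (sb l m)) \<and> (\<not> (\<exists>j<i. sq b j = m) \<longrightarrow> T (m + 1) i = T m i)" for m i
  proof (rule ind[where P = "\<lambda>i. i \<le> n + 1 \<longrightarrow> ((\<exists>j<i. sq b j = m) \<longrightarrow> T (m + 1) i = T m i + p2 (sb l m)) \<and> (\<not> (\<exists>j<i. sq b j = m) \<longrightarrow> T (m + 1) i = T m i)"])
    have d: "dec [N] (\<lambda>\<rho>. \<exists>j<num (hd \<rho>). sq b j = m)"
      by (rule dec_exn) (rule dec_conj dec_lessn dec_eqn intln_sq intln_num intl_vs intl_const b intln_const)+
    show "dec [N] (\<lambda>\<rho>. num (hd \<rho>) \<le> n + 1 \<longrightarrow> ((\<exists>j<num (hd \<rho>). sq b j = m) \<longrightarrow> T (m + 1) (num (hd \<rho>)) = T m (num (hd \<rho>)) + p2 (sb l m)) \<and> (\<not> (\<exists>j<num (hd \<rho>). sq b j = m) \<longrightarrow> T (m + 1) (num (hd \<rho>)) = T m (num (hd \<rho>))))"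
      by (rule d dec_imp dec_conj dec_not dec_len dec_eqn intln_add iT intln_num intl_vs | rule intln_const)+
    show "0 \<le> n + 1 \<longrightarrow> ((\<exists>j<0. sq b j = m) \<longrightarrow> T (m + 1) 0 = T m 0 + p2 (sb l m)) \<and> (\<not> (\<exists>j<0. sq b j = m) \<longrightarrow> T (m + 1) 0 = T m 0)"
      using nonneg by (auto simp: T0 not_less[symmetric])
    fix i assume IH: "i \<le> n + 1 \<longrightarrow> ((\<exists>j<i. sq b j = m) \<longrightarrow> T (m + 1) i = T m i + p2 (sb l m)) \<and> (\<not> (\<exists>j<i. sq b j = m) \<longrightarrow> T (m + 1) i = T m i)"
    show "i + 1 \<le> n + 1 \<longrightarrow> ((\<exists>j<i + 1. sq b j = m) \<longrightarrow> T (m + 1) (i + 1) = T m (i + 1) + p2 (sb l m)) \<and> (\<not> (\<exists>j<i + 1. sq b j = m) \<longrightarrow> T (m + 1) (i + 1) = T m (i + 1))"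
    proof
      assume i: "i + 1 \<le> n + 1"
      then have i': "i \<le> n" by simp
      then have i'': "i \<le> n + 1" using less_Suc[of i n] by simp
      have ex: "(\<exists>j<i + 1. sq b j = m) \<longleftrightarrow> (\<exists>j<i. sq b j = m) \<or> sq b i = m" by (auto simp: less_Suc le_less)
      show "((\<exists>j<i + 1. sq b j = m) \<longrightarrow> T (m + 1) (i + 1) = T m (i + 1) + p2 (sb l m)) \<and> (\<not> (\<exists>j<i + 1. sq b j = m) \<longrightarrow> T (m + 1) (i + 1) = T m (i + 1))"
      proof (cases "sq b i = m")
        case True
        then have "\<not> (\<exists>j<i. sq b j = m)" using distinct[OF _ i'] unfolding True[symmetric] by auto
        moreover have "v (m + 1) i = p2 (sb l m)" "v m i = 0" using True by (simp_all add: v_def)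
        ultimately show ?thesis using IH i'' True ex by (simp add: TS)
      next
        case False
        then have "v (m + 1) i = v m i" by (simp add: v_def less_Suc le_less)
        then show ?thesis using IH i'' False ex by (simp add: TS add.assoc add.commute[of "p2 (sb l m)" "v m i"])
      qed
    qed
  qed
  \<comment> \<open>The reserve \<open>2 ^ (l + 1 - m)\<close> makes the estimate inductive: from
    \<open>m\<close> to \<open>m + 1\<close> it is halved, and the half that is released pays for
    the one possible new summand \<open>2 ^ (l - m)\<close>.\<close>
  have bound: "m \<le> l + 1 \<longrightarrow> T m (n + 1) + p2 (sb (l + 1) m) \<le> p2 (l + 1)" for m
  proof (rule ind[where P = "\<lambda>m. m \<le> l + 1 \<longrightarrow> T m (n + 1) + p2 (sb (l + 1) m) \<le> p2 (l + 1)"])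
    show "dec [N] (\<lambda>\<rho>. num (hd \<rho>) \<le> l + 1 \<longrightarrow> T (num (hd \<rho>)) (n + 1) + p2 (sb (l + 1) (num (hd \<rho>))) \<le> p2 (l + 1))"
      by (rule dec_imp dec_len iT intln_p2 intln_sb intln_num intl_vs | rule intln_const | rule intln_add)+
    show "0 \<le> l + 1 \<longrightarrow> T 0 (n + 1) + p2 (sb (l + 1) 0) \<le> p2 (l + 1)" by (simp add: Tzero sb_def)
    fix m assume IH: "m \<le> l + 1 \<longrightarrow> T m (n + 1) + p2 (sb (l + 1) m) \<le> p2 (l + 1)"
    show "m + 1 \<le> l + 1 \<longrightarrow> T (m + 1) (n + 1) + p2 (sb (l + 1) (m + 1)) \<le> p2 (l + 1)"
    proof
      assume m: "m + 1 \<le> l + 1"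
      then have ml: "m \<le> l" by simp
      then have "m \<le> l + 1" using less_Suc[of m l] by simp
      have k1: "sb (l + 1) (m + 1) = sb l m" using sb[OF m] sb[OF ml] by (metis add.assoc add.commute add_left_cancel)
      have k2: "sb (l + 1) m = sb l m + 1" using sb[OF \<open>m \<le> l + 1\<close>] sb[OF ml] by (metis add.assoc add_left_cancel)
      have k3: "T (m + 1) (n + 1) \<le> T m (n + 1) + p2 (sb l m)" using step[of "n + 1" m] by (cases "\<exists>j<n + 1. sq b j = m") auto
      have "T (m + 1) (n + 1) + p2 (sb (l + 1) (m + 1)) \<le> T m (n + 1) + p2 (sb l m) + p2 (sb l m)"
        unfolding k1 using k3 by (rule add_right_mono)
      also have "\<dots> = T m (n + 1) + p2 (sb (l + 1) m)" unfolding k2 p2_Suc by (rule add.assoc)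
      also have "\<dots> \<le> p2 (l + 1)" by (rule mp[OF IH \<open>m \<le> l + 1\<close>])
      finally show "T (m + 1) (n + 1) + p2 (sb (l + 1) (m + 1)) \<le> p2 (l + 1)" .
    qed
  qed
  show ?thesis
  \<comment> \<open>Row \<open>l + 1\<close> contains every summand up to \<open>n\<close>, since
    these values of \<open>b\<close> are at most \<open>l\<close>.\<close>
  proof (rule that[of "ap t' (nu (l + 1))" l])
    show "ap t' (nu (l + 1)) \<in> D one" using t'(1) by (meson ap_closed nu_N)
    show "sq (ap t' (nu (l + 1))) (i + 1) = sq (ap t' (nu (l + 1))) i + p2 (sb l (sq b i))" if "i \<le> n" for i
      using t'(3)[of "l + 1" i] l[OF that] by (simp add: v_def less_Suc)
    have "T (l + 1) (n + 1) \<le> T (l + 1) (n + 1) + p2 (sb (l + 1) (l + 1))" by simp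
    then show "sq (ap t' (nu (l + 1))) (n + 1) \<le> p2 (l + 1)" unfolding T_def[symmetric]
      by (rule order_trans) (use bound[of "l + 1"] in \<open>simp only: order_refl simp_thms\<close>)
    show "sq b i \<le> l" if "i \<le> n" for i by (rule l[OF that])
    show "sq (ap t' (nu (l + 1))) 0 = 0" by (rule t'(2))
  qed
qed


text \<open>One step along the partition, with \<open>t\<close> and \<open>t'\<close> successive
  partial sums of the values of the function. Each value enters at most two neighbouring
  differences, so the variation stays below \<open>t + t'\<close>.\<close>

lemma bound_step: "s' = s + \<bar>p - q\<bar> \<Longrightarrow> s \<le> t + t' \<Longrightarrow> t' = t + p \<Longrightarrow> 0 \<le> p \<Longrightarrow> 0 \<le> q \<Longrightarrow> s' \<le> t' + (t' + q)"
  for p :: "'a::linordered_idom"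
  by (simp add: abs_if split: if_splits)

text \<open>Along a partition, the values of \<open>f\<close> are distinct negative powers of two.\<close>

lemma bvar_if_injective:
  assumes f: "ufun f" and e: "\<And>x. unit x \<Longrightarrow> rv (ap f x) = rq (ip (num (ap Y x)))" and Y: "Y \<in> D two"
    and inj: "\<And>x y. unit x \<Longrightarrow> unit y \<Longrightarrow> ap Y x = ap Y y \<Longrightarrow> rv x = rv y"
  shows "bvar f"
  unfolding bvar_def
\<comment> \<open>The values along a partition sum up to at most 2 by Kraft's inequality, and each
  enters at most two differences; hence the bound 4.\<close>
proof (intro exI[of _ "1 + 1 + 1 + 1"] allI ballI impI, elim conjE)
  fix n x s assume x: "x \<in> D (N \<^bold>\<rightarrow> one)" and s: "s \<in> D (N \<^bold>\<rightarrow> one)" and p: "part n x" and vs: "vsum f n x s"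
  have u: "unit (ap x (nu i))" if "i \<le> n" for i using p that by (simp add: part_def)
  have less1: "rv (ap x (nu i)) < rv (ap x (nu (i + 1)))" if "i < n" for i using p that by (simp add: part_def)
  \<comment> \<open>The inequality of the two points is expressed by a separating rational, so that
    the induction on their distance \<open>d\<close> has a decided predicate.\<close>
  have less: "i + d + 1 \<le> n \<longrightarrow> (\<exists>q. bel (ap x (nu i)) q \<and> abv (ap x (nu (i + d + 1))) q)" for i d
  proof (rule ind[where P = "\<lambda>d. i + d + 1 \<le> n \<longrightarrow> (\<exists>q. bel (ap x (nu i)) q \<and> abv (ap x (nu (i + d + 1))) q)"])
    have iff: "(\<exists>q. bel (ap x (nu i)) q \<and> abv (ap x (nu j)) q) \<longleftrightarrow> rv (ap x (nu i)) < rv (ap x (nu j))" if "i \<le> n" "j \<le> n" for j i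
      using that u creal_dense by (auto simp: bel_iff abv_iff unit_real intro: less_trans)
    have le: "i \<le> i + k" for k by simp
    show "dec [N] (\<lambda>\<rho>. i + num (hd \<rho>) + 1 \<le> n \<longrightarrow> (\<exists>q. bel (ap x (nu i)) q \<and> abv (ap x (nu (i + num (hd \<rho>) + 1))) q))"
      by (rule dec_imp, rule dec_len, (rule intln_add intln_num intl_vs intln_const)+, rule dec_exq)
        (rule dec_conj dec_bel dec_abv intlq_qv intl_ap[OF intl_const[OF x]] intl_nu intln_add intln_num intl_vs intln_const)+
    show "i + 0 + 1 \<le> n \<longrightarrow> (\<exists>q. bel (ap x (nu i)) q \<and> abv (ap x (nu (i + 0 + 1))) q)"
    proof
      assume "i + 0 + 1 \<le> n"
      then have "i + 1 \<le> n" "i < n" by (simp_all add: less_iff_succ_less_eq)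
      then show "\<exists>q. bel (ap x (nu i)) q \<and> abv (ap x (nu (i + 0 + 1))) q" using iff[of i "i + 1"] less1[of i] by simp
    qed
    fix d assume IH: "i + d + 1 \<le> n \<longrightarrow> (\<exists>q. bel (ap x (nu i)) q \<and> abv (ap x (nu (i + d + 1))) q)"
    show "i + (d + 1) + 1 \<le> n \<longrightarrow> (\<exists>q. bel (ap x (nu i)) q \<and> abv (ap x (nu (i + (d + 1) + 1))) q)"
    proof
      assume a: "i + (d + 1) + 1 \<le> n"
      define j where "j = i + d + 1"
      have j: "i + (d + 1) = j" by (simp add: j_def add.assoc)
      have "j < n" "j \<le> n" "j + 1 \<le> n" using a unfolding j by (simp_all add: less_iff_succ_less_eq less_imp_le[of j n, unfolded less_iff_succ_less_eq])
      moreover have "i \<le> n" using \<open>j \<le> n\<close> le[of "d + 1"] unfolding j by (rule order_trans[rotated])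
      ultimately show "\<exists>q. bel (ap x (nu i)) q \<and> abv (ap x (nu (i + (d + 1) + 1))) q"
        using IH less1[of j] iff[of i j] iff[of i "j + 1"] unfolding j j_def[symmetric] by (meson less_trans)
    qed
  qed
  obtain b where b: "b \<in> D one" "\<And>i. sq b i = num (ap Y (ap x (nu i)))"
  proof -
    have "dec [N, N] (\<lambda>\<rho>. num (hd \<rho>) = num (ap Y (ap x (nu (num (hd (tl \<rho>)))))))"
      by (rule dec_eqn intln_num intl_ap[OF intl_const[OF Y]] intl_ap[OF intl_const[OF x]] intl_nu intl_vs)+
    from choice1[of "\<lambda>i m. m = num (ap Y (ap x (nu i)))", OF this] show ?thesis using that by blast
  qed
  have YN: "ap Y (ap x (nu i)) \<in> D N" for i using x Y by (meson ap_closed nu_N)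
  have distinct: "sq b i \<noteq> sq b j" if ij: "i < j" "j \<le> n" for i j
  proof
    assume "sq b i = sq b j"
    then have "nu (num (ap Y (ap x (nu i)))) = nu (num (ap Y (ap x (nu j))))" by (simp only: b)
    then have "ap Y (ap x (nu i)) = ap Y (ap x (nu j))" by (simp only: nu_num[OF YN])
    moreover have "i \<le> n" using ij by order
    ultimately have "rv (ap x (nu i)) = rv (ap x (nu j))" using inj u ij by blast
    moreover obtain d where "j = i + d + 1"
    proof -
      have "i + 1 \<le> j" using ij by (simp only: less_iff_succ_less_eq)
      then obtain d where "j = (i + 1) + d" unfolding le_ex by blast
      then show ?thesis by (intro that[of d]) (simp only: ac_simps)
    qed
    then obtain q where "bel (ap x (nu i)) q" "abv (ap x (nu j)) q" using less[of i d] ij(2) by auto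
    then have "rv (ap x (nu i)) < rq q" "rq q < rv (ap x (nu j))" using u \<open>i \<le> n\<close> ij(2) by (auto simp: bel_iff abv_iff unit_real)
    ultimately show False by simp
  qed
  obtain l t where t: "t \<in> D one" "\<And>i. i \<le> n \<Longrightarrow> sq b i \<le> l" "sq t 0 = 0"
    "\<And>i. i \<le> n \<Longrightarrow> sq t (i + 1) = sq t i + p2 (sb l (sq b i))" "sq t (n + 1) \<le> p2 (l + 1)"
  proof (rule kraft[OF b(1), of n])
    show "sq b i \<noteq> sq b j" if ij: "i < j" "j \<le> n" for i j by (rule distinct[OF ij])
  qed (rule that; (assumption | simp))
  \<comment> \<open>The sum of \<open>ip (sq b j)\<close> over \<open>j < i\<close>, for
    \<open>i \<le> n + 1\<close>, brought to the common denominator \<open>p2 l\<close>.\<close>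
  define \<tau> where "\<tau> i = nq (sq t i) / nq (p2 l)" for i
  have i\<tau>: "intlq \<Delta> (\<lambda>\<rho>. \<tau> (F \<rho>))" if "intln \<Delta> F" for \<Delta> F
    unfolding intlq_def \<tau>_def
    by (rule exI[of _ "\<lambda>\<rho>. sq t (F \<rho>)"], rule exI[of _ "\<lambda>_. 0"], rule exI[of _ "\<lambda>_. p2 l"])
      (intro conjI intln_sq intl_const t(1) that intln_const; simp)
  have \<tau>S: "\<tau> (i + 1) = \<tau> i + ip (sq b i)" if "i \<le> n" for i
  proof -
    have "p2 l = p2 (sq b i) * p2 (sb l (sq b i))" using sb[OF t(2)[OF that]] p2_add by metis
    then have "nq (p2 (sb l (sq b i))) / nq (p2 l) = ip (sq b i)" by (simp add: ip_def)
    then show ?thesis unfolding \<tau>_def t(4)[OF that] by (simp add: add_divide_distrib)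
  qed
  have fx: "rv (ap f (ap x (nu i))) = rq (ip (sq b i))" if "i \<le> n" for i using e[OF u[OF that]] b(2) by simp
  have sr: "isreal (ap s (nu i))" if "i \<le> n" for i using vs that by (simp add: vsum_def)
  \<comment> \<open>\<open>\<not> abv\<close> is the decided form of the inequality
    \<open>rv (ap s (nu i)) \<le> rq (\<tau> i + \<tau> (i + 1))\<close>.\<close>
  have main: "i \<le> n \<longrightarrow> \<not> abv (ap s (nu i)) (\<tau> i + \<tau> (i + 1))" for i
  proof (rule ind[where P = "\<lambda>i. i \<le> n \<longrightarrow> \<not> abv (ap s (nu i)) (\<tau> i + \<tau> (i + 1))"])
    show "dec [N] (\<lambda>\<rho>. num (hd \<rho>) \<le> n \<longrightarrow> \<not> abv (ap s (nu (num (hd \<rho>)))) (\<tau> (num (hd \<rho>)) + \<tau> (num (hd \<rho>) + 1)))"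
      by (rule dec_imp dec_not dec_len dec_abv intlq_add i\<tau> intl_ap[OF intl_const[OF s]] intl_nu intln_add intln_num intl_vs intln_const)+
    have "0 \<le> \<tau> i" for i unfolding \<tau>_def by simp
    then have "0 \<le> \<tau> 0 + \<tau> (0 + 1)" by (simp add: add_nonneg_nonneg del: add_0)
    moreover have "rv (ap s (nu 0)) = 0" using vs by (simp add: vsum_def)
    ultimately show "0 \<le> n \<longrightarrow> \<not> abv (ap s (nu 0)) (\<tau> 0 + \<tau> (0 + 1))"
      using rq_le[of 0 "\<tau> 0 + \<tau> (0 + 1)"] abv_iff[OF sr, of 0] by (simp only: rq_simps(1)) (simp add: not_less del: rq_simps)
    fix i assume IH: "i \<le> n \<longrightarrow> \<not> abv (ap s (nu i)) (\<tau> i + \<tau> (i + 1))"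
    show "i + 1 \<le> n \<longrightarrow> \<not> abv (ap s (nu (i + 1))) (\<tau> (i + 1) + \<tau> (i + 1 + 1))"
    proof
      assume i: "i + 1 \<le> n"
      then have i': "i < n" "i \<le> n" using less_imp_le[of i n] by (simp_all only: less_iff_succ_less_eq)
      have "rv (ap s (nu (i + 1))) = rv (ap s (nu i)) + \<bar>rq (ip (sq b i)) - rq (ip (sq b (i + 1)))\<bar>"
        using vs i' fx[OF i'(2)] fx[OF i] by (simp add: vsum_def)
      moreover have "rv (ap s (nu i)) \<le> rq (\<tau> i) + rq (\<tau> (i + 1))" using IH i' abv_iff[OF sr[OF i'(2)]] by (simp add: not_less)
      moreover have "rq (\<tau> (i + 1)) = rq (\<tau> i) + rq (ip (sq b i))" using \<tau>S[OF i'(2)] by simp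
      moreover have "0 \<le> rq (ip k)" for k using rq_le[of 0 "ip k"] ip_pos[of k] by simp
      ultimately have "rv (ap s (nu (i + 1))) \<le> rq (\<tau> (i + 1)) + (rq (\<tau> (i + 1)) + rq (ip (sq b (i + 1))))" by (intro bound_step) assumption+
      also have "\<dots> = rq (\<tau> (i + 1) + \<tau> (i + 1 + 1))" by (simp only: \<tau>S[OF i] rq_simps)
      finally show "\<not> abv (ap s (nu (i + 1))) (\<tau> (i + 1) + \<tau> (i + 1 + 1))" using abv_iff[OF sr[OF i]] by (simp only: not_less)
    qed
  qed
  have "\<tau> n \<le> \<tau> (n + 1)" using \<tau>S[of n] ip_pos[of "sq b n"] by (simp add: less_imp_le)
  moreover have "\<tau> (n + 1) \<le> 1 + 1"
  proof -
    have "nq (sq t (n + 1)) \<le> nq (p2 l + p2 l)" using t(5) by (simp only: nq_simps(6) p2_Suc)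
    then have "\<tau> (n + 1) \<le> nq (p2 l + p2 l) / nq (p2 l)" unfolding \<tau>_def by (rule divide_right_mono) simp
    also have "\<dots> = 1 + 1" by (simp add: add_divide_distrib)
    finally show ?thesis .
  qed
  ultimately have "\<tau> n + \<tau> (n + 1) \<le> (1 + 1) + (1 + 1)" by (intro add_mono) (rule order_trans)
  then have "\<tau> n + \<tau> (n + 1) \<le> nq (1 + 1 + 1 + 1)" by simp
  then have "rq (\<tau> n + \<tau> (n + 1)) \<le> rq (nq (1 + 1 + 1 + 1))" by (simp only: rq_le)
  moreover have "rv (ap s (nu n)) \<le> rq (\<tau> n + \<tau> (n + 1))" using main[of n] abv_iff[OF sr[of n]] by (simp only: not_less order_refl simp_thms)
  ultimately show "rv (ap s (nu n)) \<le> rq (nq (1 + 1 + 1 + 1))" by (rule order_trans[rotated])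
qed

lemma double_inj: "(a::'n) + a = b + b \<longleftrightarrow> a = b"
  using add_strict_mono[of a b a b] add_strict_mono[of b a b a] by (cases a b rule: linorder_cases) auto

lemma fr_succ: "fr (a + 1) w = fr a w + fr 1 w"
  by (simp add: fr_def add_divide_distrib)

lemma fr_quarters: assumes "v + 1 = (w + 1) + (w + 1) + (w + 1) + (w + 1)" shows "fr (j + j + j + j) v = fr j w"
proof -
  have "nq (v + 1) = nq (w + 1) + nq (w + 1) + nq (w + 1) + nq (w + 1)" unfolding assms by (simp only: nq_simps)
  moreover have "nq (w + 1) \<noteq> 0" by (simp add: nq_Suc_pos)
  moreover have "nq (j + j + j + j) = nq j + nq j + nq j + nq j" by (simp only: nq_simps)
  ultimately show ?thesis unfolding fr_def by (simp add: field_simps)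
qed

lemma fr_ip: "w + 1 = p2 m \<Longrightarrow> fr 1 w = ip m"
  unfolding fr_def ip_def by (simp only: nq_simps)

text \<open>The power of two is not of the form \<open>w + 1\<close> on its face. A sequence
  \<open>e\<close> chooses codes of the rationals \<open>1 / 2 ^ m\<close>, and the values of
  \<open>f\<close> are constant sequences of such codes.\<close>

lemma reciprocal_function: assumes Y: "Y \<in> D two"
  shows "\<exists>f \<in> D (one \<^bold>\<rightarrow> one). \<forall>x \<in> D one. isreal (ap f x) \<and> rv (ap f x) = rq (ip (num (ap Y x)))"
proof -
  have "dec [N, N] (\<lambda>\<rho>. \<exists>w. w + 1 = p2 (num (hd (tl \<rho>))) \<and> num (hd \<rho>) = code 1 0 w)"
    by (rule dec_exn) (rule dec_conj dec_eqn intln_add intln_p2 intln_code intln_num intl_vs intln_const)+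
  moreover have "\<exists>c w. w + 1 = p2 m \<and> c = code 1 0 w" for m using p2_pos[of m] by (metis add.commute le_ex less_iff_succ_less_eq add_0)
  ultimately obtain e where e: "e \<in> D one" "\<And>m. \<exists>w. w + 1 = p2 m \<and> sq e m = code 1 0 w"
    using choice1[of "\<lambda>m c. \<exists>w. w + 1 = p2 m \<and> c = code 1 0 w"] by blast
  have i: "intl [one] one (\<lambda>\<rho>. ap (cs (PiC N N)) (nu (sq e (num (ap Y (hd \<rho>))))))"
    by (rule intl_ap[OF intl_const[OF cs_types(5)]]) (rule intl_nu intln_sq intl_const[OF e(1)] intln_num intl_ap[OF intl_const[OF Y]] intl_vs)+
  let ?f = "lam one one (\<lambda>x. ap (cs (PiC N N)) (nu (sq e (num (ap Y x)))))"
  have "isreal (ap ?f x) \<and> rv (ap ?f x) = rq (ip (num (ap Y x)))" if "x \<in> D one" for x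
  proof -
    obtain w where w: "w + 1 = p2 (num (ap Y x))" "sq e (num (ap Y x)) = code 1 0 w" using e(2) by blast
    have "ap ?f x = cr 1 w" unfolding lam1(2)[OF i that] w(2) cr_def ..
    then show ?thesis using cr[of 1 w] fr_ip[OF w(1)] by simp
  qed
  then show ?thesis using lam1(1)[OF i] by blast
qed

text \<open>Descend from an interval of length \<open>1 / 4 ^ n\<close> to its left or right quarter. The centers \<open>y i\<close> with \<open>b i = n\<close>
  are all equal, and the ball of radius \<open>1 / 4 ^ (n + 1)\<close> around them misses one of the two.\<close>

lemma uncovered_point:
  assumes y: "y \<in> D (N \<^bold>\<rightarrow> one)" "\<And>i. i \<le> k \<Longrightarrow> unit (ap y (nu i))" and b: "b \<in> D one"
    and inj: "\<And>i j. i \<le> k \<Longrightarrow> j \<le> k \<Longrightarrow> sq b i = sq b j \<Longrightarrow> rv (ap y (nu i)) = rv (ap y (nu j))"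
  shows "\<exists>x. unit x \<and> (\<forall>i\<le>k. rq (ip (sq b i + sq b i + 1 + 1)) \<le> \<bar>rv x - rv (ap y (nu i))\<bar>)"
proof -
  define r where "r i = ip (sq b i + sq b i + 1 + 1)" for i
  \<comment> \<open>The interval from \<open>fr j w\<close> to \<open>fr (j + 1) w\<close> lies
    outside the open ball number \<open>i\<close>, in decided form; \<open>miss\<close> below
    restates it with reals.\<close>
  define miss where "miss j w i \<longleftrightarrow> \<not> abv (ap y (nu i)) (fr j w - r i) \<or> \<not> bel (ap y (nu i)) (fr (j + 1) w + r i)" for j w i
  have miss: "miss j w i \<longleftrightarrow> rv (ap y (nu i)) + rq (r i) \<le> rq (fr j w) \<or> rq (fr (j + 1) w) + rq (r i) \<le> rv (ap y (nu i))" if "i \<le> k" for j w i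
    using y(2)[OF that] by (simp add: miss_def abv_iff bel_iff unit_real not_less le_diff_eq)
  \<comment> \<open>With \<open>w + 1 = 4 ^ n\<close> this is an interval of length
    \<open>1 / 4 ^ n\<close>, and \<open>j \<le> w\<close> keeps it inside the unit
    interval.\<close>
  let ?P = "\<lambda>n. \<exists>j w. w + 1 = p2 (n + n) \<and> j \<le> w \<and> (\<forall>i\<le>k. sq b i < n \<longrightarrow> miss j w i)"
  have P: "?P n" for n
  proof (rule ind[where P = ?P])
    show "dec [N] (\<lambda>\<rho>. ?P (num (hd \<rho>)))"
      unfolding miss_def r_def
      by (rule dec_exn, rule dec_exn, rule dec_conj, (rule dec_eqn intln_add intln_p2 intln_num intl_vs intln_const)+,
          rule dec_conj, (rule dec_len intln_num intl_vs)+, rule dec_alln)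
        (rule dec_imp dec_disj dec_not dec_len dec_lessn dec_abv dec_bel intlq_add intlq_diff intlq_fr intlq_ip
          intln_sq intl_const[OF b] intl_ap[OF intl_const[OF y(1)]] intl_nu intln_add intln_num intl_vs intln_const)+
    show "?P 0" by (rule exI[of _ 0], rule exI[of _ 0]) (simp add: nonneg[THEN leD])
    fix n assume "?P n"
    then obtain j w where w: "w + 1 = p2 (n + n)" and j: "j \<le> w" and IH: "\<And>i. i \<le> k \<Longrightarrow> sq b i < n \<Longrightarrow> miss j w i" by blast
    \<comment> \<open>The denominator \<open>v + 1\<close> is four times \<open>w + 1\<close>, so
      the four quarters start at the numerators \<open>?j\<close>, \<open>?j + 1\<close>,
      \<open>?j + 2\<close> and \<open>?j + 3\<close>.\<close>
    define v where "v = (w + 1) + (w + 1) + (w + 1) + w"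
    have v1: "v + 1 = (w + 1) + (w + 1) + (w + 1) + (w + 1)" by (simp only: v_def add.assoc)
    have v2: "v + 1 = p2 (n + n + 1 + 1)" unfolding v1 w p2_Suc by (simp only: add.assoc)
    have n2: "n + 1 + (n + 1) = n + n + 1 + 1" by (simp only: ac_simps)
    define d where "d = rq (ip (n + n + 1 + 1))"
    have d: "0 < d" using rq_less[of 0 "ip (n + n + 1 + 1)"] by (simp add: d_def del: rq_less)
    define a where "a = rq (fr j w)"
    let ?j = "j + j + j + j"
    have S: "rq (fr (i + 1) v) = rq (fr i v) + d" for i unfolding fr_succ fr_ip[OF v2] by (simp add: d_def)
    have f0: "rq (fr ?j v) = a" unfolding fr_quarters[OF v1] a_def ..
    have f1: "rq (fr (?j + 1) v) = a + d" unfolding S f0 ..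
    have f3: "rq (fr (?j + 1 + 1 + 1) v) = a + d + d + d" unfolding S f0 ..
    have f4: "rq (fr (?j + 1 + 1 + 1 + 1) v) = a + d + d + d + d" unfolding S f0 ..
    have f4': "rq (fr (j + 1) w) = a + d + d + d + d"
    proof -
      have "?j + 1 + 1 + 1 + 1 = (j + 1) + (j + 1) + (j + 1) + (j + 1)" by (simp only: ac_simps)
      then show ?thesis using f4 fr_quarters[OF v1, of "j + 1"] by (simp only:)
    qed
    have ri: "rq (r i) = d" if "sq b i = n" for i unfolding r_def d_def that ..
    \<comment> \<open>A ball outside the whole interval is outside its quarters.\<close>
    have old0: "miss ?j v i" and old3: "miss (?j + 1 + 1 + 1) v i" if "i \<le> k" "sq b i < n" for i
      using IH[OF that] d unfolding miss[OF that(1)] f0 f1 f3 f4 f4' a_def[symmetric] by (auto simp: algebra_simps)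
    have step: "?P (n + 1)" if J: "J \<le> v" "\<And>i. i \<le> k \<Longrightarrow> sq b i < n \<Longrightarrow> miss J v i" "\<And>i. i \<le> k \<Longrightarrow> sq b i = n \<Longrightarrow> miss J v i" for J
    proof (rule exI[of _ J], rule exI[of _ v], intro conjI allI impI)
      show "v + 1 = p2 (n + 1 + (n + 1))" unfolding n2 by (rule v2)
      fix i assume "i \<le> k" "sq b i < n + 1"
      then show "miss J v i" using J unfolding less_Suc le_less by blast
    qed (rule J(1))
    show "?P (n + 1)"
    \<comment> \<open>The right quarter starts at \<open>a + 3 * d\<close> and the new balls have
      radius \<open>d\<close>. So it is missed if no new center lies beyond the middle
      \<open>a + 2 * d\<close>.\<close>
    proof (cases "\<forall>i\<le>k. sq b i = n \<longrightarrow> rv (ap y (nu i)) + d \<le> a + d + d + d")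
      case True
      show ?thesis
      proof (rule step[OF _ old3])
        show "?j + 1 + 1 + 1 \<le> v"
        proof -
          have "?j + 1 + 1 + 1 = (j + 1) + (j + 1) + (j + 1) + j" by (simp only: ac_simps)
          then show ?thesis unfolding v_def using j by (simp only:) (intro add_mono order_refl)
        qed
        show "miss (?j + 1 + 1 + 1) v i" if "i \<le> k" "sq b i = n" for i
          unfolding miss[OF that(1)] f3 ri[OF that(2)] using True that by blast
      qed
    next
      case False
      \<comment> \<open>One center of level \<open>n\<close> beyond the middle suffices: by
        \<open>inj\<close> all centers of this level are equal, so all their balls miss the left
        quarter.\<close>
      then obtain i0 where i0: "i0 \<le> k" "sq b i0 = n" "\<not> rv (ap y (nu i0)) + d \<le> a + d + d + d" by blast
      show ?thesis
      proof (rule step[OF _ old0])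
        have "j \<le> w + 1" using j by (rule order_trans) simp
        then show "?j \<le> v" unfolding v_def using j by (intro add_mono)
        show "miss ?j v i" if "i \<le> k" "sq b i = n" for i
        proof -
          have "rv (ap y (nu i)) = rv (ap y (nu i0))" by (rule inj[OF that(1) i0(1)]) (simp only: that i0)
          then show ?thesis unfolding miss[OF that(1)] f1 ri[OF that(2)] using i0(3) by (simp add: not_le algebra_simps less_imp_le)
        qed
      qed
    qed
  qed
  obtain l where l: "\<And>i. i \<le> k \<Longrightarrow> sq b i \<le> l" using bounded_values[OF b] by blast
  \<comment> \<open>At level \<open>l + 1\<close> all balls have been treated; the left end of the
    interval is the point.\<close>
  from P[of "l + 1"] obtain j w where j: "j \<le> w" and m: "\<And>i. i \<le> k \<Longrightarrow> sq b i < l + 1 \<Longrightarrow> miss j w i" by blast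
  show ?thesis
  proof (rule exI[of _ "cr j w"], intro conjI allI impI)
    show "unit (cr j w)" by (rule unit_cr) (rule order_trans[OF j], simp)
    fix i assume i: "i \<le> k"
    have "rq (fr (j + 1) w) = rq (fr j w) + rq (fr 1 w)" "0 \<le> rq (fr 1 w)" using rq_le[of 0 "fr 1 w"] by (simp_all add: fr_succ)
    moreover have "b \<le> \<bar>p - z\<bar>" if "z + b \<le> p \<or> q + b \<le> z" "q = p + s" "0 \<le> s" for b p q s z :: "'n creal"
      using that by (auto simp: abs_if algebra_simps)
    ultimately show "rq (ip (sq b i + sq b i + 1 + 1)) \<le> \<bar>rv (cr j w) - rv (ap y (nu i))\<bar>"
      unfolding r_def[symmetric] cr using m[OF i, unfolded less_Suc, OF l[OF i]] unfolding miss[OF i] by blast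
  qed
qed

theorem HBU_imp_NIN: assumes "sat [] HBU_bv" shows "sat [] NIN"
  unfolding sat_NIN
proof (rule notI, elim bexE)
  fix Y assume Y: "Y \<in> D two" and all: "\<forall>x y. unit x \<and> unit y \<longrightarrow> (ap Y x = ap Y y \<longleftrightarrow> rv x = rv y)"
  have YN: "ap Y x \<in> D N" if "x \<in> D one" for x using Y that by (rule ap_closed)
  \<comment> \<open>The exponent \<open>2 * (Y x + 1)\<close> writes the powers of four as powers of
    two, for which bounded variation has been shown. It is still injective in
    \<open>Y x\<close>.\<close>
  let ?Y = "lam one N (\<lambda>x. nu (num (ap Y x) + num (ap Y x) + 1 + 1))"
  have i: "intl [one] N (\<lambda>\<rho>. nu (num (ap Y (hd \<rho>)) + num (ap Y (hd \<rho>)) + 1 + 1))"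
    by (rule intl_nu intln_add intln_num intl_ap[OF intl_const[OF Y]] intl_vs intln_const)+
  have aY: "ap ?Y x = nu (num (ap Y x) + num (ap Y x) + 1 + 1)" if "x \<in> D one" for x by (rule lam1(2)[OF i that])
  have Y': "?Y \<in> D two" by (rule lam1(1)[OF i])
  obtain f where f: "f \<in> D (one \<^bold>\<rightarrow> one)" "\<And>x. x \<in> D one \<Longrightarrow> isreal (ap f x)" "\<And>x. x \<in> D one \<Longrightarrow> rv (ap f x) = rq (ip (num (ap ?Y x)))"
    using reciprocal_function[OF Y'] by blast
  have uf: "ufun f" unfolding ufun_def
  proof (intro conjI allI impI)
    fix x y assume "unit x \<and> unit y \<and> rv x = rv y"
    then have u: "unit x" "unit y" and "ap Y x = ap Y y" using all by blast+
    then show "rv (ap f x) = rv (ap f y)" by (simp only: f(3) aY unit_D)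
  qed (use f unit_D in auto)
  have "0 < rv (ap f x)" if "unit x" for x using rq_less[of 0 "ip (num (ap ?Y x))"] by (simp add: f(3)[OF unit_D[OF that]] del: rq_less)
  moreover have "bvar f"
  proof (rule bvar_if_injective[OF uf f(3)[OF unit_D] Y'])
    fix x y assume u: "unit x" "unit y" and "ap ?Y x = ap ?Y y"
    then have "num (ap Y x) + num (ap Y x) + 1 + 1 = num (ap Y y) + num (ap Y y) + 1 + 1" by (simp only: aY[OF unit_D] nu_inj)
    then have "num (ap Y x) = num (ap Y y)" by (simp only: add_right_cancel double_inj)
    then have "nu (num (ap Y x)) = nu (num (ap Y y))" by (rule arg_cong)
    then have "ap Y x = ap Y y" by (simp only: nu_num[OF YN[OF unit_D]] u)
    then show "rv x = rv y" using all u by blast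
  qed
  ultimately obtain k y where y: "y \<in> D (N \<^bold>\<rightarrow> one)" "\<And>i. i \<le> k \<Longrightarrow> unit (ap y (nu i))"
    and cover: "\<And>x. unit x \<Longrightarrow> \<exists>i\<le>k. \<bar>rv x - rv (ap y (nu i))\<bar> < rv (ap f (ap y (nu i)))"
    using assms uf unfolding sat_HBU by blast
  have yD: "ap y (nu i) \<in> D one" for i using y(1) nu_N by (rule ap_closed)
  have "dec [N, N] (\<lambda>\<rho>. num (hd \<rho>) = num (ap Y (ap y (nu (num (hd (tl \<rho>)))))))"
    by (rule dec_eqn intln_num intl_ap[OF intl_const[OF Y]] intl_ap[OF intl_const[OF y(1)]] intl_nu intl_vs)+
  from choice1[of "\<lambda>i m. m = num (ap Y (ap y (nu i)))", OF this] obtain b where b: "b \<in> D one" "\<And>i. sq b i = num (ap Y (ap y (nu i)))" by blast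
  have inj: "rv (ap y (nu i)) = rv (ap y (nu j))" if ij: "i \<le> k" "j \<le> k" "sq b i = sq b j" for i j
  proof -
    have "nu (num (ap Y (ap y (nu i)))) = nu (num (ap Y (ap y (nu j))))" using ij(3) unfolding b(2) by (rule arg_cong)
    then have "ap Y (ap y (nu i)) = ap Y (ap y (nu j))" by (simp only: nu_num[OF YN[OF yD]])
    then show ?thesis using all y(2)[OF ij(1)] y(2)[OF ij(2)] by blast
  qed
  obtain x where x: "unit x" "\<And>i. i \<le> k \<Longrightarrow> rq (ip (sq b i + sq b i + 1 + 1)) \<le> \<bar>rv x - rv (ap y (nu i))\<bar>"
    using uncovered_point[OF y b(1) inj] by blast
  obtain i where i: "i \<le> k" "\<bar>rv x - rv (ap y (nu i))\<bar> < rv (ap f (ap y (nu i)))" using cover[OF x(1)] by blast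
  have "rv (ap f (ap y (nu i))) = rq (ip (sq b i + sq b i + 1 + 1))" by (simp only: f(3)[OF yD] aY[OF yD] num_nu b(2))
  then show False using x(2)[OF i(1)] i(2) by order
qed

end

section \<open>Well-formedness of the principles\<close>

definition WF :: "ty list \<Rightarrow> pfm \<Rightarrow> bool" where "WF \<Delta> A \<longleftrightarrow> wf_fm \<Delta> (A (length \<Delta>))"
definition TYr :: "ty list \<Rightarrow> rat_tm \<Rightarrow> bool" where "TYr \<Delta> q \<longleftrightarrow> (case q of (a, b, c) \<Rightarrow> TY \<Delta> a N \<and> TY \<Delta> b N \<and> TY \<Delta> c N)"

lemma TYrI: "TY \<Delta> a N \<Longrightarrow> TY \<Delta> b N \<Longrightarrow> TY \<Delta> c N \<Longrightarrow> TYr \<Delta> (a, b, c)" by (simp add: TYr_def)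
lemma TYrE: assumes "TYr \<Delta> q" obtains a b c where "q = (a, b, c)" "TY \<Delta> a N" "TY \<Delta> b N" "TY \<Delta> c N"
  using assms by (auto simp: TYr_def)
lemma TYr_weaken: "TYr \<Delta> q \<Longrightarrow> TYr (\<sigma> # \<Delta>) q" by (auto simp: TYr_def TY_weaken)

lemma TY_num: "TY \<Delta> \<^bold>0 N" "TY \<Delta> \<^bold>1 N" "TY \<Delta> s N \<Longrightarrow> TY \<Delta> (psuc s) N" "TY \<Delta> s N \<Longrightarrow> TY \<Delta> t N \<Longrightarrow> TY \<Delta> (s \<^bold>+ t) N"
  "TY \<Delta> s N \<Longrightarrow> TY \<Delta> t N \<Longrightarrow> TY \<Delta> (s \<^bold>* t) N" "TY \<Delta> s N \<Longrightarrow> TY \<Delta> t N \<Longrightarrow> TY \<Delta> (ppair s t) N" "TY \<Delta> s N \<Longrightarrow> TY \<Delta> (ppow2 s) N"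
  by (auto simp: TY_def ppair_def ppow2_def pzero_def pone_def psuc_def padd_def pmul_def papp_def pconst_def)

lemma TYr_rules: "TYr \<Delta> q \<Longrightarrow> TYr \<Delta> r \<Longrightarrow> TYr \<Delta> (rat_add q r)" "TYr \<Delta> q \<Longrightarrow> TYr \<Delta> r \<Longrightarrow> TYr \<Delta> (rat_sub q r)"
  "TY \<Delta> n N \<Longrightarrow> TYr \<Delta> (inv_pow2 n)" "TY \<Delta> n N \<Longrightarrow> TYr \<Delta> (two_inv_pow2 n)"
  by (auto simp: TYr_def rat_add_def rat_sub_def inv_pow2_def two_inv_pow2_def intro: TY_num)

lemma WF_fm: "WF \<Delta> A \<Longrightarrow> WF \<Delta> B \<Longrightarrow> WF \<Delta> (A \<^bold>\<longrightarrow> B)" "WF \<Delta> A \<Longrightarrow> WF \<Delta> (\<^bold>\<not> A)" "WF \<Delta> A \<Longrightarrow> WF \<Delta> B \<Longrightarrow> WF \<Delta> (A \<^bold>\<and> B)"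
  "WF \<Delta> A \<Longrightarrow> WF \<Delta> B \<Longrightarrow> WF \<Delta> (A \<^bold>\<or> B)" "TY \<Delta> s N \<Longrightarrow> TY \<Delta> t N \<Longrightarrow> WF \<Delta> (s \<^bold>= t)" "TY \<Delta> s N \<Longrightarrow> TY \<Delta> t N \<Longrightarrow> WF \<Delta> (s \<^bold>< t)"
  "TY \<Delta> s N \<Longrightarrow> TY \<Delta> t N \<Longrightarrow> WF \<Delta> (s \<^bold>\<le> t)"
  by (auto simp: WF_def pimp_def pnot_def pand_def por_def peq_def pless_def ple_def dest: TY_typed)

lemma WF_allq: "(\<And>x. TY (\<sigma> # \<Delta>) x \<sigma> \<Longrightarrow> WF (\<sigma> # \<Delta>) (F x)) \<Longrightarrow> WF \<Delta> (allq \<sigma> F)"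
  unfolding WF_def wf_allq using TY_bv by blast

lemma WF_exq: "(\<And>x. TY (\<sigma> # \<Delta>) x \<sigma> \<Longrightarrow> WF (\<sigma> # \<Delta>) (F x)) \<Longrightarrow> WF \<Delta> (exq \<sigma> F)"
  unfolding exq_def by (intro WF_fm(2) WF_allq)

lemma WF_rat: "TYr \<Delta> q \<Longrightarrow> TYr \<Delta> r \<Longrightarrow> WF \<Delta> (rat_less q r)" "TYr \<Delta> q \<Longrightarrow> TYr \<Delta> r \<Longrightarrow> WF \<Delta> (rat_le q r)"
  by (auto simp: rat_less_def rat_le_def elim!: TYrE intro!: WF_fm TY_num)

lemma WF_with_abs: "TYr \<Delta> q \<Longrightarrow> (\<And>r. TYr \<Delta> r \<Longrightarrow> WF \<Delta> (A r)) \<Longrightarrow> WF \<Delta> (with_abs q A)"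
  by (auto simp: with_abs_def elim!: TYrE intro!: WF_fm TYrI)

text \<open>The continuation is checked below three more binders, the quantifiers of
  \<open>with_rat\<close>.\<close>

lemma WF_seq: assumes "TY \<Delta> x one" "TY \<Delta> n N" "\<And>r. TYr (N # N # N # \<Delta>) r \<Longrightarrow> WF (N # N # N # \<Delta>) (A r)" shows "WF \<Delta> (seq x n A)"
  unfolding seq_def with_rat_def
  by (rule WF_exq WF_fm)+ (rule assms TY_num TYrI TY_app[of _ x] | assumption | rule TY_weaken)+

lemma WF_real_num: "TY \<Delta> t N \<Longrightarrow> (\<And>r. TYr \<Delta> r \<Longrightarrow> WF \<Delta> (A r)) \<Longrightarrow> WF \<Delta> (real_num t n A)"
  unfolding real_num_def by (simp add: TYrI TY_num)

lemmas WF_rules = WF_fm WF_allq WF_exq WF_rat WF_with_abs WF_seq WF_real_num TYr_rules TY_num TY_app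

lemmas real_ops = real_add_def real_sub_def real_abs_def real_le_def real_less_def real_eq_def

lemma WF_is_real: "TY \<Delta> x one \<Longrightarrow> WF \<Delta> (is_real x)"
  unfolding is_real_def by (rule WF_rules | assumption | rule TY_weaken TYr_weaken)+

lemma WF_in_unit: "TY \<Delta> x one \<Longrightarrow> WF \<Delta> (in_unit x)"
  unfolding in_unit_def real_ops by (rule WF_rules WF_is_real | assumption | rule TY_weaken TYr_weaken)+

lemma WF_unit_fun: "TY \<Delta> f (one \<^bold>\<rightarrow> one) \<Longrightarrow> WF \<Delta> (unit_fun f)"
  unfolding unit_fun_def real_ops by (rule WF_rules WF_is_real WF_in_unit | assumption | rule TY_weaken TYr_weaken)+

lemma WF_nondecreasing: "TY \<Delta> f (one \<^bold>\<rightarrow> one) \<Longrightarrow> WF \<Delta> (nondecreasing f)"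
  unfolding nondecreasing_def real_ops by (rule WF_rules WF_is_real WF_in_unit | assumption | rule TY_weaken TYr_weaken)+

lemma WF_bounded_variation: "TY \<Delta> f (one \<^bold>\<rightarrow> one) \<Longrightarrow> WF \<Delta> (bounded_variation f)"
  unfolding bounded_variation_def unit_partition_def variation_sums_def real_ops
  by (rule WF_rules WF_is_real WF_in_unit | assumption | rule TY_weaken TYr_weaken)+

lemma wf_principles: "wf_fm [] Jordan" "wf_fm [] HBU_bv" "wf_fm [] NIN"
proof -
  have *: "WF [] A \<Longrightarrow> wf_fm [] (sentence A)" for A by (simp add: WF_def sentence_def)
  show "wf_fm [] Jordan" "wf_fm [] HBU_bv" "wf_fm [] NIN"
    unfolding Jordan_def HBU_bv_def NIN_def real_ops
    by (rule * WF_rules WF_in_unit WF_unit_fun WF_nondecreasing WF_bounded_variation | assumption | rule TY_weaken TYr_weaken)+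
qed

theorem theorem8:
  shows "ACA0w \<turnstile> Imp Jordan HBU_bv \<and> ACA0w \<turnstile> Imp HBU_bv NIN"
proof (rule ccontr)
  assume "\<not> ?thesis"
  from nmodel_existence[OF this] wf_principles
  obtain D :: "ty \<Rightarrow> tm set" and ap fv cs lt and nu :: "mnat \<Rightarrow> tm" where M: "nmodel D ap fv cs lt nu"
    and bad: "\<not> (frame.sat D ap fv cs lt [] (Imp Jordan HBU_bv) \<and> frame.sat D ap fv cs lt [] (Imp HBU_bv NIN))"
    by (auto simp del: frame.sat.simps)
  interpret nmodel D ap fv cs lt nu by (rule M)
  show False using bad Jordan_imp_HBU HBU_imp_NIN by simp
qed

end
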